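(* Let $\mathcal{A}$ be an essentially small additive category, $S$ a set of morphisms of $\mathcal{A}$, $\mathcal{C}=K^b(\mathcal{A})$, $B$ the set of cones of elements of $S$, $D$ the extension-closure of $B$ in $\mathcal{C}$, and $\mathcal{D}\subset\mathcal{C}$ the triangulated subcategory generated by $B$. Let $A_1,A_1',A_2,A_2'$ be objects of $\mathcal{A}$, and for $j=1,2$ let $f_j\in(\mathcal{C}/\mathcal{D})(A_j,A_j')$ be presented as $f_j=g_j\circ s_j^{-1}\circ i_j$, where $C_j,C_j'$ are objects of $\mathcal{A}$, $g_j\in\mathcal{A}(C_j',A_j')$, $s_j\in\mathcal{A}(C_j',C_j)$ with $\operatorname{Cone}(s_j)\in D$, and $i_j\in\mathcal{A}(A_j,C_j)$ (not necessarily a coretraction). Then the following hold. 1. $f_1\oplus f_2=(g_1\oplus g_2)\circ(s_1\oplus s_2)^{-1}\circ(i_1\oplus i_2)$. 2. If $A_1=A_2'$, then $f_1\circ f_2=\begin{pmatrix} 0 & g_1 \end{pmatrix}\circ\begin{pmatrix} s_2 & 0 \\ -i_1\circ g_2 & s_1 \end{pmatrix}^{-1}\circ\begin{pmatrix} i_2 \\ 0 \end{pmatrix}$. 3. Suppose $A_1=A_2=A$ and $A_1'=A_2'=A'$. (a) $f_1+f_2=\begin{pmatrix} g_1 & g_2 \end{pmatrix}\circ(s_1\oplus s_2)^{-1}\circ\begin{pmatrix} i_1 \\ i_2 \end{pmatrix}$. (b) Let $r=\begin{pmatrix} i_1 & s_1 & 0 \\ i_2 & 0 & s_2 \end{pmatrix}\in\mathcal{A}(A\oplus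 C_1'\oplus C_2',\,C_1\oplus C_2)$. The following are equivalent: (i) $f_1=f_2$; (ii) for the complex $T=\bigl(A\oplus C_1'\oplus C_2'\xrightarrow{r}C_1\oplus C_2\bigr)$ with terms in degrees $0$ and $1$, the morphism $T\to A'$ in $C^b(\mathcal{A})$ given in degree $0$ by $\begin{pmatrix} 0 & g_1 & -g_2 \end{pmatrix}$ factors in $C^b(\mathcal{A})$ through an object of $\mathcal{D}$; (iii) there exist objects $Z,Z',T_1,T_2$ of $\mathcal{A}$ and morphisms $k_1\in\mathcal{A}(Z,T_1)$, $k_2\in\mathcal{A}(T_2,Z')$, $p\in\mathcal{A}(Z,T_2)$, $g\in\mathcal{A}(T_1,Z')$, $\alpha_1^1\in\mathcal{A}(C_1\oplus C_2,Z')$, $\alpha_1^0\in\mathcal{A}(A\oplus C_1'\oplus C_2',T_1\oplus T_2)$, $\alpha_2\in\mathcal{A}(T_1\oplus T_2,A')$ such that $\operatorname{Cone}(k_1),\operatorname{Cone}(k_2)\in D$ and $$\begin{pmatrix} \alpha_2 \\ \begin{pmatrix} g & k_2 \end{pmatrix} \end{pmatrix}\circ\begin{pmatrix} \alpha_1^0 & \begin{pmatrix} k_1 \\ p \end{pmatrix} \end{pmatrix}=\begin{pmatrix} \begin{pmatrix} 0 & g_1 & -g_2 \end{pmatrix} & 0 \\ \alpha_1^1\circ r & 0 \end{pmatrix}.$$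
   Context: $C^b(\mathcal{A})$ is the category of bounded complexes over $\mathcal{A}$ (homotopic morphisms are not identified), and $K^b(\mathcal{A})$ is its homotopy category (same objects). $\mathcal{A}$ is embedded in $K^b(\mathcal{A})$ as complexes concentrated in degree $0$. The cone of a morphism $s:X\to Y$ of $\mathcal{A}$ is the complex $X\xrightarrow{s}Y$ with $Y$ in degree $0$. A class of objects $E$ of a triangulated category is extension-closed if it contains $0$ and, for any distinguished triangle $X\to Y\to Z$ with $X,Z\in E$, one has $Y\in E$; the extension-closure of $B$ is the smallest extension-closed class containing $B$. The triangulated subcategory generated by $B$ is the smallest full strict triangulated subcategory containing $B$. $\mathcal{C}/\mathcal{D}$ is the Verdier quotient; morphisms of $\mathcal{A}$ are identified with their images in it, and any morphism of $\mathcal{A}$ with cone in $D$ is invertible in it. *)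

theory Defs
  imports "HOL-Algebra.FiniteProduct"
begin

section \<open>Additive categories\<close>

text \<open>
  Every category here has its objects and its arrows ranging over HOL types, so it is small;
  an essentially small category is one equivalent to such a category.  Arrows know their
  domain and codomain, and \<open>g \<cdot>\<^bsub>A\<^esub> f\<close> is \<open>g\<close> after \<open>f\<close>.
\<close>

record ('o, 'm) acat =
  Obj :: "'o set"
  Arr :: "'m set"
  Dom :: "'m \<Rightarrow> 'o"
  Cod :: "'m \<Rightarrow> 'o"
  Ident :: "'o \<Rightarrow> 'm"
  Comp :: "'m \<Rightarrow> 'm \<Rightarrow> 'm"  (infixr "\<cdot>\<index>" 70)
  Zero :: "'o \<Rightarrow> 'o \<Rightarrow> 'm"
  Add :: "'m \<Rightarrow> 'm \<Rightarrow> 'm"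

definition Hom :: "('o, 'm, 'z) acat_scheme \<Rightarrow> 'o \<Rightarrow> 'o \<Rightarrow> 'm set" where
  "Hom C X Y = {f \<in> Arr C. Dom C f = X \<and> Cod C f = Y}"

definition hom_group :: "('o, 'm, 'z) acat_scheme \<Rightarrow> 'o \<Rightarrow> 'o \<Rightarrow> 'm monoid" where
  "hom_group C X Y = \<lparr>carrier = Hom C X Y, mult = Add C, one = Zero C X Y\<rparr>"

definition neg :: "('o, 'm, 'z) acat_scheme \<Rightarrow> 'm \<Rightarrow> 'm" where
  "neg C f = inv\<^bsub>hom_group C (Dom C f) (Cod C f)\<^esub> f"

locale preadditive_category =
  fixes C :: "('o, 'm, 'z) acat_scheme" (structure)
  assumes Dom_Obj: "f \<in> Arr C \<Longrightarrow> Dom C f \<in> Obj C"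
    and Cod_Obj: "f \<in> Arr C \<Longrightarrow> Cod C f \<in> Obj C"
    and Ident_Hom: "X \<in> Obj C \<Longrightarrow> Ident C X \<in> Hom C X X"
    and Comp_Hom: "\<lbrakk>f \<in> Hom C X Y; g \<in> Hom C Y Z\<rbrakk> \<Longrightarrow> g \<cdot> f \<in> Hom C X Z"
    and Comp_Ident_left: "f \<in> Hom C X Y \<Longrightarrow> Ident C Y \<cdot> f = f"
    and Comp_Ident_right: "f \<in> Hom C X Y \<Longrightarrow> f \<cdot> Ident C X = f"
    and Comp_assoc: "\<lbrakk>f \<in> Hom C X Y; g \<in> Hom C Y Z; h \<in> Hom C Z W\<rbrakk>
          \<Longrightarrow> (h \<cdot> g) \<cdot> f = h \<cdot> (g \<cdot> f)"
    and hom_comm_group: "\<lbrakk>X \<in> Obj C; Y \<in> Obj C\<rbrakk> \<Longrightarrow> comm_group (hom_group C X Y)"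
    and Comp_Add_left: "\<lbrakk>f \<in> Hom C X Y; g \<in> Hom C Y Z; g' \<in> Hom C Y Z\<rbrakk>
          \<Longrightarrow> Add C g g' \<cdot> f = Add C (g \<cdot> f) (g' \<cdot> f)"
    and Comp_Add_right: "\<lbrakk>f \<in> Hom C X Y; f' \<in> Hom C X Y; g \<in> Hom C Y Z\<rbrakk>
          \<Longrightarrow> g \<cdot> Add C f f' = Add C (g \<cdot> f) (g \<cdot> f')"

definition zero_object :: "('o, 'm, 'z) acat_scheme \<Rightarrow> 'o \<Rightarrow> bool" where
  "zero_object C X \<longleftrightarrow> X \<in> Obj C \<and>
     (\<forall>Y\<in>Obj C. (\<exists>!f. f \<in> Hom C X Y) \<and> (\<exists>!f. f \<in> Hom C Y X))"

definition is_biproduct ::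
    "('o, 'm, 'z) acat_scheme \<Rightarrow> 'o list \<Rightarrow> 'o \<Rightarrow> (nat \<Rightarrow> 'm) \<Rightarrow> (nat \<Rightarrow> 'm) \<Rightarrow> bool" where
  "is_biproduct C Xs P \<iota> \<pi> \<longleftrightarrow> P \<in> Obj C \<and>
     (\<forall>i<length Xs. \<iota> i \<in> Hom C (Xs ! i) P \<and> \<pi> i \<in> Hom C P (Xs ! i)) \<and>
     (\<forall>i<length Xs. \<forall>j<length Xs.
        \<pi> j \<cdot>\<^bsub>C\<^esub> \<iota> i = (if i = j then Ident C (Xs ! i) else Zero C (Xs ! i) (Xs ! j))) \<and>
     finprod (hom_group C P P) (\<lambda>i. \<iota> i \<cdot>\<^bsub>C\<^esub> \<pi> i) {..<length Xs} = Ident C P"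

locale additive_category = preadditive_category +
  assumes ex_zero_object: "\<exists>X. zero_object C X"
    and ex_biproduct: "\<lbrakk>X \<in> Obj C; Y \<in> Obj C\<rbrakk> \<Longrightarrow> \<exists>P \<iota> \<pi>. is_biproduct C [X, Y] P \<iota> \<pi>"

definition zero_obj :: "('o, 'm, 'z) acat_scheme \<Rightarrow> 'o" where
  "zero_obj C = (SOME X. zero_object C X)"

text \<open>
  A chosen direct sum of a list of objects.  The choice is normalised on one-element lists,
  so that the sum of \<open>[X]\<close> is \<open>X\<close> itself.
\<close>

definition biproduct :: "('o, 'm, 'z) acat_scheme \<Rightarrow> 'o list \<Rightarrow> 'o \<times> (nat \<Rightarrow> 'm) \<times> (nat \<Rightarrow> 'm)" where
  "biproduct C Xs = (SOME b. case b of (P, \<iota>, \<pi>) \<Rightarrow> is_biproduct C Xs P \<iota> \<pi> \<and>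
     (\<forall>X. Xs = [X] \<longrightarrow> P = X \<and> \<iota> 0 = Ident C X \<and> \<pi> 0 = Ident C X))"

definition dsum :: "('o, 'm, 'z) acat_scheme \<Rightarrow> 'o list \<Rightarrow> 'o" where
  "dsum C Xs = fst (biproduct C Xs)"

definition dsum_in :: "('o, 'm, 'z) acat_scheme \<Rightarrow> 'o list \<Rightarrow> nat \<Rightarrow> 'm" where
  "dsum_in C Xs = fst (snd (biproduct C Xs))"

definition dsum_pr :: "('o, 'm, 'z) acat_scheme \<Rightarrow> 'o list \<Rightarrow> nat \<Rightarrow> 'm" where
  "dsum_pr C Xs = snd (snd (biproduct C Xs))"

text \<open>
  The arrow \<open>dsum C Xs \<rightarrow> dsum C Ys\<close> given by a matrix, listed by rows: the entry in row \<open>i\<close>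
  and column \<open>j\<close> is an arrow \<open>Xs ! j \<rightarrow> Ys ! i\<close>.
\<close>

definition matarr :: "('o, 'm, 'z) acat_scheme \<Rightarrow> 'o list \<Rightarrow> 'o list \<Rightarrow> 'm list list \<Rightarrow> 'm" where
  "matarr C Xs Ys M = finprod (hom_group C (dsum C Xs) (dsum C Ys))
     (\<lambda>(i, j). dsum_in C Ys i \<cdot>\<^bsub>C\<^esub> (M ! i ! j) \<cdot>\<^bsub>C\<^esub> dsum_pr C Xs j)
     ({..<length Ys} \<times> {..<length Xs})"

definition oplus :: "('o, 'm, 'z) acat_scheme \<Rightarrow> 'm \<Rightarrow> 'm \<Rightarrow> 'm" where
  "oplus C f g = matarr C [Dom C f, Dom C g] [Cod C f, Cod C g]
     [[f, Zero C (Dom C g) (Cod C f)], [Zero C (Dom C f) (Cod C g), g]]"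

definition arr_iso :: "('o, 'm, 'z) acat_scheme \<Rightarrow> 'm \<Rightarrow> bool" where
  "arr_iso C f \<longleftrightarrow> f \<in> Arr C \<and> (\<exists>g \<in> Hom C (Cod C f) (Dom C f).
     g \<cdot>\<^bsub>C\<^esub> f = Ident C (Dom C f) \<and> f \<cdot>\<^bsub>C\<^esub> g = Ident C (Cod C f))"

definition arr_inv :: "('o, 'm, 'z) acat_scheme \<Rightarrow> 'm \<Rightarrow> 'm" where
  "arr_inv C f = (THE g. g \<in> Hom C (Cod C f) (Dom C f) \<and>
     g \<cdot>\<^bsub>C\<^esub> f = Ident C (Dom C f) \<and> f \<cdot>\<^bsub>C\<^esub> g = Ident C (Cod C f))"

definition isomorphic :: "('o, 'm, 'z) acat_scheme \<Rightarrow> 'o \<Rightarrow> 'o \<Rightarrow> bool" where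
  "isomorphic C X Y \<longleftrightarrow> (\<exists>f. arr_iso C f \<and> Dom C f = X \<and> Cod C f = Y)"


section \<open>Classes of objects in triangulated categories and Verdier quotients\<close>

text \<open>
  A distinguished triangle \<open>X \<rightarrow> Y \<rightarrow> Z \<rightarrow> X[1]\<close> is recorded by its three arrows.  This is only
  the data of a triangulated category; it is used below for \<open>K\<^sup>b(A)\<close>.
\<close>

record ('o, 'm) tricat = "('o, 'm) acat" +
  Shift :: "'o \<Rightarrow> 'o"
  Dist :: "('m \<times> 'm \<times> 'm) set"

definition extension_closed :: "('o, 'm, 'z) tricat_scheme \<Rightarrow> 'o set \<Rightarrow> bool" where
  "extension_closed T E \<longleftrightarrow> E \<subseteq> Obj T \<and> (\<forall>X. zero_object T X \<longrightarrow> X \<in> E) \<and>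
     (\<forall>(u, v, w)\<in>Dist T. Dom T u \<in> E \<and> Cod T v \<in> E \<longrightarrow> Cod T u \<in> E)"

definition extension_closure :: "('o, 'm, 'z) tricat_scheme \<Rightarrow> 'o set \<Rightarrow> 'o set" where
  "extension_closure T B = \<Inter>{E. extension_closed T E \<and> B \<subseteq> E}"

text \<open>Full strict triangulated subcategories are identified with their classes of objects.\<close>

definition triangulated_subcat :: "('o, 'm, 'z) tricat_scheme \<Rightarrow> 'o set \<Rightarrow> bool" where
  "triangulated_subcat T N \<longleftrightarrow> N \<subseteq> Obj T \<and> (\<forall>X. zero_object T X \<longrightarrow> X \<in> N) \<and>
     (\<forall>X Y. isomorphic T X Y \<and> X \<in> N \<longrightarrow> Y \<in> N) \<and>
     (\<forall>X\<in>Obj T. Shift T X \<in> N \<longleftrightarrow> X \<in> N) \<and>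
     (\<forall>(u, v, w)\<in>Dist T. Dom T u \<in> N \<and> Cod T u \<in> N \<longrightarrow> Cod T v \<in> N)"

definition triangulated_generated :: "('o, 'm, 'z) tricat_scheme \<Rightarrow> 'o set \<Rightarrow> 'o set" where
  "triangulated_generated T B = \<Inter>{N. triangulated_subcat T N \<and> B \<subseteq> N}"

text \<open>
  The Verdier quotient \<open>T/N\<close>: it has the objects of \<open>T\<close>, and an arrow \<open>X \<rightarrow> Y\<close> is a class of
  roofs \<open>X \<leftarrow> Z \<rightarrow> Y\<close>, written \<open>(s, f)\<close>, where \<open>s\<close> has its cone in \<open>N\<close>.  Roofs are composed by
  completing \<open>\<rightarrow> \<leftarrow>\<close> to a commutative square, and added over a common denominator.
\<close>

definition verdier_weq :: "('o, 'm, 'z) tricat_scheme \<Rightarrow> 'o set \<Rightarrow> 'm set" where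
  "verdier_weq T N = {s \<in> Arr T. \<exists>v w. (s, v, w) \<in> Dist T \<and> Cod T v \<in> N}"

definition roofs :: "('o, 'm, 'z) tricat_scheme \<Rightarrow> 'o set \<Rightarrow> ('m \<times> 'm) set" where
  "roofs T N = {(s, f). s \<in> verdier_weq T N \<and> f \<in> Arr T \<and> Dom T s = Dom T f}"

definition roof_rel ::
    "('o, 'm, 'z) tricat_scheme \<Rightarrow> 'o set \<Rightarrow> (('m \<times> 'm) \<times> ('m \<times> 'm)) set" where
  "roof_rel T N = {((s, f), (t, g)). (s, f) \<in> roofs T N \<and> (t, g) \<in> roofs T N \<and>
     Cod T s = Cod T t \<and> Cod T f = Cod T g \<and>
     (\<exists>Z. \<exists>u \<in> Hom T Z (Dom T s). \<exists>v \<in> Hom T Z (Dom T t).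
        s \<cdot>\<^bsub>T\<^esub> u \<in> verdier_weq T N \<and> s \<cdot>\<^bsub>T\<^esub> u = t \<cdot>\<^bsub>T\<^esub> v \<and> f \<cdot>\<^bsub>T\<^esub> u = g \<cdot>\<^bsub>T\<^esub> v)}"

definition verdier_quotient ::
    "('o, 'm, 'z) tricat_scheme \<Rightarrow> 'o set \<Rightarrow> ('o, ('m \<times> 'm) set) acat" where
  "verdier_quotient T N = \<lparr>
     Obj = Obj T,
     Arr = roofs T N // roof_rel T N,
     Dom = (\<lambda>F. Cod T (fst (SOME r. r \<in> F))),
     Cod = (\<lambda>F. Cod T (snd (SOME r. r \<in> F))),
     Ident = (\<lambda>X. roof_rel T N `` {(Ident T X, Ident T X)}),
     Comp = (\<lambda>G F. \<Union>{roof_rel T N `` {(s \<cdot>\<^bsub>T\<^esub> u, g \<cdot>\<^bsub>T\<^esub> v)} | s f t g u v Z.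
        (s, f) \<in> F \<and> (t, g) \<in> G \<and> u \<in> Hom T Z (Dom T f) \<and> v \<in> Hom T Z (Dom T t) \<and>
        u \<in> verdier_weq T N \<and> f \<cdot>\<^bsub>T\<^esub> u = t \<cdot>\<^bsub>T\<^esub> v}),
     Zero = (\<lambda>X Y. roof_rel T N `` {(Ident T X, Zero T X Y)}),
     Add = (\<lambda>F G. \<Union>{roof_rel T N `` {(s, Add T f g)} | s f g. (s, f) \<in> F \<and> (s, g) \<in> G})\<rparr>"

definition verdier_map :: "('o, 'm, 'z) tricat_scheme \<Rightarrow> 'o set \<Rightarrow> 'm \<Rightarrow> ('m \<times> 'm) set" where
  "verdier_map T N f = roof_rel T N `` {(Ident T (Dom T f), f)}"


section \<open>Bounded complexes\<close>

datatype ('o, 'm) cplx = Cplx (obj_at: "int \<Rightarrow> 'o") (diff_at: "int \<Rightarrow> 'm")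

datatype ('o, 'm) chmap =
  ChMap (src: "('o, 'm) cplx") (tgt: "('o, 'm) cplx") (arr_at: "int \<Rightarrow> 'm")

definition bounded_complex :: "('o, 'm, 'z) acat_scheme \<Rightarrow> ('o, 'm) cplx \<Rightarrow> bool" where
  "bounded_complex A X \<longleftrightarrow>
     (\<forall>n. obj_at X n \<in> Obj A) \<and>
     (\<forall>n. diff_at X n \<in> Hom A (obj_at X n) (obj_at X (n + 1))) \<and>
     (\<forall>n. diff_at X (n + 1) \<cdot>\<^bsub>A\<^esub> diff_at X n = Zero A (obj_at X n) (obj_at X (n + 2))) \<and>
     (\<exists>N. \<forall>n. \<bar>n\<bar> > N \<longrightarrow> zero_object A (obj_at X n))"

definition chain_map :: "('o, 'm, 'z) acat_scheme \<Rightarrow> ('o, 'm) chmap \<Rightarrow> bool" where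
  "chain_map A f \<longleftrightarrow> bounded_complex A (src f) \<and> bounded_complex A (tgt f) \<and>
     (\<forall>n. arr_at f n \<in> Hom A (obj_at (src f) n) (obj_at (tgt f) n)) \<and>
     (\<forall>n. diff_at (tgt f) n \<cdot>\<^bsub>A\<^esub> arr_at f n = arr_at f (n + 1) \<cdot>\<^bsub>A\<^esub> diff_at (src f) n)"

definition Cb :: "('o, 'm, 'z) acat_scheme \<Rightarrow> (('o, 'm) cplx, ('o, 'm) chmap) acat" where
  "Cb A = \<lparr>
     Obj = {X. bounded_complex A X},
     Arr = {f. chain_map A f},
     Dom = src,
     Cod = tgt,
     Ident = (\<lambda>X. ChMap X X (\<lambda>n. Ident A (obj_at X n))),
     Comp = (\<lambda>g f. ChMap (src f) (tgt g) (\<lambda>n. arr_at g n \<cdot>\<^bsub>A\<^esub> arr_at f n)),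
     Zero = (\<lambda>X Y. ChMap X Y (\<lambda>n. Zero A (obj_at X n) (obj_at Y n))),
     Add = (\<lambda>f g. ChMap (src f) (tgt f) (\<lambda>n. Add A (arr_at f n) (arr_at g n)))\<rparr>"

definition homotopy_rel ::
    "('o, 'm, 'z) acat_scheme \<Rightarrow> (('o, 'm) chmap \<times> ('o, 'm) chmap) set" where
  "homotopy_rel A = {(f, g). chain_map A f \<and> chain_map A g \<and> src f = src g \<and> tgt f = tgt g \<and>
     (\<exists>h. (\<forall>n. h n \<in> Hom A (obj_at (src f) n) (obj_at (tgt f) (n - 1))) \<and>
       (\<forall>n. arr_at f n = Add A (arr_at g n)
          (Add A (diff_at (tgt f) (n - 1) \<cdot>\<^bsub>A\<^esub> h n) (h (n + 1) \<cdot>\<^bsub>A\<^esub> diff_at (src f) n))))}"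

definition shift_cplx :: "('o, 'm, 'z) acat_scheme \<Rightarrow> ('o, 'm) cplx \<Rightarrow> ('o, 'm) cplx" where
  "shift_cplx A X = Cplx (\<lambda>n. obj_at X (n + 1)) (\<lambda>n. neg A (diff_at X (n + 1)))"

definition shift_chmap :: "('o, 'm, 'z) acat_scheme \<Rightarrow> ('o, 'm) chmap \<Rightarrow> ('o, 'm) chmap" where
  "shift_chmap A f = ChMap (shift_cplx A (src f)) (shift_cplx A (tgt f)) (\<lambda>n. arr_at f (n + 1))"

definition mapping_cone :: "('o, 'm, 'z) acat_scheme \<Rightarrow> ('o, 'm) chmap \<Rightarrow> ('o, 'm) cplx" where
  "mapping_cone A f = (let X = src f; Y = tgt f in
     Cplx (\<lambda>n. dsum A [obj_at X (n + 1), obj_at Y n])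
       (\<lambda>n. matarr A [obj_at X (n + 1), obj_at Y n] [obj_at X (n + 2), obj_at Y (n + 1)]
          [[neg A (diff_at X (n + 1)), Zero A (obj_at Y n) (obj_at X (n + 2))],
           [arr_at f (n + 1), diff_at Y n]]))"

definition mapping_cone_in :: "('o, 'm, 'z) acat_scheme \<Rightarrow> ('o, 'm) chmap \<Rightarrow> ('o, 'm) chmap" where
  "mapping_cone_in A f = ChMap (tgt f) (mapping_cone A f)
     (\<lambda>n. dsum_in A [obj_at (src f) (n + 1), obj_at (tgt f) n] 1)"

definition mapping_cone_pr :: "('o, 'm, 'z) acat_scheme \<Rightarrow> ('o, 'm) chmap \<Rightarrow> ('o, 'm) chmap" where
  "mapping_cone_pr A f = ChMap (mapping_cone A f) (shift_cplx A (src f))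
     (\<lambda>n. dsum_pr A [obj_at (src f) (n + 1), obj_at (tgt f) n] 0)"

definition Kb_cat ::
    "('o, 'm, 'z) acat_scheme \<Rightarrow> (('o, 'm) cplx, ('o, 'm) chmap set) acat" where
  "Kb_cat A = \<lparr>
     Obj = Obj (Cb A),
     Arr = Arr (Cb A) // homotopy_rel A,
     Dom = (\<lambda>F. src (SOME f. f \<in> F)),
     Cod = (\<lambda>F. tgt (SOME f. f \<in> F)),
     Ident = (\<lambda>X. homotopy_rel A `` {Ident (Cb A) X}),
     Comp = (\<lambda>G F. \<Union>f\<in>F. \<Union>g\<in>G. homotopy_rel A `` {g \<cdot>\<^bsub>Cb A\<^esub> f}),
     Zero = (\<lambda>X Y. homotopy_rel A `` {Zero (Cb A) X Y}),
     Add = (\<lambda>F G. \<Union>f\<in>F. \<Union>g\<in>G. homotopy_rel A `` {Add (Cb A) f g})\<rparr>"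

definition shift_class ::
    "('o, 'm, 'z) acat_scheme \<Rightarrow> ('o, 'm) chmap set \<Rightarrow> ('o, 'm) chmap set" where
  "shift_class A F = (\<Union>f\<in>F. homotopy_rel A `` {shift_chmap A f})"

text \<open>The triangles of \<open>K\<^sup>b(A)\<close> isomorphic to \<open>X \<rightarrow> Y \<rightarrow> Cone(f) \<rightarrow> X[1]\<close> for a chain map \<open>f\<close>.\<close>

definition Kb_triangles ::
    "('o, 'm, 'z) acat_scheme
      \<Rightarrow> (('o, 'm) chmap set \<times> ('o, 'm) chmap set \<times> ('o, 'm) chmap set) set" where
  "Kb_triangles A = (let K = Kb_cat A; cls = (\<lambda>f. homotopy_rel A `` {f}) in
     {(u, v, w). u \<in> Arr K \<and> v \<in> Arr K \<and> w \<in> Arr K \<and> Cod K u = Dom K v \<and>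
        Cod K v = Dom K w \<and> Cod K w = shift_cplx A (Dom K u) \<and>
        (\<exists>f \<in> Arr (Cb A). \<exists>a \<in> Hom K (Dom K u) (src f). \<exists>b \<in> Hom K (Cod K u) (tgt f).
         \<exists>c \<in> Hom K (Cod K v) (mapping_cone A f).
           arr_iso K a \<and> arr_iso K b \<and> arr_iso K c \<and>
           b \<cdot>\<^bsub>K\<^esub> u = cls f \<cdot>\<^bsub>K\<^esub> a \<and>
           c \<cdot>\<^bsub>K\<^esub> v = cls (mapping_cone_in A f) \<cdot>\<^bsub>K\<^esub> b \<and>
           shift_class A a \<cdot>\<^bsub>K\<^esub> w = cls (mapping_cone_pr A f) \<cdot>\<^bsub>K\<^esub> c)})"

definition Kb ::
    "('o, 'm, 'z) acat_scheme \<Rightarrow> (('o, 'm) cplx, ('o, 'm) chmap set) tricat" where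
  "Kb A = (let K = Kb_cat A in
     \<lparr>Obj = Obj K, Arr = Arr K, Dom = Dom K, Cod = Cod K, Ident = Ident K, Comp = Comp K,
      Zero = Zero K, Add = Add K, Shift = shift_cplx A, Dist = Kb_triangles A\<rparr>)"


section \<open>Objects and arrows of \<open>A\<close> as complexes\<close>

definition two_term :: "('o, 'm, 'z) acat_scheme \<Rightarrow> int \<Rightarrow> 'm \<Rightarrow> ('o, 'm) cplx" where
  "two_term A k s = (let X = (\<lambda>n. if n = k then Dom A s else if n = k + 1 then Cod A s else zero_obj A)
     in Cplx X (\<lambda>n. if n = k then s else Zero A (X n) (X (n + 1))))"

definition cone_of :: "('o, 'm, 'z) acat_scheme \<Rightarrow> 'm \<Rightarrow> ('o, 'm) cplx" where
  "cone_of A s = two_term A (-1) s"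

definition emb_obj :: "('o, 'm, 'z) acat_scheme \<Rightarrow> 'o \<Rightarrow> ('o, 'm) cplx" where
  "emb_obj A Y = (let X = (\<lambda>n. if n = 0 then Y else zero_obj A)
     in Cplx X (\<lambda>n. Zero A (X n) (X (n + 1))))"

definition degree_zero_map ::
    "('o, 'm, 'z) acat_scheme \<Rightarrow> ('o, 'm) cplx \<Rightarrow> ('o, 'm) cplx \<Rightarrow> 'm \<Rightarrow> ('o, 'm) chmap" where
  "degree_zero_map A X Y f =
     ChMap X Y (\<lambda>n. if n = 0 then f else Zero A (obj_at X n) (obj_at Y n))"

definition emb_arr :: "('o, 'm, 'z) acat_scheme \<Rightarrow> 'm \<Rightarrow> ('o, 'm) chmap set" where
  "emb_arr A f =
     homotopy_rel A `` {degree_zero_map A (emb_obj A (Dom A f)) (emb_obj A (Cod A f)) f}"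

definition quot_arr :: "('o, 'm, 'z) acat_scheme \<Rightarrow> ('o, 'm) cplx set \<Rightarrow> 'm
      \<Rightarrow> (('o, 'm) chmap set \<times> ('o, 'm) chmap set) set" where
  "quot_arr A N f = verdier_map (Kb A) N (emb_arr A f)"

text \<open>
  The direct sum of arrows \<open>f1: X1 \<rightarrow> Y1\<close> and \<open>f2: X2 \<rightarrow> Y2\<close> of the quotient between objects of
  \<open>A\<close>, as an arrow between the images of the chosen sums \<open>X1 \<oplus> X2\<close> and \<open>Y1 \<oplus> Y2\<close> in \<open>A\<close>.
\<close>

definition quot_oplus :: "('o, 'm, 'z) acat_scheme \<Rightarrow> ('o, 'm) cplx set \<Rightarrow> 'o list \<Rightarrow> 'o list
      \<Rightarrow> (('o, 'm) chmap set \<times> ('o, 'm) chmap set) set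
      \<Rightarrow> (('o, 'm) chmap set \<times> ('o, 'm) chmap set) set
      \<Rightarrow> (('o, 'm) chmap set \<times> ('o, 'm) chmap set) set" where
  "quot_oplus A N Xs Ys f1 f2 = (let V = verdier_quotient (Kb A) N; q = quot_arr A N in
     Add V (q (dsum_in A Ys 0) \<cdot>\<^bsub>V\<^esub> f1 \<cdot>\<^bsub>V\<^esub> q (dsum_pr A Xs 0))
           (q (dsum_in A Ys 1) \<cdot>\<^bsub>V\<^esub> f2 \<cdot>\<^bsub>V\<^esub> q (dsum_pr A Xs 1)))"

definition factors_through :: "('o, 'm, 'z) acat_scheme \<Rightarrow> 'm \<Rightarrow> 'o set \<Rightarrow> bool" where
  "factors_through C f N \<longleftrightarrow> f \<in> Arr C \<and>
     (\<exists>M\<in>N. \<exists>u \<in> Hom C (Dom C f) M. \<exists>v \<in> Hom C M (Cod C f). v \<cdot>\<^bsub>C\<^esub> u = f)"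

end

theory Submission
  imports Defs
begin

text \<open>
  A map of complexes is inverted in the quotient iff its mapping cone lies in \<open>DD\<close>.  Everything about
  cones is reduced to degreewise split short exact sequences, each of which gives a triangle; this yields
  two-out-of-three for \<open>DD\<close>, the octahedron, and the calculus of right fractions, so that the
  quotient is preadditive.  Items 1, 2 and 3(a) are then identities between arrows: with
  \<open>w = s\<^sup>-\<^sup>1 i\<close> one has \<open>s w = i\<close>, and the three formulas are checked by exhibiting the solution \<open>y\<close> of
  \<open>t y = i'\<close> for the (triangular) middle matrix \<open>t\<close>.

  For 3(b), the degree 0 projection \<open>\<tau>: T \<rightarrow> A\<close> has kernel \<open>C1' \<oplus> C2' \<rightarrow> C1 \<oplus> C2\<close>, hence is inverted, and the
  rows of \<open>r\<close> are null-homotopies showing that \<open>T \<rightarrow> A'\<close> equals \<open>(f2 - f1) \<tau>\<close>.  An arrow vanishes in the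
  quotient iff it factors through \<open>DD\<close>, which gives (i) iff (ii).  A solution of the equation in (iii) is the same
  as a factorization through the three-term complex \<open>Z \<rightarrow> T1 \<oplus> T2 \<rightarrow> Z'\<close>.  Conversely, up to
  homotopy every object of \<open>DD\<close> splits in each degree \<open>n\<close> as \<open>Z n \<oplus> T n\<close> with the components \<open>Z n \<rightarrow> T (n + 1)\<close>
  of the differential having cones in \<open>D\<close>, because such complexes form a triangulated subcategory;
  degrees -1, 0 and 1 of such a complex provide the data in (iii).
\<close>

section \<open>Calculus in preadditive categories\<close>

text \<open>Neither the axioms of a triangulated structure on the homotopy category nor one on the
  quotient are established. Rotation is replaced by the computation of the cone of a degreewise
  split epimorphism, and independence of the choice of a triangle by the fact that isomorphic arrows
  have isomorphic cones. Two obstacles shape the normal form. \<open>DD\<close> is an intersection,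
  so its objects are accessible only through some triangulated class containing the generators. And
  \<open>D\<close> is closed under extensions but not visibly under shifts, while \<open>DD\<close>
  is shift-invariant; so an object of \<open>DD\<close> is cut into single arrows, each tested
  against \<open>D\<close> as a cone in degrees -1 and 0. A mapping cone makes these arrows
  triangular and a shift changes their sign; the condition survives both. The factorization in (ii)
  lives in the category of complexes, not up to homotopy. A null-homotopy is therefore converted
  into a strict factorization through a cone, and a homotopy has to be absorbed by hand once the
  middle object is replaced by an isomorphic one.\<close>

notation Add (infixl "\<boxplus>\<index>" 65)
notation neg ("\<boxminus>\<index> _" [81] 80)

definition tp :: "'o \<Rightarrow> 'o \<Rightarrow> ('o \<times> 'o) option" where
  "tp X Y = Some (X, Y)"

text \<open>
  The type of an arrow as a term: conditional rewriting can infer the unknown objects in a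
  premise of the form \<open>ty C f = tp X Y\<close>.
\<close>

definition ty :: "('o, 'm, 'z) acat_scheme \<Rightarrow> 'm \<Rightarrow> ('o \<times> 'o) option" where
  "ty C f = (if f \<in> Arr C then Some (Dom C f, Cod C f) else None)"

lemma tp_eq: "tp X Y = tp X' Y' \<longleftrightarrow> X = X' \<and> Y = Y'"
  by (simp add: tp_def)

lemma Hom_ty: "f \<in> Hom C X Y \<longleftrightarrow> ty C f = tp X Y"
  by (auto simp: Hom_def ty_def tp_def)

lemma Dom_ty: "ty C f = tp X Y \<Longrightarrow> Dom C f = X"
  and Cod_ty: "ty C f = tp X Y \<Longrightarrow> Cod C f = Y"
  and Arr_ty: "ty C f = tp X Y \<Longrightarrow> f \<in> Arr C"
  by (auto simp: ty_def tp_def split: if_splits)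

lemma ty_Arr: "f \<in> Arr C \<Longrightarrow> ty C f = tp (Dom C f) (Cod C f)"
  by (auto simp: ty_def tp_def)

text \<open>
  Formal differences: collecting the negative terms of an equation in the second component
  turns it into an equation between sums without signs.
\<close>

definition dif :: "('o, 'm, 'z) acat_scheme \<Rightarrow> 'm \<Rightarrow> 'm \<Rightarrow> 'm" where
  "dif C a b = Add C a (neg C b)"

context preadditive_category
begin

lemma ty_Dom_Obj: "ty C f = tp X Y \<Longrightarrow> X \<in> Obj C"
  and ty_Cod_Obj: "ty C f = tp X Y \<Longrightarrow> Y \<in> Obj C"
  using Dom_Obj Cod_Obj by (metis Arr_ty Dom_ty, metis Arr_ty Cod_ty)

lemma ty_Ident: "X \<in> Obj C \<Longrightarrow> ty C (Ident C X) = tp X X"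
  using Ident_Hom by (simp add: Hom_ty)

lemma ty_Comp: "\<lbrakk>ty C f = tp X Y; ty C g = tp Y Z\<rbrakk> \<Longrightarrow> ty C (g \<cdot> f) = tp X Z"
  using Comp_Hom by (simp add: Hom_ty)

lemma hom_group_simps:
  "carrier (hom_group C X Y) = {f. ty C f = tp X Y}"
  "mult (hom_group C X Y) = Add C"
  "one (hom_group C X Y) = Zero C X Y"
  by (auto simp: hom_group_def Hom_ty)

lemma hom_grp:
  assumes "X \<in> Obj C" "Y \<in> Obj C"
  shows "comm_group (hom_group C X Y)" "group (hom_group C X Y)" "comm_monoid (hom_group C X Y)"
    "monoid (hom_group C X Y)"
  using hom_comm_group[OF assms] by (auto simp: comm_group_def group_def comm_group.axioms)

lemma ty_Zero: "\<lbrakk>X \<in> Obj C; Y \<in> Obj C\<rbrakk> \<Longrightarrow> ty C (Zero C X Y) = tp X Y"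
  using monoid.one_closed[OF hom_grp(4)] by (simp add: hom_group_simps)

lemma ty_Add: "\<lbrakk>ty C f = tp X Y; ty C g = tp X Y\<rbrakk> \<Longrightarrow> ty C (f \<boxplus> g) = tp X Y"
  using monoid.m_closed[OF hom_grp(4)[OF ty_Dom_Obj ty_Cod_Obj], of f X Y f X Y f g]
  by (simp add: hom_group_simps)

lemma ty_neg: "ty C f = tp X Y \<Longrightarrow> ty C (\<boxminus> f) = tp X Y"
  using group.inv_closed[OF hom_grp(2)[OF ty_Dom_Obj ty_Cod_Obj], of f X Y f X Y f]
  by (simp add: hom_group_simps neg_def Dom_ty Cod_ty)

lemma comp_assoc:
  "\<lbrakk>ty C f = tp X Y; ty C g = tp Y Z; ty C h = tp Z W\<rbrakk> \<Longrightarrow> (h \<cdot> g) \<cdot> f = h \<cdot> (g \<cdot> f)"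
  using Comp_assoc by (simp add: Hom_ty)

lemma comp_Ident_l: "ty C f = tp X Y \<Longrightarrow> Ident C Y \<cdot> f = f"
  and comp_Ident_r: "ty C f = tp X Y \<Longrightarrow> f \<cdot> Ident C X = f"
  using Comp_Ident_left Comp_Ident_right by (simp_all add: Hom_ty)

lemma comp_Add_l:
  "\<lbrakk>ty C f = tp X Y; ty C g = tp Y Z; ty C g' = tp Y Z\<rbrakk> \<Longrightarrow> (g \<boxplus> g') \<cdot> f = g \<cdot> f \<boxplus> g' \<cdot> f"
  and comp_Add_r:
  "\<lbrakk>ty C f = tp X Y; ty C f' = tp X Y; ty C g = tp Y Z\<rbrakk> \<Longrightarrow> g \<cdot> (f \<boxplus> f') = g \<cdot> f \<boxplus> g \<cdot> f'"
  using Comp_Add_left Comp_Add_right by (simp_all add: Hom_ty)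

lemma add_assoc:
  "\<lbrakk>ty C f = tp X Y; ty C g = tp X Y; ty C h = tp X Y\<rbrakk> \<Longrightarrow> (f \<boxplus> g) \<boxplus> h = f \<boxplus> (g \<boxplus> h)"
  using monoid.m_assoc[OF hom_grp(4)[OF ty_Dom_Obj ty_Cod_Obj], of f X Y f X Y f g h]
  by (simp add: hom_group_simps)

lemma add_comm: "\<lbrakk>ty C f = tp X Y; ty C g = tp X Y\<rbrakk> \<Longrightarrow> f \<boxplus> g = g \<boxplus> f"
  using comm_monoid.m_comm[OF hom_grp(3)[OF ty_Dom_Obj ty_Cod_Obj], of f X Y f X Y f g]
  by (simp add: hom_group_simps)

lemma add_lcomm:
  "\<lbrakk>ty C f = tp X Y; ty C g = tp X Y; ty C h = tp X Y\<rbrakk> \<Longrightarrow> f \<boxplus> (g \<boxplus> h) = g \<boxplus> (f \<boxplus> h)"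
  by (metis add_assoc add_comm)

lemma add_Zero_l: "ty C f = tp X Y \<Longrightarrow> Zero C X Y \<boxplus> f = f"
  using monoid.l_one[OF hom_grp(4)[OF ty_Dom_Obj ty_Cod_Obj], of f X Y f X Y f]
  by (simp add: hom_group_simps)

lemma add_Zero_r: "ty C f = tp X Y \<Longrightarrow> f \<boxplus> Zero C X Y = f"
  using add_Zero_l add_comm ty_Zero ty_Dom_Obj ty_Cod_Obj by metis

lemma add_neg_l: "ty C f = tp X Y \<Longrightarrow> \<boxminus> f \<boxplus> f = Zero C X Y"
  using group.l_inv[OF hom_grp(2)[OF ty_Dom_Obj ty_Cod_Obj], of f X Y f X Y f]
  by (simp add: hom_group_simps neg_def Dom_ty Cod_ty)

lemma add_neg_r: "ty C f = tp X Y \<Longrightarrow> f \<boxplus> \<boxminus> f = Zero C X Y"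
  using add_neg_l add_comm ty_neg by metis

lemma add_cancel_l:
  assumes "ty C f = tp X Y" "ty C g = tp X Y" "ty C h = tp X Y"
  shows "f \<boxplus> g = f \<boxplus> h \<longleftrightarrow> g = h"
  using assms by (metis add_assoc add_neg_l add_Zero_l ty_neg)

lemma add_cancel_r:
  assumes "ty C f = tp X Y" "ty C g = tp X Y" "ty C h = tp X Y"
  shows "g \<boxplus> f = h \<boxplus> f \<longleftrightarrow> g = h"
  using assms by (metis add_comm add_cancel_l)

lemma neg_unique:
  assumes "ty C f = tp X Y" "ty C g = tp X Y" "g \<boxplus> f = Zero C X Y"
  shows "\<boxminus> f = g"
  using assms by (metis add_neg_l add_cancel_r ty_neg)

lemma comp_Zero_r:
  assumes "ty C f = tp X Y" "W \<in> Obj C"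
  shows "f \<cdot> Zero C W X = Zero C W Y"
proof -
  have z: "ty C (Zero C W X) = tp W X" "ty C (f \<cdot> Zero C W X) = tp W Y"
    using assms ty_Zero ty_Comp ty_Dom_Obj by metis+
  have "f \<cdot> Zero C W X \<boxplus> f \<cdot> Zero C W X = f \<cdot> (Zero C W X \<boxplus> Zero C W X)"
    using comp_Add_r[OF z(1) z(1) assms(1)] by simp
  also have "\<dots> = f \<cdot> Zero C W X \<boxplus> Zero C W Y"
    using z by (simp add: add_Zero_l add_Zero_r)
  finally show ?thesis
    using z add_cancel_l[OF z(2) z(2)] ty_Zero assms ty_Cod_Obj by metis
qed

lemma comp_Zero_l:
  assumes "ty C f = tp X Y" "W \<in> Obj C"
  shows "Zero C Y W \<cdot> f = Zero C X W"
proof -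
  have z: "ty C (Zero C Y W) = tp Y W" "ty C (Zero C Y W \<cdot> f) = tp X W"
    using assms ty_Zero ty_Comp ty_Cod_Obj by metis+
  have "Zero C Y W \<cdot> f \<boxplus> Zero C Y W \<cdot> f = (Zero C Y W \<boxplus> Zero C Y W) \<cdot> f"
    using comp_Add_l[OF assms(1) z(1) z(1)] by simp
  also have "\<dots> = Zero C Y W \<cdot> f \<boxplus> Zero C X W"
    using z by (simp add: add_Zero_l add_Zero_r)
  finally show ?thesis
    using z add_cancel_l[OF z(2) z(2)] ty_Zero assms ty_Dom_Obj by metis
qed

lemma comp_neg_r:
  assumes "ty C f = tp X Y" "ty C g = tp Y Z"
  shows "g \<cdot> \<boxminus> f = \<boxminus> (g \<cdot> f)"
  using neg_unique[OF ty_Comp[OF assms] ty_Comp[OF ty_neg[OF assms(1)] assms(2)]]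
    comp_Add_r[OF ty_neg[OF assms(1)] assms(1) assms(2)] add_neg_l[OF assms(1)]
    comp_Zero_r[OF assms(2) ty_Dom_Obj[OF assms(1)]] by simp

lemma comp_neg_l:
  assumes "ty C f = tp X Y" "ty C g = tp Y Z"
  shows "\<boxminus> g \<cdot> f = \<boxminus> (g \<cdot> f)"
  using neg_unique[OF ty_Comp[OF assms] ty_Comp[OF assms(1) ty_neg[OF assms(2)]]]
    comp_Add_l[OF assms(1) ty_neg[OF assms(2)] assms(2)] add_neg_l[OF assms(2)]
    comp_Zero_l[OF assms(1) ty_Cod_Obj[OF assms(2)]] by simp

lemma neg_neg: "ty C f = tp X Y \<Longrightarrow> \<boxminus> (\<boxminus> f) = f"
  using neg_unique add_neg_r ty_neg by metis

lemma neg_Add: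
  assumes "ty C f = tp X Y" "ty C g = tp X Y"
  shows "\<boxminus> (f \<boxplus> g) = \<boxminus> f \<boxplus> \<boxminus> g"
proof (rule neg_unique)
  note nt = ty_neg[OF assms(1)] ty_neg[OF assms(2)]
  show "\<boxminus> f \<boxplus> \<boxminus> g \<boxplus> (f \<boxplus> g) = Zero C X Y"
    unfolding add_assoc[OF nt ty_Add[OF assms]] add_lcomm[OF nt(2) assms]
      add_neg_l[OF assms(2)] add_Zero_r[OF assms(1)] add_neg_l[OF assms(1)] ..
qed (use assms in \<open>simp_all add: ty_Add ty_neg\<close>)

lemma neg_Zero: "\<lbrakk>X \<in> Obj C; Y \<in> Obj C\<rbrakk> \<Longrightarrow> \<boxminus> (Zero C X Y) = Zero C X Y"
  using neg_unique add_Zero_l ty_Zero by metis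

lemma ty_dif: "\<lbrakk>ty C a = tp X Y; ty C b = tp X Y\<rbrakk> \<Longrightarrow> ty C (dif C a b) = tp X Y"
  by (simp add: dif_def ty_Add ty_neg)

lemma neg_dif: "ty C a = tp X Y \<Longrightarrow> \<boxminus> a = dif C (Zero C X Y) a"
  by (simp add: dif_def add_Zero_l ty_neg)

lemma neg_of_dif: "\<lbrakk>ty C a = tp X Y; ty C b = tp X Y\<rbrakk> \<Longrightarrow> \<boxminus> (dif C a b) = dif C b a"
  by (simp add: dif_def neg_Add neg_neg ty_neg add_comm)

lemma dif_Zero: "ty C a = tp X Y \<Longrightarrow> dif C a (Zero C X Y) = a"
  by (simp add: dif_def neg_Zero add_Zero_r ty_Dom_Obj ty_Cod_Obj)

lemma dif_self: "ty C a = tp X Y \<Longrightarrow> dif C a a = Zero C X Y"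
  by (simp add: dif_def add_neg_r)

lemma dif_add:
  assumes "ty C a = tp X Y" "ty C b = tp X Y" "ty C c = tp X Y"
  shows "dif C a b \<boxplus> c = dif C (a \<boxplus> c) b" "c \<boxplus> dif C a b = dif C (c \<boxplus> a) b"
  using assms by (simp_all add: dif_def ty_neg ty_Add add_assoc add_comm add_lcomm)

lemma dif_dif:
  assumes "ty C a = tp X Y" "ty C b = tp X Y" "ty C c = tp X Y"
  shows "dif C (dif C a b) c = dif C a (b \<boxplus> c)" "dif C c (dif C a b) = dif C (c \<boxplus> b) a"
  using assms
  by (simp_all add: dif_def ty_neg ty_Add neg_Add neg_neg add_assoc add_comm add_lcomm)

lemma comp_dif:
  assumes "ty C a = tp X Y" "ty C b = tp X Y"
  shows "ty C f = tp W X \<Longrightarrow> dif C a b \<cdot> f = dif C (a \<cdot> f) (b \<cdot> f)"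
    "ty C g = tp Y Z \<Longrightarrow> g \<cdot> dif C a b = dif C (g \<cdot> a) (g \<cdot> b)"
  using assms
  by (simp_all add: dif_def ty_neg ty_Comp comp_Add_l comp_Add_r comp_neg_l comp_neg_r)

lemma dif_eq:
  assumes "ty C a = tp X Y" "ty C b = tp X Y" "ty C c = tp X Y"
  shows "dif C a b = c \<longleftrightarrow> a = c \<boxplus> b" "c = dif C a b \<longleftrightarrow> c \<boxplus> b = a"
proof -
  have 1: "dif C a b = c \<longleftrightarrow> a = c \<boxplus> b"
    using assms
    by (auto simp: dif_def ty_neg ty_Add add_assoc add_neg_l add_neg_r add_Zero_r)
  then show "dif C a b = c \<longleftrightarrow> a = c \<boxplus> b" "c = dif C a b \<longleftrightarrow> c \<boxplus> b = a"
    by auto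
qed

text \<open>Rewriting sets for two rival normal forms. \<open>arr_calc\<close> turns every sign into
  a formal difference and balances the equation; \<open>arr_neg\<close> instead pulls signs out of
  composites. Both are used with \<open>arr_ty\<close>, which discharges the typing
  premises.\<close>

lemmas arr_ty = ty_Comp ty_Add ty_neg ty_dif ty_Ident ty_Zero
lemmas arr_mult = comp_assoc comp_Ident_l comp_Ident_r comp_Zero_l comp_Zero_r
  comp_Add_l comp_Add_r add_Zero_l add_Zero_r
lemmas arr_dif = neg_dif neg_of_dif dif_Zero dif_self dif_add dif_dif comp_dif dif_eq
lemmas arr_neg = comp_neg_l comp_neg_r neg_neg neg_Add neg_Zero
lemmas arr_ac = add_assoc add_comm add_lcomm
lemmas arr_calc = arr_ty arr_mult arr_dif arr_ac

text \<open>Simplification brackets composites to the right, so a rule for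
  \<open>a \<cdot> b\<close> no longer matches inside \<open>a \<cdot> (b \<cdot> x)\<close>. This
  is the form of the rule that does.\<close>

lemma reassoc:
  "\<lbrakk>a \<cdot> b = c; ty C a = tp Y Z; ty C b = tp X Y; ty C x = tp W X\<rbrakk> \<Longrightarrow> a \<cdot> (b \<cdot> x) = c \<cdot> x"
  using comp_assoc by metis

end

section \<open>Biproducts and matrices\<close>

definition inl :: "('o, 'm, 'z) acat_scheme \<Rightarrow> 'o \<Rightarrow> 'o \<Rightarrow> 'm" where
  "inl C X Y = dsum_in C [X, Y] 0"
definition inr :: "('o, 'm, 'z) acat_scheme \<Rightarrow> 'o \<Rightarrow> 'o \<Rightarrow> 'm" where
  "inr C X Y = dsum_in C [X, Y] 1"
definition prl :: "('o, 'm, 'z) acat_scheme \<Rightarrow> 'o \<Rightarrow> 'o \<Rightarrow> 'm" where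
  "prl C X Y = dsum_pr C [X, Y] 0"
definition prr :: "('o, 'm, 'z) acat_scheme \<Rightarrow> 'o \<Rightarrow> 'o \<Rightarrow> 'm" where
  "prr C X Y = dsum_pr C [X, Y] 1"

text \<open>A two-summand biproduct given by single arrows instead of the indexed families of
  \<open>is_biproduct\<close>. The injections \<open>i\<close>, \<open>j\<close> come before the
  projections \<open>p\<close>, \<open>q\<close>. The same predicate states that a sequence of
  complexes splits in a given degree.\<close>

definition bip ::
    "('o, 'm, 'z) acat_scheme \<Rightarrow> 'o \<Rightarrow> 'o \<Rightarrow> 'o \<Rightarrow> 'm \<Rightarrow> 'm \<Rightarrow> 'm \<Rightarrow> 'm \<Rightarrow> bool" where
  "bip C X Y P i j p q \<longleftrightarrow> ty C i = tp X P \<and> ty C j = tp Y P \<and> ty C p = tp P X \<and> ty C q = tp P Y \<and>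
     p \<cdot>\<^bsub>C\<^esub> i = Ident C X \<and> p \<cdot>\<^bsub>C\<^esub> j = Zero C Y X \<and> q \<cdot>\<^bsub>C\<^esub> i = Zero C X Y \<and> q \<cdot>\<^bsub>C\<^esub> j = Ident C Y \<and>
     Add C (i \<cdot>\<^bsub>C\<^esub> p) (j \<cdot>\<^bsub>C\<^esub> q) = Ident C P"

context preadditive_category
begin

lemma sum_empty: "\<lbrakk>X \<in> Obj C; Y \<in> Obj C\<rbrakk> \<Longrightarrow> finprod (hom_group C X Y) F {} = Zero C X Y"
  using comm_monoid.finprod_empty[OF hom_grp(3)] by (simp add: hom_group_simps)

lemma sum_insert:
  assumes "finite I" "i \<notin> I" "ty C (F i) = tp X Y" "\<forall>j\<in>I. ty C (F j) = tp X Y"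
  shows "finprod (hom_group C X Y) F (insert i I) = F i \<boxplus> finprod (hom_group C X Y) F I"
  using comm_monoid.finprod_insert[OF hom_grp(3)[OF ty_Dom_Obj ty_Cod_Obj], of "F i" X Y "F i" X Y I i F]
    assms by (auto simp: hom_group_simps)

lemma bipD:
  assumes b: "bip C X Y P i j p q"
  shows "ty C i = tp X P" "ty C j = tp Y P" "ty C p = tp P X" "ty C q = tp P Y"
    "X \<in> Obj C" "Y \<in> Obj C" "P \<in> Obj C"
    "p \<cdot> i = Ident C X" "p \<cdot> j = Zero C Y X" "q \<cdot> i = Zero C X Y" "q \<cdot> j = Ident C Y"
    "i \<cdot> p \<boxplus> j \<cdot> q = Ident C P"
    "ty C f = tp W X \<Longrightarrow> p \<cdot> (i \<cdot> f) = f" "ty C g = tp W Y \<Longrightarrow> p \<cdot> (j \<cdot> g) = Zero C W X"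
    "ty C f = tp W X \<Longrightarrow> q \<cdot> (i \<cdot> f) = Zero C W Y" "ty C g = tp W Y \<Longrightarrow> q \<cdot> (j \<cdot> g) = g"
proof -
  show 1: "ty C i = tp X P" "ty C j = tp Y P" "ty C p = tp P X" "ty C q = tp P Y"
    "p \<cdot> i = Ident C X" "p \<cdot> j = Zero C Y X" "q \<cdot> i = Zero C X Y" "q \<cdot> j = Ident C Y"
    "i \<cdot> p \<boxplus> j \<cdot> q = Ident C P"
    using b by (auto simp: bip_def)
  then show 2: "X \<in> Obj C" "Y \<in> Obj C" "P \<in> Obj C"
    using ty_Dom_Obj ty_Cod_Obj by blast+
  show "ty C f = tp W X \<Longrightarrow> p \<cdot> (i \<cdot> f) = f" "ty C g = tp W Y \<Longrightarrow> p \<cdot> (j \<cdot> g) = Zero C W X"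
    "ty C f = tp W X \<Longrightarrow> q \<cdot> (i \<cdot> f) = Zero C W Y" "ty C g = tp W Y \<Longrightarrow> q \<cdot> (j \<cdot> g) = g"
    using 1 2 reassoc[OF 1(5) 1(3) 1(1)] reassoc[OF 1(6) 1(3) 1(2)]
      reassoc[OF 1(7) 1(4) 1(1)] reassoc[OF 1(8) 1(4) 1(2)]
    by (simp_all add: comp_Ident_l comp_Zero_l)
qed

lemma bip_into_eq:
  assumes b: "bip C X Y P i j p q" and f: "ty C f = tp W P" "ty C g = tp W P"
    and e: "p \<cdot> f = p \<cdot> g" "q \<cdot> f = q \<cdot> g"
  shows "f = g"
proof -
  have *: "h = i \<cdot> (p \<cdot> h) \<boxplus> j \<cdot> (q \<cdot> h)" if h: "ty C h = tp W P" for h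
  proof -
    have "h = (i \<cdot> p \<boxplus> j \<cdot> q) \<cdot> h"
      using h by (simp add: bipD[OF b] comp_Ident_l)
    also have "\<dots> = i \<cdot> (p \<cdot> h) \<boxplus> j \<cdot> (q \<cdot> h)"
      by (simp add: bipD(1-4)[OF b] h arr_ty comp_Add_l comp_assoc)
    finally show ?thesis .
  qed
  show ?thesis
    using *[OF f(1)] *[OF f(2)] e by simp
qed

end

context additive_category
begin

text \<open>The iterated sum of \<open>X \<oplus> Y\<close> and \<open>Z\<close> is a biproduct of
  the list. The chosen sum of three objects need not be this one; existence is what makes the choice
  in \<open>biproduct\<close> meaningful.\<close>

lemma biproduct3_exists:
  assumes "X \<in> Obj C" "Y \<in> Obj C" "Z \<in> Obj C"
  shows "\<exists>P \<iota> \<pi>. is_biproduct C [X, Y, Z] P \<iota> \<pi>"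
proof -
  obtain P i p where P: "is_biproduct C [X, Y] P i p"
    using ex_biproduct[OF assms(1,2)] by blast
  then have [simp]: "P \<in> Obj C"
    by (simp add: is_biproduct_def)
  obtain Q j q where Q: "is_biproduct C [P, Z] Q j q"
    using ex_biproduct[of P Z] assms by auto
  have [simp]: "Q \<in> Obj C"
    using Q by (simp add: is_biproduct_def)
  note [simp] = assms
  have t[simp]: "ty C (i 0) = tp X P" "ty C (i (Suc 0)) = tp Y P" "ty C (p 0) = tp P X" "ty C (p (Suc 0)) = tp P Y"
    "ty C (j 0) = tp P Q" "ty C (j (Suc 0)) = tp Z Q" "ty C (q 0) = tp Q P" "ty C (q (Suc 0)) = tp Q Z"
    using P Q by (auto simp: is_biproduct_def Hom_ty less_Suc_eq)
  have e: "p 0 \<cdot> i 0 = Ident C X" "p 0 \<cdot> i (Suc 0) = Zero C Y X" "p (Suc 0) \<cdot> i 0 = Zero C X Y"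
      "p (Suc 0) \<cdot> i (Suc 0) = Ident C Y"
      "q 0 \<cdot> j 0 = Ident C P" "q 0 \<cdot> j (Suc 0) = Zero C Z P" "q (Suc 0) \<cdot> j 0 = Zero C P Z"
      "q (Suc 0) \<cdot> j (Suc 0) = Ident C Z"
    using P Q by (auto simp: is_biproduct_def less_Suc_eq)
  note e' = e(5)[THEN reassoc] e(6)[THEN reassoc] e(7)[THEN reassoc] e(8)[THEN reassoc]
    e(1)[THEN reassoc] e(2)[THEN reassoc] e(3)[THEN reassoc] e(4)[THEN reassoc]
  have s: "i 0 \<cdot> p 0 \<boxplus> i (Suc 0) \<cdot> p (Suc 0) = Ident C P" "j 0 \<cdot> q 0 \<boxplus> j (Suc 0) \<cdot> q (Suc 0) = Ident C Q"
    using P Q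
    by (auto simp: is_biproduct_def lessThan_Suc sum_insert sum_empty arr_ty add_Zero_l add_Zero_r arr_ac)
  define k where "k n = (if n = 0 then j 0 \<cdot> i 0 else if n = Suc 0 then j 0 \<cdot> i (Suc 0) else j (Suc 0))" for n :: nat
  define r where "r n = (if n = 0 then p 0 \<cdot> q 0 else if n = Suc 0 then p (Suc 0) \<cdot> q 0 else q (Suc 0))" for n :: nat
  have "Ident C Q = j 0 \<cdot> ((i 0 \<cdot> p 0 \<boxplus> i (Suc 0) \<cdot> p (Suc 0)) \<cdot> q 0) \<boxplus> j (Suc 0) \<cdot> q (Suc 0)"
    unfolding s(1) by (simp add: arr_ty comp_Ident_l s)
  also have "\<dots> = finprod (hom_group C Q Q) (\<lambda>n. k n \<cdot> r n) {..<Suc (Suc (Suc 0))}"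
    by (auto simp: lessThan_Suc sum_insert sum_empty arr_ty k_def r_def arr_mult arr_ac)
  finally have s3: "finprod (hom_group C Q Q) (\<lambda>n. k n \<cdot> r n) {..<Suc (Suc (Suc 0))} = Ident C Q" ..
  have "is_biproduct C [X, Y, Z] Q k r"
    unfolding is_biproduct_def using s3
    by (auto simp: less_Suc_eq Hom_ty arr_ty k_def r_def arr_mult e e')
  then show ?thesis
    by blast
qed

lemma biproduct1: "X \<in> Obj C \<Longrightarrow> is_biproduct C [X] X (\<lambda>_. Ident C X) (\<lambda>_. Ident C X)"
  by (simp add: is_biproduct_def Hom_ty lessThan_Suc sum_insert sum_empty arr_ty arr_mult)

text \<open>For a list of length other than one the normalisation clause in \<open>biproduct\<close>
  is vacuous, so every biproduct witnesses the choice.\<close>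

lemma biproduct_spec:
  assumes "\<exists>P \<iota> \<pi>. is_biproduct C Xs P \<iota> \<pi>" "length Xs \<noteq> 1"
  shows "is_biproduct C Xs (dsum C Xs) (dsum_in C Xs) (dsum_pr C Xs)"
proof -
  have "\<exists>b. case b of (P, \<iota>, \<pi>) \<Rightarrow> is_biproduct C Xs P \<iota> \<pi> \<and>
     (\<forall>X. Xs = [X] \<longrightarrow> P = X \<and> \<iota> 0 = Ident C X \<and> \<pi> 0 = Ident C X)"
    using assms by fastforce
  from someI_ex[OF this, folded biproduct_def] show ?thesis
    by (simp add: dsum_def dsum_in_def dsum_pr_def split: prod.splits)
qed

lemma dsum_single:
  assumes "X \<in> Obj C"
  shows "dsum C [X] = X" "dsum_in C [X] 0 = Ident C X" "dsum_pr C [X] 0 = Ident C X"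
proof -
  have "\<exists>b. case b of (P, \<iota>, \<pi>) \<Rightarrow> is_biproduct C [X] P \<iota> \<pi> \<and>
     (\<forall>X'. [X] = [X'] \<longrightarrow> P = X' \<and> \<iota> 0 = Ident C X' \<and> \<pi> 0 = Ident C X')"
    using biproduct1[OF assms] by auto
  from someI_ex[OF this, folded biproduct_def]
  show "dsum C [X] = X" "dsum_in C [X] 0 = Ident C X" "dsum_pr C [X] 0 = Ident C X"
    by (simp_all add: dsum_def dsum_in_def dsum_pr_def split: prod.splits)
qed

lemma bip_dsum:
  assumes "X \<in> Obj C" "Y \<in> Obj C"
  shows "bip C X Y (dsum C [X, Y]) (inl C X Y) (inr C X Y) (prl C X Y) (prr C X Y)"
proof -
  have b: "is_biproduct C [X, Y] (dsum C [X, Y]) (dsum_in C [X, Y]) (dsum_pr C [X, Y])"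
    using biproduct_spec[OF ex_biproduct[OF assms]] by simp
  then have t: "ty C (inl C X Y) = tp X (dsum C [X, Y])" "ty C (inr C X Y) = tp Y (dsum C [X, Y])"
     "ty C (prl C X Y) = tp (dsum C [X, Y]) X" "ty C (prr C X Y) = tp (dsum C [X, Y]) Y"
     "dsum C [X, Y] \<in> Obj C"
    by (auto simp: is_biproduct_def Hom_ty less_Suc_eq inl_def inr_def prl_def prr_def)
  moreover have "inl C X Y \<cdot> prl C X Y \<boxplus> inr C X Y \<cdot> prr C X Y = Ident C (dsum C [X, Y])"
    using b t
    by (simp add: is_biproduct_def lessThan_Suc sum_insert sum_empty arr_ty inl_def inr_def prl_def prr_def
        add_Zero_l add_Zero_r arr_ac)
  ultimately show ?thesis
    using b by (auto simp: bip_def is_biproduct_def less_Suc_eq inl_def inr_def prl_def prr_def)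
qed

lemmas bin = bipD(1-4,7-11,13-16)[OF bip_dsum]
lemmas bin_Ident = bipD(12)[OF bip_dsum]
lemma dsum3:
  assumes "X \<in> Obj C" "Y \<in> Obj C" "Z \<in> Obj C"
  defines "P \<equiv> dsum C [X, Y, Z]" and "i \<equiv> dsum_in C [X, Y, Z]" and "p \<equiv> dsum_pr C [X, Y, Z]"
  shows "P \<in> Obj C" "ty C (i 0) = tp X P" "ty C (i 1) = tp Y P" "ty C (i 2) = tp Z P"
    "ty C (p 0) = tp P X" "ty C (p 1) = tp P Y" "ty C (p 2) = tp P Z"
    "p 0 \<cdot> i 0 = Ident C X" "p 0 \<cdot> i 1 = Zero C Y X" "p 0 \<cdot> i 2 = Zero C Z X"
    "p 1 \<cdot> i 0 = Zero C X Y" "p 1 \<cdot> i 1 = Ident C Y" "p 1 \<cdot> i 2 = Zero C Z Y"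
    "p 2 \<cdot> i 0 = Zero C X Z" "p 2 \<cdot> i 1 = Zero C Y Z" "p 2 \<cdot> i 2 = Ident C Z"
    "i 0 \<cdot> p 0 \<boxplus> (i 1 \<cdot> p 1 \<boxplus> i 2 \<cdot> p 2) = Ident C P"
proof -
  have b: "is_biproduct C [X, Y, Z] P i p"
    unfolding P_def i_def p_def using biproduct_spec[OF biproduct3_exists[OF assms(1-3)]] by simp
  have two: "(2::nat) = Suc (Suc 0)"
    by simp
  show t: "P \<in> Obj C" "ty C (i 0) = tp X P" "ty C (i 1) = tp Y P" "ty C (i 2) = tp Z P"
    "ty C (p 0) = tp P X" "ty C (p 1) = tp P Y" "ty C (p 2) = tp P Z"
    "p 0 \<cdot> i 0 = Ident C X" "p 0 \<cdot> i 1 = Zero C Y X" "p 0 \<cdot> i 2 = Zero C Z X"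
    "p 1 \<cdot> i 0 = Zero C X Y" "p 1 \<cdot> i 1 = Ident C Y" "p 1 \<cdot> i 2 = Zero C Z Y"
    "p 2 \<cdot> i 0 = Zero C X Z" "p 2 \<cdot> i 1 = Zero C Y Z" "p 2 \<cdot> i 2 = Ident C Z"
    using b unfolding two by (auto simp: is_biproduct_def Hom_ty less_Suc_eq)
  then show "i 0 \<cdot> p 0 \<boxplus> (i 1 \<cdot> p 1 \<boxplus> i 2 \<cdot> p 2) = Ident C P"
    using b unfolding two
    by (simp add: is_biproduct_def lessThan_Suc sum_insert sum_empty arr_ty add_Zero_l add_Zero_r arr_ac)
qed

text \<open>Each matrix shape occurring later is expanded once into injections, entries and
  projections. A one-element list contributes identities because the choice of its sum is
  normalised.\<close>

lemma matarr_12: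
  assumes "ty C a = tp X W" "ty C b = tp Y W"
  shows "matarr C [X, Y] [W] [[a, b]] = a \<cdot> prl C X Y \<boxplus> b \<cdot> prr C X Y"
proof -
  note o = ty_Dom_Obj[OF assms(1)] ty_Dom_Obj[OF assms(2)] ty_Cod_Obj[OF assms(1)]
  have e: "{..<length [W]} \<times> {..<length [X, Y]} = {(0, 0), (0, 1)}"
    by auto
  note b = bin(1-5)[OF o(1,2), unfolded prl_def prr_def inl_def inr_def One_nat_def]
  show ?thesis
    unfolding matarr_def e
    by (simp add: sum_insert sum_empty arr_ty arr_mult o assms b dsum_single prl_def prr_def)
qed

lemma matarr_21:
  assumes "ty C a = tp W X" "ty C b = tp W Y"
  shows "matarr C [W] [X, Y] [[a], [b]] = inl C X Y \<cdot> a \<boxplus> inr C X Y \<cdot> b"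
proof -
  note o = ty_Cod_Obj[OF assms(1)] ty_Cod_Obj[OF assms(2)] ty_Dom_Obj[OF assms(1)]
  have e: "{..<length [X, Y]} \<times> {..<length [W]} = {(0, 0), (1, 0)}"
    by auto
  note b = bin(1-5)[OF o(1,2), unfolded prl_def prr_def inl_def inr_def One_nat_def]
  show ?thesis
    unfolding matarr_def e
    by (simp add: sum_insert sum_empty arr_ty arr_mult o assms b dsum_single inl_def inr_def)
qed

lemma matarr_22:
  assumes "ty C a = tp X Z" "ty C b = tp Y Z" "ty C c = tp X W" "ty C d = tp Y W"
  shows "matarr C [X, Y] [Z, W] [[a, b], [c, d]] =
    inl C Z W \<cdot> a \<cdot> prl C X Y \<boxplus> (inl C Z W \<cdot> b \<cdot> prr C X Y \<boxplus>
      (inr C Z W \<cdot> c \<cdot> prl C X Y \<boxplus> inr C Z W \<cdot> d \<cdot> prr C X Y))"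
proof -
  note o = ty_Dom_Obj[OF assms(1)] ty_Dom_Obj[OF assms(2)] ty_Cod_Obj[OF assms(1)] ty_Cod_Obj[OF assms(3)]
  have e: "{..<length [Z, W]} \<times> {..<length [X, Y]} = {(0, 0), (0, 1), (1, 0), (1, 1)}"
    by auto
  note b = bin(1-5)[OF o(1,2), unfolded prl_def prr_def inl_def inr_def One_nat_def]
    bin(1-5)[OF o(3,4), unfolded prl_def prr_def inl_def inr_def One_nat_def]
  show ?thesis
    unfolding matarr_def e
    by (simp add: sum_insert sum_empty arr_ty arr_mult o assms b inl_def inr_def prl_def prr_def)
qed

lemma matarr_13:
  assumes "ty C a = tp X W" "ty C b = tp Y W" "ty C c = tp Z W"
  shows "matarr C [X, Y, Z] [W] [[a, b, c]] = a \<cdot> dsum_pr C [X, Y, Z] 0 \<boxplus>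
    (b \<cdot> dsum_pr C [X, Y, Z] 1 \<boxplus> c \<cdot> dsum_pr C [X, Y, Z] 2)"
proof -
  note o = ty_Dom_Obj[OF assms(1)] ty_Dom_Obj[OF assms(2)] ty_Dom_Obj[OF assms(3)] ty_Cod_Obj[OF assms(1)]
  have e: "{..<length [W]} \<times> {..<length [X, Y, Z]} = {(0, 0), (0, 1), (0, 2)}"
    by auto
  note b = dsum3(1-7)[OF o(1-3), unfolded One_nat_def]
  show ?thesis
    unfolding matarr_def e
    by (simp add: sum_insert sum_empty arr_ty arr_mult o assms b dsum_single)
qed

lemma matarr_23:
  assumes "ty C a = tp X V" "ty C b = tp Y V" "ty C c = tp Z V"
    "ty C a' = tp X W" "ty C b' = tp Y W" "ty C c' = tp Z W"
  shows "matarr C [X, Y, Z] [V, W] [[a, b, c], [a', b', c']] =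
    inl C V W \<cdot> (a \<cdot> dsum_pr C [X, Y, Z] 0 \<boxplus> (b \<cdot> dsum_pr C [X, Y, Z] 1 \<boxplus> c \<cdot> dsum_pr C [X, Y, Z] 2)) \<boxplus>
    inr C V W \<cdot> (a' \<cdot> dsum_pr C [X, Y, Z] 0 \<boxplus> (b' \<cdot> dsum_pr C [X, Y, Z] 1 \<boxplus> c' \<cdot> dsum_pr C [X, Y, Z] 2))"
proof -
  note o = ty_Dom_Obj[OF assms(1)] ty_Dom_Obj[OF assms(2)] ty_Dom_Obj[OF assms(3)]
    ty_Cod_Obj[OF assms(1)] ty_Cod_Obj[OF assms(4)]
  have e: "{..<length [V, W]} \<times> {..<length [X, Y, Z]} = {(0, 0), (0, 1), (0, 2), (1, 0), (1, 1), (1, 2)}"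
    by auto
  note b = dsum3(1-7)[OF o(1-3), unfolded One_nat_def]
    bin(1-5)[OF o(4,5), unfolded prl_def prr_def inl_def inr_def One_nat_def]
  show ?thesis
    unfolding matarr_def e
    by (simp add: sum_insert sum_empty arr_ty arr_mult o assms b inl_def inr_def prl_def prr_def add_assoc)
qed

end

section \<open>Complexes and homotopies\<close>

text \<open>Types of arrows are compared as terms, so the degrees inside them need a common normal
  form before two composites can be recognised as composable.\<close>

lemma int_shift_simps:
  "(n::int) + 1 + 1 = n + 2" "n + 1 - 1 = n" "n - 1 + 1 = n" "n + 2 - 1 = n + 1" "n - 1 + 2 = n + 1"
  "n + 1 + 2 = n + 3" "n + 2 + 1 = n + 3" "n - 1 - 1 = n - 2" "n - 2 + 1 = n - 1" "n - 2 + 2 = n"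
  "n + 1 - 2 = n - 1" "n + 2 - 2 = n"
  by simp_all

definition cm :: "('o, 'm, 'z) acat_scheme \<Rightarrow> ('o, 'm) cplx \<Rightarrow> ('o, 'm) cplx \<Rightarrow> (int \<Rightarrow> 'm) \<Rightarrow> bool" where
  "cm C X Y \<phi> \<longleftrightarrow> chain_map C (ChMap X Y \<phi>)"

definition homotopy :: "('o, 'm, 'z) acat_scheme \<Rightarrow> ('o, 'm) cplx \<Rightarrow> ('o, 'm) cplx \<Rightarrow>
    (int \<Rightarrow> 'm) \<Rightarrow> (int \<Rightarrow> 'm) \<Rightarrow> (int \<Rightarrow> 'm) \<Rightarrow> bool" where
  "homotopy C X Y h \<phi> \<psi> \<longleftrightarrow> (\<forall>n. ty C (h n) = tp (obj_at X n) (obj_at Y (n - 1))) \<and>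
     (\<forall>n. \<phi> n = \<psi> n \<boxplus>\<^bsub>C\<^esub> (diff_at Y (n - 1) \<cdot>\<^bsub>C\<^esub> h n \<boxplus>\<^bsub>C\<^esub> h (n + 1) \<cdot>\<^bsub>C\<^esub> diff_at X n))"

definition cl :: "('o, 'm, 'z) acat_scheme \<Rightarrow> ('o, 'm) cplx \<Rightarrow> ('o, 'm) cplx \<Rightarrow> (int \<Rightarrow> 'm) \<Rightarrow> ('o, 'm) chmap set" where
  "cl C X Y \<phi> = homotopy_rel C `` {ChMap X Y \<phi>}"

lemma homotopy_rel_iff:
  "(ChMap X Y \<phi>, ChMap X' Y' \<psi>) \<in> homotopy_rel C \<longleftrightarrow>
    cm C X Y \<phi> \<and> cm C X' Y' \<psi> \<and> X = X' \<and> Y = Y' \<and> (\<exists>h. homotopy C X Y h \<phi> \<psi>)"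
  by (auto simp: homotopy_rel_def cm_def homotopy_def Hom_ty)

lemma Kb_simps:
  "Obj (Kb C) = {X. bounded_complex C X}"
  "Arr (Kb C) = {f. chain_map C f} // homotopy_rel C"
  "Dom (Kb C) = (\<lambda>F. src (SOME f. f \<in> F))"
  "Cod (Kb C) = (\<lambda>F. tgt (SOME f. f \<in> F))"
  "Ident (Kb C) X = cl C X X (\<lambda>n. Ident C (obj_at X n))"
  "Comp (Kb C) G F = (\<Union>f\<in>F. \<Union>g\<in>G. cl C (src f) (tgt g) (\<lambda>n. arr_at g n \<cdot>\<^bsub>C\<^esub> arr_at f n))"
  "Zero (Kb C) X Y = cl C X Y (\<lambda>n. Zero C (obj_at X n) (obj_at Y n))"
  "Add (Kb C) F G = (\<Union>f\<in>F. \<Union>g\<in>G. cl C (src f) (tgt f) (\<lambda>n. arr_at f n \<boxplus>\<^bsub>C\<^esub> arr_at g n))"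
  "Shift (Kb C) = shift_cplx C" "Dist (Kb C) = Kb_triangles C"
  by (simp_all add: Kb_def Kb_cat_def Cb_def Let_def cl_def)

context preadditive_category
begin

lemma cxD:
  assumes "bounded_complex C X"
  shows "obj_at X n \<in> Obj C" "ty C (diff_at X n) = tp (obj_at X n) (obj_at X (n + 1))"
    "m = n + 1 \<Longrightarrow> diff_at X m \<cdot> diff_at X n = Zero C (obj_at X n) (obj_at X (n + 2))"
    "\<lbrakk>m = n + 1; ty C f = tp W (obj_at X n)\<rbrakk> \<Longrightarrow> diff_at X m \<cdot> (diff_at X n \<cdot> f) = Zero C W (obj_at X (n + 2))"
proof -
  show 1: "obj_at X n \<in> Obj C" "ty C (diff_at X n) = tp (obj_at X n) (obj_at X (n + 1))" for n
    using assms by (auto simp: bounded_complex_def Hom_ty)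
  show 2: "m = n + 1 \<Longrightarrow> diff_at X m \<cdot> diff_at X n = Zero C (obj_at X n) (obj_at X (n + 2))"
    using assms by (auto simp: bounded_complex_def)
  show "\<lbrakk>m = n + 1; ty C f = tp W (obj_at X n)\<rbrakk> \<Longrightarrow> diff_at X m \<cdot> (diff_at X n \<cdot> f) = Zero C W (obj_at X (n + 2))"
    using reassoc[OF 2, of "obj_at X (n+1)" "obj_at X (n+2)" "obj_at X n" f W]
    by (simp add: 1 comp_Zero_l int_shift_simps)
qed

lemma cmD:
  assumes "cm C X Y \<phi>"
  shows "bounded_complex C X" "bounded_complex C Y"
    "ty C (\<phi> n) = tp (obj_at X n) (obj_at Y n)"
    "diff_at Y n \<cdot> \<phi> n = \<phi> (n + 1) \<cdot> diff_at X n"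
    "ty C f = tp W (obj_at X n) \<Longrightarrow> diff_at Y n \<cdot> (\<phi> n \<cdot> f) = \<phi> (n + 1) \<cdot> (diff_at X n \<cdot> f)"
proof -
  show 1: "bounded_complex C X" "bounded_complex C Y" "ty C (\<phi> n) = tp (obj_at X n) (obj_at Y n)"
    "diff_at Y n \<cdot> \<phi> n = \<phi> (n + 1) \<cdot> diff_at X n" for n
    using assms by (auto simp: cm_def chain_map_def Hom_ty)
  show "ty C f = tp W (obj_at X n) \<Longrightarrow> diff_at Y n \<cdot> (\<phi> n \<cdot> f) = \<phi> (n + 1) \<cdot> (diff_at X n \<cdot> f)"
    using reassoc[OF 1(4)[of n], of "obj_at Y n" "obj_at Y (n+1)" "obj_at X n" f W]
    by (simp add: 1 cxD[OF 1(1)] cxD[OF 1(2)] comp_assoc)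
qed

lemma cmI:
  assumes "bounded_complex C X" "bounded_complex C Y" "\<And>n. ty C (\<phi> n) = tp (obj_at X n) (obj_at Y n)"
    "\<And>n. diff_at Y n \<cdot> \<phi> n = \<phi> (n + 1) \<cdot> diff_at X n"
  shows "cm C X Y \<phi>"
  using assms by (auto simp: cm_def chain_map_def Hom_ty)

lemma homotopyD:
  assumes "homotopy C X Y h \<phi> \<psi>"
  shows "ty C (h n) = tp (obj_at X n) (obj_at Y (n - 1))"
    "\<phi> n = \<psi> n \<boxplus> (diff_at Y (n - 1) \<cdot> h n \<boxplus> h (n + 1) \<cdot> diff_at X n)"
  using assms by (auto simp: homotopy_def)

lemma homotopyI:
  assumes "\<And>n. ty C (h n) = tp (obj_at X n) (obj_at Y (n - 1))"
    "\<And>n. \<phi> n = \<psi> n \<boxplus> (diff_at Y (n - 1) \<cdot> h n \<boxplus> h (n + 1) \<cdot> diff_at X n)"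
  shows "homotopy C X Y h \<phi> \<psi>"
  using assms by (auto simp: homotopy_def)

lemma cm_Ident: "bounded_complex C X \<Longrightarrow> cm C X X (\<lambda>n. Ident C (obj_at X n))"
  by (rule cmI) (simp_all add: cxD arr_calc)

lemma cm_Zero: "\<lbrakk>bounded_complex C X; bounded_complex C Y\<rbrakk> \<Longrightarrow> cm C X Y (\<lambda>n. Zero C (obj_at X n) (obj_at Y n))"
  by (rule cmI) (simp_all add: cxD arr_calc)

lemma cm_Comp:
  assumes "cm C X Y \<phi>" "cm C Y Z \<psi>"
  shows "cm C X Z (\<lambda>n. \<psi> n \<cdot> \<phi> n)"
  by (rule cmI) (simp_all add: cmD[OF assms(1)] cmD[OF assms(2)] cxD[OF cmD(1)[OF assms(1)]]
      cxD[OF cmD(2)[OF assms(1)]] cxD[OF cmD(2)[OF assms(2)]] arr_calc)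

lemma cm_Add:
  assumes "cm C X Y \<phi>" "cm C X Y \<psi>"
  shows "cm C X Y (\<lambda>n. \<phi> n \<boxplus> \<psi> n)"
  by (rule cmI) (simp_all add: cmD[OF assms(1)] cmD[OF assms(2)] cxD[OF cmD(1)[OF assms(1)]]
      cxD[OF cmD(2)[OF assms(1)]] arr_calc)

lemma cm_neg:
  assumes "cm C X Y \<phi>"
  shows "cm C X Y (\<lambda>n. \<boxminus> \<phi> n)"
  by (rule cmI) (simp_all add: cmD[OF assms(1)] cxD[OF cmD(1)[OF assms(1)]]
      cxD[OF cmD(2)[OF assms(1)]] arr_calc)

lemma homotopy_refl:
  assumes "cm C X Y \<phi>"
  shows "homotopy C X Y (\<lambda>n. Zero C (obj_at X n) (obj_at Y (n - 1))) \<phi> \<phi>"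
  by (rule homotopyI) (simp_all add: cmD[OF assms(1)] cxD[OF cmD(1)[OF assms(1)]]
      cxD[OF cmD(2)[OF assms(1)]] arr_calc int_shift_simps)

lemma homotopy_sym:
  assumes c: "cm C X Y \<phi>" "cm C X Y \<psi>" and h: "homotopy C X Y h \<phi> \<psi>"
  shows "homotopy C X Y (\<lambda>n. \<boxminus> h n) \<psi> \<phi>"
proof (rule homotopyI)
  note [simp] = homotopyD(1)[OF h] cxD[OF cmD(1)[OF c(1)]] cxD[OF cmD(2)[OF c(1)]]
    cmD(3)[OF c(1)] cmD(3)[OF c(2)] int_shift_simps
  show "\<And>n. ty C (\<boxminus> h n) = tp (obj_at X n) (obj_at Y (n - 1))"
    by (simp add: arr_ty)
  show "\<psi> n = \<phi> n \<boxplus> (diff_at Y (n - 1) \<cdot> \<boxminus> h n \<boxplus> \<boxminus> h (n + 1) \<cdot> diff_at X n)" for n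
    using homotopyD(2)[OF h, of n] by (simp add: arr_calc)
qed

lemma homotopy_trans:
  assumes c: "cm C X Y \<phi>" "cm C X Y \<psi>" "cm C X Y \<chi>"
    and h: "homotopy C X Y h \<phi> \<psi>" and k: "homotopy C X Y k \<psi> \<chi>"
  shows "homotopy C X Y (\<lambda>n. h n \<boxplus> k n) \<phi> \<chi>"
proof (rule homotopyI)
  note [simp] = homotopyD(1)[OF h] homotopyD(1)[OF k] cxD[OF cmD(1)[OF c(1)]] cxD[OF cmD(2)[OF c(1)]]
    cmD(3)[OF c(1)] cmD(3)[OF c(2)] cmD(3)[OF c(3)] int_shift_simps
  show "\<And>n. ty C (h n \<boxplus> k n) = tp (obj_at X n) (obj_at Y (n - 1))"
    by (simp add: arr_ty)
  show "\<phi> n = \<chi> n \<boxplus> (diff_at Y (n - 1) \<cdot> (h n \<boxplus> k n) \<boxplus> (h (n + 1) \<boxplus> k (n + 1)) \<cdot> diff_at X n)" for n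
    using homotopyD(2)[OF h, of n] homotopyD(2)[OF k, of n] by (simp add: arr_calc)
qed

lemma homotopy_equiv: "equiv {f. chain_map C f} (homotopy_rel C)"
proof (rule equivI)
  show "homotopy_rel C \<subseteq> {f. chain_map C f} \<times> {f. chain_map C f}"
    by (auto simp: homotopy_rel_def)
  show "refl_on {f. chain_map C f} (homotopy_rel C)"
  proof (rule refl_onI)
    fix f assume "f \<in> {f. chain_map C f}"
    then show "(f, f) \<in> homotopy_rel C"
      by (cases f) (auto simp: homotopy_rel_iff cm_def intro: homotopy_refl[unfolded cm_def])
  qed
  show "sym (homotopy_rel C)"
  proof (rule symI)
    fix f g assume "(f, g) \<in> homotopy_rel C"
    then show "(g, f) \<in> homotopy_rel C"
      by (cases f; cases g) (auto simp: homotopy_rel_iff intro: homotopy_sym)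
  qed
  show "trans (homotopy_rel C)"
  proof (rule transI)
    fix f g k assume "(f, g) \<in> homotopy_rel C" "(g, k) \<in> homotopy_rel C"
    then show "(f, k) \<in> homotopy_rel C"
      by (cases f; cases g; cases k) (auto simp: homotopy_rel_iff intro: homotopy_trans)
  qed
qed

lemma cl_eq:
  assumes "cm C X Y \<phi>" "cm C X Y \<psi>"
  shows "cl C X Y \<phi> = cl C X Y \<psi> \<longleftrightarrow> (\<exists>h. homotopy C X Y h \<phi> \<psi>)"
  using eq_equiv_class_iff[OF homotopy_equiv, of "ChMap X Y \<phi>" "ChMap X Y \<psi>"] assms
  by (simp add: cl_def homotopy_rel_iff cm_def)

lemma cl_eqI: "\<lbrakk>cm C X Y \<phi>; cm C X Y \<psi>; homotopy C X Y h \<phi> \<psi>\<rbrakk> \<Longrightarrow> cl C X Y \<phi> = cl C X Y \<psi>"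
  using cl_eq by blast

lemma cl_mem:
  "f \<in> cl C X Y \<phi> \<longleftrightarrow> (\<exists>\<psi> h. f = ChMap X Y \<psi> \<and> cm C X Y \<phi> \<and> cm C X Y \<psi> \<and> homotopy C X Y h \<phi> \<psi>)"
  by (cases f) (auto simp: cl_def homotopy_rel_iff)

lemma cl_self: "cm C X Y \<phi> \<Longrightarrow> ChMap X Y \<phi> \<in> cl C X Y \<phi>"
  using homotopy_refl by (auto simp: cl_mem)

lemma ty_cl: "cm C X Y \<phi> \<Longrightarrow> ty (Kb C) (cl C X Y \<phi>) = tp X Y"
proof -
  assume c: "cm C X Y \<phi>"
  then have s: "(SOME f. f \<in> cl C X Y \<phi>) \<in> cl C X Y \<phi>"
    using someI[of "\<lambda>f. f \<in> cl C X Y \<phi>"] cl_self by blast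
  have "cl C X Y \<phi> \<in> Arr (Kb C)"
    using c by (auto simp: Kb_simps cl_def cm_def intro: quotientI)
  then show ?thesis
    using s by (auto simp: ty_def tp_def Kb_simps cl_mem)
qed

lemma ty_clE:
  assumes "ty (Kb C) F = tp X Y"
  obtains \<phi> where "cm C X Y \<phi>" "F = cl C X Y \<phi>"
proof -
  have "F \<in> Arr (Kb C)"
    using Arr_ty[OF assms] .
  then obtain f where f: "chain_map C f" "F = homotopy_rel C `` {f}"
    by (auto simp: Kb_simps quotient_def)
  then have g: "cm C (src f) (tgt f) (arr_at f)" "F = cl C (src f) (tgt f) (arr_at f)"
    by (auto simp: cm_def cl_def)
  then have "src f = X" "tgt f = Y"
    using ty_cl[OF g(1)] assms by (auto simp: tp_eq)
  then show ?thesis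
    using that g by blast
qed

lemma union_const: "\<lbrakk>a \<in> S; b \<in> T; \<And>x y. x \<in> S \<Longrightarrow> y \<in> T \<Longrightarrow> f x y = c\<rbrakk> \<Longrightarrow> (\<Union>x\<in>S. \<Union>y\<in>T. f x y) = c"
  by auto

text \<open>If \<open>h\<close> is a homotopy from \<open>\<phi>\<close> to \<open>\<phi>'\<close>
  and \<open>k\<close> one from \<open>\<psi>\<close> to \<open>\<psi>'\<close>, then
  \<open>\<psi>' h + k \<phi>\<close> is a homotopy of the composites. Hence the union that defines
  composition of classes has a single value.\<close>

lemma cl_Comp:
  assumes c: "cm C X Y \<phi>" "cm C Y Z \<psi>"
  shows "cl C Y Z \<psi> \<cdot>\<^bsub>Kb C\<^esub> cl C X Y \<phi> = cl C X Z (\<lambda>n. \<psi> n \<cdot> \<phi> n)"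
proof -
  have "cl C (src f) (tgt g) (\<lambda>n. arr_at g n \<cdot> arr_at f n) = cl C X Z (\<lambda>n. \<psi> n \<cdot> \<phi> n)"
    if f: "f \<in> cl C X Y \<phi>" and g: "g \<in> cl C Y Z \<psi>" for f g
  proof -
    obtain \<phi>' h where f': "f = ChMap X Y \<phi>'" "cm C X Y \<phi>'" "homotopy C X Y h \<phi> \<phi>'"
      using f by (auto simp: cl_mem)
    obtain \<psi>' k where g': "g = ChMap Y Z \<psi>'" "cm C Y Z \<psi>'" "homotopy C Y Z k \<psi> \<psi>'"
      using g by (auto simp: cl_mem)
    note [simp] = homotopyD(1)[OF f'(3)] homotopyD(1)[OF g'(3)] cxD[OF cmD(1)[OF c(1)]]
      cxD[OF cmD(2)[OF c(1)]] cxD[OF cmD(2)[OF c(2)]] int_shift_simps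
      cmD[OF c(1)] cmD[OF c(2)] cmD[OF f'(2)] cmD[OF g'(2)] arr_ty
    have "homotopy C X Z (\<lambda>n. \<psi>' (n - 1) \<cdot> h n \<boxplus> k n \<cdot> \<phi> n) (\<lambda>n. \<psi> n \<cdot> \<phi> n) (\<lambda>n. \<psi>' n \<cdot> \<phi>' n)"
    proof (rule homotopyI)
      fix n
      have "\<psi> n \<cdot> \<phi> n = \<psi>' n \<cdot> (\<phi>' n \<boxplus> (diff_at Y (n - 1) \<cdot> h n \<boxplus> h (n + 1) \<cdot> diff_at X n)) \<boxplus>
          (diff_at Z (n - 1) \<cdot> k n \<boxplus> k (n + 1) \<cdot> diff_at Y n) \<cdot> \<phi> n"
        using homotopyD(2)[OF g'(3), of n] homotopyD(2)[OF f'(3), of n, symmetric]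
        by (simp add: comp_Add_l)
      also have "\<dots> = \<psi>' n \<cdot> \<phi>' n \<boxplus> (diff_at Z (n - 1) \<cdot> (\<psi>' (n - 1) \<cdot> h n \<boxplus> k n \<cdot> \<phi> n) \<boxplus>
          (\<psi>' (n + 1 - 1) \<cdot> h (n + 1) \<boxplus> k (n + 1) \<cdot> \<phi> (n + 1)) \<cdot> diff_at X n)"
        by (simp add: arr_calc)
      finally show "\<psi> n \<cdot> \<phi> n = \<psi>' n \<cdot> \<phi>' n \<boxplus> (diff_at Z (n - 1) \<cdot> (\<psi>' (n - 1) \<cdot> h n \<boxplus> k n \<cdot> \<phi> n) \<boxplus>
          (\<psi>' (n + 1 - 1) \<cdot> h (n + 1) \<boxplus> k (n + 1) \<cdot> \<phi> (n + 1)) \<cdot> diff_at X n)" .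
    qed simp
    then have "cl C X Z (\<lambda>n. \<psi> n \<cdot> \<phi> n) = cl C X Z (\<lambda>n. \<psi>' n \<cdot> \<phi>' n)"
      by (rule cl_eqI[OF cm_Comp[OF c] cm_Comp[OF f'(2) g'(2)]])
    then show ?thesis
      by (simp add: f' g')
  qed
  then show ?thesis
    unfolding Kb_simps by (intro union_const[OF cl_self[OF c(1)] cl_self[OF c(2)]])
qed

lemma cl_Add:
  assumes c: "cm C X Y \<phi>" "cm C X Y \<psi>"
  shows "cl C X Y \<phi> \<boxplus>\<^bsub>Kb C\<^esub> cl C X Y \<psi> = cl C X Y (\<lambda>n. \<phi> n \<boxplus> \<psi> n)"
proof -
  have "cl C (src f) (tgt f) (\<lambda>n. arr_at f n \<boxplus> arr_at g n) = cl C X Y (\<lambda>n. \<phi> n \<boxplus> \<psi> n)"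
    if f: "f \<in> cl C X Y \<phi>" and g: "g \<in> cl C X Y \<psi>" for f g
  proof -
    obtain \<phi>' h where f': "f = ChMap X Y \<phi>'" "cm C X Y \<phi>'" "homotopy C X Y h \<phi> \<phi>'"
      using f by (auto simp: cl_mem)
    obtain \<psi>' k where g': "g = ChMap X Y \<psi>'" "cm C X Y \<psi>'" "homotopy C X Y k \<psi> \<psi>'"
      using g by (auto simp: cl_mem)
    note [simp] = homotopyD(1)[OF f'(3)] homotopyD(1)[OF g'(3)] cxD[OF cmD(1)[OF c(1)]]
      cxD[OF cmD(2)[OF c(1)]] int_shift_simps
      cmD[OF c(1)] cmD[OF c(2)] cmD[OF f'(2)] cmD[OF g'(2)] arr_ty
    have "homotopy C X Y (\<lambda>n. h n \<boxplus> k n) (\<lambda>n. \<phi> n \<boxplus> \<psi> n) (\<lambda>n. \<phi>' n \<boxplus> \<psi>' n)"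
    proof (rule homotopyI)
      show "\<phi> n \<boxplus> \<psi> n = \<phi>' n \<boxplus> \<psi>' n \<boxplus> (diff_at Y (n - 1) \<cdot> (h n \<boxplus> k n) \<boxplus>
          (h (n + 1) \<boxplus> k (n + 1)) \<cdot> diff_at X n)" for n
        using homotopyD(2)[OF g'(3), of n] homotopyD(2)[OF f'(3), of n] by (simp add: arr_calc)
    qed simp
    then have "cl C X Y (\<lambda>n. \<phi> n \<boxplus> \<psi> n) = cl C X Y (\<lambda>n. \<phi>' n \<boxplus> \<psi>' n)"
      by (rule cl_eqI[OF cm_Add[OF c] cm_Add[OF f'(2) g'(2)]])
    then show ?thesis
      by (simp add: f' g')
  qed
  then show ?thesis
    unfolding Kb_simps by (intro union_const[OF cl_self[OF c(1)] cl_self[OF c(2)]])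
qed

lemma cl_simps:
  "bounded_complex C X \<Longrightarrow> ty (Kb C) (Ident (Kb C) X) = tp X X"
  "\<lbrakk>bounded_complex C X; bounded_complex C Y\<rbrakk> \<Longrightarrow> ty (Kb C) (Zero (Kb C) X Y) = tp X Y"
  by (simp_all add: Kb_simps ty_cl cm_Ident cm_Zero)

lemma cl_cong: "(\<And>n. \<phi> n = \<psi> n) \<Longrightarrow> cl C X Y \<phi> = cl C X Y \<psi>"
  by presburger

lemma Kb_preadditive: "preadditive_category (Kb C)"
proof (rule preadditive_category.intro)
  fix f assume "f \<in> Arr (Kb C)"
  from ty_Arr[OF this] obtain \<phi> where "cm C (Dom (Kb C) f) (Cod (Kb C) f) \<phi>"
    using ty_clE by blast
  then show "Dom (Kb C) f \<in> Obj (Kb C)" "Cod (Kb C) f \<in> Obj (Kb C)"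
    using cmD by (auto simp: Kb_simps(1))
next
  fix X assume "X \<in> Obj (Kb C)"
  then show "Ident (Kb C) X \<in> Hom (Kb C) X X"
    by (simp add: cl_simps Hom_ty Kb_simps(1))
next
  fix f X Y g Z assume "f \<in> Hom (Kb C) X Y" "g \<in> Hom (Kb C) Y Z"
  then show "g \<cdot>\<^bsub>Kb C\<^esub> f \<in> Hom (Kb C) X Z"
    unfolding Hom_ty by (elim ty_clE) (simp add: cl_Comp ty_cl cm_Comp)
next
  fix f X Y assume "f \<in> Hom (Kb C) X Y"
  then obtain \<phi> where f: "cm C X Y \<phi>" "f = cl C X Y \<phi>"
    unfolding Hom_ty by (elim ty_clE)
  note [simp] = cmD[OF f(1)] cm_Ident
  show "Ident (Kb C) Y \<cdot>\<^bsub>Kb C\<^esub> f = f"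
    unfolding f Kb_simps(5) cl_Comp[OF f(1) cm_Ident[OF cmD(2)[OF f(1)]]]
    by (rule cl_cong) (rule comp_Ident_l, simp)
  show "f \<cdot>\<^bsub>Kb C\<^esub> Ident (Kb C) X = f"
    unfolding f Kb_simps(5) cl_Comp[OF cm_Ident[OF cmD(1)[OF f(1)]] f(1)]
    by (rule cl_cong) (rule comp_Ident_r, simp)
next
  fix f X Y g Z h W
  assume "f \<in> Hom (Kb C) X Y" "g \<in> Hom (Kb C) Y Z" "h \<in> Hom (Kb C) Z W"
  then obtain \<phi> \<psi> \<chi> where c: "cm C X Y \<phi>" "cm C Y Z \<psi>" "cm C Z W \<chi>"
    and e: "f = cl C X Y \<phi>" "g = cl C Y Z \<psi>" "h = cl C Z W \<chi>"
    unfolding Hom_ty by (elim ty_clE) blast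
  show "(h \<cdot>\<^bsub>Kb C\<^esub> g) \<cdot>\<^bsub>Kb C\<^esub> f = h \<cdot>\<^bsub>Kb C\<^esub> g \<cdot>\<^bsub>Kb C\<^esub> f"
    by (simp add: e cl_Comp[OF c(1,2)] cl_Comp[OF c(2,3)] cl_Comp[OF cm_Comp[OF c(1,2)] c(3)]
        cl_Comp[OF c(1) cm_Comp[OF c(2,3)]] comp_assoc[OF cmD(3)[OF c(1)] cmD(3)[OF c(2)] cmD(3)[OF c(3)]])
next
  fix f X Y g Z g'
  assume "f \<in> Hom (Kb C) X Y" "g \<in> Hom (Kb C) Y Z" "g' \<in> Hom (Kb C) Y Z"
  then obtain \<phi> \<psi> \<chi> where c: "cm C X Y \<phi>" "cm C Y Z \<psi>" "cm C Y Z \<chi>"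
    and e: "f = cl C X Y \<phi>" "g = cl C Y Z \<psi>" "g' = cl C Y Z \<chi>"
    unfolding Hom_ty by (elim ty_clE) blast
  show "(g \<boxplus>\<^bsub>Kb C\<^esub> g') \<cdot>\<^bsub>Kb C\<^esub> f = g \<cdot>\<^bsub>Kb C\<^esub> f \<boxplus>\<^bsub>Kb C\<^esub> g' \<cdot>\<^bsub>Kb C\<^esub> f"
    by (simp add: e cl_Comp[OF c(1,2)] cl_Comp[OF c(1,3)] cl_Comp[OF c(1) cm_Add[OF c(2,3)]]
        cl_Add[OF c(2,3)] cl_Add[OF cm_Comp[OF c(1,2)] cm_Comp[OF c(1,3)]] comp_Add_l[OF cmD(3)[OF c(1)] cmD(3)[OF c(2)] cmD(3)[OF c(3)]])
next
  fix f X Y f' g Z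
  assume "f \<in> Hom (Kb C) X Y" "f' \<in> Hom (Kb C) X Y" "g \<in> Hom (Kb C) Y Z"
  then obtain \<phi> \<psi> \<chi> where c: "cm C X Y \<phi>" "cm C X Y \<psi>" "cm C Y Z \<chi>"
    and e: "f = cl C X Y \<phi>" "f' = cl C X Y \<psi>" "g = cl C Y Z \<chi>"
    unfolding Hom_ty by (elim ty_clE) blast
  show "g \<cdot>\<^bsub>Kb C\<^esub> (f \<boxplus>\<^bsub>Kb C\<^esub> f') = g \<cdot>\<^bsub>Kb C\<^esub> f \<boxplus>\<^bsub>Kb C\<^esub> g \<cdot>\<^bsub>Kb C\<^esub> f'"
    by (simp add: e cl_Comp[OF c(1,3)] cl_Comp[OF c(2,3)] cl_Comp[OF cm_Add[OF c(1,2)] c(3)]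
        cl_Add[OF c(1,2)] cl_Add[OF cm_Comp[OF c(1,3)] cm_Comp[OF c(2,3)]] comp_Add_r[OF cmD(3)[OF c(1)] cmD(3)[OF c(2)] cmD(3)[OF c(3)]])
next
  fix X Y assume "X \<in> Obj (Kb C)" "Y \<in> Obj (Kb C)"
  then have X: "bounded_complex C X" and Y: "bounded_complex C Y"
    by (simp_all add: Kb_simps(1))
  have g: "carrier (hom_group (Kb C) X Y) = {f. ty (Kb C) f = tp X Y}"
    "mult (hom_group (Kb C) X Y) = Add (Kb C)" "one (hom_group (Kb C) X Y) = Zero (Kb C) X Y"
    by (auto simp: hom_group_def Hom_ty)
  show "comm_group (hom_group (Kb C) X Y)"
  proof (rule comm_groupI, unfold g mem_Collect_eq)
    fix x y z assume "ty (Kb C) x = tp X Y" "ty (Kb C) y = tp X Y" "ty (Kb C) z = tp X Y"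
    then obtain \<phi> \<psi> \<chi> where c: "cm C X Y \<phi>" "cm C X Y \<psi>" "cm C X Y \<chi>"
      and e: "x = cl C X Y \<phi>" "y = cl C X Y \<psi>" "z = cl C X Y \<chi>"
      by (elim ty_clE) blast
    show "(x \<boxplus>\<^bsub>Kb C\<^esub> y) \<boxplus>\<^bsub>Kb C\<^esub> z = x \<boxplus>\<^bsub>Kb C\<^esub> (y \<boxplus>\<^bsub>Kb C\<^esub> z)"
      by (simp add: e cl_Add c cm_Add add_assoc[OF cmD(3)[OF c(1)] cmD(3)[OF c(2)] cmD(3)[OF c(3)]])
  next
    fix x y assume "ty (Kb C) x = tp X Y" "ty (Kb C) y = tp X Y"
    then obtain \<phi> \<psi> where c: "cm C X Y \<phi>" "cm C X Y \<psi>"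
      and e: "x = cl C X Y \<phi>" "y = cl C X Y \<psi>"
      by (elim ty_clE) blast
    show "ty (Kb C) (x \<boxplus>\<^bsub>Kb C\<^esub> y) = tp X Y"
      by (simp add: e cl_Add c cm_Add ty_cl)
    show "x \<boxplus>\<^bsub>Kb C\<^esub> y = y \<boxplus>\<^bsub>Kb C\<^esub> x"
      by (simp add: e cl_Add c add_comm[OF cmD(3)[OF c(1)] cmD(3)[OF c(2)]])
  next
    fix x assume "ty (Kb C) x = tp X Y"
    then obtain \<phi> where c: "cm C X Y \<phi>" and e: "x = cl C X Y \<phi>"
      by (elim ty_clE) blast
    show "Zero (Kb C) X Y \<boxplus>\<^bsub>Kb C\<^esub> x = x"
      by (simp add: e cl_Add c Kb_simps(7) cm_Zero X Y add_Zero_l[OF cmD(3)[OF c]])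
    show "\<exists>y\<in>{f. ty (Kb C) f = tp X Y}. y \<boxplus>\<^bsub>Kb C\<^esub> x = Zero (Kb C) X Y"
      by (rule bexI[of _ "cl C X Y (\<lambda>n. \<boxminus> \<phi> n)"])
        (simp_all add: e cl_Add c Kb_simps(7) cm_neg ty_cl add_neg_l[OF cmD(3)[OF c]])
  qed (simp add: X Y cl_simps)
qed

end

section \<open>Shifts and mapping cones\<close>

definition cone :: "('o, 'm, 'z) acat_scheme \<Rightarrow> ('o, 'm) cplx \<Rightarrow> ('o, 'm) cplx \<Rightarrow> (int \<Rightarrow> 'm) \<Rightarrow> ('o, 'm) cplx" where
  "cone C X Y \<phi> = mapping_cone C (ChMap X Y \<phi>)"

definition unshift :: "('o, 'm, 'z) acat_scheme \<Rightarrow> ('o, 'm) cplx \<Rightarrow> ('o, 'm) cplx" where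
  "unshift C X = Cplx (\<lambda>n. obj_at X (n - 1)) (\<lambda>n. \<boxminus>\<^bsub>C\<^esub> (diff_at X (n - 1)))"

lemma shift_simps:
  "obj_at (shift_cplx C X) n = obj_at X (n + 1)"
  "diff_at (shift_cplx C X) n = \<boxminus>\<^bsub>C\<^esub> (diff_at X (n + 1))"
  "obj_at (unshift C X) n = obj_at X (n - 1)"
  "diff_at (unshift C X) n = \<boxminus>\<^bsub>C\<^esub> (diff_at X (n - 1))"
  by (simp_all add: shift_cplx_def unshift_def)

lemma cone_obj: "obj_at (cone C X Y \<phi>) n = dsum C [obj_at X (n + 1), obj_at Y n]"
  by (simp add: cone_def mapping_cone_def Let_def)

context preadditive_category
begin

section \<open>Zero objects and isomorphisms in a preadditive category\<close>

lemma zero_object_iff: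
  assumes X: "X \<in> Obj C"
  shows "zero_object C X \<longleftrightarrow> Ident C X = Zero C X X"
proof
  assume "zero_object C X"
  then have "\<exists>!f. ty C f = tp X X"
    using X by (auto simp: zero_object_def Hom_ty)
  then show "Ident C X = Zero C X X"
    using ty_Ident[OF X] ty_Zero[OF X X] by blast
next
  assume e: "Ident C X = Zero C X X"
  have 1: "f = Zero C X Y" if "ty C f = tp X Y" for f Y
    using comp_Ident_r[OF that] comp_Zero_r[OF that X] e by simp
  have 2: "f = Zero C Y X" if "ty C f = tp Y X" for f Y
    using comp_Ident_l[OF that] comp_Zero_l[OF that X] e by simp
  have "(\<exists>!f. ty C f = tp X Y) \<and> (\<exists>!f. ty C f = tp Y X)" if Y: "Y \<in> Obj C" for Y
    using 1[of _ Y] 2[of _ Y] ty_Zero[OF X Y] ty_Zero[OF Y X] by blast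
  then show "zero_object C X"
    unfolding zero_object_def Hom_ty using X by blast
qed

lemma arr_isoI:
  assumes "ty C f = tp X Y" "ty C g = tp Y X" "g \<cdot> f = Ident C X" "f \<cdot> g = Ident C Y"
  shows "arr_iso C f"
  using assms by (auto simp: arr_iso_def Hom_ty Dom_ty Cod_ty Arr_ty)

lemma arr_isoE:
  assumes "arr_iso C f" "ty C f = tp X Y"
  obtains g where "ty C g = tp Y X" "g \<cdot> f = Ident C X" "f \<cdot> g = Ident C Y"
  using assms by (auto simp: arr_iso_def Hom_ty Dom_ty Cod_ty)

lemma arr_iso_Ident: "X \<in> Obj C \<Longrightarrow> arr_iso C (Ident C X)"
  by (rule arr_isoI[of _ X X "Ident C X"]) (simp_all add: arr_ty comp_Ident_l[OF ty_Ident])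

lemma arr_iso_Comp:
  assumes "arr_iso C f" "arr_iso C g" "ty C f = tp X Y" "ty C g = tp Y Z"
  shows "arr_iso C (g \<cdot> f)"
proof -
  obtain f' where f': "ty C f' = tp Y X" "f' \<cdot> f = Ident C X" "f \<cdot> f' = Ident C Y"
    using arr_isoE[OF assms(1,3)] .
  obtain g' where g': "ty C g' = tp Z Y" "g' \<cdot> g = Ident C Y" "g \<cdot> g' = Ident C Z"
    using arr_isoE[OF assms(2,4)] .
  note [simp] = f' g' f'(2,3)[THEN reassoc] g'(2,3)[THEN reassoc] assms(3,4)
  show ?thesis
    by (rule arr_isoI[of _ X Z "f' \<cdot> g'"]) (simp_all add: arr_ty arr_mult)
qed

text \<open>If \<open>p\<close> inverts \<open>g \<cdot> f\<close> and \<open>q\<close> inverts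
  \<open>f \<cdot> g\<close>, then \<open>p \<cdot> g\<close> is a left and
  \<open>g \<cdot> q\<close> a right inverse of \<open>f\<close>, so they agree. For maps of cones
  the composites are known to be invertible but not to be identities.\<close>

lemma arr_iso_of_two_sided:
  assumes "ty C f = tp X Y" "ty C g = tp Y X" "arr_iso C (g \<cdot> f)" "arr_iso C (f \<cdot> g)"
  shows "arr_iso C f"
proof -
  obtain p where p: "ty C p = tp X X" "p \<cdot> (g \<cdot> f) = Ident C X"
    using arr_isoE[OF assms(3) ty_Comp[OF assms(1,2)]] .
  obtain q where q: "ty C q = tp Y Y" "(f \<cdot> g) \<cdot> q = Ident C Y"
    using arr_isoE[OF assms(4) ty_Comp[OF assms(2,1)]] .
  note t = assms(1,2) p(1) q(1)
  have "p \<cdot> g = (p \<cdot> g) \<cdot> ((f \<cdot> g) \<cdot> q)"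
    by (simp add: t arr_ty q(2) comp_Ident_r comp_assoc)
  also have "\<dots> = (p \<cdot> (g \<cdot> f)) \<cdot> (g \<cdot> q)"
    by (simp add: t arr_ty comp_assoc)
  also have "\<dots> = g \<cdot> q"
    using p(2) by (simp add: t arr_ty comp_Ident_l)
  finally have e: "p \<cdot> g = g \<cdot> q" .
  show ?thesis
  proof (rule arr_isoI[of _ X Y "p \<cdot> g"])
    show "(p \<cdot> g) \<cdot> f = Ident C X"
      using p(2) by (simp add: t arr_ty comp_assoc)
    show "f \<cdot> (p \<cdot> g) = Ident C Y"
      unfolding e using q(2) by (simp add: t arr_ty comp_assoc)
  qed (simp_all add: t arr_ty)
qed

lemma isomorphic_ty: "isomorphic C X Y \<longleftrightarrow> (\<exists>f. arr_iso C f \<and> ty C f = tp X Y)"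
  unfolding isomorphic_def by (auto simp: ty_def tp_def arr_iso_def split: if_splits)

lemma isomorphic_sym: "isomorphic C X Y \<Longrightarrow> isomorphic C Y X"
  unfolding isomorphic_ty by (elim exE conjE, erule (1) arr_isoE) (auto intro: arr_isoI)

lemma isomorphic_trans: "isomorphic C X Y \<Longrightarrow> isomorphic C Y Z \<Longrightarrow> isomorphic C X Z"
  unfolding isomorphic_ty using arr_iso_Comp ty_Comp by blast

lemma isomorphic_refl: "X \<in> Obj C \<Longrightarrow> isomorphic C X X"
  unfolding isomorphic_ty using arr_iso_Ident ty_Ident by blast

lemma isomorphic_zero_objects:
  assumes "zero_object C X" "zero_object C Y"
  shows "isomorphic C X Y"
proof -
  have "X \<in> Obj C" "Y \<in> Obj C"
    using assms by (auto simp: zero_object_def)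
  then show ?thesis
    unfolding isomorphic_ty using assms
    by (intro exI[of _ "Zero C X Y"] conjI arr_isoI[of _ X Y "Zero C Y X"])
      (simp_all add: ty_Zero zero_object_iff comp_Zero_l[OF ty_Zero])
qed

lemma zero_object_isomorphic:
  assumes "isomorphic C X Y" "zero_object C X"
  shows "zero_object C Y"
proof -
  obtain f where f: "arr_iso C f" "ty C f = tp X Y"
    using assms(1) by (auto simp: isomorphic_ty)
  obtain g where g: "ty C g = tp Y X" "g \<cdot> f = Ident C X" "f \<cdot> g = Ident C Y"
    using arr_isoE[OF f] .
  have o: "X \<in> Obj C" "Y \<in> Obj C"
    using f(2) ty_Dom_Obj ty_Cod_Obj by auto
  have "f = f \<cdot> Ident C X"
    using comp_Ident_r[OF f(2)] by simp
  then have "f = Zero C X Y"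
    using assms(2) o comp_Zero_r[OF f(2) o(1)] by (simp add: zero_object_iff)
  then show ?thesis
    using g(3) o comp_Zero_l[OF g(1) o(2)] by (simp add: zero_object_iff)
qed

text \<open>The inverse is the identity minus \<open>f\<close>.\<close>

lemma unipotent_iso:
  assumes "ty C f = tp X X" "f \<cdot> f = Zero C X X"
  shows "arr_iso C (Ident C X \<boxplus> f)"
proof -
  note o = ty_Dom_Obj[OF assms(1)]
  show ?thesis
    by (rule arr_isoI[of _ X X "Ident C X \<boxplus> \<boxminus> f"]) (simp_all add: assms o arr_calc)
qed

section \<open>Shifts of complexes, chain maps and homotopies\<close>

lemma shift_cx: "bounded_complex C X \<Longrightarrow> bounded_complex C (shift_cplx C X)"
proof -
  assume X: "bounded_complex C X"
  then obtain N where "\<forall>n. \<bar>n\<bar> > N \<longrightarrow> zero_object C (obj_at X n)"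
    by (auto simp: bounded_complex_def)
  then have "\<forall>n. \<bar>n\<bar> > N + 1 \<longrightarrow> zero_object C (obj_at (shift_cplx C X) n)"
    by (auto simp: shift_simps)
  then show ?thesis
    unfolding bounded_complex_def
    by (auto simp: cxD[OF X] shift_simps Hom_ty int_shift_simps arr_ty arr_neg)
qed

lemma unshift_cx: "bounded_complex C X \<Longrightarrow> bounded_complex C (unshift C X)"
proof -
  assume X: "bounded_complex C X"
  then obtain N where "\<forall>n. \<bar>n\<bar> > N \<longrightarrow> zero_object C (obj_at X n)"
    by (auto simp: bounded_complex_def)
  then have "\<forall>n. \<bar>n\<bar> > N + 1 \<longrightarrow> zero_object C (obj_at (unshift C X) n)"
    by (auto simp: shift_simps)
  then show ?thesis
    unfolding bounded_complex_def
    by (auto simp: cxD[OF X] shift_simps Hom_ty int_shift_simps arr_ty arr_neg)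
qed

text \<open>An equality of complexes, not merely an isomorphism: the two signs on each differential
  cancel. Membership of an unshifted complex in a class can thereby be read off from the rule for
  shifts.\<close>

lemma shift_unshift:
  assumes "bounded_complex C X"
  shows "shift_cplx C (unshift C X) = X" "unshift C (shift_cplx C X) = X"
  by (cases X, use cxD(2)[OF assms] in \<open>simp add: shift_cplx_def unshift_def neg_neg\<close>)+

lemma cm_shift:
  assumes "cm C X Y \<phi>"
  shows "cm C (shift_cplx C X) (shift_cplx C Y) (\<lambda>n. \<phi> (n + 1))"
  by (rule cmI) (simp_all add: shift_cx cmD[OF assms] cxD[OF cmD(1)[OF assms]] cxD[OF cmD(2)[OF assms]]
      shift_simps arr_ty arr_neg int_shift_simps)

lemma cm_unshift:
  assumes "cm C X Y \<phi>"
  shows "cm C (unshift C X) (unshift C Y) (\<lambda>n. \<phi> (n - 1))"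
  by (rule cmI) (simp_all add: unshift_cx cmD[OF assms] cxD[OF cmD(1)[OF assms]] cxD[OF cmD(2)[OF assms]]
      shift_simps arr_ty arr_neg int_shift_simps)

text \<open>The differential of the shift carries a sign, so the homotopy has to change sign as
  well.\<close>

lemma homotopy_shift:
  assumes c: "cm C X Y \<phi>" "cm C X Y \<psi>" and h: "homotopy C X Y h \<phi> \<psi>"
  shows "homotopy C (shift_cplx C X) (shift_cplx C Y) (\<lambda>n. \<boxminus> h (n + 1)) (\<lambda>n. \<phi> (n + 1)) (\<lambda>n. \<psi> (n + 1))"
proof (rule homotopyI)
  note [simp] = homotopyD(1)[OF h] cxD[OF cmD(1)[OF c(1)]] cxD[OF cmD(2)[OF c(1)]]
    cmD(3)[OF c(1)] cmD(3)[OF c(2)] int_shift_simps shift_simps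
  show "\<And>n. ty C (\<boxminus> h (n + 1)) = tp (obj_at (shift_cplx C X) n) (obj_at (shift_cplx C Y) (n - 1))"
    by (simp add: arr_ty)
  show "\<phi> (n + 1) = \<psi> (n + 1) \<boxplus> (diff_at (shift_cplx C Y) (n - 1) \<cdot> \<boxminus> h (n + 1) \<boxplus>
      \<boxminus> h (n + 1 + 1) \<cdot> diff_at (shift_cplx C X) n)" for n
    using homotopyD(2)[OF h, of "n + 1"] by (simp add: arr_ty arr_neg)
qed

lemma homotopy_unshift:
  assumes c: "cm C X Y \<phi>" "cm C X Y \<psi>" and h: "homotopy C X Y h \<phi> \<psi>"
  shows "homotopy C (unshift C X) (unshift C Y) (\<lambda>n. \<boxminus> h (n - 1)) (\<lambda>n. \<phi> (n - 1)) (\<lambda>n. \<psi> (n - 1))"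
proof (rule homotopyI)
  note [simp] = homotopyD(1)[OF h] cxD[OF cmD(1)[OF c(1)]] cxD[OF cmD(2)[OF c(1)]]
    cmD(3)[OF c(1)] cmD(3)[OF c(2)] int_shift_simps shift_simps
  show "\<And>n. ty C (\<boxminus> h (n - 1)) = tp (obj_at (unshift C X) n) (obj_at (unshift C Y) (n - 1))"
    by (simp add: arr_ty)
  show "\<phi> (n - 1) = \<psi> (n - 1) \<boxplus> (diff_at (unshift C Y) (n - 1) \<cdot> \<boxminus> h (n - 1) \<boxplus>
      \<boxminus> h (n + 1 - 1) \<cdot> diff_at (unshift C X) n)" for n
    using homotopyD(2)[OF h, of "n - 1"] by (simp add: arr_ty arr_neg)
qed

lemma shift_class_cl:
  assumes "cm C X Y \<phi>"
  shows "shift_class C (cl C X Y \<phi>) = cl C (shift_cplx C X) (shift_cplx C Y) (\<lambda>n. \<phi> (n + 1))"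
proof -
  have "homotopy_rel C `` {shift_chmap C f} = cl C (shift_cplx C X) (shift_cplx C Y) (\<lambda>n. \<phi> (n + 1))"
    if f: "f \<in> cl C X Y \<phi>" for f
  proof -
    obtain \<psi> h where p: "f = ChMap X Y \<psi>" "cm C X Y \<psi>" "homotopy C X Y h \<phi> \<psi>"
      using f by (auto simp: cl_mem)
    show ?thesis
      using cl_eqI[OF cm_shift[OF assms] cm_shift[OF p(2)] homotopy_shift[OF assms p(2,3)]]
      by (simp add: p(1) shift_chmap_def cl_def)
  qed
  then show ?thesis
    using cl_self[OF assms] unfolding shift_class_def by blast
qed

section \<open>Isomorphism in the homotopy category\<close>

lemma isomorphic_Kb:
  "isomorphic (Kb C) X Y \<longleftrightarrow> (\<exists>\<phi> \<psi> h k. cm C X Y \<phi> \<and> cm C Y X \<psi> \<and>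
    homotopy C X X h (\<lambda>n. \<psi> n \<cdot> \<phi> n) (\<lambda>n. Ident C (obj_at X n)) \<and>
    homotopy C Y Y k (\<lambda>n. \<phi> n \<cdot> \<psi> n) (\<lambda>n. Ident C (obj_at Y n)))" (is "?L \<longleftrightarrow> ?R")
proof
  interpret K: preadditive_category "Kb C"
    by (rule Kb_preadditive)
  {
    assume ?L
    then obtain f where f: "arr_iso (Kb C) f" "ty (Kb C) f = tp X Y"
      by (auto simp: K.isomorphic_ty)
    obtain g where g: "ty (Kb C) g = tp Y X" "g \<cdot>\<^bsub>Kb C\<^esub> f = Ident (Kb C) X" "f \<cdot>\<^bsub>Kb C\<^esub> g = Ident (Kb C) Y"
      using K.arr_isoE[OF f] .
    obtain \<phi> where \<phi>: "cm C X Y \<phi>" "f = cl C X Y \<phi>"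
      using ty_clE[OF f(2)] .
    obtain \<psi> where \<psi>: "cm C Y X \<psi>" "g = cl C Y X \<psi>"
      using ty_clE[OF g(1)] .
    show ?R
      using g(2,3) cl_eq[OF cm_Comp[OF \<phi>(1) \<psi>(1)] cm_Ident[OF cmD(1)[OF \<phi>(1)]]]
        cl_eq[OF cm_Comp[OF \<psi>(1) \<phi>(1)] cm_Ident[OF cmD(2)[OF \<phi>(1)]]]
      unfolding \<phi>(2) \<psi>(2) cl_Comp[OF \<phi>(1) \<psi>(1)] cl_Comp[OF \<psi>(1) \<phi>(1)] Kb_simps(5)
      using \<phi>(1) \<psi>(1) by blast
  next
    assume ?R
    then obtain \<phi> \<psi> h k where c: "cm C X Y \<phi>" "cm C Y X \<psi>"
      "homotopy C X X h (\<lambda>n. \<psi> n \<cdot> \<phi> n) (\<lambda>n. Ident C (obj_at X n))"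
      "homotopy C Y Y k (\<lambda>n. \<phi> n \<cdot> \<psi> n) (\<lambda>n. Ident C (obj_at Y n))"
      by blast
    show ?L
      unfolding K.isomorphic_ty
    proof (intro exI conjI)
      show "ty (Kb C) (cl C X Y \<phi>) = tp X Y"
        using c by (simp add: ty_cl)
      show "arr_iso (Kb C) (cl C X Y \<phi>)"
        using c(1,2) cl_eqI[OF cm_Comp[OF c(1,2)] cm_Ident[OF cmD(1)[OF c(1)]] c(3)]
          cl_eqI[OF cm_Comp[OF c(2,1)] cm_Ident[OF cmD(2)[OF c(1)]] c(4)]
        by (intro K.arr_isoI[of _ X Y "cl C Y X \<psi>"])
          (simp_all add: ty_cl Kb_simps(5) cl_Comp[OF c(1,2)] cl_Comp[OF c(2,1)])
    qed
  }
qed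

text \<open>A degreewise inverse of a chain map commutes with the differentials automatically, so
  its entries need only be typed; the zero homotopy then does the rest.\<close>

lemma isomorphic_strict:
  assumes "cm C X Y \<phi>" "\<And>n. ty C (\<psi> n) = tp (obj_at Y n) (obj_at X n)"
    "\<And>n. \<psi> n \<cdot> \<phi> n = Ident C (obj_at X n)" "\<And>n. \<phi> n \<cdot> \<psi> n = Ident C (obj_at Y n)"
  shows "isomorphic (Kb C) X Y"
proof -
  note [simp] = cmD[OF assms(1)] cxD[OF cmD(1)[OF assms(1)]] cxD[OF cmD(2)[OF assms(1)]] assms(2)
  have c: "cm C Y X \<psi>"
  proof (rule cmI)
    fix n
    have "diff_at X n \<cdot> \<psi> n = (\<psi> (n + 1) \<cdot> \<phi> (n + 1)) \<cdot> (diff_at X n \<cdot> \<psi> n)"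
      unfolding assms(3) by (simp add: arr_ty comp_Ident_l)
    also have "\<dots> = \<psi> (n + 1) \<cdot> ((\<phi> (n + 1) \<cdot> diff_at X n) \<cdot> \<psi> n)"
      by (simp add: arr_ty comp_assoc del: cmD(4)[OF assms(1)] cmD(5)[OF assms(1)])
    also have "\<dots> = \<psi> (n + 1) \<cdot> (diff_at Y n \<cdot> (\<phi> n \<cdot> \<psi> n))"
      by (simp add: arr_ty comp_assoc)
    also have "\<dots> = \<psi> (n + 1) \<cdot> diff_at Y n"
      unfolding assms(4) by (simp add: arr_ty comp_Ident_r)
    finally show "diff_at X n \<cdot> \<psi> n = \<psi> (n + 1) \<cdot> diff_at Y n" .
  qed simp_all
  have "homotopy C X X (\<lambda>n. Zero C (obj_at X n) (obj_at X (n - 1))) (\<lambda>n. \<psi> n \<cdot> \<phi> n) (\<lambda>n. Ident C (obj_at X n))"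
    "homotopy C Y Y (\<lambda>n. Zero C (obj_at Y n) (obj_at Y (n - 1))) (\<lambda>n. \<phi> n \<cdot> \<psi> n) (\<lambda>n. Ident C (obj_at Y n))"
    using homotopy_refl[OF cm_Ident[OF cmD(1)[OF assms(1)]]] homotopy_refl[OF cm_Ident[OF cmD(2)[OF assms(1)]]]
    by (simp_all add: assms(3,4))
  then show ?thesis
    using assms(1) c unfolding isomorphic_Kb by blast
qed

lemma isomorphic_unshift: "isomorphic (Kb C) X Y \<Longrightarrow> isomorphic (Kb C) (unshift C X) (unshift C Y)"
  unfolding isomorphic_Kb
proof (elim exE conjE)
  fix \<phi> \<psi> h k
  assume c: "cm C X Y \<phi>" "cm C Y X \<psi>"
    "homotopy C X X h (\<lambda>n. \<psi> n \<cdot> \<phi> n) (\<lambda>n. Ident C (obj_at X n))"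
    "homotopy C Y Y k (\<lambda>n. \<phi> n \<cdot> \<psi> n) (\<lambda>n. Ident C (obj_at Y n))"
  show "\<exists>\<phi> \<psi> h k. cm C (unshift C X) (unshift C Y) \<phi> \<and> cm C (unshift C Y) (unshift C X) \<psi> \<and>
    homotopy C (unshift C X) (unshift C X) h (\<lambda>n. \<psi> n \<cdot> \<phi> n) (\<lambda>n. Ident C (obj_at (unshift C X) n)) \<and>
    homotopy C (unshift C Y) (unshift C Y) k (\<lambda>n. \<phi> n \<cdot> \<psi> n) (\<lambda>n. Ident C (obj_at (unshift C Y) n))"
    using cm_unshift[OF c(1)] cm_unshift[OF c(2)]
      homotopy_unshift[OF cm_Comp[OF c(1,2)] cm_Ident[OF cmD(1)[OF c(1)]] c(3)]
      homotopy_unshift[OF cm_Comp[OF c(2,1)] cm_Ident[OF cmD(2)[OF c(1)]] c(4)]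
    by (simp add: shift_simps) blast
qed

lemma isomorphic_shift: "isomorphic (Kb C) X Y \<Longrightarrow> isomorphic (Kb C) (shift_cplx C X) (shift_cplx C Y)"
  unfolding isomorphic_Kb
proof (elim exE conjE)
  fix \<phi> \<psi> h k
  assume c: "cm C X Y \<phi>" "cm C Y X \<psi>"
    "homotopy C X X h (\<lambda>n. \<psi> n \<cdot> \<phi> n) (\<lambda>n. Ident C (obj_at X n))"
    "homotopy C Y Y k (\<lambda>n. \<phi> n \<cdot> \<psi> n) (\<lambda>n. Ident C (obj_at Y n))"
  show "\<exists>\<phi> \<psi> h k. cm C (shift_cplx C X) (shift_cplx C Y) \<phi> \<and> cm C (shift_cplx C Y) (shift_cplx C X) \<psi> \<and>
    homotopy C (shift_cplx C X) (shift_cplx C X) h (\<lambda>n. \<psi> n \<cdot> \<phi> n) (\<lambda>n. Ident C (obj_at (shift_cplx C X) n)) \<and>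
    homotopy C (shift_cplx C Y) (shift_cplx C Y) k (\<lambda>n. \<phi> n \<cdot> \<psi> n) (\<lambda>n. Ident C (obj_at (shift_cplx C Y) n))"
    using cm_shift[OF c(1)] cm_shift[OF c(2)]
      homotopy_shift[OF cm_Comp[OF c(1,2)] cm_Ident[OF cmD(1)[OF c(1)]] c(3)]
      homotopy_shift[OF cm_Comp[OF c(2,1)] cm_Ident[OF cmD(2)[OF c(1)]] c(4)]
    by (simp add: shift_simps) blast
qed

text \<open>A term of the form \<open>d h + h d\<close> always commutes with \<open>d\<close>. This
  spares the verification of the chain map condition for a family that arises by modifying a chain
  map by a homotopy.\<close>

lemma cm_homotopic:
  assumes c: "cm C X Y \<phi>" and t: "\<And>n. ty C (\<psi> n) = tp (obj_at X n) (obj_at Y n)"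
    and h: "homotopy C X Y h \<phi> \<psi>"
  shows "cm C X Y \<psi>"
proof (rule cmI)
  fix n
  note [simp] = homotopyD(1)[OF h] cxD[OF cmD(1)[OF c(1)]] cxD[OF cmD(2)[OF c(1)]]
    cmD(3)[OF c] t int_shift_simps
  have e: "\<psi> n = dif C (\<phi> n) (diff_at Y (n - 1) \<cdot> h n \<boxplus> h (n + 1) \<cdot> diff_at X n)" for n
    using homotopyD(2)[OF h, of n] by (simp add: arr_calc)
  show "diff_at Y n \<cdot> \<psi> n = \<psi> (n + 1) \<cdot> diff_at X n"
    unfolding e by (simp add: arr_calc cmD(4)[OF c])
qed (use c t cmD in auto)

end

abbreviation "cinl C X Y n \<equiv> inl C (obj_at X (n + 1)) (obj_at Y n)"
abbreviation "cinr C X Y n \<equiv> inr C (obj_at X (n + 1)) (obj_at Y n)"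
abbreviation "cprl C X Y n \<equiv> prl C (obj_at X (n + 1)) (obj_at Y n)"
abbreviation "cprr C X Y n \<equiv> prr C (obj_at X (n + 1)) (obj_at Y n)"

context additive_category
begin

section \<open>The mapping cone as a bounded complex with its two canonical maps\<close>

lemma zero_object_dsum:
  assumes "zero_object C X" "zero_object C Y"
  shows "zero_object C (dsum C [X, Y])"
proof -
  have o: "X \<in> Obj C" "Y \<in> Obj C"
    using assms by (auto simp: zero_object_def)
  note [simp] = bin[OF o] bin_Ident[OF o] o
  have z: "Ident C X = Zero C X X" "Ident C Y = Zero C Y Y"
    using assms by (simp_all add: zero_object_iff)
  have "Ident C (dsum C [X, Y]) = inl C X Y \<cdot> (Ident C X \<cdot> prl C X Y) \<boxplus> inr C X Y \<cdot> (Ident C Y \<cdot> prr C X Y)"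
    by (simp add: comp_Ident_l)
  also have "\<dots> = Zero C (dsum C [X, Y]) (dsum C [X, Y])"
    unfolding z by (simp add: arr_calc del: bin_Ident)
  finally show ?thesis
    by (simp add: zero_object_iff)
qed

lemma cone_diff:
  assumes "cm C X Y \<phi>"
  shows "diff_at (cone C X Y \<phi>) n =
    inr C (obj_at X (n + 2)) (obj_at Y (n + 1)) \<cdot> \<phi> (n + 1) \<cdot> cprl C X Y n \<boxplus>
    inr C (obj_at X (n + 2)) (obj_at Y (n + 1)) \<cdot> diff_at Y n \<cdot> cprr C X Y n \<boxplus>
    \<boxminus> (inl C (obj_at X (n + 2)) (obj_at Y (n + 1)) \<cdot> diff_at X (n + 1) \<cdot> cprl C X Y n)"
proof -
  note [simp] = cmD(1-3)[OF assms] cxD[OF cmD(1)[OF assms]] cxD[OF cmD(2)[OF assms]] int_shift_simps arr_ty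
  show ?thesis
    unfolding cone_def mapping_cone_def Let_def
    by (simp add: matarr_22[of _ "obj_at X (n + 1)" "obj_at X (n + 2)"] bin arr_mult arr_neg arr_ac)
qed

lemma cone_cx:
  assumes "cm C X Y \<phi>"
  shows "bounded_complex C (cone C X Y \<phi>)"
proof -
  note [simp] = cmD[OF assms(1)] cxD[OF cmD(1)[OF assms(1)]] cxD[OF cmD(2)[OF assms(1)]] int_shift_simps
    arr_ty
  obtain N M where N: "\<forall>n. \<bar>n\<bar> > N \<longrightarrow> zero_object C (obj_at X n)" "\<forall>n. \<bar>n\<bar> > M \<longrightarrow> zero_object C (obj_at Y n)"
    using cmD(1,2)[OF assms] unfolding bounded_complex_def by blast
  have "zero_object C (obj_at (cone C X Y \<phi>) n)" if "\<bar>n\<bar> > max (N + 1) M" for n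
    unfolding cone_obj using N that by (intro zero_object_dsum) auto
  then have "\<exists>N. \<forall>n. \<bar>n\<bar> > N \<longrightarrow> zero_object C (obj_at (cone C X Y \<phi>) n)"
    by blast
  then show ?thesis
    unfolding bounded_complex_def
    by (simp add: Hom_ty cone_obj cone_diff[OF assms] bin arr_calc)
qed

lemma cm_cone_in:
  assumes "cm C X Y \<phi>"
  shows "cm C Y (cone C X Y \<phi>) (\<lambda>n. cinr C X Y n)"
proof -
  note [simp] = cmD[OF assms(1)] cxD[OF cmD(1)[OF assms(1)]] cxD[OF cmD(2)[OF assms(1)]] int_shift_simps
    arr_ty
  show ?thesis
    by (rule cmI) (simp_all add: cone_obj cone_cx[OF assms] cone_diff[OF assms] bin arr_calc)
qed

lemma cm_cone_pr:
  assumes "cm C X Y \<phi>"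
  shows "cm C (cone C X Y \<phi>) (shift_cplx C X) (\<lambda>n. cprl C X Y n)"
proof -
  note [simp] = cmD[OF assms(1)] cxD[OF cmD(1)[OF assms(1)]] cxD[OF cmD(2)[OF assms(1)]] int_shift_simps
    arr_ty
  show ?thesis
    by (rule cmI) (simp_all add: cone_obj cone_cx[OF assms] cone_diff[OF assms] shift_simps shift_cx bin arr_calc)
qed

text \<open>Degree \<open>n\<close> and degree \<open>n - 1\<close> of the cone both contain a copy
  of \<open>X\<close> in degree \<open>n\<close>; the contraction maps the first copy identically
  onto the second.\<close>

lemma cone_Ident_zero:
  assumes X: "bounded_complex C X"
  shows "zero_object (Kb C) (cone C X X (\<lambda>n. Ident C (obj_at X n)))" (is "zero_object _ ?N")
proof -
  note c = cm_Ident[OF X]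
  note [simp] = X cxD[OF X] int_shift_simps arr_ty
  have "homotopy C ?N ?N (\<lambda>n. inl C (obj_at X n) (obj_at X (n - 1)) \<cdot> cprr C X X n)
    (\<lambda>n. Ident C (obj_at ?N n)) (\<lambda>n. Zero C (obj_at ?N n) (obj_at ?N n))"
    by (rule homotopyI)
      (simp_all add: cone_obj cone_diff[OF c] bin_Ident[symmetric] bin arr_calc)
  from cl_eqI[OF _ _ this]
  show ?thesis
    by (simp add: preadditive_category.zero_object_iff[OF Kb_preadditive] Kb_simps cone_cx[OF c] cm_Ident cm_Zero)
qed

end

section \<open>Triangles from degreewise split sequences\<close>

text \<open>\<open>\<rho>\<close> is a retraction of \<open>u\<close> and \<open>\<sigma>\<close> a
  section of \<open>v\<close> in each degree; neither has to be a chain map.\<close>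

definition split_exact :: "('o, 'm, 'z) acat_scheme \<Rightarrow> ('o, 'm) cplx \<Rightarrow> ('o, 'm) cplx \<Rightarrow> ('o, 'm) cplx \<Rightarrow>
    (int \<Rightarrow> 'm) \<Rightarrow> (int \<Rightarrow> 'm) \<Rightarrow> (int \<Rightarrow> 'm) \<Rightarrow> (int \<Rightarrow> 'm) \<Rightarrow> bool" where
  "split_exact C X M Z u v \<rho> \<sigma> \<longleftrightarrow> cm C X M u \<and> cm C M Z v \<and>
     (\<forall>n. bip C (obj_at X n) (obj_at Z n) (obj_at M n) (u n) (\<sigma> n) (\<rho> n) (v n))"

context additive_category
begin

text \<open>The third arrow of the triangle is the cone projection composed with
  \<open>\<phi>\<close>. The comparison with the standard triangle is the identity on
  \<open>X\<close> and \<open>M\<close> and \<open>\<phi>\<close> on \<open>Z\<close>, and the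
  homotopy \<open>h\<close> makes its middle square commute.\<close>

lemma dist_of_cone_iso:
  assumes u: "cm C X M u" and v: "cm C M Z v" and \<phi>: "cm C Z (cone C X M u) \<phi>"
    and iso: "arr_iso (Kb C) (cl C Z (cone C X M u) \<phi>)"
    and h: "homotopy C M (cone C X M u) h (\<lambda>n. \<phi> n \<cdot> v n) (\<lambda>n. cinr C X M n)"
  shows "\<exists>w. (cl C X M u, cl C M Z v, w) \<in> Dist (Kb C)"
proof -
  interpret K: preadditive_category "Kb C"
    by (rule Kb_preadditive)
  let ?N = "cone C X M u" and ?SX = "shift_cplx C X"
  let ?w = "cl C ?N ?SX (\<lambda>n. cprl C X M n) \<cdot>\<^bsub>Kb C\<^esub> cl C Z ?N \<phi>"
  note c = cm_cone_in[OF u] cm_cone_pr[OF u]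
  note bX = cmD(1)[OF u] note bM = cmD(2)[OF u]
  note t = ty_cl[OF u] ty_cl[OF v] ty_cl[OF \<phi>] ty_cl[OF c(1)] ty_cl[OF c(2)]
  have tw: "ty (Kb C) ?w = tp Z ?SX"
    using t K.ty_Comp by blast
  have s: "shift_class C (Ident (Kb C) X) = Ident (Kb C) ?SX"
    using shift_class_cl[OF cm_Ident[OF bX]] by (simp add: Kb_simps(5) shift_simps)
  have e: "cl C Z ?N \<phi> \<cdot>\<^bsub>Kb C\<^esub> cl C M Z v = cl C M ?N (\<lambda>n. cinr C X M n)"
    unfolding cl_Comp[OF v \<phi>] by (rule cl_eqI[OF cm_Comp[OF v \<phi>] c(1) h])
  have "(cl C X M u, cl C M Z v, ?w) \<in> Kb_triangles C"
    unfolding Kb_triangles_def Let_def mem_Collect_eq prod.case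
  proof (intro conjI)
    have o: "X \<in> Obj (Kb C)" "M \<in> Obj (Kb C)" "?SX \<in> Obj (Kb C)"
      using bX bM shift_cx by (auto simp: Kb_simps)
    have K: "Arr (Kb_cat C) = Arr (Kb C)" "Dom (Kb_cat C) = Dom (Kb C)" "Cod (Kb_cat C) = Cod (Kb C)"
      "Hom (Kb_cat C) = Hom (Kb C)" "arr_iso (Kb_cat C) = arr_iso (Kb C)" "Comp (Kb_cat C) = Comp (Kb C)"
      by (simp_all add: Kb_def Let_def Hom_def arr_iso_def fun_eq_iff)
    note [simp] = K t tw Dom_ty[OF t(1)] Cod_ty[OF t(1)] Dom_ty[OF t(2)] Cod_ty[OF t(2)] Dom_ty[OF tw] Cod_ty[OF tw]
    show "cl C X M u \<in> Arr (Kb_cat C)" "cl C M Z v \<in> Arr (Kb_cat C)" "?w \<in> Arr (Kb_cat C)"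
      unfolding K(1) using Arr_ty[OF t(1)] Arr_ty[OF t(2)] Arr_ty[OF tw] by simp_all
    show "Cod (Kb_cat C) (cl C X M u) = Dom (Kb_cat C) (cl C M Z v)"
      "Cod (Kb_cat C) (cl C M Z v) = Dom (Kb_cat C) ?w"
      "Cod (Kb_cat C) ?w = shift_cplx C (Dom (Kb_cat C) (cl C X M u))"
      by simp_all
    show "\<exists>f\<in>Arr (Cb C). \<exists>a\<in>Hom (Kb_cat C) (Dom (Kb_cat C) (cl C X M u)) (src f).
       \<exists>b\<in>Hom (Kb_cat C) (Cod (Kb_cat C) (cl C X M u)) (tgt f).
       \<exists>c\<in>Hom (Kb_cat C) (Cod (Kb_cat C) (cl C M Z v)) (mapping_cone C f).
          arr_iso (Kb_cat C) a \<and> arr_iso (Kb_cat C) b \<and> arr_iso (Kb_cat C) c \<and>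
          b \<cdot>\<^bsub>Kb_cat C\<^esub> cl C X M u = homotopy_rel C `` {f} \<cdot>\<^bsub>Kb_cat C\<^esub> a \<and>
          c \<cdot>\<^bsub>Kb_cat C\<^esub> cl C M Z v = homotopy_rel C `` {mapping_cone_in C f} \<cdot>\<^bsub>Kb_cat C\<^esub> b \<and>
          shift_class C a \<cdot>\<^bsub>Kb_cat C\<^esub> ?w = homotopy_rel C `` {mapping_cone_pr C f} \<cdot>\<^bsub>Kb_cat C\<^esub> c"
    proof (rule bexI[of _ "ChMap X M u"], rule bexI[of _ "Ident (Kb C) X"], rule bexI[of _ "Ident (Kb C) M"],
        rule bexI[of _ "cl C Z ?N \<phi>"])
      have f: "homotopy_rel C `` {ChMap X M u} = cl C X M u"
        "homotopy_rel C `` {mapping_cone_in C (ChMap X M u)} = cl C M ?N (\<lambda>n. cinr C X M n)"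
        "homotopy_rel C `` {mapping_cone_pr C (ChMap X M u)} = cl C ?N ?SX (\<lambda>n. cprl C X M n)"
        by (simp_all add: cl_def mapping_cone_in_def mapping_cone_pr_def cone_def inr_def prl_def)
      show "arr_iso (Kb_cat C) (Ident (Kb C) X) \<and> arr_iso (Kb_cat C) (Ident (Kb C) M) \<and>
          arr_iso (Kb_cat C) (cl C Z ?N \<phi>) \<and>
          Ident (Kb C) M \<cdot>\<^bsub>Kb_cat C\<^esub> cl C X M u = homotopy_rel C `` {ChMap X M u} \<cdot>\<^bsub>Kb_cat C\<^esub> Ident (Kb C) X \<and>
          cl C Z ?N \<phi> \<cdot>\<^bsub>Kb_cat C\<^esub> cl C M Z v =
            homotopy_rel C `` {mapping_cone_in C (ChMap X M u)} \<cdot>\<^bsub>Kb_cat C\<^esub> Ident (Kb C) M \<and>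
          shift_class C (Ident (Kb C) X) \<cdot>\<^bsub>Kb_cat C\<^esub> ?w =
            homotopy_rel C `` {mapping_cone_pr C (ChMap X M u)} \<cdot>\<^bsub>Kb_cat C\<^esub> cl C Z ?N \<phi>"
        unfolding K f s e using iso
        by (simp add: K.arr_iso_Ident[OF o(1)] K.arr_iso_Ident[OF o(2)] K.comp_Ident_l[OF t(1)]
            K.comp_Ident_r[OF t(1)] K.comp_Ident_r[OF t(4)] K.comp_Ident_l[OF tw] del: K)
      show "ChMap X M u \<in> Arr (Cb C)"
        using u by (simp add: Cb_def cm_def)
    qed (use o in \<open>simp_all add: Hom_ty K.ty_Ident cone_def[symmetric]\<close>)
  qed
  then show ?thesis
    by (auto simp: Kb_simps)
qed

lemma dist_cone:
  assumes u: "cm C X Y f"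
  shows "\<exists>w. (cl C X Y f, cl C Y (cone C X Y f) (\<lambda>n. cinr C X Y n), w) \<in> Dist (Kb C)"
proof -
  note [simp] = cmD[OF u] cxD[OF cmD(1)[OF u]] cxD[OF cmD(2)[OF u]]
  note i = cm_Ident[OF cone_cx[OF u]]
  have "arr_iso (Kb C) (cl C (cone C X Y f) (cone C X Y f) (\<lambda>n. Ident C (obj_at (cone C X Y f) n)))"
    using preadditive_category.arr_iso_Ident[OF Kb_preadditive, of "cone C X Y f"] cone_cx[OF u]
    by (simp add: Kb_simps)
  from dist_of_cone_iso[OF u cm_cone_in[OF u] i this, of "\<lambda>n. Zero C (obj_at Y n) (obj_at (cone C X Y f) (n - 1))"]
  show ?thesis
    using homotopy_refl[OF cm_cone_in[OF u]]
    by (simp add: comp_Ident_l[OF cmD(3)[OF cm_cone_in[OF u]]])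
qed

text \<open>For the splitting of \<open>M\<close> into \<open>X\<close> and \<open>Z\<close> in each
  degree the differential is triangular with corner \<open>-\<theta>\<close>, where
  \<open>\<theta>\<close> is a chain map from \<open>Z\<close> to the shift of \<open>X\<close>. The
  map \<open>\<phi>\<close> with components \<open>\<theta>\<close> and \<open>\<sigma>\<close>
  becomes the identity of \<open>Z\<close> when followed by the projection of the cone to
  \<open>M\<close> and by \<open>v\<close>; the other composite is homotopic to the identity through
  \<open>-\<rho>\<close>.\<close>

lemma split_exact_triangle:
  assumes ex: "split_exact C X M Z u v \<rho> \<sigma>"
  obtains \<phi> w where "cm C Z (cone C X M u) \<phi>" "arr_iso (Kb C) (cl C Z (cone C X M u) \<phi>)"
    "cl C Z (cone C X M u) \<phi> \<cdot>\<^bsub>Kb C\<^esub> cl C M Z v = cl C M (cone C X M u) (\<lambda>n. cinr C X M n)"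
    "(cl C X M u, cl C M Z v, w) \<in> Dist (Kb C)"
proof -
  have u: "cm C X M u" and v: "cm C M Z v"
    and b: "bip C (obj_at X n) (obj_at Z n) (obj_at M n) (u n) (\<sigma> n) (\<rho> n) (v n)" for n
    using ex by (auto simp: split_exact_def)
  note [simp] = cmD[OF u] cmD[OF v] cxD[OF cmD(1)[OF u]] cxD[OF cmD(2)[OF u]] cxD[OF cmD(2)[OF v]]
    bipD(1-4,8-11,13-16)[OF b] int_shift_simps arr_ty cone_cx[OF u]
  let ?N = "cone C X M u"
  let ?il = "\<lambda>n. cinl C X M n" and ?ir = "\<lambda>n. cinr C X M n"
  let ?pl = "\<lambda>n. cprl C X M n" and ?pr = "\<lambda>n. cprr C X M n"
  define \<theta> where "\<theta> n = \<boxminus> (\<rho> (n + 1) \<cdot> diff_at M n \<cdot> \<sigma> n)" for n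
  have t\<theta>[simp]: "ty C (\<theta> n) = tp (obj_at Z n) (obj_at X (n + 1))" for n
    by (simp add: \<theta>_def)
  have idM: "Ident C (obj_at M n) = u n \<cdot> \<rho> n \<boxplus> \<sigma> n \<cdot> v n" for n
    by (simp add: bipD(12)[OF b])
  have d\<sigma>: "diff_at M n \<cdot> \<sigma> n = dif C (\<sigma> (n + 1) \<cdot> diff_at Z n) (u (n + 1) \<cdot> \<theta> n)" for n
    by (rule bip_into_eq[OF b[of "n + 1"], of _ "obj_at Z n"])
      (simp_all add: \<theta>_def arr_calc cmD(4,5)[OF v, symmetric] del: cmD(4,5)[OF v])
  have d\<sigma>': "diff_at M n \<cdot> (\<sigma> n \<cdot> f) = dif C (\<sigma> (n + 1) \<cdot> (diff_at Z n \<cdot> f)) (u (n + 1) \<cdot> (\<theta> n \<cdot> f))"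
    if "ty C f = tp W (obj_at Z n)" for f W n
    using reassoc[OF d\<sigma>[of n], of "obj_at M n" "obj_at M (n + 1)" "obj_at Z n" f W] that
    by (simp add: comp_dif comp_assoc)
  \<comment> \<open>The split monomorphism \<open>u\<close> may be applied first. There
    \<open>u \<theta>\<close> is \<open>\<sigma> d - d \<sigma>\<close>, and the claim follows from
    \<open>d d = 0\<close>.\<close>
  have d\<theta>: "diff_at X (n + 1) \<cdot> \<theta> n = \<boxminus> (\<theta> (n + 1) \<cdot> diff_at Z n)" for n
  proof -
    have "u (n + 2) \<cdot> (diff_at X (n + 1) \<cdot> \<theta> n) = diff_at M (n + 1) \<cdot> (u (n + 1) \<cdot> \<theta> n)"
      by simp
    also have "u (n + 1) \<cdot> \<theta> n = dif C (\<sigma> (n + 1) \<cdot> diff_at Z n) (diff_at M n \<cdot> \<sigma> n)"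
      by (simp add: d\<sigma> arr_calc)
    also have "diff_at M (n + 1) \<cdot> \<dots> = \<boxminus> (u (n + 2) \<cdot> (\<theta> (n + 1) \<cdot> diff_at Z n))"
      by (simp add: arr_calc d\<sigma>' del: d\<sigma>)
    finally have "\<rho> (n + 2) \<cdot> (u (n + 2) \<cdot> (diff_at X (n + 1) \<cdot> \<theta> n)) =
        \<rho> (n + 2) \<cdot> \<boxminus> (u (n + 2) \<cdot> (\<theta> (n + 1) \<cdot> diff_at Z n))"
      by simp
    then show ?thesis
      by (simp add: comp_neg_r)
  qed
  define \<phi> where "\<phi> n = ?il n \<cdot> \<theta> n \<boxplus> ?ir n \<cdot> \<sigma> n" for n
  have c\<phi>: "cm C Z ?N \<phi>"
  proof (rule cmI)
    show "diff_at ?N n \<cdot> \<phi> n = \<phi> (n + 1) \<cdot> diff_at Z n" for n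
      by (simp add: \<phi>_def cone_diff[OF u] bin d\<sigma> d\<theta> arr_calc)
  qed (simp_all add: \<phi>_def cone_obj bin)
  have c\<psi>: "cm C ?N Z (\<lambda>n. v n \<cdot> ?pr n)"
    by (rule cmI) (simp_all add: cone_obj cone_diff[OF u] bin arr_calc)
  have h: "homotopy C ?N ?N (\<lambda>n. \<boxminus> (?il (n - 1) \<cdot> \<rho> n \<cdot> ?pr n)) (\<lambda>n. \<phi> n \<cdot> v n \<cdot> ?pr n) (\<lambda>n. Ident C (obj_at ?N n))"
  proof (rule homotopyI)
    fix n
    have uv: "\<theta> n \<cdot> v n = dif C (diff_at X n \<cdot> \<rho> n) (\<rho> (n + 1) \<cdot> diff_at M n)"
    proof -
      have "\<rho> (n + 1) \<cdot> (diff_at M n \<cdot> (u n \<cdot> \<rho> n \<boxplus> \<sigma> n \<cdot> v n)) = \<rho> (n + 1) \<cdot> diff_at M n"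
        unfolding idM[symmetric] by (simp add: comp_Ident_r)
      then show ?thesis
        by (simp add: d\<sigma>' arr_calc)
    qed
    have sv: "\<sigma> n \<cdot> v n = dif C (Ident C (obj_at M n)) (u n \<cdot> \<rho> n)"
      unfolding idM by (simp add: arr_calc)
    show "\<phi> n \<cdot> v n \<cdot> ?pr n = Ident C (obj_at ?N n) \<boxplus> (diff_at ?N (n - 1) \<cdot> \<boxminus> (?il (n - 1) \<cdot> \<rho> n \<cdot> ?pr n) \<boxplus>
        \<boxminus> (?il (n + 1 - 1) \<cdot> \<rho> (n + 1) \<cdot> ?pr (n + 1)) \<cdot> diff_at ?N n)"
      unfolding \<phi>_def
      by (simp add: cone_obj cone_diff[OF u] bin bin_Ident[symmetric] arr_calc reassoc[OF uv] reassoc[OF sv])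
  qed (simp add: cone_obj bin)
  have e1: "(\<lambda>n. (v n \<cdot> ?pr n) \<cdot> \<phi> n) = (\<lambda>n. Ident C (obj_at Z n))"
    by (rule ext) (simp add: \<phi>_def bin arr_calc)
  have iso: "arr_iso (Kb C) (cl C Z ?N \<phi>)"
  proof (rule preadditive_category.arr_isoI[OF Kb_preadditive])
    show "ty (Kb C) (cl C Z ?N \<phi>) = tp Z ?N" "ty (Kb C) (cl C ?N Z (\<lambda>n. v n \<cdot> ?pr n)) = tp ?N Z"
      using c\<phi> c\<psi> ty_cl by auto
    show "cl C ?N Z (\<lambda>n. v n \<cdot> ?pr n) \<cdot>\<^bsub>Kb C\<^esub> cl C Z ?N \<phi> = Ident (Kb C) Z"
      unfolding cl_Comp[OF c\<phi> c\<psi>] Kb_simps(5) e1 ..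
    show "cl C Z ?N \<phi> \<cdot>\<^bsub>Kb C\<^esub> cl C ?N Z (\<lambda>n. v n \<cdot> ?pr n) = Ident (Kb C) ?N"
      unfolding cl_Comp[OF c\<psi> c\<phi>] Kb_simps(5)
      by (rule cl_eqI[OF cm_Comp[OF c\<psi> c\<phi>] cm_Ident h]) simp
  qed
  \<comment> \<open>The preceding homotopy precomposed with the inclusion of \<open>M\<close> into
    the cone.\<close>
  have h2: "homotopy C M ?N (\<lambda>n. \<boxminus> (?il (n - 1) \<cdot> \<rho> n)) (\<lambda>n. \<phi> n \<cdot> v n) ?ir"
  proof (rule homotopyI)
    fix n
    have "(\<phi> n \<cdot> v n \<cdot> ?pr n) \<cdot> ?ir n = (Ident C (obj_at ?N n) \<boxplus> (diff_at ?N (n - 1) \<cdot> \<boxminus> (?il (n - 1) \<cdot> \<rho> n \<cdot> ?pr n) \<boxplus>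
        \<boxminus> (?il (n + 1 - 1) \<cdot> \<rho> (n + 1) \<cdot> ?pr (n + 1)) \<cdot> diff_at ?N n)) \<cdot> ?ir n"
      using homotopyD(2)[OF h, of n] by simp
    then show "\<phi> n \<cdot> v n = ?ir n \<boxplus> (diff_at ?N (n - 1) \<cdot> \<boxminus> (?il (n - 1) \<cdot> \<rho> n) \<boxplus>
        \<boxminus> (?il (n + 1 - 1) \<cdot> \<rho> (n + 1)) \<cdot> diff_at M n)"
      using cmD(3)[OF c\<phi>] by (simp add: cone_obj cone_diff[OF u] bin arr_calc)
  qed (simp add: cone_obj bin)
  have e: "cl C Z ?N \<phi> \<cdot>\<^bsub>Kb C\<^esub> cl C M Z v = cl C M ?N ?ir"
    unfolding cl_Comp[OF v c\<phi>] by (rule cl_eqI[OF cm_Comp[OF v c\<phi>] cm_cone_in[OF u] h2])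
  show thesis
    using that[OF c\<phi> iso e] dist_of_cone_iso[OF u v c\<phi> iso h2] by blast
qed

end

section \<open>Maps of mapping cones\<close>

context additive_category
begin

text \<open>The triangular matrix with diagonal \<open>a\<close>, \<open>b\<close> and the homotopy
  \<open>h\<close> in the corner. The homotopy equation for the square is exactly the chain map
  condition in the corner entry.\<close>

lemma cm_cone_map:
  assumes f: "cm C X Y f" "cm C X' Y' f'" and a: "cm C X X' a" "cm C Y Y' b"
    and h: "homotopy C X Y' h (\<lambda>n. b n \<cdot> f n) (\<lambda>n. f' n \<cdot> a n)"
  shows "cm C (cone C X Y f) (cone C X' Y' f')
    (\<lambda>n. cinl C X' Y' n \<cdot> a (n + 1) \<cdot> cprl C X Y n \<boxplus>
      (cinr C X' Y' n \<cdot> h (n + 1) \<cdot> cprl C X Y n \<boxplus>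
       cinr C X' Y' n \<cdot> b n \<cdot> cprr C X Y n))"
proof (rule cmI)
  note [simp] = cmD[OF f(1)] cmD[OF f(2)] cmD[OF a(1)] cmD[OF a(2)] cxD[OF cmD(1)[OF f(1)]] cxD[OF cmD(2)[OF f(1)]]
    cxD[OF cmD(1)[OF f(2)]] cxD[OF cmD(2)[OF f(2)]] int_shift_simps arr_ty homotopyD(1)[OF h] bin
  show "bounded_complex C (cone C X Y f)" "bounded_complex C (cone C X' Y' f')"
    using cone_cx f by auto
  fix n
  let ?\<Phi> = "\<lambda>n. cinl C X' Y' n \<cdot> a (n + 1) \<cdot> cprl C X Y n \<boxplus>
      (cinr C X' Y' n \<cdot> h (n + 1) \<cdot> cprl C X Y n \<boxplus>
       cinr C X' Y' n \<cdot> b n \<cdot> cprr C X Y n)"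
  show "ty C (?\<Phi> n) = tp (obj_at (cone C X Y f) n) (obj_at (cone C X' Y' f') n)"
    by (simp add: cone_obj)
  have "b (n + 1) \<cdot> f (n + 1) = f' (n + 1) \<cdot> a (n + 1) \<boxplus> (diff_at Y' n \<cdot> h (n + 1) \<boxplus> h (n + 2) \<cdot> diff_at X (n + 1))"
    using homotopyD(2)[OF h, of "n + 1"] by simp
  note e = reassoc[OF this]
  show "diff_at (cone C X' Y' f') n \<cdot> ?\<Phi> n = ?\<Phi> (n + 1) \<cdot> diff_at (cone C X Y f) n"
    by (simp add: cone_diff[OF f(1)] cone_diff[OF f(2)] e arr_calc)
qed

text \<open>
  Correcting the diagonal entries by their homotopies to the identity makes the endomorphism
  of the cone strictly unipotent.
\<close>

lemma cone_endo_iso: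
  assumes f: "cm C X Y f" and x: "\<And>n. ty C (x n) = tp (obj_at X (n + 1)) (obj_at Y n)"
    and E: "cm C (cone C X Y f) (cone C X Y f) (\<lambda>n.
        cinl C X Y n \<cdot> \<alpha> (n + 1) \<cdot> cprl C X Y n \<boxplus>
       (cinr C X Y n \<cdot> x n \<cdot> cprl C X Y n \<boxplus>
        cinr C X Y n \<cdot> \<beta> n \<cdot> cprr C X Y n))"
      (is "cm C ?N ?N ?E")
    and k: "homotopy C X X k \<alpha> (\<lambda>n. Ident C (obj_at X n))" and l: "homotopy C Y Y l \<beta> (\<lambda>n. Ident C (obj_at Y n))"
    and ab: "cm C X X \<alpha>" "cm C Y Y \<beta>"
  shows "arr_iso (Kb C) (cl C ?N ?N ?E)"
proof -
  note [simp] = cmD[OF f(1)] cmD[OF ab(1)] cmD[OF ab(2)] cxD[OF cmD(1)[OF f(1)]] cxD[OF cmD(2)[OF f(1)]]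
    int_shift_simps arr_ty homotopyD(1)[OF k] homotopyD(1)[OF l] x bin
  let ?il = "\<lambda>n. cinl C X Y n" and ?ir = "\<lambda>n. cinr C X Y n"
  let ?pl = "\<lambda>n. cprl C X Y n" and ?pr = "\<lambda>n. cprr C X Y n"
  \<comment> \<open>What remains in the corner after \<open>k\<close> and \<open>l\<close> have
    reduced the diagonal to identities; both contribute through their composites with
    \<open>f\<close>.\<close>
  define y where "y n = x n \<boxplus> (f n \<cdot> k (n + 1) \<boxplus> \<boxminus> (l (n + 1) \<cdot> f (n + 1)))" for n
  define z where "z n = ?ir n \<cdot> y n \<cdot> ?pl n" for n
  have ty[simp]: "ty C (y n) = tp (obj_at X (n + 1)) (obj_at Y n)" for n
    by (simp add: y_def)
  have tz[simp]: "ty C (z n) = tp (dsum C [obj_at X (n + 1), obj_at Y n]) (dsum C [obj_at X (n + 1), obj_at Y n])" for n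
    by (simp add: z_def)
  let ?I = "\<lambda>n. Ident C (obj_at ?N n)"
  have h: "homotopy C ?N ?N (\<lambda>n. ?ir (n - 1) \<cdot> l n \<cdot> ?pr n \<boxplus> \<boxminus> (?il (n - 1) \<cdot> k (n + 1) \<cdot> ?pl n)) ?E (\<lambda>n. ?I n \<boxplus> z n)"
  proof (rule homotopyI)
    fix n
    have ea: "\<alpha> (n + 1) = Ident C (obj_at X (n + 1)) \<boxplus> (diff_at X n \<cdot> k (n + 1) \<boxplus> k (n + 2) \<cdot> diff_at X (n + 1))"
      using homotopyD(2)[OF k, of "n + 1"] by simp
    have eb: "\<beta> n = Ident C (obj_at Y n) \<boxplus> (diff_at Y (n - 1) \<cdot> l n \<boxplus> l (n + 1) \<cdot> diff_at Y n)"
      using homotopyD(2)[OF l, of "n"] by simp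
    show "?E n = ?I n \<boxplus> z n \<boxplus> (diff_at ?N (n - 1) \<cdot> (?ir (n - 1) \<cdot> l n \<cdot> ?pr n \<boxplus> \<boxminus> (?il (n - 1) \<cdot> k (n + 1) \<cdot> ?pl n)) \<boxplus>
       (?ir (n + 1 - 1) \<cdot> l (n + 1) \<cdot> ?pr (n + 1) \<boxplus> \<boxminus> (?il (n + 1 - 1) \<cdot> k (n + 1 + 1) \<cdot> ?pl (n + 1))) \<cdot> diff_at ?N n)"
      unfolding ea eb z_def y_def
      by (simp add: cone_obj cone_diff[OF f(1)] bin_Ident[symmetric] arr_calc)
  qed (simp add: cone_obj)
  \<comment> \<open>No computation is required here: a family homotopic to a chain map is a chain
    map. Subtracting the identity then shows that \<open>z\<close> is one too.\<close>
  have c1: "cm C ?N ?N (\<lambda>n. ?I n \<boxplus> z n)"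
    by (rule cm_homotopic[OF E _ h]) (simp add: cone_obj)
  have "cm C ?N ?N (\<lambda>n. (?I n \<boxplus> z n) \<boxplus> \<boxminus> ?I n)"
    by (intro cm_Add cm_neg c1 cm_Ident cone_cx f)
  moreover have "(\<lambda>n. (?I n \<boxplus> z n) \<boxplus> \<boxminus> ?I n) = z"
    by (rule ext) (simp add: cone_obj arr_calc)
  ultimately have cz: "cm C ?N ?N z"
    by simp
  have zz: "(\<lambda>n. z n \<cdot> z n) = (\<lambda>n. Zero C (obj_at ?N n) (obj_at ?N n))"
    by (rule ext) (simp add: z_def cone_obj arr_calc)
  have "cl C ?N ?N ?E = cl C ?N ?N (\<lambda>n. ?I n \<boxplus> z n)"
    by (rule cl_eqI[OF E c1 h])
  also have "\<dots> = Ident (Kb C) ?N \<boxplus>\<^bsub>Kb C\<^esub> cl C ?N ?N z"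
    by (simp add: Kb_simps(5) cl_Add[OF cm_Ident[OF cmD(1)[OF cz]] cz])
  finally show ?thesis
    using preadditive_category.unipotent_iso[OF Kb_preadditive ty_cl[OF cz]]
    by (simp add: cl_Comp[OF cz cz] zz Kb_simps(7))
qed

text \<open>Homotopy inverses of the two vertical arrows give a map of cones in the other direction.
  Both composites are triangular with diagonal homotopic to the identity, so
  \<open>cone_endo_iso\<close> makes them invertible whatever stands in the corner.\<close>

lemma cone_isomorphic:
  assumes f: "cm C X Y f" "cm C X' Y' f'"
    and a: "arr_iso (Kb C) a" "ty (Kb C) a = tp X X'" and b: "arr_iso (Kb C) b" "ty (Kb C) b = tp Y Y'"
    and e: "b \<cdot>\<^bsub>Kb C\<^esub> cl C X Y f = cl C X' Y' f' \<cdot>\<^bsub>Kb C\<^esub> a"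
  shows "isomorphic (Kb C) (cone C X Y f) (cone C X' Y' f')"
proof -
  interpret K: preadditive_category "Kb C"
    by (rule Kb_preadditive)
  obtain a' where a': "ty (Kb C) a' = tp X' X" "a' \<cdot>\<^bsub>Kb C\<^esub> a = Ident (Kb C) X" "a \<cdot>\<^bsub>Kb C\<^esub> a' = Ident (Kb C) X'"
    using K.arr_isoE[OF a] .
  obtain b' where b': "ty (Kb C) b' = tp Y' Y" "b' \<cdot>\<^bsub>Kb C\<^esub> b = Ident (Kb C) Y" "b \<cdot>\<^bsub>Kb C\<^esub> b' = Ident (Kb C) Y'"
    using K.arr_isoE[OF b] .
  note tf = ty_cl[OF f(1)] ty_cl[OF f(2)]
  have e': "b' \<cdot>\<^bsub>Kb C\<^esub> cl C X' Y' f' = cl C X Y f \<cdot>\<^bsub>Kb C\<^esub> a'"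
  proof -
    have "b' \<cdot>\<^bsub>Kb C\<^esub> cl C X' Y' f' = b' \<cdot>\<^bsub>Kb C\<^esub> ((cl C X' Y' f' \<cdot>\<^bsub>Kb C\<^esub> a) \<cdot>\<^bsub>Kb C\<^esub> a')"
      by (simp add: tf a a' b' K.arr_ty K.comp_assoc K.comp_Ident_r)
    also have "\<dots> = (b' \<cdot>\<^bsub>Kb C\<^esub> b) \<cdot>\<^bsub>Kb C\<^esub> (cl C X Y f \<cdot>\<^bsub>Kb C\<^esub> a')"
      unfolding e[symmetric] by (simp add: tf a a' b b'(1) K.arr_ty K.comp_assoc del: b'(2))
    also have "\<dots> = cl C X Y f \<cdot>\<^bsub>Kb C\<^esub> a'"
      unfolding b'(2) by (simp add: tf a' K.arr_ty K.comp_Ident_l)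
    finally show ?thesis .
  qed
  obtain \<alpha> where \<alpha>: "cm C X X' \<alpha>" "a = cl C X X' \<alpha>"
    using ty_clE[OF a(2)] .
  obtain \<alpha>' where \<alpha>': "cm C X' X \<alpha>'" "a' = cl C X' X \<alpha>'"
    using ty_clE[OF a'(1)] .
  obtain \<beta> where \<beta>: "cm C Y Y' \<beta>" "b = cl C Y Y' \<beta>"
    using ty_clE[OF b(2)] .
  obtain \<beta>' where \<beta>': "cm C Y' Y \<beta>'" "b' = cl C Y' Y \<beta>'"
    using ty_clE[OF b'(1)] .
  note cc = cm_Comp[OF f(1) \<beta>(1)] cm_Comp[OF \<alpha>(1) f(2)] cm_Comp[OF f(2) \<beta>'(1)] cm_Comp[OF \<alpha>'(1) f(1)]
  obtain h where h: "homotopy C X Y' h (\<lambda>n. \<beta> n \<cdot> f n) (\<lambda>n. f' n \<cdot> \<alpha> n)"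
    using e unfolding \<alpha> \<beta> cl_Comp[OF f(1) \<beta>(1)] cl_Comp[OF \<alpha>(1) f(2)] cl_eq[OF cc(1,2)] by blast
  obtain h' where h': "homotopy C X' Y h' (\<lambda>n. \<beta>' n \<cdot> f' n) (\<lambda>n. f n \<cdot> \<alpha>' n)"
    using e' unfolding \<alpha>' \<beta>' cl_Comp[OF f(2) \<beta>'(1)] cl_Comp[OF \<alpha>'(1) f(1)] cl_eq[OF cc(3,4)] by blast
  have hid: "\<exists>k. homotopy C Z Z k (\<lambda>n. q n \<cdot> p n) (\<lambda>n. Ident C (obj_at Z n))"
    if "cm C Z W p" "cm C W Z q" "cl C W Z q \<cdot>\<^bsub>Kb C\<^esub> cl C Z W p = Ident (Kb C) Z" for Z W p q
    using that(3) unfolding cl_Comp[OF that(1,2)] Kb_simps(5)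
      cl_eq[OF cm_Comp[OF that(1,2)] cm_Ident[OF cmD(1)[OF that(1)]]] .
  obtain k where k: "homotopy C X X k (\<lambda>n. \<alpha>' n \<cdot> \<alpha> n) (\<lambda>n. Ident C (obj_at X n))"
    using hid[OF \<alpha>(1) \<alpha>'(1)] a'(2) \<alpha>(2) \<alpha>'(2) by auto
  obtain k' where k': "homotopy C X' X' k' (\<lambda>n. \<alpha> n \<cdot> \<alpha>' n) (\<lambda>n. Ident C (obj_at X' n))"
    using hid[OF \<alpha>'(1) \<alpha>(1)] a'(3) \<alpha>(2) \<alpha>'(2) by auto
  obtain l where l: "homotopy C Y Y l (\<lambda>n. \<beta>' n \<cdot> \<beta> n) (\<lambda>n. Ident C (obj_at Y n))"
    using hid[OF \<beta>(1) \<beta>'(1)] b'(2) \<beta>(2) \<beta>'(2) by auto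
  obtain l' where l': "homotopy C Y' Y' l' (\<lambda>n. \<beta> n \<cdot> \<beta>' n) (\<lambda>n. Ident C (obj_at Y' n))"
    using hid[OF \<beta>'(1) \<beta>(1)] b'(3) \<beta>(2) \<beta>'(2) by auto
  note \<Phi> = cm_cone_map[OF f(1) f(2) \<alpha>(1) \<beta>(1) h]
  note \<Psi> = cm_cone_map[OF f(2) f(1) \<alpha>'(1) \<beta>'(1) h']
  note [simp] = cmD(1-3)[OF f(1)] cmD(1-3)[OF f(2)] cmD(1-3)[OF \<alpha>(1)] cmD(1-3)[OF \<beta>(1)] cmD(1-3)[OF
    \<alpha>'(1)] cmD(1-3)[OF \<beta>'(1)]
    cxD(1,2)[OF cmD(1)[OF f(1)]] cxD(1,2)[OF cmD(2)[OF f(1)]] cxD(1,2)[OF cmD(1)[OF f(2)]] cxD(1,2)[OF cmD(2)[OF f(2)]]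
    int_shift_simps arr_ty homotopyD(1)[OF h] homotopyD(1)[OF h'] bin
  let ?\<Phi> = "\<lambda>n. cinl C X' Y' n \<cdot> \<alpha> (n + 1) \<cdot> cprl C X Y n \<boxplus>
      (cinr C X' Y' n \<cdot> h (n + 1) \<cdot> cprl C X Y n \<boxplus>
       cinr C X' Y' n \<cdot> \<beta> n \<cdot> cprr C X Y n)"
  let ?\<Psi> = "\<lambda>n. cinl C X Y n \<cdot> \<alpha>' (n + 1) \<cdot> cprl C X' Y' n \<boxplus>
      (cinr C X Y n \<cdot> h' (n + 1) \<cdot> cprl C X' Y' n \<boxplus>
       cinr C X Y n \<cdot> \<beta>' n \<cdot> cprr C X' Y' n)"
  have "arr_iso (Kb C) (cl C (cone C X Y f) (cone C X' Y' f') ?\<Phi>)"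
  proof (rule K.arr_iso_of_two_sided[OF ty_cl[OF \<Phi>] ty_cl[OF \<Psi>]])
    have e1: "(\<lambda>n. ?\<Psi> n \<cdot> ?\<Phi> n) = (\<lambda>n.
        cinl C X Y n \<cdot> (\<alpha>' (n + 1) \<cdot> \<alpha> (n + 1)) \<cdot> cprl C X Y n \<boxplus>
       (cinr C X Y n \<cdot> (h' (n + 1) \<cdot> \<alpha> (n + 1) \<boxplus> \<beta>' n \<cdot> h (n + 1)) \<cdot> cprl C X Y n \<boxplus>
        cinr C X Y n \<cdot> (\<beta>' n \<cdot> \<beta> n) \<cdot> cprr C X Y n))"
      by (rule ext) (simp add: arr_calc)
    show "arr_iso (Kb C) (cl C (cone C X' Y' f') (cone C X Y f) ?\<Psi> \<cdot>\<^bsub>Kb C\<^esub> cl C (cone C X Y f) (cone C X' Y' f') ?\<Phi>)"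
      using cm_Comp[OF \<Phi> \<Psi>] unfolding cl_Comp[OF \<Phi> \<Psi>] e1
      by (intro cone_endo_iso[OF f(1) _ _ k l]) (simp_all add: cm_Comp[OF \<alpha>(1) \<alpha>'(1)] cm_Comp[OF \<beta>(1) \<beta>'(1)])
    have e2: "(\<lambda>n. ?\<Phi> n \<cdot> ?\<Psi> n) = (\<lambda>n.
        cinl C X' Y' n \<cdot> (\<alpha> (n + 1) \<cdot> \<alpha>' (n + 1)) \<cdot> cprl C X' Y' n \<boxplus>
       (cinr C X' Y' n \<cdot> (h (n + 1) \<cdot> \<alpha>' (n + 1) \<boxplus> \<beta> n \<cdot> h' (n + 1)) \<cdot> cprl C X' Y' n \<boxplus>
        cinr C X' Y' n \<cdot> (\<beta> n \<cdot> \<beta>' n) \<cdot> cprr C X' Y' n))"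
      by (rule ext) (simp add: arr_calc)
    show "arr_iso (Kb C) (cl C (cone C X Y f) (cone C X' Y' f') ?\<Phi> \<cdot>\<^bsub>Kb C\<^esub> cl C (cone C X' Y' f') (cone C X Y f) ?\<Psi>)"
      using cm_Comp[OF \<Psi> \<Phi>] unfolding cl_Comp[OF \<Psi> \<Phi>] e2
      by (intro cone_endo_iso[OF f(2) _ _ k' l']) (simp_all add: cm_Comp[OF \<alpha>'(1) \<alpha>(1)] cm_Comp[OF \<beta>'(1) \<beta>(1)])
  qed
  then show ?thesis
    using ty_cl[OF \<Phi>] by (auto simp: K.isomorphic_ty)
qed

text \<open>
  The octahedron: both outer terms determine the middle one, which is the cone of a map
  from the unshifted cone of \<open>g\<close> to the cone of \<open>f\<close>.
\<close>

lemma octahedron: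
  assumes f: "cm C X Y f" and g: "cm C Y Z g"
  obtains \<delta> u v \<rho> \<sigma> where "cm C (unshift C (cone C Y Z g)) (cone C X Y f) \<delta>"
    "split_exact C (cone C Y Y (\<lambda>n. Ident C (obj_at Y n))) (cone C (unshift C (cone C Y Z g)) (cone C X Y f) \<delta>)
      (cone C X Z (\<lambda>n. g n \<cdot> f n)) u v \<rho> \<sigma>"
proof -
  note cY = cmD(2)[OF f]
  note i = cm_Ident[OF cY]
  note gf = cm_Comp[OF f g]
  note [simp] = cmD[OF f] cmD[OF g] cxD[OF cmD(1)[OF f(1)]] cxD[OF cmD(2)[OF f(1)]] cxD[OF cmD(2)[OF g]]
    int_shift_simps arr_ty bin shift_simps cone_obj cone_cx[OF f] cone_cx[OF g] cone_cx[OF i] cone_cx[OF gf] unshift_cx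
  let ?U = "unshift C (cone C Y Z g)" and ?F = "cone C X Y f"
  \<comment> \<open>\<open>\<delta>\<close> projects the unshifted cone of \<open>g\<close> to
    \<open>Y\<close> and then includes \<open>Y\<close> in the cone of \<open>f\<close>.\<close>
  define \<delta> where "\<delta> n = cinr C X Y n \<cdot> prl C (obj_at Y n) (obj_at Z (n - 1))" for n
  have td[simp]: "ty C (\<delta> n) = tp (dsum C [obj_at Y n, obj_at Z (n - 1)]) (dsum C [obj_at X (n + 1), obj_at Y n])" for n
    by (simp add: \<delta>_def)
  have d: "cm C ?U ?F \<delta>"
    by (rule cmI) (simp_all add: \<delta>_def cone_diff[OF f] cone_diff[OF g] arr_calc)
  let ?E = "cone C ?U ?F \<delta>"
  let ?P = "\<lambda>n. dsum C [obj_at Y (n + 1), obj_at Z n]" and ?Q = "\<lambda>n. dsum C [obj_at X (n + 1), obj_at Y n]"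
  \<comment> \<open>In degree \<open>n\<close> the cone of \<open>\<delta>\<close> has the four
    summands \<open>Y (n + 1)\<close>, \<open>Z n\<close>, \<open>X (n + 1)\<close> and
    \<open>Y n\<close>. The prime marks the copy of \<open>Y\<close> in degree
    \<open>n + 1\<close>.\<close>
  define iy' where "iy' n = inl C (?P n) (?Q n) \<cdot> cinl C Y Z n" for n
  define iz where "iz n = inl C (?P n) (?Q n) \<cdot> cinr C Y Z n" for n
  define ix where "ix n = inr C (?P n) (?Q n) \<cdot> cinl C X Y n" for n
  define iy where "iy n = inr C (?P n) (?Q n) \<cdot> cinr C X Y n" for n
  define py' where "py' n = cprl C Y Z n \<cdot> prl C (?P n) (?Q n)" for n
  define pz where "pz n = cprr C Y Z n \<cdot> prl C (?P n) (?Q n)" for n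
  define px where "px n = cprl C X Y n \<cdot> prr C (?P n) (?Q n)" for n
  define py where "py n = cprr C X Y n \<cdot> prr C (?P n) (?Q n)" for n
  note ds = iy'_def iz_def ix_def iy_def py'_def pz_def px_def py_def
  \<comment> \<open>On elements, \<open>u\<close> is the graph
    \<open>(y', y) \<mapsto> (y', g y, 0, y)\<close> and \<open>v\<close> sends
    \<open>(y', z, x, y)\<close> to \<open>(-x, z - g y)\<close>, whose kernel is that
    graph.\<close>
  define u where "u n = iy' n \<cdot> cprl C Y Y n \<boxplus>
    (iz n \<cdot> g n \<cdot> cprr C Y Y n \<boxplus> iy n \<cdot> cprr C Y Y n)" for n
  define \<rho> where "\<rho> n = cinl C Y Y n \<cdot> py' n \<boxplus> cinr C Y Y n \<cdot> py n" for n
  define v where "v n = \<boxminus> (cinl C X Z n \<cdot> px n) \<boxplus>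
    (cinr C X Z n \<cdot> pz n \<boxplus> \<boxminus> (cinr C X Z n \<cdot> g n \<cdot> py n))" for n
  define \<sigma> where "\<sigma> n = iz n \<cdot> cprr C X Z n \<boxplus>
    \<boxminus> (ix n \<cdot> cprl C X Z n)" for n
  have cu: "cm C (cone C Y Y (\<lambda>n. Ident C (obj_at Y n))) ?E u"
    by (rule cmI) (simp_all add: u_def ds cone_cx[OF d] cone_diff[OF d] cone_diff[OF f] cone_diff[OF g] cone_diff[OF i] \<delta>_def arr_calc)
  have cv: "cm C ?E (cone C X Z (\<lambda>n. g n \<cdot> f n)) v"
    by (rule cmI) (simp_all add: v_def ds cone_cx[OF d] cone_diff[OF d] cone_diff[OF f] cone_diff[OF g] cone_diff[OF gf] \<delta>_def arr_calc)
  have b: "bip C (obj_at (cone C Y Y (\<lambda>n. Ident C (obj_at Y n))) n) (obj_at (cone C X Z (\<lambda>n. g n \<cdot> f n)) n)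
      (obj_at ?E n) (u n) (\<sigma> n) (\<rho> n) (v n)" for n
  proof -
    have "u n \<cdot> \<rho> n \<boxplus> \<sigma> n \<cdot> v n = inl C (?P n) (?Q n) \<cdot> (Ident C (?P n) \<cdot> prl C (?P n) (?Q n)) \<boxplus>
        inr C (?P n) (?Q n) \<cdot> (Ident C (?Q n) \<cdot> prr C (?P n) (?Q n))"
      unfolding bin_Ident[symmetric, OF cxD(1)[OF cY] cxD(1)[OF cmD(2)[OF g]]]
        bin_Ident[symmetric, OF cxD(1)[OF cmD(1)[OF f]] cxD(1)[OF cY]]
      by (simp add: u_def v_def \<rho>_def \<sigma>_def ds arr_calc)
    also have "\<dots> = Ident C (obj_at ?E n)"
      by (simp add: comp_Ident_l bin_Ident)
    finally have I: "u n \<cdot> \<rho> n \<boxplus> \<sigma> n \<cdot> v n = Ident C (obj_at ?E n)" .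
    show ?thesis
      unfolding bip_def I
      by (simp add: u_def v_def \<rho>_def \<sigma>_def ds bin_Ident[symmetric] arr_calc)
  qed
  show thesis
    by (rule that[OF d, of u v \<rho> \<sigma>]) (simp add: split_exact_def cu cv b del: cone_obj)
qed

end

section \<open>Triangulated subcategories and their weak equivalences\<close>

context additive_category
begin

lemma split_exact_cone:
  assumes f: "cm C X Y f"
  shows "split_exact C Y (cone C X Y f) (shift_cplx C X) (\<lambda>n. cinr C X Y n)
    (\<lambda>n. cprl C X Y n) (\<lambda>n. cprr C X Y n)
    (\<lambda>n. cinl C X Y n)"
proof -
  note [simp] = cxD[OF cmD(1)[OF f]] cxD[OF cmD(2)[OF f]]
  show ?thesis
    unfolding split_exact_def
    by (simp add: cm_cone_in[OF f] cm_cone_pr[OF f] bip_def shift_simps cone_obj bin arr_ty bin_Ident[symmetric] add_comm)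
qed

text \<open>The unshifted cone plays the role of the homotopy fibre of \<open>f\<close>: it projects
  onto \<open>X\<close> with the unshift of \<open>Y\<close> as kernel.\<close>

lemma split_exact_cocone:
  assumes f: "cm C X Y f"
  shows "split_exact C (unshift C Y) (unshift C (cone C X Y f)) X (\<lambda>n. inr C (obj_at X n) (obj_at Y (n - 1)))
    (\<lambda>n. prl C (obj_at X n) (obj_at Y (n - 1))) (\<lambda>n. prr C (obj_at X n) (obj_at Y (n - 1)))
    (\<lambda>n. inl C (obj_at X n) (obj_at Y (n - 1)))"
proof -
  have b: "bounded_complex C X" "bounded_complex C Y"
    using cmD[OF f] by auto
  have "bip C (obj_at Y (n - 1)) (obj_at X (n - 1 + 1)) (obj_at (cone C X Y f) (n - 1))
      (inr C (obj_at X (n - 1 + 1)) (obj_at Y (n - 1))) (inl C (obj_at X (n - 1 + 1)) (obj_at Y (n - 1)))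
      (prr C (obj_at X (n - 1 + 1)) (obj_at Y (n - 1))) (prl C (obj_at X (n - 1 + 1)) (obj_at Y (n - 1)))" for n
    using split_exact_cone[OF f] unfolding split_exact_def shift_simps by blast
  with b show ?thesis
    using cm_unshift[OF cm_cone_in[OF f]] cm_unshift[OF cm_cone_pr[OF f]]
    by (simp add: split_exact_def shift_simps shift_unshift int_shift_simps)
qed

section \<open>Null-homotopies as lifts and factorizations\<close>

lemma cocone_comp_zero:
  assumes f: "cm C X Y f"
  shows "cl C X Y f \<cdot>\<^bsub>Kb C\<^esub> cl C (unshift C (cone C X Y f)) X (\<lambda>n. prl C (obj_at X n) (obj_at Y (n - 1))) =
    Zero (Kb C) (unshift C (cone C X Y f)) Y"
proof -
  let ?P = "unshift C (cone C X Y f)"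
  note [simp] = cmD[OF f] cxD[OF cmD(1)[OF f]] cxD[OF cmD(2)[OF f]] shift_simps cone_obj int_shift_simps arr_ty bin
  have t: "cm C ?P X (\<lambda>n. prl C (obj_at X n) (obj_at Y (n - 1)))"
    using split_exact_cocone[OF f] by (simp add: split_exact_def)
  have P: "bounded_complex C ?P"
    using cmD(1)[OF t] .
  have "homotopy C ?P Y (\<lambda>n. \<boxminus> prr C (obj_at X n) (obj_at Y (n - 1)))
      (\<lambda>n. f n \<cdot> prl C (obj_at X n) (obj_at Y (n - 1))) (\<lambda>n. Zero C (obj_at ?P n) (obj_at Y n))"
    by (rule homotopyI) (simp_all add: cone_diff[OF f] arr_calc)
  from cl_eqI[OF cm_Comp[OF t f] cm_Zero[OF P] this]
  show ?thesis
    by (simp add: cl_Comp[OF t f] Kb_simps(7))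
qed

text \<open>A null-homotopy with values in the cone of \<open>s\<close> has two components: the one
  in \<open>Z\<close> is a chain map \<open>a\<close>, the one in \<open>Y\<close> is a homotopy
  from \<open>h\<close> to \<open>s a\<close>.\<close>

lemma lift_along_cone_in:
  assumes h: "cm C X Y h" and s: "cm C Z Y s"
    and e: "cl C Y (cone C Z Y s) (\<lambda>n. cinr C Z Y n) \<cdot>\<^bsub>Kb C\<^esub> cl C X Y h =
      Zero (Kb C) X (cone C Z Y s)"
  obtains a where "cm C X Z a" "cl C X Y h = cl C Z Y s \<cdot>\<^bsub>Kb C\<^esub> cl C X Z a"
proof -
  note [simp] = cmD[OF h] cmD[OF s] cxD[OF cmD(1)[OF h]] cxD[OF cmD(2)[OF h]] cxD[OF cmD(1)[OF s]] cone_obj int_shift_simps arr_ty bin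
  note c = cm_cone_in[OF s]
  let ?pl = "\<lambda>n. cprl C Z Y n" and ?pr = "\<lambda>n. cprr C Z Y n"
  obtain H where H: "homotopy C X (cone C Z Y s) H (\<lambda>n. cinr C Z Y n \<cdot> h n)
      (\<lambda>n. Zero C (obj_at X n) (obj_at (cone C Z Y s) n))"
    using e unfolding cl_Comp[OF h c] Kb_simps(7)
      cl_eq[OF cm_Comp[OF h c] cm_Zero[OF cmD(1)[OF h] cone_cx[OF s]]] by blast
  have tH[simp]: "ty C (H n) = tp (obj_at X n) (dsum C [obj_at Z n, obj_at Y (n - 1)])" for n
    using homotopyD(1)[OF H, of n] by simp
  have eq: "cinr C Z Y n \<cdot> h n =
      diff_at (cone C Z Y s) (n - 1) \<cdot> H n \<boxplus> H (n + 1) \<cdot> diff_at X n" for n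
    using homotopyD(2)[OF H, of n] by (simp add: add_Zero_l cone_diff[OF s])
  have e1: "?pl n \<cdot> (cinr C Z Y n \<cdot> h n) =
      ?pl n \<cdot> (diff_at (cone C Z Y s) (n - 1) \<cdot> H n \<boxplus> H (n + 1) \<cdot> diff_at X n)" for n
    unfolding eq ..
  have e2: "?pr n \<cdot> (cinr C Z Y n \<cdot> h n) =
      ?pr n \<cdot> (diff_at (cone C Z Y s) (n - 1) \<cdot> H n \<boxplus> H (n + 1) \<cdot> diff_at X n)" for n
    unfolding eq ..
  define a where "a n = ?pl (n - 1) \<cdot> H n" for n
  have a: "cm C X Z a"
    by (rule cmI) (use e1 in \<open>simp_all add: a_def cone_diff[OF s] arr_calc\<close>)
  have "homotopy C X Y (\<lambda>n. ?pr (n - 1) \<cdot> H n) h (\<lambda>n. s n \<cdot> a n)"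
    by (rule homotopyI) (use e2 in \<open>simp_all add: a_def cone_diff[OF s] arr_calc\<close>)
  from cl_eqI[OF h cm_Comp[OF a s] this] have "cl C X Y h = cl C Z Y s \<cdot>\<^bsub>Kb C\<^esub> cl C X Z a"
    by (simp add: cl_Comp[OF a s])
  with a show thesis
    by (rule that)
qed

text \<open>The components of \<open>u\<close> are \<open>f\<close> and minus a null-homotopy of
  \<open>s f\<close>. The factorization through the fibre is an equality in each degree, not a
  homotopy.\<close>

lemma factor_through_cocone:
  assumes f: "cm C X Y f" and s: "cm C Y Z s"
    and e: "cl C Y Z s \<cdot>\<^bsub>Kb C\<^esub> cl C X Y f = Zero (Kb C) X Z"
  obtains u where "cm C X (unshift C (cone C Y Z s)) u"
    "\<And>n. f n = prl C (obj_at Y n) (obj_at Z (n - 1)) \<cdot> u n"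
proof -
  note [simp] = cmD[OF f] cmD[OF s] cxD[OF cmD(1)[OF f]] cxD[OF cmD(2)[OF f]] cxD[OF cmD(2)[OF s]]
    cone_obj int_shift_simps arr_ty bin shift_simps
  obtain H where H: "homotopy C X Z H (\<lambda>n. s n \<cdot> f n) (\<lambda>n. Zero C (obj_at X n) (obj_at Z n))"
    using e unfolding cl_Comp[OF f s] Kb_simps(7)
      cl_eq[OF cm_Comp[OF f s] cm_Zero[OF cmD(1)[OF f] cmD(2)[OF s]]] by blast
  note [simp] = homotopyD(1)[OF H]
  have eq: "s n \<cdot> f n = diff_at Z (n - 1) \<cdot> H n \<boxplus> H (n + 1) \<cdot> diff_at X n" for n
    using homotopyD(2)[OF H, of n] by (simp add: add_Zero_l)
  define u where "u n = inl C (obj_at Y n) (obj_at Z (n - 1)) \<cdot> f n \<boxplus>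
    \<boxminus> (inr C (obj_at Y n) (obj_at Z (n - 1)) \<cdot> H n)" for n
  have "cm C X (unshift C (cone C Y Z s)) u"
    by (rule cmI) (simp_all add: unshift_cx cone_cx[OF s] u_def cone_diff[OF s] eq arr_calc)
  then show thesis
    by (rule that) (simp add: u_def arr_calc)
qed

text \<open>Dually, \<open>u\<close> is a null-homotopy of \<open>f t\<close> on the shifted summand
  of the cone and \<open>f\<close> on the other one. That the factorization is strict is what later
  produces a factorization in the category of complexes.\<close>

lemma factor_through_cone:
  assumes t: "cm C X Y t" and f: "cm C Y Z f"
    and e: "cl C Y Z f \<cdot>\<^bsub>Kb C\<^esub> cl C X Y t = Zero (Kb C) X Z"
  obtains u where "cm C (cone C X Y t) Z u" "\<And>n. f n = u n \<cdot> cinr C X Y n"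
proof -
  note [simp] = cmD[OF f] cmD[OF t] cxD[OF cmD(1)[OF t]] cxD[OF cmD(1)[OF f]] cxD[OF cmD(2)[OF f]]
    cone_obj int_shift_simps arr_ty bin
  obtain H where H: "homotopy C X Z H (\<lambda>n. f n \<cdot> t n) (\<lambda>n. Zero C (obj_at X n) (obj_at Z n))"
    using e unfolding cl_Comp[OF t f] Kb_simps(7)
      cl_eq[OF cm_Comp[OF t f] cm_Zero[OF cmD(1)[OF t] cmD(2)[OF f]]] by blast
  note [simp] = homotopyD(1)[OF H]
  have eq: "f n \<cdot> t n = diff_at Z (n - 1) \<cdot> H n \<boxplus> H (n + 1) \<cdot> diff_at X n" for n
    using homotopyD(2)[OF H, of n] by (simp add: add_Zero_l)
  have eq': "f n \<cdot> (t n \<cdot> g) = diff_at Z (n - 1) \<cdot> (H n \<cdot> g) \<boxplus> H (n + 1) \<cdot> (diff_at X n \<cdot> g)"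
    if "ty C g = tp W (obj_at X n)" for n g W
    using reassoc[OF eq[of n], of "obj_at Y n" "obj_at Z n" "obj_at X n" g W] that
    by (simp add: comp_Add_l comp_assoc)
  define u where "u n = H (n + 1) \<cdot> cprl C X Y n \<boxplus>
    f n \<cdot> cprr C X Y n" for n
  have "cm C (cone C X Y t) Z u"
    by (rule cmI) (simp_all add: cone_cx[OF t] u_def cone_diff[OF t] eq' arr_calc)
  then show thesis
    by (rule that) (simp add: u_def arr_calc)
qed

text \<open>Hence membership of the third vertex in an isomorphism-closed class does not depend on
  the triangle chosen over \<open>f\<close>.\<close>

lemma dist_cone_isomorphic:
  assumes f: "cm C X Y f" and d: "(cl C X Y f, v, w) \<in> Dist (Kb C)"
  shows "isomorphic (Kb C) (Cod (Kb C) v) (cone C X Y f)"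
proof -
  have K: "Arr (Kb_cat C) = Arr (Kb C)" "Dom (Kb_cat C) = Dom (Kb C)" "Cod (Kb_cat C) = Cod (Kb C)"
    "Hom (Kb_cat C) = Hom (Kb C)" "arr_iso (Kb_cat C) = arr_iso (Kb C)" "Comp (Kb_cat C) = Comp (Kb C)"
    by (simp_all add: Kb_def Let_def Hom_def arr_iso_def fun_eq_iff)
  obtain g a b c where g: "chain_map C g" and
    a: "ty (Kb C) a = tp X (src g)" "arr_iso (Kb C) a" and b: "ty (Kb C) b = tp Y (tgt g)" "arr_iso (Kb C) b"
    and c: "ty (Kb C) c = tp (Cod (Kb C) v) (mapping_cone C g)" "arr_iso (Kb C) c"
    and e: "b \<cdot>\<^bsub>Kb C\<^esub> cl C X Y f = homotopy_rel C `` {g} \<cdot>\<^bsub>Kb C\<^esub> a"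
    using d Dom_ty[OF ty_cl[OF f]] Cod_ty[OF ty_cl[OF f]]
    by (auto simp: Kb_simps(10) Kb_triangles_def Let_def K Hom_ty Cb_def)
  have g': "cm C (src g) (tgt g) (arr_at g)" "homotopy_rel C `` {g} = cl C (src g) (tgt g) (arr_at g)"
    "mapping_cone C g = cone C (src g) (tgt g) (arr_at g)"
    using g by (simp_all add: cm_def cl_def cone_def)
  have "isomorphic (Kb C) (cone C X Y f) (cone C (src g) (tgt g) (arr_at g))"
    using cone_isomorphic[OF f g'(1) a(2,1) b(2,1)] e g'(2) by simp
  moreover have "isomorphic (Kb C) (Cod (Kb C) v) (cone C (src g) (tgt g) (arr_at g))"
    using c g'(3) by (auto simp: preadditive_category.isomorphic_ty[OF Kb_preadditive])
  ultimately show ?thesis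
    using preadditive_category.isomorphic_trans[OF Kb_preadditive]
      preadditive_category.isomorphic_sym[OF Kb_preadditive] by blast
qed

lemma split_exact_isomorphic_cone:
  assumes "split_exact C X M Z u v \<rho> \<sigma>"
  shows "isomorphic (Kb C) Z (cone C X M u)"
proof -
  obtain \<phi> where "cm C Z (cone C X M u) \<phi>" "arr_iso (Kb C) (cl C Z (cone C X M u) \<phi>)"
    using split_exact_triangle[OF assms] .
  then show ?thesis
    using ty_cl by (auto simp: preadditive_category.isomorphic_ty[OF Kb_preadditive])
qed

text \<open>Stands in for the rotation of triangles: up to isomorphism \<open>v\<close> is the
  inclusion of \<open>M\<close> into the cone of \<open>u\<close>, and the cone of that inclusion is
  the shift of \<open>X\<close>.\<close>

lemma cone_of_split_epi:
  assumes "split_exact C X M Z u v \<rho> \<sigma>"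
  shows "isomorphic (Kb C) (cone C M Z v) (shift_cplx C X)"
proof -
  interpret K: preadditive_category "Kb C"
    by (rule Kb_preadditive)
  have u: "cm C X M u" and v: "cm C M Z v"
    using assms by (auto simp: split_exact_def)
  obtain \<phi> w where \<phi>: "cm C Z (cone C X M u) \<phi>" "arr_iso (Kb C) (cl C Z (cone C X M u) \<phi>)"
    "cl C Z (cone C X M u) \<phi> \<cdot>\<^bsub>Kb C\<^esub> cl C M Z v = cl C M (cone C X M u) (\<lambda>n. cinr C X M n)"
    using split_exact_triangle[OF assms] .
  have M: "M \<in> Obj (Kb C)"
    using cmD[OF u] by (simp add: Kb_simps)
  have "isomorphic (Kb C) (cone C M Z v) (cone C M (cone C X M u) (\<lambda>n. cinr C X M n))"
    by (rule cone_isomorphic[OF v cm_cone_in[OF u] K.arr_iso_Ident[OF M] K.ty_Ident[OF M] \<phi>(2) ty_cl[OF \<phi>(1)]])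
      (simp add: \<phi>(3) K.comp_Ident_r[OF ty_cl[OF cm_cone_in[OF u]]])
  then show ?thesis
    using K.isomorphic_sym[OF split_exact_isomorphic_cone[OF split_exact_cone[OF u]]] K.isomorphic_trans by blast
qed

end

locale triangulated_subcategory = additive_category +
  fixes N
  assumes N: "triangulated_subcat (Kb C) N"
begin

abbreviation "W \<equiv> verdier_weq (Kb C) N"

sublocale K: preadditive_category "Kb C"
  by (rule Kb_preadditive)

section \<open>Closure properties of a triangulated subcategory\<close>

lemma N_cx: "X \<in> N \<Longrightarrow> bounded_complex C X"
  using N by (auto simp: triangulated_subcat_def Kb_simps)

lemma N_zero: "zero_object (Kb C) X \<Longrightarrow> X \<in> N"
  using N by (auto simp: triangulated_subcat_def)

lemma N_iso: "\<lbrakk>isomorphic (Kb C) X Y; X \<in> N\<rbrakk> \<Longrightarrow> Y \<in> N"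
  using N unfolding triangulated_subcat_def by blast

lemma N_iso_iff: "isomorphic (Kb C) X Y \<Longrightarrow> X \<in> N \<longleftrightarrow> Y \<in> N"
  using N_iso K.isomorphic_sym by blast

lemma N_shift: "bounded_complex C X \<Longrightarrow> shift_cplx C X \<in> N \<longleftrightarrow> X \<in> N"
  using N by (simp add: triangulated_subcat_def Kb_simps)

lemma N_unshift: "bounded_complex C X \<Longrightarrow> unshift C X \<in> N \<longleftrightarrow> X \<in> N"
  using N_shift[of "unshift C X"] by (simp add: unshift_cx shift_unshift)

lemma N_cone:
  assumes f: "cm C X Y f" and "X \<in> N" "Y \<in> N"
  shows "cone C X Y f \<in> N"
proof -
  obtain w where w: "(cl C X Y f, cl C Y (cone C X Y f) (\<lambda>n. cinr C X Y n), w) \<in> Dist (Kb C)"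
    using dist_cone[OF f] by blast
  have "\<forall>(u, v, w)\<in>Dist (Kb C). Dom (Kb C) u \<in> N \<and> Cod (Kb C) u \<in> N \<longrightarrow> Cod (Kb C) v \<in> N"
    using N by (simp add: triangulated_subcat_def)
  from bspec[OF this w] show ?thesis
    using assms Dom_ty[OF ty_cl[OF f]] Cod_ty[OF ty_cl[OF f]] Cod_ty[OF ty_cl[OF cm_cone_in[OF f]]] by simp
qed

lemma N_split_right:
  assumes "split_exact C X M Z u v \<rho> \<sigma>" "X \<in> N" "M \<in> N"
  shows "Z \<in> N"
  using split_exact_isomorphic_cone[OF assms(1)] N_cone[of X M u] assms N_iso_iff
  by (simp add: split_exact_def)

text \<open>The defining closure property speaks of the third vertex only. \<open>X\<close> is
  reached through its shift, the quotient of the cone of \<open>u\<close> by \<open>M\<close>, and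
  that cone is isomorphic to \<open>Z\<close>.\<close>

lemma N_split_left:
  assumes ex: "split_exact C X M Z u v \<rho> \<sigma>" and "M \<in> N" "Z \<in> N"
  shows "X \<in> N"
proof -
  have u: "cm C X M u"
    using ex by (simp add: split_exact_def)
  have "cone C X M u \<in> N"
    using N_iso[OF split_exact_isomorphic_cone[OF ex] \<open>Z \<in> N\<close>] .
  then have "shift_cplx C X \<in> N"
    using N_split_right[OF split_exact_cone[OF u] \<open>M \<in> N\<close>] by simp
  then show ?thesis
    using N_shift cmD(1)[OF u] by simp
qed

text \<open>\<open>verdier_weq\<close> asks for some triangle over the arrow. The mapping cone
  completes one, and every other third vertex is isomorphic to it.\<close>

lemma W_iff:
  assumes f: "cm C X Y f"
  shows "cl C X Y f \<in> W \<longleftrightarrow> cone C X Y f \<in> N"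
proof
  assume "cl C X Y f \<in> W"
  then show "cone C X Y f \<in> N"
    using dist_cone_isomorphic[OF f] N_iso by (auto simp: verdier_weq_def)
next
  assume "cone C X Y f \<in> N"
  then show "cl C X Y f \<in> W"
    using dist_cone[OF f] Arr_ty[OF ty_cl[OF f]] Cod_ty[OF ty_cl[OF cm_cone_in[OF f]]]
    by (fastforce simp: verdier_weq_def)
qed

section \<open>Right calculus of fractions for arrows with cone in the subcategory\<close>

lemma W_Ident: "X \<in> Obj (Kb C) \<Longrightarrow> Ident (Kb C) X \<in> W"
  using W_iff[OF cm_Ident, of X] N_zero[OF cone_Ident_zero, of X] by (simp add: Kb_simps)

text \<open>In the sequence of \<open>octahedron\<close> the left term is contractible and the
  middle one is the cone of a map between objects of \<open>N\<close>, so the right term, the cone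
  of the composite, lies in \<open>N\<close>.\<close>

lemma W_Comp:
  assumes "s \<in> W" "t \<in> W" "ty (Kb C) s = tp X Y" "ty (Kb C) t = tp Y Z"
  shows "t \<cdot>\<^bsub>Kb C\<^esub> s \<in> W"
proof -
  obtain f where f: "cm C X Y f" "s = cl C X Y f"
    using ty_clE[OF assms(3)] .
  obtain g where g: "cm C Y Z g" "t = cl C Y Z g"
    using ty_clE[OF assms(4)] .
  have Nf: "cone C X Y f \<in> N" and Ng: "unshift C (cone C Y Z g) \<in> N"
    using assms f g W_iff N_unshift[OF cone_cx[OF g(1)]] by auto
  obtain \<delta> u v \<rho> \<sigma> where d: "cm C (unshift C (cone C Y Z g)) (cone C X Y f) \<delta>"
    and ex: "split_exact C (cone C Y Y (\<lambda>n. Ident C (obj_at Y n))) (cone C (unshift C (cone C Y Z g)) (cone C X Y f) \<delta>)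
      (cone C X Z (\<lambda>n. g n \<cdot> f n)) u v \<rho> \<sigma>"
    using octahedron[OF f(1) g(1)] .
  have "cone C X Z (\<lambda>n. g n \<cdot> f n) \<in> N"
    using N_split_right[OF ex N_zero[OF cone_Ident_zero[OF cmD(2)[OF f(1)]]] N_cone[OF d Ng Nf]] .
  then show ?thesis
    using W_iff[OF cm_Comp[OF f(1) g(1)]] by (simp add: f g cl_Comp[OF f(1) g(1)])
qed

text \<open>The cone of \<open>v\<close> is the shift of its kernel \<open>X\<close>.\<close>

lemma W_split_epi:
  assumes ex: "split_exact C X M Z u v \<rho> \<sigma>" and "X \<in> N"
  shows "cl C M Z v \<in> W"
proof -
  have c: "cm C X M u" "cm C M Z v"
    using ex by (auto simp: split_exact_def)
  then show ?thesis
    using W_iff[OF c(2)] N_iso_iff[OF cone_of_split_epi[OF ex]] N_shift[OF cmD(1)[OF c(1)]] assms(2) by simp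
qed

lemma W_cocone:
  assumes g: "cm C X Y g" and "Y \<in> N"
  shows "cl C (unshift C (cone C X Y g)) X (\<lambda>n. prl C (obj_at X n) (obj_at Y (n - 1))) \<in> W"
  using W_split_epi[OF split_exact_cocone[OF g]] N_unshift N_cx \<open>Y \<in> N\<close> by simp

text \<open>\<open>t\<close> is the projection of the homotopy fibre of \<open>g\<close>, whose
  kernel is the unshift of \<open>Y\<close>. Both the Ore condition and cancellation are reduced to
  this case.\<close>

lemma W_kills:
  assumes g: "ty (Kb C) g = tp X Y" and "Y \<in> N"
  obtains P t where "t \<in> W" "ty (Kb C) t = tp P X" "g \<cdot>\<^bsub>Kb C\<^esub> t = Zero (Kb C) P Y"
proof -
  obtain f where f: "cm C X Y f" "g = cl C X Y f"
    using ty_clE[OF g] .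
  have "cm C (unshift C (cone C X Y f)) X (\<lambda>n. prl C (obj_at X n) (obj_at Y (n - 1)))"
    using split_exact_cocone[OF f(1)] by (simp add: split_exact_def)
  from ty_cl[OF this] show thesis
    using that W_cocone[OF f(1) assms(2)] cocone_comp_zero[OF f(1)] f(2) by blast
qed

text \<open>The composite of \<open>f\<close> with the inclusion into the cone of \<open>s\<close>
  is killed by some \<open>t\<close>; then \<open>f t\<close> lifts along \<open>s\<close>.\<close>

lemma W_Ore:
  assumes "s \<in> W" "ty (Kb C) s = tp Z Y" "ty (Kb C) f = tp X Y"
  obtains P t g where "t \<in> W" "ty (Kb C) t = tp P X" "ty (Kb C) g = tp P Z" "f \<cdot>\<^bsub>Kb C\<^esub> t = s \<cdot>\<^bsub>Kb C\<^esub> g"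
proof -
  obtain \<sigma> where \<sigma>: "cm C Z Y \<sigma>" "s = cl C Z Y \<sigma>"
    using ty_clE[OF assms(2)] .
  have N: "cone C Z Y \<sigma> \<in> N"
    using assms \<sigma> W_iff by auto
  let ?i = "cl C Y (cone C Z Y \<sigma>) (\<lambda>n. cinr C Z Y n)"
  note ti = ty_cl[OF cm_cone_in[OF \<sigma>(1)]]
  obtain P t where t: "t \<in> W" "ty (Kb C) t = tp P X" "(?i \<cdot>\<^bsub>Kb C\<^esub> f) \<cdot>\<^bsub>Kb C\<^esub> t = Zero (Kb C) P (cone C Z Y \<sigma>)"
    using W_kills[OF K.ty_Comp[OF assms(3) ti] N] .
  obtain h where h: "cm C P Y h" "f \<cdot>\<^bsub>Kb C\<^esub> t = cl C P Y h"
    using ty_clE[OF K.ty_Comp[OF t(2) assms(3)]] .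
  obtain a where "cm C P Z a" "cl C P Y h = cl C Z Y \<sigma> \<cdot>\<^bsub>Kb C\<^esub> cl C P Z a"
    using lift_along_cone_in[OF h(1) \<sigma>(1)] t(3) K.comp_assoc[OF t(2) assms(3) ti] h(2) by auto
  then show thesis
    using that[OF t(1,2), of "cl C P Z a"] ty_cl h(2) \<sigma>(2) by auto
qed

text \<open>Since \<open>s f\<close> vanishes, \<open>f\<close> factors through the homotopy fibre
  of \<open>s\<close>. This fibre lies in \<open>N\<close>, so the first factor can be
  killed.\<close>

lemma W_cancel:
  assumes "s \<in> W" "ty (Kb C) s = tp Y Z" "ty (Kb C) f = tp X Y" "s \<cdot>\<^bsub>Kb C\<^esub> f = Zero (Kb C) X Z"
  obtains P t where "t \<in> W" "ty (Kb C) t = tp P X" "f \<cdot>\<^bsub>Kb C\<^esub> t = Zero (Kb C) P Y"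
proof -
  obtain \<sigma> where \<sigma>: "cm C Y Z \<sigma>" "s = cl C Y Z \<sigma>"
    using ty_clE[OF assms(2)] .
  obtain \<phi> where \<phi>: "cm C X Y \<phi>" "f = cl C X Y \<phi>"
    using ty_clE[OF assms(3)] .
  let ?Q = "unshift C (cone C Y Z \<sigma>)"
  have N: "?Q \<in> N"
    using assms \<sigma> W_iff N_unshift[OF cone_cx[OF \<sigma>(1)]] by auto
  obtain u where u: "cm C X ?Q u" "\<And>n. \<phi> n = prl C (obj_at Y n) (obj_at Z (n - 1)) \<cdot> u n"
    using factor_through_cocone[OF \<phi>(1) \<sigma>(1)] assms(4) \<phi>(2) \<sigma>(2) by auto
  have w: "cm C ?Q Y (\<lambda>n. prl C (obj_at Y n) (obj_at Z (n - 1)))"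
    using split_exact_cocone[OF \<sigma>(1)] by (simp add: split_exact_def)
  obtain P t where t: "t \<in> W" "ty (Kb C) t = tp P X" "cl C X ?Q u \<cdot>\<^bsub>Kb C\<^esub> t = Zero (Kb C) P ?Q"
    using W_kills[OF ty_cl[OF u(1)] N] .
  have "f = cl C ?Q Y (\<lambda>n. prl C (obj_at Y n) (obj_at Z (n - 1))) \<cdot>\<^bsub>Kb C\<^esub> cl C X ?Q u"
    unfolding \<phi>(2) cl_Comp[OF u(1) w] by (rule cl_cong) (rule u(2))
  then have "f \<cdot>\<^bsub>Kb C\<^esub> t = Zero (Kb C) P Y"
    using t(3) K.comp_assoc[OF t(2) ty_cl[OF u(1)] ty_cl[OF w]]
      K.comp_Zero_r[OF ty_cl[OF w] K.ty_Dom_Obj[OF t(2)]] by simp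
  then show thesis
    using that t by blast
qed

end

section \<open>Right fractions and the Verdier quotient\<close>

text \<open>A right calculus of fractions over a preadditive category. Cancellation is stated for a
  single arrow annihilated by \<open>s\<close>; a pair of arrows is handled through its
  difference.\<close>

locale fractions = preadditive_category C for C :: "('o, 'm, 'z) tricat_scheme" (structure) +
  fixes N :: "'o set"
  assumes W_Ident: "X \<in> Obj C \<Longrightarrow> Ident C X \<in> verdier_weq C N"
    and W_Comp: "\<lbrakk>s \<in> verdier_weq C N; t \<in> verdier_weq C N; ty C s = tp X Y; ty C t = tp Y Z\<rbrakk>
      \<Longrightarrow> t \<cdot> s \<in> verdier_weq C N"
    and W_Ore: "\<lbrakk>s \<in> verdier_weq C N; ty C s = tp Z Y; ty C f = tp X Y\<rbrakk>
      \<Longrightarrow> \<exists>P t g. t \<in> verdier_weq C N \<and> ty C t = tp P X \<and> ty C g = tp P Z \<and> f \<cdot> t = s \<cdot> g"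
    and W_cancel: "\<lbrakk>s \<in> verdier_weq C N; ty C s = tp Y Z; ty C f = tp X Y; s \<cdot> f = Zero C X Z\<rbrakk>
      \<Longrightarrow> \<exists>P t. t \<in> verdier_weq C N \<and> ty C t = tp P X \<and> f \<cdot> t = Zero C P Y"
begin

abbreviation "W \<equiv> verdier_weq C N"
abbreviation "V \<equiv> verdier_quotient C N"

definition frac :: "'m \<Rightarrow> 'm \<Rightarrow> ('m \<times> 'm) set" where
  "frac s f = roof_rel C N `` {(s, f)}"

lemma V_simps:
  "Obj V = Obj C" "Arr V = roofs C N // roof_rel C N"
  "Dom V = (\<lambda>F. Cod C (fst (SOME r. r \<in> F)))" "Cod V = (\<lambda>F. Cod C (snd (SOME r. r \<in> F)))"
  "Ident V X = frac (Ident C X) (Ident C X)" "Zero V X Y = frac (Ident C X) (Zero C X Y)"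
  "Comp V G F = \<Union>{frac (s \<cdot> u) (g \<cdot> v) | s f t g u v Z.
        (s, f) \<in> F \<and> (t, g) \<in> G \<and> u \<in> Hom C Z (Dom C f) \<and> v \<in> Hom C Z (Dom C t) \<and> u \<in> W \<and> f \<cdot> u = t \<cdot> v}"
  "Add V F G = \<Union>{frac s (f \<boxplus> g) | s f g. (s, f) \<in> F \<and> (s, g) \<in> G}"
  by (simp_all add: verdier_quotient_def frac_def)

lemma W_cancel_eq:
  assumes "t \<in> W" "ty C t = tp Y Z" "ty C a = tp X Y" "ty C b = tp X Y" "t \<cdot> a = t \<cdot> b"
  obtains P r where "r \<in> W" "ty C r = tp P X" "a \<cdot> r = b \<cdot> r"
proof -
  note [simp] = assms(2-4) arr_ty ty_Dom_Obj[OF assms(3)] ty_Cod_Obj[OF assms(3)] ty_Cod_Obj[OF assms(2)]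
  have "t \<cdot> dif C a b = Zero C X Z"
    using assms(5) by (simp add: arr_calc)
  then obtain P r where r: "r \<in> W" "ty C r = tp P X" "dif C a b \<cdot> r = Zero C P Y"
    using W_cancel[OF assms(1,2), of "dif C a b" X] by auto
  have "a \<cdot> r = b \<cdot> r"
    using r(3) ty_Dom_Obj[OF r(2)] by (simp add: r(2) arr_calc)
  with r show thesis
    using that by blast
qed

section \<open>Equivalence of roofs and arithmetic of fractions\<close>

lemma roofs_iff: "(s, f) \<in> roofs C N \<longleftrightarrow> s \<in> W \<and> (\<exists>P X Y. ty C s = tp P X \<and> ty C f = tp P Y)"
  by (auto simp: roofs_def ty_def tp_def verdier_weq_def split: if_splits)

lemma roof_rel_iff:
  assumes "s \<in> W" "ty C s = tp P X" "ty C f = tp P Y"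
  shows "((s, f), (t, g)) \<in> roof_rel C N \<longleftrightarrow> t \<in> W \<and> (\<exists>P'. ty C t = tp P' X \<and> ty C g = tp P' Y \<and>
    (\<exists>Z u v. ty C u = tp Z P \<and> ty C v = tp Z P' \<and> s \<cdot> u \<in> W \<and> s \<cdot> u = t \<cdot> v \<and> f \<cdot> u = g \<cdot> v))"
    (is "?L \<longleftrightarrow> ?R")
proof -
  note d = Dom_ty[OF assms(2)] Cod_ty[OF assms(2)] Dom_ty[OF assms(3)] Cod_ty[OF assms(3)]
  show ?thesis
  proof
    assume ?L
    then obtain Z u v where "(t, g) \<in> roofs C N" "X = Cod C t" "Y = Cod C g" "u \<in> Hom C Z P" "v \<in> Hom C Z (Dom C t)"
      "s \<cdot> u \<in> W" "s \<cdot> u = t \<cdot> v" "f \<cdot> u = g \<cdot> v"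
      unfolding roof_rel_def using d by auto
    moreover from this obtain P' where "ty C t = tp P' X" "ty C g = tp P' Y" "t \<in> W"
      by (auto simp: roofs_iff Cod_ty)
    ultimately show ?R
      using Dom_ty by (fastforce simp: Hom_ty)
  next
    assume ?R
    then obtain P' Z u v where *: "t \<in> W" "ty C t = tp P' X" "ty C g = tp P' Y" "ty C u = tp Z P" "ty C v = tp Z P'"
      "s \<cdot> u \<in> W" "s \<cdot> u = t \<cdot> v" "f \<cdot> u = g \<cdot> v"
      by blast
    then have "(s, f) \<in> roofs C N" "(t, g) \<in> roofs C N"
      using assms roofs_iff by blast+
    moreover have "\<exists>Z. \<exists>u\<in>Hom C Z (Dom C s). \<exists>v\<in>Hom C Z (Dom C t). s \<cdot> u \<in> W \<and> s \<cdot> u = t \<cdot> v \<and> f \<cdot> u = g \<cdot> v"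
      using * d Dom_ty[OF *(2)] by (intro exI[of _ Z] bexI[of _ v] bexI[of _ u]) (simp_all add: Hom_ty)
    ultimately show ?L
      unfolding roof_rel_def using d Cod_ty[OF *(2)] Cod_ty[OF *(3)] by simp
  qed
qed

text \<open>Transitivity is the case that rests on the axioms. The two relations refine the middle
  roof in different ways; an Ore square joins the refinements, and cancelling \<open>t\<close> turns
  them into one and the same.\<close>

lemma roof_rel_equiv: "equiv (roofs C N) (roof_rel C N)"
proof (rule equivI)
  show "roof_rel C N \<subseteq> roofs C N \<times> roofs C N"
    by (auto simp: roof_rel_def)
  show "refl_on (roofs C N) (roof_rel C N)"
  proof (rule refl_onI)
    fix x assume "x \<in> roofs C N"
    then obtain s f P X Y where x: "x = (s, f)" "s \<in> W" "ty C s = tp P X" "ty C f = tp P Y"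
      by (cases x) (auto simp: roofs_iff)
    then show "(x, x) \<in> roof_rel C N"
      using ty_Ident[OF ty_Dom_Obj[OF x(3)]] comp_Ident_r[OF x(3)] unfolding x(1) roof_rel_iff[OF x(2-4)]
      by (intro conjI exI[of _ P] exI[of _ "Ident C P"]) simp_all
  qed
  show "sym (roof_rel C N)"
  proof (rule symI)
    fix x y assume "(x, y) \<in> roof_rel C N"
    then obtain s f t g Z u v where *: "x = (s, f)" "y = (t, g)" "(s, f) \<in> roofs C N" "(t, g) \<in> roofs C N"
      "Cod C s = Cod C t" "Cod C f = Cod C g" "u \<in> Hom C Z (Dom C s)" "v \<in> Hom C Z (Dom C t)"
      "s \<cdot> u \<in> W" "s \<cdot> u = t \<cdot> v" "f \<cdot> u = g \<cdot> v"
      unfolding roof_rel_def by blast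
    then have "\<exists>Z. \<exists>u\<in>Hom C Z (Dom C t). \<exists>v\<in>Hom C Z (Dom C s). t \<cdot> u \<in> W \<and> t \<cdot> u = s \<cdot> v \<and> g \<cdot> u = f \<cdot> v"
      by (intro exI[of _ Z] bexI[of _ v] bexI[of _ u]) simp_all
    with * show "(y, x) \<in> roof_rel C N"
      unfolding roof_rel_def by simp
  qed
  show "trans (roof_rel C N)"
  proof (rule transI)
    fix x y z assume xy: "(x, y) \<in> roof_rel C N" and yz: "(y, z) \<in> roof_rel C N"
    then have "x \<in> roofs C N" "y \<in> roofs C N"
      by (auto simp: roof_rel_def)
    then obtain s f P X Y t g where x: "x = (s, f)" "s \<in> W" "ty C s = tp P X" "ty C f = tp P Y" and y: "y = (t, g)" "t \<in> W"
      by (cases x; cases y) (auto simp: roofs_iff)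
    obtain Q A u v where q: "ty C t = tp Q X" "ty C g = tp Q Y" "ty C u = tp A P" "ty C v = tp A Q" "s \<cdot> u \<in> W"
      "s \<cdot> u = t \<cdot> v" "f \<cdot> u = g \<cdot> v"
      using xy unfolding x(1) y(1) roof_rel_iff[OF x(2-4)] by auto
    obtain r h where z: "z = (r, h)"
      by (cases z)
    obtain R B u' v' where r: "r \<in> W" "ty C r = tp R X" "ty C h = tp R Y" "ty C u' = tp B Q" "ty C v' = tp B R" "t \<cdot> u' \<in> W"
      "t \<cdot> u' = r \<cdot> v'" "g \<cdot> u' = h \<cdot> v'"
      using yz unfolding y(1) z roof_rel_iff[OF y(2) q(1,2)] by auto
    note [simp] = x(3,4) q(1-4) r(2-5) arr_ty
    obtain D a b where a: "a \<in> W" "ty C a = tp D A" "ty C b = tp D B" "(t \<cdot> v) \<cdot> a = (t \<cdot> u') \<cdot> b"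
      using W_Ore[OF r(6), of B X "t \<cdot> v" A] by auto
    note [simp] = a(2,3)
    have "t \<cdot> (v \<cdot> a) = t \<cdot> (u' \<cdot> b)"
      using a(4) by (simp add: comp_assoc)
    from W_cancel_eq[OF y(2) q(1) ty_Comp[OF a(2) q(4)] ty_Comp[OF a(3) r(4)] this]
    obtain E c where c: "c \<in> W" "ty C c = tp E D" "(v \<cdot> a) \<cdot> c = (u' \<cdot> b) \<cdot> c" .
    note [simp] = c(2)
    have e: "v \<cdot> (a \<cdot> c) = u' \<cdot> (b \<cdot> c)"
      using c(3) by (simp add: comp_assoc)
    have "s \<cdot> (u \<cdot> (a \<cdot> c)) = (s \<cdot> u) \<cdot> (a \<cdot> c)"
      by (simp add: comp_assoc)
    also have "\<dots> \<in> W"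
      by (rule W_Comp[OF W_Comp[OF c(1) a(1) c(2) a(2)] q(5)]) simp_all
    finally have w: "s \<cdot> (u \<cdot> (a \<cdot> c)) \<in> W" .
    have "s \<cdot> (u \<cdot> (a \<cdot> c)) = r \<cdot> (v' \<cdot> (b \<cdot> c))"
      by (simp add: reassoc[OF q(6)] reassoc[OF r(7)[symmetric]] comp_assoc e)
    moreover have "f \<cdot> (u \<cdot> (a \<cdot> c)) = h \<cdot> (v' \<cdot> (b \<cdot> c))"
      by (simp add: reassoc[OF q(7)] reassoc[OF r(8)[symmetric]] comp_assoc e)
    ultimately show "(x, z) \<in> roof_rel C N"
      unfolding x(1) z roof_rel_iff[OF x(2-4)] using w r(1)
      by (intro conjI exI[of _ R] exI[of _ E] exI[of _ "u \<cdot> (a \<cdot> c)"] exI[of _ "v' \<cdot> (b \<cdot> c)"]) simp_all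
  qed
qed

lemma frac_eq:
  assumes "s \<in> W" "ty C s = tp P X" "ty C f = tp P Y" "t \<in> W" "ty C t = tp P' X" "ty C g = tp P' Y"
  shows "frac s f = frac t g \<longleftrightarrow>
    (\<exists>Z u v. ty C u = tp Z P \<and> ty C v = tp Z P' \<and> s \<cdot> u \<in> W \<and> s \<cdot> u = t \<cdot> v \<and> f \<cdot> u = g \<cdot> v)"
proof -
  have "(s, f) \<in> roofs C N" "(t, g) \<in> roofs C N"
    using assms roofs_iff by blast+
  then have "frac s f = frac t g \<longleftrightarrow> ((s, f), (t, g)) \<in> roof_rel C N"
    unfolding frac_def by (rule eq_equiv_class_iff[OF roof_rel_equiv])
  then show ?thesis
    unfolding roof_rel_iff[OF assms(1-3)] using assms(4-6) by (auto simp: tp_eq)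
qed

lemma frac_eqI:
  assumes "s \<in> W" "ty C s = tp P X" "ty C f = tp P Y" "t \<in> W" "ty C t = tp P' X" "ty C g = tp P' Y"
    "ty C u = tp Z P" "ty C v = tp Z P'" "s \<cdot> u \<in> W" "s \<cdot> u = t \<cdot> v" "f \<cdot> u = g \<cdot> v"
  shows "frac s f = frac t g"
  using frac_eq[OF assms(1-6)] assms(7-11) by blast

lemma frac_expand:
  assumes "s \<in> W" "ty C s = tp P X" "ty C f = tp P Y" "ty C u = tp Z P" "s \<cdot> u \<in> W"
  shows "frac (s \<cdot> u) (f \<cdot> u) = frac s f"
proof -
  note [simp] = assms(2-4) arr_ty ty_Dom_Obj[OF assms(4)]
  show ?thesis
    by (rule frac_eqI[OF assms(5) _ _ assms(1-3), where u = "Ident C Z" and v = u and Z = Z])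
      (simp_all add: comp_Ident_r assms(5) comp_assoc)
qed

lemma frac_memD:
  assumes "s \<in> W" "ty C s = tp P X" "ty C f = tp P Y" "(t, g) \<in> frac s f"
  shows "t \<in> W \<and> (\<exists>P'. ty C t = tp P' X \<and> ty C g = tp P' Y) \<and> frac t g = frac s f"
proof -
  have r: "((s, f), (t, g)) \<in> roof_rel C N"
    using assms(4) by (simp add: frac_def)
  then have "frac s f = frac t g"
    unfolding frac_def by (rule equiv_class_eq[OF roof_rel_equiv])
  then show ?thesis
    using r unfolding roof_rel_iff[OF assms(1-3)] by auto
qed

lemma frac_self:
  assumes "s \<in> W" "ty C s = tp P X" "ty C f = tp P Y"
  shows "(s, f) \<in> frac s f"
proof -
  have "(s, f) \<in> roofs C N"
    using assms roofs_iff by blast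
  then show ?thesis
    unfolding frac_def by (rule equiv_class_self[OF roof_rel_equiv])
qed

lemma ty_frac:
  assumes "s \<in> W" "ty C s = tp P X" "ty C f = tp P Y"
  shows "ty V (frac s f) = tp X Y"
proof -
  obtain t g where tg: "(SOME r. r \<in> frac s f) = (t, g)"
    by fastforce
  have "(t, g) \<in> frac s f"
    unfolding tg[symmetric] by (rule someI) (rule frac_self[OF assms])
  from frac_memD[OF assms this] have "Cod C t = X" "Cod C g = Y"
    by (auto simp: Cod_ty)
  moreover have "frac s f \<in> Arr V"
    using assms roofs_iff unfolding V_simps frac_def by (blast intro: quotientI)
  ultimately show ?thesis
    by (simp add: ty_def tp_def V_simps tg)
qed

lemma ty_fracE:
  assumes "ty V F = tp X Y"
  obtains P s f where "s \<in> W" "ty C s = tp P X" "ty C f = tp P Y" "F = frac s f"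
proof -
  have "F \<in> Arr V"
    using Arr_ty[OF assms] .
  then obtain s f where "(s, f) \<in> roofs C N" "F = frac s f"
    unfolding V_simps quotient_def frac_def by auto
  then obtain P X' Y' where *: "s \<in> W" "ty C s = tp P X'" "ty C f = tp P Y'" "F = frac s f"
    by (auto simp: roofs_iff)
  moreover have "X' = X" "Y' = Y"
    using ty_frac[OF *(1-3)] assms *(4) by (simp_all add: tp_eq)
  ultimately show thesis
    using that by blast
qed

lemma common_denominator:
  assumes "ty V F = tp X Y" "ty V G = tp X Y'"
  obtains P s f g where "s \<in> W" "ty C s = tp P X" "ty C f = tp P Y" "ty C g = tp P Y'" "F = frac s f" "G = frac s g"
proof -
  obtain P s f where f: "s \<in> W" "ty C s = tp P X" "ty C f = tp P Y" "F = frac s f"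
    using ty_fracE[OF assms(1)] .
  obtain Q t g where g: "t \<in> W" "ty C t = tp Q X" "ty C g = tp Q Y'" "G = frac t g"
    using ty_fracE[OF assms(2)] .
  obtain R p q where p: "p \<in> W" "ty C p = tp R P" "ty C q = tp R Q" "s \<cdot> p = t \<cdot> q"
    using W_Ore[OF g(1,2) f(2)] by blast
  note [simp] = f(2,3) g(2,3) p(2,3) arr_ty
  have w: "s \<cdot> p \<in> W"
    by (rule W_Comp[OF p(1) f(1) p(2) f(2)])
  have "F = frac (s \<cdot> p) (f \<cdot> p)" "G = frac (s \<cdot> p) (g \<cdot> q)"
    using frac_expand[OF f(1-3) p(2) w] frac_expand[OF g(1-3) p(3)] w p(4) f(4) g(4) by simp_all
  then show thesis
    using that[OF w, of R "f \<cdot> p" "g \<cdot> q"] by simp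
qed

lemma common_denominator3:
  assumes "ty V F = tp X Y" "ty V G = tp X Y'" "ty V H = tp X Y''"
  obtains P s f g h where "s \<in> W" "ty C s = tp P X" "ty C f = tp P Y" "ty C g = tp P Y'" "ty C h = tp P Y''"
    "F = frac s f" "G = frac s g" "H = frac s h"
proof -
  obtain P s f g where f: "s \<in> W" "ty C s = tp P X" "ty C f = tp P Y" "ty C g = tp P Y'" "F = frac s f" "G = frac s g"
    using common_denominator[OF assms(1,2)] .
  obtain Q t h where h: "t \<in> W" "ty C t = tp Q X" "ty C h = tp Q Y''" "H = frac t h"
    using ty_fracE[OF assms(3)] .
  obtain R p q where p: "p \<in> W" "ty C p = tp R P" "ty C q = tp R Q" "s \<cdot> p = t \<cdot> q"
    using W_Ore[OF h(1,2) f(2)] by blast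
  note [simp] = f(2-4) h(2,3) p(2,3) arr_ty
  have w: "s \<cdot> p \<in> W"
    by (rule W_Comp[OF p(1) f(1) p(2) f(2)])
  have "F = frac (s \<cdot> p) (f \<cdot> p)" "G = frac (s \<cdot> p) (g \<cdot> p)" "H = frac (s \<cdot> p) (h \<cdot> q)"
    using frac_expand[OF f(1,2,3) p(2) w] frac_expand[OF f(1,2,4) p(2) w] frac_expand[OF h(1-3) p(3)] w p(4) f(5,6) h(4) by simp_all
  then show thesis
    using that[OF w, of R "f \<cdot> p" "g \<cdot> p" "h \<cdot> q"] by simp
qed

text \<open>Neither the choice of the Ore square nor an expansion of the first roof by
  \<open>a\<close> affects the composite. A further Ore square compares \<open>u\<close> with
  \<open>a u'\<close>; the resulting maps to \<open>Q\<close> agree after \<open>t\<close>, and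
  cancellation makes them equal.\<close>

lemma comp_change_numerator:
  assumes s: "s \<in> W" "ty C s = tp P X" "ty C f = tp P Y" and a: "ty C a = tp P' P" "s \<cdot> a \<in> W"
    and t: "t \<in> W" "ty C t = tp Q Y" "ty C g = tp Q Z"
    and u: "u \<in> W" "ty C u = tp R P" "ty C v = tp R Q" "f \<cdot> u = t \<cdot> v"
    and u': "u' \<in> W" "ty C u' = tp R' P'" "ty C v' = tp R' Q" "(f \<cdot> a) \<cdot> u' = t \<cdot> v'"
  shows "frac (s \<cdot> u) (g \<cdot> v) = frac ((s \<cdot> a) \<cdot> u') (g \<cdot> v')"
proof -
  note [simp] = s(2,3) a(1) t(2,3) u(2,3) u'(2,3) arr_ty
  obtain D p q where p: "p \<in> W" "ty C p = tp D R'" "ty C q = tp D R" "(a \<cdot> u') \<cdot> p = u \<cdot> q"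
    using W_Ore[OF u(1,2), of "a \<cdot> u'" R'] by auto
  note [simp] = p(2,3)
  have "t \<cdot> (v' \<cdot> p) = ((f \<cdot> a) \<cdot> u') \<cdot> p"
    using u'(4) by (simp add: comp_assoc)
  also have "\<dots> = f \<cdot> ((a \<cdot> u') \<cdot> p)"
    by (simp add: comp_assoc)
  also have "\<dots> = (f \<cdot> u) \<cdot> q"
    unfolding p(4) by (simp add: comp_assoc)
  also have "\<dots> = t \<cdot> (v \<cdot> q)"
    using u(4) by (simp add: comp_assoc)
  finally have "t \<cdot> (v' \<cdot> p) = t \<cdot> (v \<cdot> q)" .
  from W_cancel_eq[OF t(1,2) ty_Comp[OF p(2) u'(3)] ty_Comp[OF p(3) u(3)] this]
  obtain E r where r: "r \<in> W" "ty C r = tp E D" "(v' \<cdot> p) \<cdot> r = (v \<cdot> q) \<cdot> r" .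
  note [simp] = r(2)
  have w1: "s \<cdot> u \<in> W"
    by (rule W_Comp[OF u(1) s(1) u(2) s(2)])
  have w2: "(s \<cdot> a) \<cdot> u' \<in> W"
    by (rule W_Comp[OF u'(1) a(2) u'(2)]) simp
  have w3: "p \<cdot> r \<in> W"
    by (rule W_Comp[OF r(1) p(1) r(2) p(2)])
  have "((s \<cdot> a) \<cdot> u') \<cdot> (p \<cdot> r) \<in> W"
    by (rule W_Comp[OF w3 w2]) simp_all
  moreover have "(s \<cdot> u) \<cdot> (q \<cdot> r) = ((s \<cdot> a) \<cdot> u') \<cdot> (p \<cdot> r)"
  proof -
    have "(s \<cdot> u) \<cdot> (q \<cdot> r) = s \<cdot> ((u \<cdot> q) \<cdot> r)"
      by (simp add: comp_assoc)
    also have "\<dots> = ((s \<cdot> a) \<cdot> u') \<cdot> (p \<cdot> r)"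
      unfolding p(4)[symmetric] by (simp add: comp_assoc)
    finally show ?thesis .
  qed
  moreover have "(g \<cdot> v) \<cdot> (q \<cdot> r) = (g \<cdot> v') \<cdot> (p \<cdot> r)"
  proof -
    have "(g \<cdot> v) \<cdot> (q \<cdot> r) = g \<cdot> ((v \<cdot> q) \<cdot> r)"
      by (simp add: comp_assoc)
    also have "\<dots> = (g \<cdot> v') \<cdot> (p \<cdot> r)"
      unfolding r(3)[symmetric] by (simp add: comp_assoc)
    finally show ?thesis .
  qed
  ultimately show ?thesis
    by (intro frac_eqI[OF w1 _ _ w2, where u = "q \<cdot> r" and Z = E and v = "p \<cdot> r"]) simp_all
qed

text \<open>Equal fractions have a common expansion. Both composites are compared with the composite
  of the two common expansions over a single Ore square.\<close>

lemma frac_comp_unique: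
  assumes s: "s \<in> W" "ty C s = tp P X" "ty C f = tp P Y" and s': "s' \<in> W" "ty C s' = tp P' X" "ty C f' = tp P' Y"
    and e: "frac s f = frac s' f'"
    and t: "t \<in> W" "ty C t = tp Q Y" "ty C g = tp Q Z" and t': "t' \<in> W" "ty C t' = tp Q' Y" "ty C g' = tp Q' Z"
    and e': "frac t g = frac t' g'"
    and u: "u \<in> W" "ty C u = tp R P" "ty C v = tp R Q" "f \<cdot> u = t \<cdot> v"
    and u': "u' \<in> W" "ty C u' = tp R' P'" "ty C v' = tp R' Q'" "f' \<cdot> u' = t' \<cdot> v'"
  shows "frac (s \<cdot> u) (g \<cdot> v) = frac (s' \<cdot> u') (g' \<cdot> v')"
proof -
  obtain A a b where a: "ty C a = tp A P" "ty C b = tp A P'" "s \<cdot> a \<in> W" "s \<cdot> a = s' \<cdot> b" "f \<cdot> a = f' \<cdot> b"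
    using e unfolding frac_eq[OF s s'] by blast
  obtain B c d where c: "ty C c = tp B Q" "ty C d = tp B Q'" "t \<cdot> c \<in> W" "t \<cdot> c = t' \<cdot> d" "g \<cdot> c = g' \<cdot> d"
    using e' unfolding frac_eq[OF t t'] by blast
  note [simp] = s(2,3) s'(2,3) t(2,3) t'(2,3) u(2,3) u'(2,3) a(1,2) c(1,2) arr_ty
  obtain D x y where x: "x \<in> W" "ty C x = tp D A" "ty C y = tp D B" "(f \<cdot> a) \<cdot> x = (t \<cdot> c) \<cdot> y"
    using W_Ore[OF c(3), of B Y "f \<cdot> a" A] by auto
  note [simp] = x(2,3)
  have "frac (s \<cdot> u) (g \<cdot> v) = frac ((s \<cdot> a) \<cdot> x) (g \<cdot> (c \<cdot> y))"
    by (rule comp_change_numerator[OF s a(1,3) t u x(1,2)]) (simp_all add: x(4) comp_assoc)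
  also have "\<dots> = frac ((s' \<cdot> b) \<cdot> x) (g' \<cdot> (d \<cdot> y))"
    using a(4) reassoc[OF c(5)] by (simp add: comp_assoc)
  also have "\<dots> = frac (s' \<cdot> u') (g' \<cdot> v')"
    by (rule comp_change_numerator[OF s' a(2) _ t' u' x(1,2), symmetric])
      (use a(3-5) x(4) c(4) in \<open>simp_all add: comp_assoc\<close>)
  finally show ?thesis .
qed

lemma Union_const: "\<lbrakk>S \<noteq> {}; \<And>x. x \<in> S \<Longrightarrow> x = c\<rbrakk> \<Longrightarrow> \<Union>S = c"
  by auto

lemma frac_Comp:
  assumes s: "s \<in> W" "ty C s = tp P X" "ty C f = tp P Y" and t: "t \<in> W" "ty C t = tp Q Y" "ty C g = tp Q Z"
    and u: "u \<in> W" "ty C u = tp R P" "ty C v = tp R Q" "f \<cdot> u = t \<cdot> v"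
  shows "frac t g \<cdot>\<^bsub>V\<^esub> frac s f = frac (s \<cdot> u) (g \<cdot> v)"
  unfolding V_simps
proof (rule Union_const)
  have d: "Dom C f = P" "Dom C t = Q"
    using s t by (auto simp: Dom_ty)
  have "u \<in> Hom C R (Dom C f)" "v \<in> Hom C R (Dom C t)"
    using u d by (auto simp: Hom_ty)
  note h = this
  show "{frac (s' \<cdot> u) (g' \<cdot> v) | s' f' t' g' u v Z. (s', f') \<in> frac s f \<and> (t', g') \<in> frac t g \<and>
      u \<in> Hom C Z (Dom C f') \<and> v \<in> Hom C Z (Dom C t') \<and> u \<in> W \<and> f' \<cdot> u = t' \<cdot> v} \<noteq> {}"
    using frac_self[OF s] frac_self[OF t] h u(1,4) by blast
  fix x
  assume "x \<in> {frac (s' \<cdot> u) (g' \<cdot> v) | s' f' t' g' u v Z. (s', f') \<in> frac s f \<and> (t', g') \<in> frac t g \<and>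
      u \<in> Hom C Z (Dom C f') \<and> v \<in> Hom C Z (Dom C t') \<and> u \<in> W \<and> f' \<cdot> u = t' \<cdot> v}"
  then obtain s' f' t' g' u' v' D where x: "x = frac (s' \<cdot> u') (g' \<cdot> v')" and m: "(s', f') \<in> frac s f" "(t', g') \<in> frac t g"
    and h: "u' \<in> Hom C D (Dom C f')" "v' \<in> Hom C D (Dom C t')" "u' \<in> W" "f' \<cdot> u' = t' \<cdot> v'"
    by blast
  obtain P' where s': "s' \<in> W" "ty C s' = tp P' X" "ty C f' = tp P' Y" "frac s' f' = frac s f"
    using frac_memD[OF s m(1)] by blast
  obtain Q' where t': "t' \<in> W" "ty C t' = tp Q' Y" "ty C g' = tp Q' Z" "frac t' g' = frac t g"
    using frac_memD[OF t m(2)] by blast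
  have "ty C u' = tp D P'" "ty C v' = tp D Q'"
    using h(1,2) s'(3) t'(2) by (auto simp: Hom_ty Dom_ty)
  then show "x = frac (s \<cdot> u) (g \<cdot> v)"
    unfolding x using frac_comp_unique[OF s'(1-3) s s'(4) t'(1-3) t t'(4) h(3) _ _ h(4) u] by blast
qed

text \<open>The equivalences for \<open>f\<close> and for \<open>g\<close> come with expansions that
  need not coincide. An Ore square joins them, and cancelling \<open>s\<close> and then
  \<open>s'\<close> produces one expansion that serves both numerators.\<close>

lemma frac_Add:
  assumes s: "s \<in> W" "ty C s = tp P X" "ty C f = tp P Y" "ty C g = tp P Y"
  shows "frac s f \<boxplus>\<^bsub>V\<^esub> frac s g = frac s (f \<boxplus> g)"
  unfolding V_simps
proof (rule Union_const)
  show "{frac s' (f' \<boxplus> g') | s' f' g'. (s', f') \<in> frac s f \<and> (s', g') \<in> frac s g} \<noteq> {}"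
    using frac_self[OF s(1,2,3)] frac_self[OF s(1,2,4)] by blast
  fix x assume "x \<in> {frac s' (f' \<boxplus> g') | s' f' g'. (s', f') \<in> frac s f \<and> (s', g') \<in> frac s g}"
  then obtain s' f' g' where x: "x = frac s' (f' \<boxplus> g')" and m: "(s', f') \<in> frac s f" "(s', g') \<in> frac s g"
    by blast
  obtain P' where s': "s' \<in> W" "ty C s' = tp P' X" "ty C f' = tp P' Y" "frac s f = frac s' f'"
    using frac_memD[OF s(1,2,3) m(1)] by auto
  have g': "ty C g' = tp P' Y" "frac s g = frac s' g'"
    using frac_memD[OF s(1,2,4) m(2)] s'(2) by (auto simp: tp_eq)
  obtain A a b where a: "ty C a = tp A P" "ty C b = tp A P'" "s \<cdot> a \<in> W" "s \<cdot> a = s' \<cdot> b" "f \<cdot> a = f' \<cdot> b"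
    using s'(4) unfolding frac_eq[OF s(1,2,3) s'(1-3)] by blast
  obtain B c d where c: "ty C c = tp B P" "ty C d = tp B P'" "s \<cdot> c \<in> W" "s \<cdot> c = s' \<cdot> d" "g \<cdot> c = g' \<cdot> d"
    using g'(2) unfolding frac_eq[OF s(1,2,4) s'(1,2) g'(1)] by blast
  note [simp] = s(2-4) s'(2,3) g'(1) a(1,2) c(1,2) arr_ty
  obtain D p q where p: "p \<in> W" "ty C p = tp D B" "ty C q = tp D A" "(s \<cdot> c) \<cdot> p = (s \<cdot> a) \<cdot> q"
    using W_Ore[OF a(3), of A X "s \<cdot> c" B] by auto
  note [simp] = p(2,3)
  have "s \<cdot> (c \<cdot> p) = s \<cdot> (a \<cdot> q)"
    using p(4) by (simp add: comp_assoc)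
  from W_cancel_eq[OF s(1,2) ty_Comp[OF p(2) c(1)] ty_Comp[OF p(3) a(1)] this]
  obtain E r where r: "r \<in> W" "ty C r = tp E D" "(c \<cdot> p) \<cdot> r = (a \<cdot> q) \<cdot> r" .
  note [simp] = r(2)
  have "s' \<cdot> ((d \<cdot> p) \<cdot> r) = (s' \<cdot> d) \<cdot> (p \<cdot> r)"
    by (simp add: comp_assoc)
  also have "\<dots> = s \<cdot> ((c \<cdot> p) \<cdot> r)"
    unfolding c(4)[symmetric] by (simp add: comp_assoc)
  also have "\<dots> = (s \<cdot> a) \<cdot> (q \<cdot> r)"
    unfolding r(3) by (simp add: comp_assoc)
  also have "\<dots> = s' \<cdot> ((b \<cdot> q) \<cdot> r)"
    unfolding a(4) by (simp add: comp_assoc)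
  finally have "s' \<cdot> ((d \<cdot> p) \<cdot> r) = s' \<cdot> ((b \<cdot> q) \<cdot> r)" .
  from W_cancel_eq[OF s'(1,2) ty_Comp[OF r(2) ty_Comp[OF p(2) c(2)]] ty_Comp[OF r(2) ty_Comp[OF p(3) a(2)]] this]
  obtain F w where w: "w \<in> W" "ty C w = tp F E" "((d \<cdot> p) \<cdot> r) \<cdot> w = ((b \<cdot> q) \<cdot> r) \<cdot> w" .
  note [simp] = w(2)
  let ?x = "(a \<cdot> q) \<cdot> (r \<cdot> w)" and ?y = "(b \<cdot> q) \<cdot> (r \<cdot> w)"
  have "?x = ((c \<cdot> p) \<cdot> r) \<cdot> w"
    unfolding r(3) by (simp add: comp_assoc)
  then have x2: "?x = (c \<cdot> p) \<cdot> (r \<cdot> w)"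
    by (simp add: comp_assoc)
  have y2: "?y = (d \<cdot> p) \<cdot> (r \<cdot> w)"
    using w(3) by (simp add: comp_assoc)
  have "s \<cdot> ?x = (s \<cdot> c) \<cdot> (p \<cdot> (r \<cdot> w))"
    unfolding x2 by (simp add: comp_assoc)
  moreover have "\<dots> \<in> W"
    by (rule W_Comp[OF W_Comp[OF W_Comp[OF w(1) r(1) w(2) r(2)] p(1)] c(3)]) simp_all
  ultimately have wx: "s \<cdot> ?x \<in> W"
    by simp
  have sx: "s \<cdot> ?x = s' \<cdot> ?y"
    by (simp add: comp_assoc reassoc[OF a(4)])
  have fx: "f \<cdot> ?x = f' \<cdot> ?y"
    by (simp add: comp_assoc reassoc[OF a(5)])
  have gx: "g \<cdot> ?x = g' \<cdot> ?y"
    unfolding x2 y2 by (simp add: comp_assoc reassoc[OF c(5)])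
  have "frac s (f \<boxplus> g) = frac s' (f' \<boxplus> g')"
    by (rule frac_eqI[OF s(1,2) _ s'(1,2) _ _ _ wx sx, where Z = F])
      (use fx gx in \<open>simp_all add: comp_Add_l\<close>)
  then show "x = frac s (f \<boxplus> g)"
    unfolding x ..
qed

end

context fractions
begin

lemma frac_Comp_ex:
  assumes "s \<in> W" "ty C s = tp P X" "ty C f = tp P Y" "t \<in> W" "ty C t = tp Q Y" "ty C g = tp Q Z"
  obtains R u v where "u \<in> W" "ty C u = tp R P" "ty C v = tp R Q" "f \<cdot> u = t \<cdot> v"
    "s \<cdot> u \<in> W" "ty C (s \<cdot> u) = tp R X" "ty C (g \<cdot> v) = tp R Z" "frac t g \<cdot>\<^bsub>V\<^esub> frac s f = frac (s \<cdot> u) (g \<cdot> v)"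
proof -
  obtain R u v where u: "u \<in> W" "ty C u = tp R P" "ty C v = tp R Q" "f \<cdot> u = t \<cdot> v"
    using W_Ore[OF assms(4,5,3)] by blast
  show thesis
    by (rule that[OF u W_Comp[OF u(1) assms(1) u(2) assms(2)] ty_Comp[OF u(2) assms(2)]
          ty_Comp[OF u(3) assms(6)] frac_Comp[OF assms u]])
qed

lemma frac_Ident_Comp:
  assumes "s \<in> W" "ty C s = tp P X" "ty C f = tp P Y" and that: "ty C g = tp Y Z"
  shows "frac (Ident C Y) g \<cdot>\<^bsub>V\<^esub> frac s f = frac s (g \<cdot> f)"
proof -
  note o = ty_Dom_Obj[OF assms(2)] ty_Cod_Obj[OF assms(3)]
  have "f \<cdot> Ident C P = Ident C Y \<cdot> f"
    using assms(3) by (simp add: comp_Ident_l comp_Ident_r)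
  from frac_Comp[OF assms(1-3) W_Ident[OF o(2)] ty_Ident[OF o(2)] that W_Ident[OF o(1)] ty_Ident[OF o(1)] assms(3) this]
  show ?thesis
    using assms(2) by (simp add: comp_Ident_r)
qed

lemma ty_V_Ident: "X \<in> Obj C \<Longrightarrow> ty V (Ident V X) = tp X X"
  by (simp add: V_simps ty_frac[OF W_Ident ty_Ident ty_Ident])

lemma ty_V_Zero: "\<lbrakk>X \<in> Obj C; Y \<in> Obj C\<rbrakk> \<Longrightarrow> ty V (Zero V X Y) = tp X Y"
  by (simp add: V_simps ty_frac[OF W_Ident ty_Ident ty_Zero])

lemma frac_Zero:
  assumes "s \<in> W" "ty C s = tp P X" "Y \<in> Obj C"
  shows "frac s (Zero C P Y) = Zero V X Y"
proof -
  note o = ty_Dom_Obj[OF assms(2)] ty_Cod_Obj[OF assms(2)]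
  have w: "Ident C X \<cdot> s \<in> W"
    using assms by (simp add: comp_Ident_l)
  show ?thesis
    using frac_expand[OF W_Ident[OF o(2)] ty_Ident[OF o(2)] ty_Zero[OF o(2) assms(3)] assms(2) w] assms
    by (simp add: V_simps comp_Ident_l comp_Zero_l[OF assms(2)])
qed

text \<open>Over a common denominator the group axioms become those of the numerators. Associativity
  and distributivity follow once the representatives are chosen compatibly.\<close>

lemma V_preadditive: "preadditive_category V"
proof (rule preadditive_category.intro)
  fix F assume "F \<in> Arr V"
  from ty_fracE[OF ty_Arr[OF this]] show "Dom V F \<in> Obj V" "Cod V F \<in> Obj V"
    using ty_Cod_Obj unfolding V_simps(1) by metis+
next
  fix X assume "X \<in> Obj V"
  then show "Ident V X \<in> Hom V X X"
    using ty_V_Ident by (simp add: Hom_ty V_simps(1))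
next
  fix F X Y G Z assume "F \<in> Hom V X Y" "G \<in> Hom V Y Z"
  then obtain P s f Q t g where s: "s \<in> W" "ty C s = tp P X" "ty C f = tp P Y" "F = frac s f"
    and t: "t \<in> W" "ty C t = tp Q Y" "ty C g = tp Q Z" "G = frac t g"
    unfolding Hom_ty by (elim ty_fracE) blast
  obtain R u v where "u \<in> W" "ty C u = tp R P" "ty C v = tp R Q" "f \<cdot> u = t \<cdot> v"
    and w: "s \<cdot> u \<in> W" "ty C (s \<cdot> u) = tp R X" "ty C (g \<cdot> v) = tp R Z"
    "frac t g \<cdot>\<^bsub>V\<^esub> frac s f = frac (s \<cdot> u) (g \<cdot> v)"
    using frac_Comp_ex[OF s(1-3) t(1-3)] .
  then show "G \<cdot>\<^bsub>V\<^esub> F \<in> Hom V X Z"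
    using ty_frac[OF w(1-3)] s(4) t(4) by (simp add: Hom_ty)
next
  fix F X Y assume "F \<in> Hom V X Y"
  then obtain P s f where s: "s \<in> W" "ty C s = tp P X" "ty C f = tp P Y" "F = frac s f"
    unfolding Hom_ty by (elim ty_fracE) blast
  note o = ty_Dom_Obj[OF s(2)] ty_Cod_Obj[OF s(2)] ty_Cod_Obj[OF s(3)]
  show "Ident V Y \<cdot>\<^bsub>V\<^esub> F = F"
    using frac_Ident_Comp[OF s(1-3) ty_Ident[OF o(3)]] s by (simp add: V_simps comp_Ident_l)
  have "Ident C X \<cdot> s = s \<cdot> Ident C P"
    using s by (simp add: comp_Ident_l comp_Ident_r)
  from frac_Comp[OF W_Ident[OF o(2)] ty_Ident[OF o(2)] ty_Ident[OF o(2)] s(1-3) s(1,2) ty_Ident[OF o(1)] this]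
  show "F \<cdot>\<^bsub>V\<^esub> Ident V X = F"
    using s by (simp add: V_simps comp_Ident_l comp_Ident_r)
next
  fix F X Y G Z H W'
  assume "F \<in> Hom V X Y" "G \<in> Hom V Y Z" "H \<in> Hom V Z W'"
  then obtain P s f Q t g R r h where s: "s \<in> W" "ty C s = tp P X" "ty C f = tp P Y" "F = frac s f"
    and t: "t \<in> W" "ty C t = tp Q Y" "ty C g = tp Q Z" "G = frac t g"
    and r: "r \<in> W" "ty C r = tp R Z" "ty C h = tp R W'" "H = frac r h"
    unfolding Hom_ty by (elim ty_fracE) blast
  obtain A a b where a: "a \<in> W" "ty C a = tp A Q" "ty C b = tp A R" "g \<cdot> a = r \<cdot> b"
    "t \<cdot> a \<in> W" "ty C (t \<cdot> a) = tp A Y" "ty C (h \<cdot> b) = tp A W'" "frac r h \<cdot>\<^bsub>V\<^esub> frac t g = frac (t \<cdot> a) (h \<cdot> b)"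
    using frac_Comp_ex[OF t(1-3) r(1-3)] .
  obtain B u v where u: "u \<in> W" "ty C u = tp B P" "ty C v = tp B A" "f \<cdot> u = (t \<cdot> a) \<cdot> v"
    "s \<cdot> u \<in> W" "ty C (s \<cdot> u) = tp B X" "ty C ((h \<cdot> b) \<cdot> v) = tp B W'"
    "frac (t \<cdot> a) (h \<cdot> b) \<cdot>\<^bsub>V\<^esub> frac s f = frac (s \<cdot> u) ((h \<cdot> b) \<cdot> v)"
    using frac_Comp_ex[OF s(1-3) a(5-7)] .
  note [simp] = s(2,3) t(2,3) r(2,3) a(2,3) u(2,3) arr_ty
  \<comment> \<open>The two squares already chosen for the other bracketing are reused, so that both
    sides get the same representative.\<close>
  have "frac t g \<cdot>\<^bsub>V\<^esub> frac s f = frac (s \<cdot> u) (g \<cdot> (a \<cdot> v))"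
    by (rule frac_Comp[OF s(1-3) t(1-3) u(1,2)]) (simp_all add: u(4) comp_assoc)
  moreover have "frac r h \<cdot>\<^bsub>V\<^esub> frac (s \<cdot> u) (g \<cdot> (a \<cdot> v)) = frac ((s \<cdot> u) \<cdot> Ident C B) (h \<cdot> (b \<cdot> v))"
  proof (rule frac_Comp[OF u(5,6) _ r(1-3) W_Ident ty_Ident])
    show "(g \<cdot> (a \<cdot> v)) \<cdot> Ident C B = r \<cdot> (b \<cdot> v)"
      using reassoc[OF a(4)] by (simp add: comp_Ident_r comp_assoc)
  qed (use ty_Dom_Obj[OF u(2)] in simp_all)
  ultimately show "(H \<cdot>\<^bsub>V\<^esub> G) \<cdot>\<^bsub>V\<^esub> F = H \<cdot>\<^bsub>V\<^esub> (G \<cdot>\<^bsub>V\<^esub> F)"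
    unfolding s(4) t(4) r(4) a(8) u(8) by (simp add: comp_Ident_r[OF u(6)] comp_assoc)
next
  fix F X Y G Z G'
  assume F: "F \<in> Hom V X Y" and G: "G \<in> Hom V Y Z" and G': "G' \<in> Hom V Y Z"
  obtain P s f where s: "s \<in> W" "ty C s = tp P X" "ty C f = tp P Y" "F = frac s f"
    using F unfolding Hom_ty by (elim ty_fracE) blast
  obtain Q t g g' where t: "t \<in> W" "ty C t = tp Q Y" "ty C g = tp Q Z" "ty C g' = tp Q Z" "G = frac t g" "G' = frac t g'"
    using common_denominator[OF G[unfolded Hom_ty] G'[unfolded Hom_ty]] .
  obtain R u v where u: "u \<in> W" "ty C u = tp R P" "ty C v = tp R Q" "f \<cdot> u = t \<cdot> v"
    using W_Ore[OF t(1,2) s(3)] by blast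
  have w: "s \<cdot> u \<in> W" "ty C (s \<cdot> u) = tp R X"
    using W_Comp[OF u(1) s(1) u(2) s(2)] ty_Comp[OF u(2) s(2)] .
  show "(G \<boxplus>\<^bsub>V\<^esub> G') \<cdot>\<^bsub>V\<^esub> F = G \<cdot>\<^bsub>V\<^esub> F \<boxplus>\<^bsub>V\<^esub> G' \<cdot>\<^bsub>V\<^esub> F"
    unfolding s(4) t(5,6) frac_Add[OF t(1-4)] frac_Comp[OF s(1-3) t(1,2) ty_Add[OF t(3,4)] u]
      frac_Comp[OF s(1-3) t(1,2,3) u] frac_Comp[OF s(1-3) t(1,2,4) u]
      frac_Add[OF w ty_Comp[OF u(3) t(3)] ty_Comp[OF u(3) t(4)]]
    by (simp add: comp_Add_l[OF u(3) t(3,4)])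
next
  fix F X Y F' G Z
  assume F: "F \<in> Hom V X Y" "F' \<in> Hom V X Y" and G: "G \<in> Hom V Y Z"
  obtain Q t g where t: "t \<in> W" "ty C t = tp Q Y" "ty C g = tp Q Z" "G = frac t g"
    using G unfolding Hom_ty by (elim ty_fracE) blast
  obtain P s f f' where s: "s \<in> W" "ty C s = tp P X" "ty C f = tp P Y" "ty C f' = tp P Y" "F = frac s f" "F' = frac s f'"
    using common_denominator[OF F(1)[unfolded Hom_ty] F(2)[unfolded Hom_ty]] .
  obtain R u v where u: "u \<in> W" "ty C u = tp R P" "ty C v = tp R Q" "f \<cdot> u = t \<cdot> v"
    using W_Ore[OF t(1,2) s(3)] by blast
  obtain R' u' v' where u': "u' \<in> W" "ty C u' = tp R' P" "ty C v' = tp R' Q" "f' \<cdot> u' = t \<cdot> v'"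
    using W_Ore[OF t(1,2) s(4)] by blast
  \<comment> \<open>The squares for \<open>f\<close> and \<open>f'\<close> have different
    denominators. They are pulled back to the single one \<open>u b = u' a\<close>, because
    \<open>frac_Add\<close> adds over equal denominators.\<close>
  obtain D a b where a: "a \<in> W" "ty C a = tp D R'" "ty C b = tp D R" "u' \<cdot> a = u \<cdot> b"
    using W_Ore[OF u(1,2) u'(2)] by blast
  note [simp] = s(2-4) t(2,3) u(2,3) u'(2,3) a(2,3) arr_ty
  have x: "u \<cdot> b \<in> W" "ty C (u \<cdot> b) = tp D P"
    using W_Comp[OF a(1) u'(1) a(2) u'(2)] a(4) by simp_all
  have e: "f \<cdot> (u \<cdot> b) = t \<cdot> (v \<cdot> b)" "f' \<cdot> (u \<cdot> b) = t \<cdot> (v' \<cdot> a)"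
    by (simp add: reassoc[OF u(4)] comp_assoc, simp add: reassoc[OF u'(4)] comp_assoc a(4)[symmetric])
  have e': "(f \<boxplus> f') \<cdot> (u \<cdot> b) = t \<cdot> (v \<cdot> b \<boxplus> v' \<cdot> a)"
    using e by (simp add: comp_Add_l comp_Add_r)
  have w: "s \<cdot> (u \<cdot> b) \<in> W" "ty C (s \<cdot> (u \<cdot> b)) = tp D X"
    using W_Comp[OF x(1) s(1) x(2) s(2)] by simp_all
  note tv = ty_Comp[OF a(3) u(3)] ty_Comp[OF a(2) u'(3)]
  show "G \<cdot>\<^bsub>V\<^esub> (F \<boxplus>\<^bsub>V\<^esub> F') = G \<cdot>\<^bsub>V\<^esub> F \<boxplus>\<^bsub>V\<^esub> G \<cdot>\<^bsub>V\<^esub> F'"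
    unfolding s(5,6) t(4) frac_Add[OF s(1-4)] frac_Comp[OF s(1,2) ty_Add[OF s(3,4)] t(1-3) x ty_Add[OF tv] e']
      frac_Comp[OF s(1-3) t(1-3) x tv(1) e(1)] frac_Comp[OF s(1,2,4) t(1-3) x tv(2) e(2)]
      frac_Add[OF w ty_Comp[OF tv(1) t(3)] ty_Comp[OF tv(2) t(3)]]
    by (simp add: comp_Add_r)
next
  fix X Y assume X: "X \<in> Obj V" and Y: "Y \<in> Obj V"
  have o: "X \<in> Obj C" "Y \<in> Obj C"
    using X Y by (simp_all add: V_simps(1))
  have gr: "carrier (hom_group V X Y) = {f. ty V f = tp X Y}"
    "mult (hom_group V X Y) = Add V" "one (hom_group V X Y) = Zero V X Y"
    by (auto simp: hom_group_def Hom_ty)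
  show "comm_group (hom_group V X Y)"
  proof (rule comm_groupI, unfold gr mem_Collect_eq)
    fix F G H assume "ty V F = tp X Y" "ty V G = tp X Y" "ty V H = tp X Y"
    then obtain P s f g h where s: "s \<in> W" "ty C s = tp P X" "ty C f = tp P Y" "ty C g = tp P Y" "ty C h = tp P Y"
      "F = frac s f" "G = frac s g" "H = frac s h"
      by (rule common_denominator3)
    show "(F \<boxplus>\<^bsub>V\<^esub> G) \<boxplus>\<^bsub>V\<^esub> H = F \<boxplus>\<^bsub>V\<^esub> (G \<boxplus>\<^bsub>V\<^esub> H)"
      unfolding s(6-8) frac_Add[OF s(1-4)] frac_Add[OF s(1,2,4,5)] frac_Add[OF s(1,2) ty_Add[OF s(3,4)] s(5)]
        frac_Add[OF s(1,2,3) ty_Add[OF s(4,5)]] add_assoc[OF s(3-5)] ..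
  next
    fix F G assume "ty V F = tp X Y" "ty V G = tp X Y"
    then obtain P s f g where s: "s \<in> W" "ty C s = tp P X" "ty C f = tp P Y" "ty C g = tp P Y"
      "F = frac s f" "G = frac s g"
      by (rule common_denominator)
    show "ty V (F \<boxplus>\<^bsub>V\<^esub> G) = tp X Y"
      unfolding s(5,6) frac_Add[OF s(1-4)] by (rule ty_frac[OF s(1,2) ty_Add[OF s(3,4)]])
    show "F \<boxplus>\<^bsub>V\<^esub> G = G \<boxplus>\<^bsub>V\<^esub> F"
      unfolding s(5,6) frac_Add[OF s(1-4)] frac_Add[OF s(1,2,4,3)] add_comm[OF s(3,4)] ..
  next
    fix F assume "ty V F = tp X Y"
    then obtain P s f where s: "s \<in> W" "ty C s = tp P X" "ty C f = tp P Y" "F = frac s f"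
      by (rule ty_fracE)
    note z = frac_Zero[OF s(1,2) o(2)] ty_Zero[OF ty_Dom_Obj[OF s(2)] o(2)]
    show "Zero V X Y \<boxplus>\<^bsub>V\<^esub> F = F"
      unfolding z(1)[symmetric] s(4) frac_Add[OF s(1,2) z(2) s(3)] add_Zero_l[OF s(3)] ..
    have "frac s (\<boxminus> f) \<boxplus>\<^bsub>V\<^esub> F = Zero V X Y"
      unfolding z(1)[symmetric] s(4) frac_Add[OF s(1,2) ty_neg[OF s(3)] s(3)] add_neg_l[OF s(3)] ..
    then show "\<exists>G\<in>{f. ty V f = tp X Y}. G \<boxplus>\<^bsub>V\<^esub> F = Zero V X Y"
      using ty_frac[OF s(1,2) ty_neg[OF s(3)]] by blast
  qed (rule ty_V_Zero[OF o])
qed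

section \<open>The localization functor\<close>

abbreviation "qm \<equiv> verdier_map C N"

lemma qm_frac: "ty C f = tp X Y \<Longrightarrow> qm f = frac (Ident C X) f"
  by (simp add: verdier_map_def frac_def Dom_ty)

lemma ty_qm: "ty C f = tp X Y \<Longrightarrow> ty V (qm f) = tp X Y"
  using ty_frac[OF W_Ident ty_Ident] ty_Dom_Obj by (simp add: qm_frac)

lemma qm_Comp:
  assumes "ty C f = tp X Y" "ty C g = tp Y Z"
  shows "qm (g \<cdot> f) = qm g \<cdot>\<^bsub>V\<^esub> qm f"
  using frac_Ident_Comp[OF W_Ident ty_Ident assms] ty_Dom_Obj[OF assms(1)]
  by (simp add: qm_frac[OF assms(1)] qm_frac[OF assms(2)] qm_frac[OF ty_Comp[OF assms]])

lemma qm_Add: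
  assumes "ty C f = tp X Y" "ty C g = tp X Y"
  shows "qm (f \<boxplus> g) = qm f \<boxplus>\<^bsub>V\<^esub> qm g"
  using frac_Add[OF W_Ident ty_Ident assms] ty_Dom_Obj[OF assms(1)]
  by (simp add: qm_frac[OF assms(1)] qm_frac[OF assms(2)] qm_frac[OF ty_Add[OF assms]])

lemma qm_Ident: "X \<in> Obj C \<Longrightarrow> qm (Ident C X) = Ident V X"
  by (simp add: qm_frac[OF ty_Ident] V_simps)

lemma qm_Zero: "\<lbrakk>X \<in> Obj C; Y \<in> Obj C\<rbrakk> \<Longrightarrow> qm (Zero C X Y) = Zero V X Y"
  by (simp add: qm_frac[OF ty_Zero] V_simps)

text \<open>The inverse is the fraction with denominator \<open>s\<close> and numerator the
  identity.\<close>

lemma qm_iso: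
  assumes "s \<in> W"
  shows "arr_iso V (qm s)"
proof -
  obtain P X where s: "ty C s = tp P X"
    using assms ty_Arr[of s C] by (fastforce simp: verdier_weq_def)
  note o = ty_Dom_Obj[OF s] ty_Cod_Obj[OF s]
  note i = W_Ident[OF o(1)] ty_Ident[OF o(1)] W_Ident[OF o(2)] ty_Ident[OF o(2)]
  show ?thesis
  proof (rule preadditive_category.arr_isoI[OF V_preadditive])
    show "ty V (qm s) = tp P X" "ty V (frac s (Ident C P)) = tp X P"
      using ty_qm[OF s] ty_frac[OF assms s i(2)] .
    have "qm s \<cdot>\<^bsub>V\<^esub> frac s (Ident C P) = frac s s"
      using frac_Ident_Comp[OF assms s i(2) s] s by (simp add: qm_frac[OF s] comp_Ident_r)
    also have "\<dots> = Ident V X"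
      using frac_expand[OF i(3,4,4) s] s assms by (simp add: comp_Ident_l V_simps)
    finally show "qm s \<cdot>\<^bsub>V\<^esub> frac s (Ident C P) = Ident V X" .
    have "s \<cdot> Ident C P = s \<cdot> Ident C P" ..
    from frac_Comp[OF i(1,2) s assms s i(2) i(1,2,2) this]
    show "frac s (Ident C P) \<cdot>\<^bsub>V\<^esub> qm s = Ident V P"
      by (simp add: qm_frac[OF s] V_simps comp_Ident_r[OF i(2)])
  qed
qed

lemma qm_zero_iff:
  assumes f: "ty C f = tp X Y"
  shows "qm f = Zero V X Y \<longleftrightarrow> (\<exists>P t. t \<in> W \<and> ty C t = tp P X \<and> f \<cdot> t = Zero C P Y)"
proof -
  note o = ty_Dom_Obj[OF f] ty_Cod_Obj[OF f]
  note i = W_Ident[OF o(1)] ty_Ident[OF o(1)]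
  have "qm f = Zero V X Y \<longleftrightarrow> (\<exists>Z u v. ty C u = tp Z X \<and> ty C v = tp Z X \<and> Ident C X \<cdot> u \<in> W \<and>
      Ident C X \<cdot> u = Ident C X \<cdot> v \<and> f \<cdot> u = Zero C X Y \<cdot> v)"
    unfolding qm_frac[OF f] V_simps frac_eq[OF i f i ty_Zero[OF o]] ..
  also have "\<dots> \<longleftrightarrow> (\<exists>P t. t \<in> W \<and> ty C t = tp P X \<and> f \<cdot> t = Zero C P Y)"
  proof
    assume "\<exists>P t. t \<in> W \<and> ty C t = tp P X \<and> f \<cdot> t = Zero C P Y"
    then obtain P t where "t \<in> W" "ty C t = tp P X" "f \<cdot> t = Zero C P Y"
      by blast
    then show "\<exists>Z u v. ty C u = tp Z X \<and> ty C v = tp Z X \<and> Ident C X \<cdot> u \<in> W \<and>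
      Ident C X \<cdot> u = Ident C X \<cdot> v \<and> f \<cdot> u = Zero C X Y \<cdot> v"
      using o(2) by (intro exI[of _ P] exI[of _ t]) (simp add: comp_Ident_l comp_Zero_l)
  next
    assume "\<exists>Z u v. ty C u = tp Z X \<and> ty C v = tp Z X \<and> Ident C X \<cdot> u \<in> W \<and>
      Ident C X \<cdot> u = Ident C X \<cdot> v \<and> f \<cdot> u = Zero C X Y \<cdot> v"
    then obtain Z u v where "ty C u = tp Z X" "ty C v = tp Z X" "Ident C X \<cdot> u \<in> W" "f \<cdot> u = Zero C X Y \<cdot> v"
      by blast
    then show "\<exists>P t. t \<in> W \<and> ty C t = tp P X \<and> f \<cdot> t = Zero C P Y"
      using o(2) by (intro exI[of _ Z] exI[of _ u]) (simp add: comp_Ident_l comp_Zero_l)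
  qed
  finally show ?thesis .
qed

end

sublocale triangulated_subcategory \<subseteq> Q: fractions "Kb C" N
proof
  show "X \<in> Obj (Kb C) \<Longrightarrow> Ident (Kb C) X \<in> W" for X
    by (rule W_Ident)
  show "t \<cdot>\<^bsub>Kb C\<^esub> s \<in> W" if "s \<in> W" "t \<in> W" "ty (Kb C) s = tp X Y" "ty (Kb C) t = tp Y Z" for s t X Y Z
    using that by (rule W_Comp)
  show "\<exists>P t g. t \<in> W \<and> ty (Kb C) t = tp P X \<and> ty (Kb C) g = tp P Z \<and> f \<cdot>\<^bsub>Kb C\<^esub> t = s \<cdot>\<^bsub>Kb C\<^esub> g"
    if "s \<in> W" "ty (Kb C) s = tp Z Y" "ty (Kb C) f = tp X Y" for s f X Y Z
    by (rule W_Ore[OF that]) blast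
  show "\<exists>P t. t \<in> W \<and> ty (Kb C) t = tp P X \<and> f \<cdot>\<^bsub>Kb C\<^esub> t = Zero (Kb C) P Y"
    if "s \<in> W" "ty (Kb C) s = tp Y Z" "ty (Kb C) f = tp X Y" "s \<cdot>\<^bsub>Kb C\<^esub> f = Zero (Kb C) X Z" for s f X Y Z
    by (rule W_cancel[OF that]) blast
qed

sublocale triangulated_subcategory \<subseteq> V: preadditive_category "verdier_quotient (Kb C) N"
  by (rule Q.V_preadditive)

section \<open>Two-term complexes and the embedding of the additive category\<close>

definition dz :: "('o, 'm, 'z) acat_scheme \<Rightarrow> ('o, 'm) cplx \<Rightarrow> ('o, 'm) cplx \<Rightarrow> 'm \<Rightarrow> int \<Rightarrow> 'm" where
  "dz C X Y f = (\<lambda>n. if n = 0 then f else Zero C (obj_at X n) (obj_at Y n))"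

text \<open>A bare family of arrows, so that it also covers the degreewise sections and retractions
  between two-term complexes, which need not be chain maps.\<close>

definition tt :: "('o, 'm, 'z) acat_scheme \<Rightarrow> int \<Rightarrow> 'm \<Rightarrow> 'm \<Rightarrow> int \<Rightarrow> 'm" where
  "tt C k x y = (\<lambda>n. if n = k then x else if n = k + 1 then y else Zero C (zero_obj C) (zero_obj C))"

lemma degree_zero_map_dz: "degree_zero_map C X Y f = ChMap X Y (dz C X Y f)"
  by (simp add: degree_zero_map_def dz_def)

context additive_category
begin

lemma zero_obj: "zero_object C (zero_obj C)"
  unfolding zero_obj_def using ex_zero_object by (rule someI_ex)

lemma zero_obj_Obj: "zero_obj C \<in> Obj C"
  using zero_obj by (simp add: zero_object_def)

lemma zero_obj_Ident: "Ident C (zero_obj C) = Zero C (zero_obj C) (zero_obj C)"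
  using zero_obj zero_object_iff[OF zero_obj_Obj] by simp

lemma to_zero_obj: "ty C f = tp X (zero_obj C) \<Longrightarrow> f = Zero C X (zero_obj C)"
  using comp_Ident_l[of f X "zero_obj C"] comp_Zero_l[of f X "zero_obj C" "zero_obj C"]
  by (simp add: zero_obj_Ident zero_obj_Obj)

lemma from_zero_obj: "ty C f = tp (zero_obj C) X \<Longrightarrow> f = Zero C (zero_obj C) X"
  using comp_Ident_r[of f "zero_obj C" X] comp_Zero_r[of f "zero_obj C" X "zero_obj C"]
  by (simp add: zero_obj_Ident zero_obj_Obj)

lemma bip_zero_obj:
  "bip C (zero_obj C) (zero_obj C) (zero_obj C) (Zero C (zero_obj C) (zero_obj C)) (Zero C (zero_obj C) (zero_obj C))
    (Zero C (zero_obj C) (zero_obj C)) (Zero C (zero_obj C) (zero_obj C))"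
  by (simp add: bip_def ty_Zero zero_obj_Obj comp_Zero_l[OF ty_Zero] zero_obj_Ident add_Zero_l[OF ty_Zero])

lemma bip_zero_l: "X \<in> Obj C \<Longrightarrow> inr C (zero_obj C) X \<cdot> prr C (zero_obj C) X = Ident C (dsum C [zero_obj C, X])"
proof -
  assume X: "X \<in> Obj C"
  have e: "inl C (zero_obj C) X = Zero C (zero_obj C) (dsum C [zero_obj C, X])"
    using X by (intro from_zero_obj) (simp add: bin zero_obj_Obj)
  show ?thesis
    using X bin_Ident[OF zero_obj_Obj X] unfolding e
    by (simp add: bin zero_obj_Obj arr_calc)
qed

lemma bip_zero_r: "X \<in> Obj C \<Longrightarrow> inl C X (zero_obj C) \<cdot> prl C X (zero_obj C) = Ident C (dsum C [X, zero_obj C])"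
proof -
  assume X: "X \<in> Obj C"
  have e: "inr C X (zero_obj C) = Zero C (zero_obj C) (dsum C [X, zero_obj C])"
    using X by (intro from_zero_obj) (simp add: bin zero_obj_Obj)
  show ?thesis
    using X bin_Ident[OF X zero_obj_Obj] unfolding e
    by (simp add: bin zero_obj_Obj arr_calc)
qed

section \<open>Complexes concentrated in degree 0 and two-term complexes\<close>

lemma emb_simps:
  "obj_at (emb_obj C Y) n = (if n = 0 then Y else zero_obj C)"
  "diff_at (emb_obj C Y) n = Zero C (obj_at (emb_obj C Y) n) (obj_at (emb_obj C Y) (n + 1))"
  by (simp_all add: emb_obj_def Let_def)

lemma emb_cx:
  assumes "Y \<in> Obj C"
  shows "bounded_complex C (emb_obj C Y)"
proof -
  have "\<forall>n. \<bar>n\<bar> > 0 \<longrightarrow> zero_object C (obj_at (emb_obj C Y) n)"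
    by (simp add: emb_simps zero_obj)
  then show ?thesis
    unfolding bounded_complex_def using assms zero_obj_Obj
    by (auto simp: Hom_ty emb_simps ty_Zero comp_Zero_l[OF ty_Zero])
qed

lemma two_term_simps:
  assumes "ty C s = tp X Y"
  shows "obj_at (two_term C k s) n = (if n = k then X else if n = k + 1 then Y else zero_obj C)"
    "diff_at (two_term C k s) n =
      (if n = k then s else Zero C (obj_at (two_term C k s) n) (obj_at (two_term C k s) (n + 1)))"
  by (simp_all add: two_term_def Let_def Dom_ty[OF assms] Cod_ty[OF assms])

lemma two_term_cx:
  assumes "ty C s = tp X Y"
  shows "bounded_complex C (two_term C k s)"
proof -
  note [simp] = ty_Dom_Obj[OF assms] ty_Cod_Obj[OF assms] zero_obj_Obj assms
  have "\<forall>n. \<bar>n\<bar> > \<bar>k\<bar> + 1 \<longrightarrow> zero_object C (obj_at (two_term C k s) n)"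
    by (auto simp: two_term_simps[OF assms] zero_obj)
  moreover have o: "\<forall>n. obj_at (two_term C k s) n \<in> Obj C"
    by (simp add: two_term_simps[OF assms])
  moreover have t: "ty C (diff_at (two_term C k s) n) = tp (obj_at (two_term C k s) n) (obj_at (two_term C k s) (n + 1))" for n
    by (simp add: two_term_simps[OF assms] ty_Zero)
  moreover have "diff_at (two_term C k s) (n + 1) \<cdot> diff_at (two_term C k s) n =
      Zero C (obj_at (two_term C k s) n) (obj_at (two_term C k s) (n + 2))" for n
  proof (cases "n = k")
    case True
    then have "diff_at (two_term C k s) (n + 1) = Zero C (obj_at (two_term C k s) (n + 1)) (obj_at (two_term C k s) (n + 2))"
      by (simp add: two_term_simps(2)[OF assms] int_shift_simps)
    then show ?thesis
      using comp_Zero_l[OF t] o by simp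
  next
    case False
    then have "diff_at (two_term C k s) n = Zero C (obj_at (two_term C k s) n) (obj_at (two_term C k s) (n + 1))"
      by (simp add: two_term_simps(2)[OF assms])
    then show ?thesis
      using comp_Zero_r[OF t] o by (simp add: int_shift_simps)
  qed
  ultimately show ?thesis
    unfolding bounded_complex_def by (auto simp: Hom_ty)
qed

lemma cm_dz:
  assumes "bounded_complex C X" "bounded_complex C Y" "ty C f = tp (obj_at X 0) (obj_at Y 0)"
    and "diff_at Y 0 \<cdot> f = Zero C (obj_at X 0) (obj_at Y 1)" "f \<cdot> diff_at X (- 1) = Zero C (obj_at X (- 1)) (obj_at Y 0)"
  shows "cm C X Y (dz C X Y f)"
proof (rule cmI)
  note [simp] = cxD[OF assms(1)] cxD[OF assms(2)] assms(3-5)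
  show "ty C (dz C X Y f n) = tp (obj_at X n) (obj_at Y n)" for n
    by (simp add: dz_def ty_Zero)
  fix n :: int
  consider "n = 0" | "n = - 1" | "n \<noteq> 0 \<and> n + 1 \<noteq> 0"
    by linarith
  then show "diff_at Y n \<cdot> dz C X Y f n = dz C X Y f (n + 1) \<cdot> diff_at X n"
    using cxD(2)[OF assms(1), of "-1"] cxD(2)[OF assms(2), of "-1"] cxD(2)[OF assms(1), of 0]
    by cases (simp_all add: dz_def arr_mult)
qed (use assms in auto)

lemma cm_dz_emb:
  assumes "ty C f = tp X Y"
  shows "cm C (emb_obj C X) (emb_obj C Y) (dz C (emb_obj C X) (emb_obj C Y) f)"
proof -
  note [simp] = ty_Dom_Obj[OF assms] ty_Cod_Obj[OF assms] zero_obj_Obj assms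
  show ?thesis
    by (rule cm_dz) (simp_all add: emb_cx emb_simps comp_Zero_l comp_Zero_r)
qed

lemma emb_arr_cl:
  assumes "ty C f = tp X Y"
  shows "emb_arr C f = cl C (emb_obj C X) (emb_obj C Y) (dz C (emb_obj C X) (emb_obj C Y) f)"
  by (simp add: emb_arr_def degree_zero_map_dz cl_def Dom_ty[OF assms] Cod_ty[OF assms])

lemma ty_emb_arr: "ty C f = tp X Y \<Longrightarrow> ty (Kb C) (emb_arr C f) = tp (emb_obj C X) (emb_obj C Y)"
  by (simp add: emb_arr_cl ty_cl cm_dz_emb)

lemma dz_Comp:
  assumes "bounded_complex C X" "bounded_complex C Y" "bounded_complex C Z"
  shows "(\<lambda>n. dz C Y Z g n \<cdot> dz C X Y f n) = dz C X Z (g \<cdot> f)"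
  by (rule ext) (simp add: dz_def cxD[OF assms(1)] cxD[OF assms(2)] cxD[OF assms(3)] comp_Zero_l[OF ty_Zero])

lemma dz_Add:
  assumes "bounded_complex C X" "bounded_complex C Y"
  shows "(\<lambda>n. dz C X Y f n \<boxplus> dz C X Y g n) = dz C X Y (f \<boxplus> g)"
  by (rule ext) (simp add: dz_def cxD[OF assms(1)] cxD[OF assms(2)] add_Zero_l[OF ty_Zero])

lemma emb_arr_Comp:
  assumes "ty C f = tp X Y" "ty C g = tp Y Z"
  shows "emb_arr C (g \<cdot> f) = emb_arr C g \<cdot>\<^bsub>Kb C\<^esub> emb_arr C f"
  using assms ty_Dom_Obj[OF assms(1)] ty_Cod_Obj[OF assms(1)] ty_Cod_Obj[OF assms(2)]
  by (simp add: emb_arr_cl[OF assms(1)] emb_arr_cl[OF assms(2)] emb_arr_cl[OF ty_Comp[OF assms]] cl_Comp[OF cm_dz_emb cm_dz_emb] dz_Comp emb_cx)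

lemma emb_arr_Add:
  assumes "ty C f = tp X Y" "ty C g = tp X Y"
  shows "emb_arr C (f \<boxplus> g) = emb_arr C f \<boxplus>\<^bsub>Kb C\<^esub> emb_arr C g"
  using assms ty_Dom_Obj[OF assms(1)] ty_Cod_Obj[OF assms(1)]
  by (simp add: emb_arr_cl[OF assms(1)] emb_arr_cl[OF assms(2)] emb_arr_cl[OF ty_Add[OF assms]] cl_Add[OF cm_dz_emb cm_dz_emb] dz_Add emb_cx)

lemma emb_arr_Ident: "X \<in> Obj C \<Longrightarrow> emb_arr C (Ident C X) = Ident (Kb C) (emb_obj C X)"
  by (simp add: emb_arr_cl[OF ty_Ident] Kb_simps(5)) (rule cl_cong, simp add: dz_def emb_simps zero_obj_Ident)

lemma emb_arr_Zero: "\<lbrakk>X \<in> Obj C; Y \<in> Obj C\<rbrakk> \<Longrightarrow> emb_arr C (Zero C X Y) = Zero (Kb C) (emb_obj C X) (emb_obj C Y)"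
  by (simp add: emb_arr_cl[OF ty_Zero] Kb_simps(7)) (rule cl_cong, simp add: dz_def emb_simps)

text \<open>The terms of the mapping cone are chosen direct sums with the zero object. Projecting
  the zero summands away is a strict isomorphism of complexes.\<close>

lemma cone_emb_isomorphic:
  assumes s: "ty C s = tp X Y"
  shows "isomorphic (Kb C) (cone C (emb_obj C X) (emb_obj C Y) (dz C (emb_obj C X) (emb_obj C Y) s)) (cone_of C s)"
proof -
  note o[simp] = ty_Dom_Obj[OF s] ty_Cod_Obj[OF s] zero_obj_Obj
  let ?N = "cone C (emb_obj C X) (emb_obj C Y) (dz C (emb_obj C X) (emb_obj C Y) s)"
  note c = cm_dz_emb[OF s]
  note [simp] = two_term_simps[OF s] cone_obj emb_simps bin s arr_ty
  have [simp]: "dz C X Y f n = (if n = 0 then f else Zero C (obj_at X n) (obj_at Y n))" for X Y f n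
    by (simp add: dz_def)
  let ?\<phi> = "\<lambda>n::int. if n = - 1 then prl C X (zero_obj C) else if n = 0 then prr C (zero_obj C) Y
    else Zero C (dsum C [zero_obj C, zero_obj C]) (zero_obj C)"
  let ?\<psi> = "\<lambda>n::int. if n = - 1 then inl C X (zero_obj C) else if n = 0 then inr C (zero_obj C) Y
    else Zero C (zero_obj C) (dsum C [zero_obj C, zero_obj C])"
  have zz: "Ident C (dsum C [zero_obj C, zero_obj C]) = Zero C (dsum C [zero_obj C, zero_obj C]) (dsum C [zero_obj C, zero_obj C])"
    using zero_object_dsum[OF zero_obj zero_obj] by (simp add: zero_object_iff)
  have m1: "(n + 1 = 0) = (n = - 1)" "(n + 2 = 0) = (n = - 2)" for n :: int
    by auto
  show ?thesis
  proof (rule isomorphic_strict[of _ _ ?\<phi> ?\<psi>])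
    show "cm C ?N (cone_of C s) ?\<phi>"
    proof (rule cmI)
      show "bounded_complex C ?N" "bounded_complex C (cone_of C s)"
        using cone_cx[OF c] two_term_cx[OF s] by (simp_all add: cone_of_def)
      show "ty C (?\<phi> n) = tp (obj_at ?N n) (obj_at (cone_of C s) n)" for n
        by (simp add: cone_of_def m1)
      fix n :: int
      consider "n = - 1" | "n = - 2" | "n = 0" | "n \<noteq> 0 \<and> n \<noteq> - 1 \<and> n \<noteq> - 2"
        by blast
      then show "diff_at (cone_of C s) n \<cdot> ?\<phi> n = ?\<phi> (n + 1) \<cdot> diff_at ?N n"
        by cases (simp_all add: cone_of_def m1 cone_diff[OF c] arr_calc)
    qed
    show "ty C (?\<psi> n) = tp (obj_at (cone_of C s) n) (obj_at ?N n)" for n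
      by (simp add: cone_of_def m1)
    show "?\<psi> n \<cdot> ?\<phi> n = Ident C (obj_at ?N n)" for n
      by (simp add: m1 bip_zero_l bip_zero_r zz comp_Zero_l[OF ty_Zero])
    show "?\<phi> n \<cdot> ?\<psi> n = Ident C (obj_at (cone_of C s) n)" for n
      by (simp add: m1 cone_of_def zero_obj_Ident comp_Zero_l[OF ty_Zero])
  qed
qed

section \<open>Maps and split sequences of two-term complexes\<close>

lemma cm_two_term:
  assumes s: "ty C s = tp X Y" and s': "ty C s' = tp X' Y'" and x: "ty C x = tp X X'" and y: "ty C y = tp Y Y'"
    and e: "s' \<cdot> x = y \<cdot> s"
  shows "cm C (two_term C k s) (two_term C k s') (tt C k x y)"
proof (rule cmI)
  note [simp] = ty_Dom_Obj[OF s] ty_Cod_Obj[OF s] ty_Dom_Obj[OF s'] ty_Cod_Obj[OF s'] zero_obj_Obj s s' x y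
    two_term_simps[OF s] two_term_simps[OF s']
  show "ty C (tt C k x y n) = tp (obj_at (two_term C k s) n) (obj_at (two_term C k s') n)" for n
    by (simp add: tt_def ty_Zero)
  fix n
  consider "n = k" | "n = k - 1" | "n = k + 1" | "n \<noteq> k \<and> n \<noteq> k - 1 \<and> n \<noteq> k + 1"
    by blast
  then show "diff_at (two_term C k s') n \<cdot> tt C k x y n = tt C k x y (n + 1) \<cdot> diff_at (two_term C k s) n"
    by cases (simp_all add: tt_def e arr_ty arr_mult)
qed (use two_term_cx s s' in blast)+

text \<open>Outside degrees \<open>k\<close> and \<open>k + 1\<close> all terms are the zero object,
  which is a biproduct of itself with itself through zero arrows.\<close>

lemma two_term_split_exact:
  assumes s: "ty C b = tp B B'" "ty C m = tp M M'" "ty C a = tp A A'"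
    and bip: "bip C B A M i j p q" "bip C B' A' M' i' j' p' q'"
    and e: "m \<cdot> i = i' \<cdot> b" "a \<cdot> q = q' \<cdot> m"
  shows "split_exact C (two_term C k b) (two_term C k m) (two_term C k a) (tt C k i i') (tt C k q q') (tt C k p p') (tt C k j j')"
  unfolding split_exact_def
proof (intro conjI allI)
  note t = bipD(1-4)[OF bip(1)] bipD(1-4)[OF bip(2)]
  show "cm C (two_term C k b) (two_term C k m) (tt C k i i')" "cm C (two_term C k m) (two_term C k a) (tt C k q q')"
    using cm_two_term[OF s(1,2) t(1) t(5) e(1)] cm_two_term[OF s(2,3) t(4) t(8) e(2)] .
  show "bip C (obj_at (two_term C k b) n) (obj_at (two_term C k a) n) (obj_at (two_term C k m) n)
      (tt C k i i' n) (tt C k j j' n) (tt C k p p' n) (tt C k q q' n)" for n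
    using bip bip_zero_obj by (simp add: tt_def two_term_simps[OF s(1)] two_term_simps[OF s(2)] two_term_simps[OF s(3)])
qed

end

section \<open>Extension-closed classes\<close>

context additive_category
begin

text \<open>\<open>extension_closed\<close> does not mention isomorphisms. A triangle over an
  isomorphism from \<open>X\<close> to \<open>Y\<close> has a zero object as its third vertex, so
  \<open>Y\<close> is an extension built from \<open>X\<close> and a zero object.\<close>

lemma ext_iso:
  assumes E: "extension_closed (Kb C) E" and iso: "isomorphic (Kb C) X Y" and X: "X \<in> E"
  shows "Y \<in> E"
proof -
  interpret K: preadditive_category "Kb C"
    by (rule Kb_preadditive)
  obtain a where a: "arr_iso (Kb C) a" "ty (Kb C) a = tp X Y"
    using iso by (auto simp: K.isomorphic_ty)
  obtain b where b: "ty (Kb C) b = tp Y X" "b \<cdot>\<^bsub>Kb C\<^esub> a = Ident (Kb C) X" "a \<cdot>\<^bsub>Kb C\<^esub> b = Ident (Kb C) Y"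
    using K.arr_isoE[OF a] .
  obtain \<alpha> where \<alpha>: "cm C X Y \<alpha>" "a = cl C X Y \<alpha>"
    using ty_clE[OF a(2)] .
  have o: "X \<in> Obj (Kb C)" "bounded_complex C X"
    using cmD[OF \<alpha>(1)] by (auto simp: Kb_simps)
  note i = cm_Ident[OF o(2)]
  have "isomorphic (Kb C) (cone C X X (\<lambda>n. Ident C (obj_at X n))) (cone C X Y \<alpha>)"
    by (rule cone_isomorphic[OF i \<alpha>(1) K.arr_iso_Ident[OF o(1)] K.ty_Ident[OF o(1)] a])
      (simp add: Kb_simps(5)[symmetric] \<alpha>(2)[symmetric])
  then have "zero_object (Kb C) (cone C X Y \<alpha>)"
    using cone_Ident_zero[OF o(2)] by (rule K.zero_object_isomorphic)
  then have "cone C X Y \<alpha> \<in> E"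
    using E by (simp add: extension_closed_def)
  moreover obtain w where w: "(cl C X Y \<alpha>, cl C Y (cone C X Y \<alpha>) (\<lambda>n. inr C (obj_at X (n + 1)) (obj_at Y n)), w) \<in> Dist (Kb C)"
    using dist_cone[OF \<alpha>(1)] by blast
  have "\<forall>(u, v, w)\<in>Dist (Kb C). Dom (Kb C) u \<in> E \<and> Cod (Kb C) v \<in> E \<longrightarrow> Cod (Kb C) u \<in> E"
    using E by (simp add: extension_closed_def)
  from bspec[OF this w] have "cone C X Y \<alpha> \<in> E \<longrightarrow> Y \<in> E"
    using X Dom_ty[OF ty_cl[OF \<alpha>(1)]] Cod_ty[OF ty_cl[OF \<alpha>(1)]] Cod_ty[OF ty_cl[OF cm_cone_in[OF \<alpha>(1)]]] by simp
  ultimately show ?thesis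
    by simp
qed

lemma ext_split:
  assumes E: "extension_closed (Kb C) E" and ex: "split_exact C X M Z u v \<rho> \<sigma>" and XZ: "X \<in> E" "Z \<in> E"
  shows "M \<in> E"
proof -
  obtain \<phi> w where "cm C Z (cone C X M u) \<phi>" "arr_iso (Kb C) (cl C Z (cone C X M u) \<phi>)"
    "cl C Z (cone C X M u) \<phi> \<cdot>\<^bsub>Kb C\<^esub> cl C M Z v = cl C M (cone C X M u) (\<lambda>n. inr C (obj_at X (n + 1)) (obj_at M n))"
    and w: "(cl C X M u, cl C M Z v, w) \<in> Dist (Kb C)"
    using split_exact_triangle[OF ex] .
  have c: "cm C X M u" "cm C M Z v"
    using ex by (auto simp: split_exact_def)
  have "\<forall>(u, v, w)\<in>Dist (Kb C). Dom (Kb C) u \<in> E \<and> Cod (Kb C) v \<in> E \<longrightarrow> Cod (Kb C) u \<in> E"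
    using E by (simp add: extension_closed_def)
  from bspec[OF this w] show ?thesis
    using XZ Dom_ty[OF ty_cl[OF c(1)]] Cod_ty[OF ty_cl[OF c(1)]] Cod_ty[OF ty_cl[OF c(2)]] by simp
qed

text \<open>\<open>m\<close> restricts to \<open>b\<close> on the first summands and induces
  \<open>a\<close> on the second ones, so it is triangular with diagonal \<open>b\<close>,
  \<open>a\<close>. The three two-term complexes then form a degreewise split sequence.\<close>

lemma ext_triangular:
  assumes "extension_closed (Kb C) E" "ty C b = tp B B'" "ty C m = tp M M'" "ty C a = tp A A'"
    "bip C B A M i j p q" "bip C B' A' M' i' j' p' q'" "m \<cdot> i = i' \<cdot> b" "a \<cdot> q = q' \<cdot> m"
    "cone_of C b \<in> E" "cone_of C a \<in> E"
  shows "cone_of C m \<in> E"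
  using ext_split[OF assms(1) two_term_split_exact[OF assms(2-8)]] assms(9,10) unfolding cone_of_def by blast

text \<open>The cone of an identity is contractible, hence a zero object.\<close>

lemma ext_Ident:
  assumes E: "extension_closed (Kb C) E" and X: "X \<in> Obj C"
  shows "cone_of C (Ident C X) \<in> E"
proof -
  have e: "dz C (emb_obj C X) (emb_obj C X) (Ident C X) = (\<lambda>n. Ident C (obj_at (emb_obj C X) n))"
    by (rule ext) (simp add: dz_def emb_simps zero_obj_Ident)
  show ?thesis
    using ext_iso[OF E cone_emb_isomorphic[OF ty_Ident[OF X]]] cone_Ident_zero[OF emb_cx[OF X]] E
    unfolding e by (simp add: extension_closed_def)
qed

text \<open>The cones are isomorphic through \<open>-id\<close> on the source and the identity on
  the target. A shift negates the differential, so this is called for whenever shifts meet a class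
  that is closed under extensions only.\<close>

lemma ext_neg:
  assumes E: "extension_closed (Kb C) E" and s: "ty C s = tp X Y" and c: "cone_of C s \<in> E"
  shows "cone_of C (\<boxminus> s) \<in> E"
proof -
  note o[simp] = ty_Dom_Obj[OF s] ty_Cod_Obj[OF s] zero_obj_Obj
  note n = ty_neg[OF s]
  have "isomorphic (Kb C) (cone_of C s) (cone_of C (\<boxminus> s))"
    unfolding cone_of_def
  proof (rule isomorphic_strict[OF cm_two_term[OF s n, of "\<boxminus> (Ident C X)" "Ident C Y"], where \<psi> = "tt C (-1) (\<boxminus> (Ident C X)) (Ident C Y)"])
    show "\<boxminus> s \<cdot> \<boxminus> (Ident C X) = Ident C Y \<cdot> s"
      using s by (simp add: arr_ty arr_neg comp_Ident_l comp_Ident_r)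
    have II: "\<boxminus> (Ident C X) \<cdot> \<boxminus> (Ident C X) = Ident C X"
      by (simp add: arr_ty arr_neg comp_Ident_l[OF ty_Ident])
    show "tt C (- 1) (\<boxminus> (Ident C X)) (Ident C Y) k \<cdot> tt C (- 1) (\<boxminus> (Ident C X)) (Ident C Y) k = Ident C (obj_at (two_term C (- 1) s) k)"
      "tt C (- 1) (\<boxminus> (Ident C X)) (Ident C Y) k \<cdot> tt C (- 1) (\<boxminus> (Ident C X)) (Ident C Y) k = Ident C (obj_at (two_term C (- 1) (\<boxminus> s)) k)" for k
      using II by (simp_all add: tt_def two_term_simps[OF s] two_term_simps[OF n] comp_Ident_l[OF ty_Ident] comp_Zero_l[OF ty_Zero] zero_obj_Ident)
  qed (simp_all add: arr_ty tt_def two_term_simps[OF s] two_term_simps[OF n])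
  then show ?thesis
    using ext_iso[OF E _ c] by blast
qed

text \<open>Ensures that the intersection defining the closure runs over a nonempty family and
  therefore stays inside the objects of the category.\<close>

lemma extension_closed_Obj: "extension_closed (Kb C) (Obj (Kb C))"
  unfolding extension_closed_def
proof (intro conjI ballI)
  show "\<forall>X. zero_object (Kb C) X \<longrightarrow> X \<in> Obj (Kb C)"
    by (simp add: zero_object_def)
  fix x assume "x \<in> Dist (Kb C)"
  then have "fst x \<in> Arr (Kb C)"
    by (auto simp: Kb_simps(10) Kb_triangles_def Let_def) (simp add: Kb_def Let_def)
  then show "case x of (u, v, w) \<Rightarrow> Dom (Kb C) u \<in> Obj (Kb C) \<and> Cod (Kb C) v \<in> Obj (Kb C) \<longrightarrow> Cod (Kb C) u \<in> Obj (Kb C)"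
    using preadditive_category.Cod_Obj[OF Kb_preadditive] by (auto split: prod.splits)
qed simp

lemma triangulated_subcat_Obj: "triangulated_subcat (Kb C) (Obj (Kb C))"
  unfolding triangulated_subcat_def
proof (intro conjI ballI)
  show "\<forall>X. zero_object (Kb C) X \<longrightarrow> X \<in> Obj (Kb C)"
    by (simp add: zero_object_def)
  show "\<forall>X Y. isomorphic (Kb C) X Y \<and> X \<in> Obj (Kb C) \<longrightarrow> Y \<in> Obj (Kb C)"
    using preadditive_category.isomorphic_ty[OF Kb_preadditive] preadditive_category.ty_Cod_Obj[OF Kb_preadditive] by blast
  show "X \<in> Obj (Kb C) \<Longrightarrow> (Shift (Kb C) X \<in> Obj (Kb C)) = (X \<in> Obj (Kb C))" for X
    by (simp add: Kb_simps shift_cx)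
  fix x assume "x \<in> Dist (Kb C)"
  then have "fst (snd x) \<in> Arr (Kb C)"
    by (auto simp: Kb_simps(10) Kb_triangles_def Let_def) (simp add: Kb_def Let_def)
  then show "case x of (u, v, w) \<Rightarrow> Dom (Kb C) u \<in> Obj (Kb C) \<and> Cod (Kb C) u \<in> Obj (Kb C) \<longrightarrow> Cod (Kb C) v \<in> Obj (Kb C)"
    using preadditive_category.Cod_Obj[OF Kb_preadditive] by (auto split: prod.splits)
qed simp

lemma extension_closed_closure:
  assumes "B \<subseteq> Obj (Kb C)"
  shows "extension_closed (Kb C) (extension_closure (Kb C) B)"
proof -
  have "Obj (Kb C) \<in> {E. extension_closed (Kb C) E \<and> B \<subseteq> E}"
    using assms extension_closed_Obj by blast
  then have s: "extension_closure (Kb C) B \<subseteq> Obj (Kb C)"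
    unfolding extension_closure_def by blast
  have G: "X \<in> extension_closure (Kb C) B \<longleftrightarrow> (\<forall>M. extension_closed (Kb C) M \<longrightarrow> B \<subseteq> M \<longrightarrow> X \<in> M)" for X
    by (auto simp: extension_closure_def)
  have 1: "zero_object (Kb C) X \<Longrightarrow> X \<in> extension_closure (Kb C) B" for X
    unfolding G by (simp add: extension_closed_def)
  have 2: "Cod (Kb C) u \<in> extension_closure (Kb C) B"
    if d: "(u, v, w) \<in> Dist (Kb C)" and u: "Dom (Kb C) u \<in> extension_closure (Kb C) B"
      and v: "Cod (Kb C) v \<in> extension_closure (Kb C) B" for u v w
    unfolding G
  proof (intro allI impI)
    fix M assume M: "extension_closed (Kb C) M" "B \<subseteq> M"
    have "\<forall>(u, v, w)\<in>Dist (Kb C). Dom (Kb C) u \<in> M \<and> Cod (Kb C) v \<in> M \<longrightarrow> Cod (Kb C) u \<in> M"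
      using M by (simp add: extension_closed_def)
    from bspec[OF this d] show "Cod (Kb C) u \<in> M"
      using u v M unfolding G by simp
  qed
  show ?thesis
    unfolding extension_closed_def[of _ "extension_closure (Kb C) B"] using s 1 2 by blast
qed

lemma triangulated_subcat_generated:
  assumes "B \<subseteq> Obj (Kb C)"
  shows "triangulated_subcat (Kb C) (triangulated_generated (Kb C) B)"
proof -
  let ?G = "triangulated_generated (Kb C) B"
  have "Obj (Kb C) \<in> {E. triangulated_subcat (Kb C) E \<and> B \<subseteq> E}"
    using assms triangulated_subcat_Obj by blast
  then have s: "?G \<subseteq> Obj (Kb C)"
    unfolding triangulated_generated_def by blast
  have G: "X \<in> ?G \<longleftrightarrow> (\<forall>M. triangulated_subcat (Kb C) M \<longrightarrow> B \<subseteq> M \<longrightarrow> X \<in> M)" for X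
    by (auto simp: triangulated_generated_def)
  have 1: "zero_object (Kb C) X \<Longrightarrow> X \<in> ?G" for X
    unfolding G by (simp add: triangulated_subcat_def)
  have 2: "isomorphic (Kb C) X Y \<Longrightarrow> X \<in> ?G \<Longrightarrow> Y \<in> ?G" for X Y
    unfolding G triangulated_subcat_def by blast
  have 3: "X \<in> Obj (Kb C) \<Longrightarrow> (Shift (Kb C) X \<in> ?G) = (X \<in> ?G)" for X
    unfolding G by (auto simp: triangulated_subcat_def)
  have 4: "Cod (Kb C) v \<in> ?G"
    if d: "(u, v, w) \<in> Dist (Kb C)" and u: "Dom (Kb C) u \<in> ?G" and v: "Cod (Kb C) u \<in> ?G" for u v w
    unfolding G
  proof (intro allI impI)
    fix M assume M: "triangulated_subcat (Kb C) M" "B \<subseteq> M"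
    have "\<forall>(u, v, w)\<in>Dist (Kb C). Dom (Kb C) u \<in> M \<and> Cod (Kb C) u \<in> M \<longrightarrow> Cod (Kb C) v \<in> M"
      using M by (simp add: triangulated_subcat_def)
    from bspec[OF this d] show "Cod (Kb C) v \<in> M"
      using u v M unfolding G by simp
  qed
  show ?thesis
    unfolding triangulated_subcat_def[of _ ?G] using s 1 2 3 4 by blast
qed

end

context triangulated_subcategory
begin

text \<open>The middle vertex is the kernel of the projection of the cone to the shift of the first
  vertex, and both of these lie in \<open>N\<close>. This is what will place \<open>D\<close> inside
  \<open>DD\<close>.\<close>

lemma N_extension_closed: "extension_closed (Kb C) N"
  unfolding extension_closed_def
proof (intro conjI ballI)
  show "N \<subseteq> Obj (Kb C)"
    using N_cx by (auto simp: Kb_simps)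
  show "\<forall>X. zero_object (Kb C) X \<longrightarrow> X \<in> N"
    using N_zero by blast
  fix x assume x: "x \<in> Dist (Kb C)"
  obtain u v w where e: "x = (u, v, w)"
    by (cases x)
  have "u \<in> Arr (Kb C)"
    using x e by (auto simp: Kb_simps(10) Kb_triangles_def Let_def) (simp add: Kb_def Let_def)
  then obtain f where f: "cm C (Dom (Kb C) u) (Cod (Kb C) u) f" "u = cl C (Dom (Kb C) u) (Cod (Kb C) u) f"
    using ty_clE[OF ty_Arr] by blast
  have "Cod (Kb C) u \<in> N" if "Dom (Kb C) u \<in> N" "Cod (Kb C) v \<in> N"
  proof (rule N_split_left[OF split_exact_cone[OF f(1)]])
    show "cone C (Dom (Kb C) u) (Cod (Kb C) u) f \<in> N"
      by (rule N_iso[OF dist_cone_isomorphic[OF f(1)] that(2)]) (use x e f(2) in simp)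
    show "shift_cplx C (Dom (Kb C) u) \<in> N"
      using that(1) N_shift cmD(1)[OF f(1)] by simp
  qed
  then show "case x of (u, v, w) \<Rightarrow> Dom (Kb C) u \<in> N \<and> Cod (Kb C) v \<in> N \<longrightarrow> Cod (Kb C) u \<in> N"
    using e by simp
qed

end

section \<open>Calculus of presented arrows in the quotient\<close>

context preadditive_category
begin

lemma arr_inv:
  assumes "arr_iso C f" "ty C f = tp X Y"
  shows "ty C (arr_inv C f) = tp Y X" "arr_inv C f \<cdot> f = Ident C X" "f \<cdot> arr_inv C f = Ident C Y"
proof -
  obtain g where g: "ty C g = tp Y X" "g \<cdot> f = Ident C X" "f \<cdot> g = Ident C Y"
    using arr_isoE[OF assms] .
  have u: "h = g" if "ty C h = tp Y X" "h \<cdot> f = Ident C X" for h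
  proof -
    have "h = (h \<cdot> f) \<cdot> g"
      using that(1) g(1,3) assms(2) by (simp add: comp_assoc comp_Ident_r)
    then show ?thesis
      using that(2) g(1) by (simp add: comp_Ident_l)
  qed
  have "arr_inv C f = g"
    unfolding arr_inv_def Hom_ty Dom_ty[OF assms(2)] Cod_ty[OF assms(2)]
    using g u by (intro the_equality) blast+
  then show "ty C (arr_inv C f) = tp Y X" "arr_inv C f \<cdot> f = Ident C X" "f \<cdot> arr_inv C f = Ident C Y"
    using g by auto
qed

lemma arr_inv_comp_eq:
  assumes "arr_iso C t" "ty C t = tp X Y" "ty C y = tp Z X" "t \<cdot> y = i"
  shows "arr_inv C t \<cdot> i = y"
  using arr_inv[OF assms(1,2)] comp_assoc[OF assms(3,2) arr_inv(1)[OF assms(1,2)]] assms(4)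
  by (simp add: comp_Ident_l[OF assms(3)])

end

context additive_category
begin

lemma oplus_eq:
  assumes "ty C f = tp X Y" "ty C g = tp Z W"
  shows "oplus C f g = inl C Y W \<cdot> f \<cdot> prl C X Z \<boxplus> inr C Y W \<cdot> g \<cdot> prr C X Z"
proof -
  note [simp] = assms ty_Dom_Obj[OF assms(1)] ty_Dom_Obj[OF assms(2)] ty_Cod_Obj[OF assms(1)] ty_Cod_Obj[OF assms(2)]
  show ?thesis
    unfolding oplus_def Dom_ty[OF assms(1)] Dom_ty[OF assms(2)] Cod_ty[OF assms(1)] Cod_ty[OF assms(2)]
    by (simp add: matarr_22[of _ X Y _ Z] arr_ty bin arr_mult)
qed

end

context triangulated_subcategory
begin

section \<open>The functor from the additive category to the quotient\<close>

abbreviation "VQ \<equiv> verdier_quotient (Kb C) N"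
abbreviation "qa \<equiv> quot_arr C N"

lemma qa_qm: "qa f = Q.qm (emb_arr C f)"
  by (simp add: quot_arr_def)

lemma ty_qa: "ty C f = tp X Y \<Longrightarrow> ty VQ (qa f) = tp (emb_obj C X) (emb_obj C Y)"
  by (simp add: qa_qm Q.ty_qm ty_emb_arr)

lemma qa_Comp: "\<lbrakk>ty C f = tp X Y; ty C g = tp Y Z\<rbrakk> \<Longrightarrow> qa (g \<cdot> f) = qa g \<cdot>\<^bsub>VQ\<^esub> qa f"
  by (simp add: qa_qm Q.qm_Comp[OF ty_emb_arr ty_emb_arr] emb_arr_Comp)

lemma qa_Add: "\<lbrakk>ty C f = tp X Y; ty C g = tp X Y\<rbrakk> \<Longrightarrow> qa (f \<boxplus> g) = qa f \<boxplus>\<^bsub>VQ\<^esub> qa g"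
  by (simp add: qa_qm Q.qm_Add[OF ty_emb_arr ty_emb_arr] emb_arr_Add)

lemma emb_Obj: "X \<in> Obj C \<Longrightarrow> emb_obj C X \<in> Obj (Kb C)" "X \<in> Obj C \<Longrightarrow> emb_obj C X \<in> Obj VQ"
  by (simp_all add: Kb_simps(1) Q.V_simps(1) emb_cx)

lemma qa_Ident: "X \<in> Obj C \<Longrightarrow> qa (Ident C X) = Ident VQ (emb_obj C X)"
  by (simp add: qa_qm emb_arr_Ident Q.qm_Ident emb_Obj)

lemma qa_Zero: "\<lbrakk>X \<in> Obj C; Y \<in> Obj C\<rbrakk> \<Longrightarrow> qa (Zero C X Y) = Zero VQ (emb_obj C X) (emb_obj C Y)"
  by (simp add: qa_qm emb_arr_Zero Q.qm_Zero emb_Obj)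

lemma qa_neg:
  assumes "ty C f = tp X Y"
  shows "qa (\<boxminus> f) = \<boxminus>\<^bsub>VQ\<^esub> (qa f)"
  using V.neg_unique[OF ty_qa[OF assms] ty_qa[OF ty_neg[OF assms]]] qa_Add[OF ty_neg[OF assms] assms]
    add_neg_l[OF assms] qa_Zero[OF ty_Dom_Obj[OF assms] ty_Cod_Obj[OF assms]] by simp

lemma qa_iso:
  assumes s: "ty C s = tp X Y" and c: "cone_of C s \<in> N"
  shows "arr_iso VQ (qa s)"
proof -
  have "emb_arr C s \<in> W"
    unfolding emb_arr_cl[OF s] W_iff[OF cm_dz_emb[OF s]]
    using N_iso_iff[OF cone_emb_isomorphic[OF s]] c by simp
  then show ?thesis
    unfolding qa_qm by (rule Q.qm_iso)
qed

text \<open>An additive functor preserves biproducts. Matrices can therefore be computed in the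
  quotient with the images of the chosen injections and projections.\<close>

lemma qa_bip:
  assumes b: "bip C X Y P i j p q"
  shows "bip VQ (emb_obj C X) (emb_obj C Y) (emb_obj C P) (qa i) (qa j) (qa p) (qa q)"
proof -
  note t = bipD(1-4)[OF b]
  show ?thesis
    unfolding bip_def
    by (simp add: ty_qa[OF t(1)] ty_qa[OF t(2)] ty_qa[OF t(3)] ty_qa[OF t(4)]
        qa_Comp[OF t(1) t(3), symmetric] qa_Comp[OF t(2) t(3), symmetric] qa_Comp[OF t(1) t(4), symmetric]
        qa_Comp[OF t(2) t(4), symmetric] qa_Comp[OF t(3) t(1), symmetric] qa_Comp[OF t(4) t(2), symmetric]
        qa_Add[OF ty_Comp[OF t(3) t(1)] ty_Comp[OF t(4) t(2)], symmetric] bipD[OF b] qa_Ident qa_Zero)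
qed

text \<open>
  With \<open>w\<close> the composite of the second and third factor of a presented arrow, the defining
  equation \<open>s w = i\<close> avoids inverses altogether.
\<close>

lemma presentation:
  assumes s: "ty C s = tp C' Cs" "cone_of C s \<in> N" and i: "ty C i = tp A Cs"
  defines "w \<equiv> arr_inv VQ (qa s) \<cdot>\<^bsub>VQ\<^esub> qa i"
  shows "ty VQ w = tp (emb_obj C A) (emb_obj C C')" "qa s \<cdot>\<^bsub>VQ\<^esub> w = qa i"
proof -
  note v = V.arr_inv[OF qa_iso[OF s] ty_qa[OF s(1)]]
  show "ty VQ w = tp (emb_obj C A) (emb_obj C C')"
    unfolding w_def by (rule V.ty_Comp[OF ty_qa[OF i] v(1)])
  show "qa s \<cdot>\<^bsub>VQ\<^esub> w = qa i"
    unfolding w_def using V.reassoc[OF v(3) ty_qa[OF s(1)] v(1) ty_qa[OF i]] V.comp_Ident_l[OF ty_qa[OF i]] by simp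
qed

section \<open>Direct sum, composite and sum of presented arrows\<close>

context
  fixes A1 A1' C1 C1' s1 i1 g1 w1 A2 A2' C2 C2' s2 i2 g2 w2
  assumes o: "A1 \<in> Obj C" "A1' \<in> Obj C" "C1 \<in> Obj C" "C1' \<in> Obj C" "A2 \<in> Obj C" "A2' \<in> Obj C" "C2 \<in> Obj C" "C2' \<in> Obj C"
    and t: "ty C s1 = tp C1' C1" "ty C i1 = tp A1 C1" "ty C g1 = tp C1' A1'"
      "ty C s2 = tp C2' C2" "ty C i2 = tp A2 C2" "ty C g2 = tp C2' A2'"
    and w: "ty VQ w1 = tp (emb_obj C A1) (emb_obj C C1')" "qa s1 \<cdot>\<^bsub>VQ\<^esub> w1 = qa i1"
      "ty VQ w2 = tp (emb_obj C A2) (emb_obj C C2')" "qa s2 \<cdot>\<^bsub>VQ\<^esub> w2 = qa i2"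
begin

lemma presented_oplus:
  assumes iso: "arr_iso VQ (qa (oplus C s1 s2))"
  shows "quot_oplus C N [A1, A2] [A1', A2'] (qa g1 \<cdot>\<^bsub>VQ\<^esub> w1) (qa g2 \<cdot>\<^bsub>VQ\<^esub> w2) =
    qa (oplus C g1 g2) \<cdot>\<^bsub>VQ\<^esub> arr_inv VQ (qa (oplus C s1 s2)) \<cdot>\<^bsub>VQ\<^esub> qa (oplus C i1 i2)"
proof -
  note tb = bin(1-5)[OF o(3,7)] bin(1-5)[OF o(4,8)] bin(1-5)[OF o(1,5)] bin(1-5)[OF o(2,6)]
  note ar = o t w tb arr_ty emb_Obj ty_qa[OF t(1)] ty_qa[OF t(2)] ty_qa[OF t(3)] ty_qa[OF t(4)] ty_qa[OF t(5)] ty_qa[OF t(6)]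
    V.bipD(1-4,8-11,13-16)[OF qa_bip[OF bip_dsum[OF o(3,7)]]] V.bipD(1-4,8-11,13-16)[OF qa_bip[OF bip_dsum[OF o(4,8)]]]
    V.bipD(1-4,8-11,13-16)[OF qa_bip[OF bip_dsum[OF o(1,5)]]] V.bipD(1-4,8-11,13-16)[OF qa_bip[OF bip_dsum[OF o(2,6)]]]
    w(2,4)[THEN V.reassoc]
  let ?y = "qa (inl C C1' C2') \<cdot>\<^bsub>VQ\<^esub> w1 \<cdot>\<^bsub>VQ\<^esub> qa (prl C A1 A2) \<boxplus>\<^bsub>VQ\<^esub> qa (inr C C1' C2') \<cdot>\<^bsub>VQ\<^esub> w2 \<cdot>\<^bsub>VQ\<^esub> qa (prr C A1 A2)"
  have ts: "ty C (oplus C s1 s2) = tp (dsum C [C1', C2']) (dsum C [C1, C2])"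
    by (simp add: oplus_eq[OF t(1,4)] ar)
  have "arr_inv VQ (qa (oplus C s1 s2)) \<cdot>\<^bsub>VQ\<^esub> qa (oplus C i1 i2) = ?y"
  proof (rule V.arr_inv_comp_eq[OF iso ty_qa[OF ts]])
    show "ty VQ ?y = tp (emb_obj C (dsum C [A1, A2])) (emb_obj C (dsum C [C1', C2']))"
      by (simp add: ar V.arr_ty)
    show "qa (oplus C s1 s2) \<cdot>\<^bsub>VQ\<^esub> ?y = qa (oplus C i1 i2)"
      by (simp add: oplus_eq[OF t(1,4)] oplus_eq[OF t(2,5)] qa_Comp qa_Add ar V.arr_calc)
  qed
  then show ?thesis
    by (simp add: quot_oplus_def Let_def oplus_eq[OF t(3,6)] qa_Comp qa_Add ar V.arr_calc
        inl_def[symmetric] inr_def[symmetric, unfolded One_nat_def] prl_def[symmetric] prr_def[symmetric, unfolded One_nat_def])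
qed

lemma presented_comp:
  assumes e: "A1 = A2'"
  defines "u \<equiv> matarr C [C2', C1'] [C2, C1] [[s2, Zero C C1' C2], [\<boxminus> (i1 \<cdot> g2), s1]]"
  assumes iso: "arr_iso VQ (qa u)"
  shows "(qa g1 \<cdot>\<^bsub>VQ\<^esub> w1) \<cdot>\<^bsub>VQ\<^esub> (qa g2 \<cdot>\<^bsub>VQ\<^esub> w2) =
    qa (matarr C [C2', C1'] [A1'] [[Zero C C2' A1', g1]]) \<cdot>\<^bsub>VQ\<^esub> arr_inv VQ (qa u) \<cdot>\<^bsub>VQ\<^esub>
      qa (matarr C [A2] [C2, C1] [[i2], [Zero C A2 C1]])"
proof -
  note t6 = t(6)[folded e]
  note tb = bin(1-5)[OF o(7,3)] bin(1-5)[OF o(8,4)]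
  note ar = o t(1-5) t6 w tb arr_ty emb_Obj ty_qa[OF t(1)] ty_qa[OF t(2)] ty_qa[OF t(3)] ty_qa[OF t(4)] ty_qa[OF t(5)] ty_qa[OF t6]
    V.bipD(1-4,8-11,13-16)[OF qa_bip[OF bip_dsum[OF o(7,3)]]] V.bipD(1-4,8-11,13-16)[OF qa_bip[OF bip_dsum[OF o(8,4)]]]
    w(2,4)[THEN V.reassoc]
  have u: "u = inl C C2 C1 \<cdot> s2 \<cdot> prl C C2' C1' \<boxplus> (inr C C2 C1 \<cdot> \<boxminus> (i1 \<cdot> g2) \<cdot> prl C C2' C1' \<boxplus> inr C C2 C1 \<cdot> s1 \<cdot> prr C C2' C1')"
    unfolding u_def by (simp add: matarr_22[of _ C2' C2 _ C1'] ar arr_mult)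
  have tu: "ty C u = tp (dsum C [C2', C1']) (dsum C [C2, C1])"
    unfolding u by (simp add: ar)
  \<comment> \<open>The solution of the triangular system \<open>s2 y1 = i2\<close>,
    \<open>-(i1 g2) y1 + s1 y2 = 0\<close>: the first row gives \<open>y1 = w2\<close>, and then
    \<open>y2 = w1 g2 w2\<close> because \<open>s1 w1 = i1\<close>.\<close>
  let ?y = "qa (inl C C2' C1') \<cdot>\<^bsub>VQ\<^esub> w2 \<boxplus>\<^bsub>VQ\<^esub> qa (inr C C2' C1') \<cdot>\<^bsub>VQ\<^esub> w1 \<cdot>\<^bsub>VQ\<^esub> qa g2 \<cdot>\<^bsub>VQ\<^esub> w2"
  have "arr_inv VQ (qa u) \<cdot>\<^bsub>VQ\<^esub> qa (matarr C [A2] [C2, C1] [[i2], [Zero C A2 C1]]) = ?y"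
  proof (rule V.arr_inv_comp_eq[OF iso ty_qa[OF tu]])
    show "ty VQ ?y = tp (emb_obj C A2) (emb_obj C (dsum C [C2', C1']))"
      by (simp add: ar V.arr_ty)
    show "qa u \<cdot>\<^bsub>VQ\<^esub> ?y = qa (matarr C [A2] [C2, C1] [[i2], [Zero C A2 C1]])"
      unfolding u
      by (simp add: matarr_21[of _ A2 C2] qa_Comp qa_Add qa_neg qa_Zero ar arr_mult V.arr_calc)
  qed
  then show ?thesis
    by (simp add: matarr_12[of _ C2' A1'] qa_Comp qa_Add qa_Zero ar arr_mult V.arr_calc)
qed

lemma presented_add:
  assumes e: "A1 = A2" "A1' = A2'" and iso: "arr_iso VQ (qa (oplus C s1 s2))"
  shows "(qa g1 \<cdot>\<^bsub>VQ\<^esub> w1) \<boxplus>\<^bsub>VQ\<^esub> (qa g2 \<cdot>\<^bsub>VQ\<^esub> w2) =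
    qa (matarr C [C1', C2'] [A1'] [[g1, g2]]) \<cdot>\<^bsub>VQ\<^esub> arr_inv VQ (qa (oplus C s1 s2)) \<cdot>\<^bsub>VQ\<^esub>
      qa (matarr C [A1] [C1, C2] [[i1], [i2]])"
proof -
  note t' = t(5,6)[folded e] w(3)[folded e]
  note tb = bin(1-5)[OF o(3,7)] bin(1-5)[OF o(4,8)]
  note ar = o t(1-4) t' w(1,2,4) tb arr_ty emb_Obj ty_qa[OF t(1)] ty_qa[OF t(2)] ty_qa[OF t(3)] ty_qa[OF t(4)]
    ty_qa[OF t'(1)] ty_qa[OF t'(2)]
    V.bipD(1-4,8-11,13-16)[OF qa_bip[OF bip_dsum[OF o(3,7)]]] V.bipD(1-4,8-11,13-16)[OF qa_bip[OF bip_dsum[OF o(4,8)]]]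
    w(2,4)[THEN V.reassoc]
  have ts: "ty C (oplus C s1 s2) = tp (dsum C [C1', C2']) (dsum C [C1, C2])"
    by (simp add: oplus_eq[OF t(1,4)] ar)
  let ?y = "qa (inl C C1' C2') \<cdot>\<^bsub>VQ\<^esub> w1 \<boxplus>\<^bsub>VQ\<^esub> qa (inr C C1' C2') \<cdot>\<^bsub>VQ\<^esub> w2"
  have "arr_inv VQ (qa (oplus C s1 s2)) \<cdot>\<^bsub>VQ\<^esub> qa (matarr C [A1] [C1, C2] [[i1], [i2]]) = ?y"
  proof (rule V.arr_inv_comp_eq[OF iso ty_qa[OF ts]])
    show "ty VQ ?y = tp (emb_obj C A1) (emb_obj C (dsum C [C1', C2']))"
      by (simp add: ar V.arr_ty)
    show "qa (oplus C s1 s2) \<cdot>\<^bsub>VQ\<^esub> ?y = qa (matarr C [A1] [C1, C2] [[i1], [i2]])"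
      by (simp add: oplus_eq[OF t(1,4)] matarr_21[of _ A1 C1] qa_Comp qa_Add ar V.arr_calc)
  qed
  then show ?thesis
    by (simp add: matarr_12[of _ C1' A1'] qa_Comp qa_Add ar V.arr_calc)
qed

end

end

section \<open>A normal form for the objects of the generated subcategory\<close>

definition bip_family :: "('o, 'm, 'z) acat_scheme \<Rightarrow> ('o, 'm) cplx \<Rightarrow> (int \<Rightarrow> 'o) \<Rightarrow> (int \<Rightarrow> 'o) \<Rightarrow>
    (int \<Rightarrow> 'm) \<Rightarrow> (int \<Rightarrow> 'm) \<Rightarrow> (int \<Rightarrow> 'm) \<Rightarrow> (int \<Rightarrow> 'm) \<Rightarrow> bool" where
  "bip_family C M Z T i j p q \<longleftrightarrow> (\<forall>n. bip C (Z n) (T n) (obj_at M n) (i n) (j n) (p n) (q n))"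

text \<open>
  Complexes \<open>M\<close> with a degreewise decomposition \<open>Z\<^sup>n \<oplus> T\<^sup>n\<close> such that the components
  \<open>Z\<^sup>n \<rightarrow> T\<^sup>n\<^sup>+\<^sup>1\<close> of the differential have their cones in \<open>E\<close>.
\<close>

definition good_complex :: "('o, 'm, 'z) acat_scheme \<Rightarrow> ('o, 'm) cplx set \<Rightarrow> ('o, 'm) cplx \<Rightarrow> bool" where
  "good_complex C E M \<longleftrightarrow> bounded_complex C M \<and> (\<exists>Z T i j p q. bip_family C M Z T i j p q \<and>
     (\<forall>n. cone_of C (q (n + 1) \<cdot>\<^bsub>C\<^esub> diff_at M n \<cdot>\<^bsub>C\<^esub> i n) \<in> E))"

context additive_category
begin

text \<open>Regroups \<open>(Z1 \<oplus> T1) \<oplus> (Z2 \<oplus> T2)\<close> as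
  \<open>(Z1 \<oplus> Z2) \<oplus> (T1 \<oplus> T2)\<close>, as needed to decompose the terms of a
  cone.\<close>

lemma bip_dsum_dsum:
  assumes b: "bip C Z1 T1 X1 i1 j1 p1 q1" "bip C Z2 T2 X2 i2 j2 p2 q2"
  shows "bip C (dsum C [Z1, Z2]) (dsum C [T1, T2]) (dsum C [X1, X2])
    (oplus C i1 i2) (oplus C j1 j2) (oplus C p1 p2) (oplus C q1 q2)"
proof -
  note t = bipD(1-4)[OF b(1)] bipD(1-4)[OF b(2)]
  note o = bipD(5-7)[OF b(1)] bipD(5-7)[OF b(2)]
  note [simp] = t o bin arr_ty bipD(8-11,13-16)[OF b(1)] bipD(8-11,13-16)[OF b(2)]
  have I: "oplus C i1 i2 \<cdot> oplus C p1 p2 \<boxplus> oplus C j1 j2 \<cdot> oplus C q1 q2 = Ident C (dsum C [X1, X2])"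
  proof -
    have "oplus C i1 i2 \<cdot> oplus C p1 p2 \<boxplus> oplus C j1 j2 \<cdot> oplus C q1 q2 =
        inl C X1 X2 \<cdot> ((i1 \<cdot> p1 \<boxplus> j1 \<cdot> q1) \<cdot> prl C X1 X2) \<boxplus> inr C X1 X2 \<cdot> ((i2 \<cdot> p2 \<boxplus> j2 \<cdot> q2) \<cdot> prr C X1 X2)"
      by (simp add: oplus_eq[OF t(1,5)] oplus_eq[OF t(2,6)] oplus_eq[OF t(3,7)] oplus_eq[OF t(4,8)] arr_calc)
    also have "\<dots> = Ident C (dsum C [X1, X2])"
      by (simp add: bipD(12)[OF b(1)] bipD(12)[OF b(2)] comp_Ident_l bin_Ident)
    finally show ?thesis .
  qed
  show ?thesis
    unfolding bip_def I
    by (simp add: oplus_eq[OF t(1,5)] oplus_eq[OF t(2,6)] oplus_eq[OF t(3,7)] oplus_eq[OF t(4,8)] bin_Ident[symmetric] arr_calc)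
qed

text \<open>The distinguished component of the cone's differential is triangular: its diagonal
  consists of the component of \<open>Y\<close> and the negative of the component of
  \<open>X\<close> one degree higher, and \<open>f\<close> contributes the corner. The cones of the
  diagonal entries determine that of the whole.\<close>

lemma good_complex_cone:
  assumes E: "extension_closed (Kb C) E" and f: "cm C X Y f" and g: "good_complex C E X" "good_complex C E Y"
  shows "good_complex C E (cone C X Y f)"
proof -
  obtain ZX TX iX jX pX qX where X: "bip C (ZX n) (TX n) (obj_at X n) (iX n) (jX n) (pX n) (qX n)"
    "cone_of C (qX (n + 1) \<cdot> diff_at X n \<cdot> iX n) \<in> E" for n
    using g(1) unfolding good_complex_def bip_family_def by blast
  obtain ZY TY iY jY pY qY where Y: "bip C (ZY n) (TY n) (obj_at Y n) (iY n) (jY n) (pY n) (qY n)"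
    "cone_of C (qY (n + 1) \<cdot> diff_at Y n \<cdot> iY n) \<in> E" for n
    using g(2) unfolding good_complex_def bip_family_def by blast
  let ?i = "\<lambda>n. oplus C (iX (n + 1)) (iY n)" and ?j = "\<lambda>n. oplus C (jX (n + 1)) (jY n)"
  let ?p = "\<lambda>n. oplus C (pX (n + 1)) (pY n)" and ?q = "\<lambda>n. oplus C (qX (n + 1)) (qY n)"
  note tX[simp] = bipD(1-7)[OF X(1)] and tY[simp] = bipD(1-7)[OF Y(1)]
  note [simp] = cmD(1-3)[OF f] cxD[OF cmD(1)[OF f]] cxD[OF cmD(2)[OF f]] int_shift_simps arr_ty bin
  have "cone_of C (?q (n + 1) \<cdot> diff_at (cone C X Y f) n \<cdot> ?i n) \<in> E" (is "cone_of C ?k \<in> E") for n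
  proof -
    let ?kX = "qX (n + 2) \<cdot> diff_at X (n + 1) \<cdot> iX (n + 1)" and ?kY = "qY (n + 1) \<cdot> diff_at Y n \<cdot> iY n"
    have k: "?k = dif C (inr C (TX (n + 2)) (TY (n + 1)) \<cdot> qY (n + 1) \<cdot> f (n + 1) \<cdot> iX (n + 1) \<cdot> prl C (ZX (n + 1)) (ZY n) \<boxplus>
        inr C (TX (n + 2)) (TY (n + 1)) \<cdot> ?kY \<cdot> prr C (ZX (n + 1)) (ZY n))
        (inl C (TX (n + 2)) (TY (n + 1)) \<cdot> ?kX \<cdot> prl C (ZX (n + 1)) (ZY n))"
      by (simp add: oplus_eq[of _ "ZX (n + 1)" "obj_at X (n + 1)" _ "ZY n" "obj_at Y n"]
          oplus_eq[of _ "obj_at X (n + 2)" "TX (n + 2)" _ "obj_at Y (n + 1)" "TY (n + 1)"] cone_diff[OF f] arr_calc)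
    have tk: "ty C ?k = tp (dsum C [ZX (n + 1), ZY n]) (dsum C [TX (n + 2), TY (n + 1)])"
      unfolding k by simp
    \<comment> \<open>\<open>f\<close> leads from the part of \<open>X\<close> to the part of
      \<open>Y\<close>, so the second summand is the invariant one and the biproducts are read in
      reversed order.\<close>
    have bs: "bip C V U (dsum C [U, V]) (inr C U V) (inl C U V) (prr C U V) (prl C U V)"
      if "U \<in> Obj C" "V \<in> Obj C" for U V
      using bip_dsum[OF that] that by (simp add: bip_def add_comm)
    show ?thesis
    proof (rule ext_triangular[OF E _ tk _ bs bs])
      show "ty C ?kY = tp (ZY n) (TY (n + 1))" "ty C (\<boxminus> ?kX) = tp (ZX (n + 1)) (TX (n + 2))"
        by simp_all
      show "?k \<cdot> inr C (ZX (n + 1)) (ZY n) = inr C (TX (n + 2)) (TY (n + 1)) \<cdot> ?kY"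
        unfolding k by (simp add: arr_calc)
      show "\<boxminus> ?kX \<cdot> prl C (ZX (n + 1)) (ZY n) = prl C (TX (n + 2)) (TY (n + 1)) \<cdot> ?k"
        unfolding k by (simp add: arr_calc)
      show "cone_of C ?kY \<in> E"
        using Y(2) .
      show "cone_of C (\<boxminus> ?kX) \<in> E"
        using ext_neg[OF E, of ?kX "ZX (n + 1)" "TX (n + 2)"] X(2)[of "n + 1"] by simp
    qed simp_all
  qed
  moreover have "bip_family C (cone C X Y f) (\<lambda>n. dsum C [ZX (n + 1), ZY n]) (\<lambda>n. dsum C [TX (n + 1), TY n]) ?i ?j ?p ?q"
    using bip_dsum_dsum[OF X(1) Y(1)] by (simp add: bip_family_def cone_obj)
  ultimately show ?thesis
    unfolding good_complex_def using cone_cx[OF f] by blast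
qed

text \<open>The decomposition moves along with the complex, and the components change by a
  sign.\<close>

lemma good_complex_shift:
  assumes E: "extension_closed (Kb C) E" and X: "good_complex C E X"
  shows "good_complex C E (shift_cplx C X)" "good_complex C E (unshift C X)"
proof -
  obtain Z T i j p q where b: "bip C (Z n) (T n) (obj_at X n) (i n) (j n) (p n) (q n)"
    and c: "cone_of C (q (n + 1) \<cdot> diff_at X n \<cdot> i n) \<in> E" for n
    using X unfolding good_complex_def bip_family_def by blast
  have cx: "bounded_complex C X"
    using X by (simp add: good_complex_def)
  note [simp] = bipD(1-7)[OF b] cxD[OF cx] arr_ty int_shift_simps
  have k: "cone_of C (q (n + 1) \<cdot> \<boxminus> (diff_at X n) \<cdot> i n) \<in> E" for n
    using ext_neg[OF E _ c, of n "Z n" "T (n + 1)"] by (simp add: comp_neg_l comp_neg_r)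
  have "bip_family C (shift_cplx C X) (\<lambda>n. Z (n + 1)) (\<lambda>n. T (n + 1)) (\<lambda>n. i (n + 1)) (\<lambda>n. j (n + 1)) (\<lambda>n. p (n + 1)) (\<lambda>n. q (n + 1))"
    using b by (simp add: bip_family_def shift_simps)
  moreover have "\<forall>n. cone_of C (q (n + 1 + 1) \<cdot> diff_at (shift_cplx C X) n \<cdot> i (n + 1)) \<in> E"
    using k[of "_ + 1"] by (simp add: shift_simps)
  ultimately show "good_complex C E (shift_cplx C X)"
    unfolding good_complex_def using shift_cx[OF cx] by blast
  have "bip_family C (unshift C X) (\<lambda>n. Z (n - 1)) (\<lambda>n. T (n - 1)) (\<lambda>n. i (n - 1)) (\<lambda>n. j (n - 1)) (\<lambda>n. p (n - 1)) (\<lambda>n. q (n - 1))"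
    using b by (simp add: bip_family_def shift_simps)
  moreover have "\<forall>n. cone_of C (q (n + 1 - 1) \<cdot> diff_at (unshift C X) n \<cdot> i (n - 1)) \<in> E"
    using k[of "_ - 1"] by (simp add: shift_simps)
  ultimately show "good_complex C E (unshift C X)"
    unfolding good_complex_def using unshift_cx[OF cx] by blast
qed

lemma bip_Ident:
  assumes "X \<in> Obj C"
  shows "bip C X (zero_obj C) X (Ident C X) (Zero C (zero_obj C) X) (Ident C X) (Zero C X (zero_obj C))"
    "bip C (zero_obj C) X X (Zero C (zero_obj C) X) (Ident C X) (Zero C X (zero_obj C)) (Ident C X)"
  using assms
  by (simp_all add: bip_def arr_ty zero_obj_Obj comp_Ident_l[OF ty_Ident] comp_Ident_l[OF ty_Zero] comp_Zero_l[OF ty_Zero]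
      comp_Ident_r[OF ty_Zero] zero_obj_Ident add_Zero_l[OF ty_Ident] add_Zero_r[OF ty_Ident])

text \<open>The source in degree -1 is taken as \<open>Z\<close>, the target in degree 0 as
  \<open>T\<close>. In every other degree the component is an arrow from the zero object to itself,
  hence an identity.\<close>

lemma good_complex_cone_of:
  assumes E: "extension_closed (Kb C) E" and s: "ty C s = tp X Y" and c: "cone_of C s \<in> E"
  shows "good_complex C E (cone_of C s)"
proof -
  note o[simp] = ty_Dom_Obj[OF s] ty_Cod_Obj[OF s] zero_obj_Obj
  let ?M = "two_term C (-1) s"
  let ?Z = "\<lambda>n::int. if n = -1 then X else zero_obj C" and ?T = "\<lambda>n::int. if n = 0 then Y else zero_obj C"
  let ?i = "\<lambda>n::int. if n = -1 then Ident C X else Zero C (zero_obj C) (obj_at ?M n)"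
  let ?j = "\<lambda>n::int. if n = 0 then Ident C Y else Zero C (zero_obj C) (obj_at ?M n)"
  let ?p = "\<lambda>n::int. if n = -1 then Ident C X else Zero C (obj_at ?M n) (zero_obj C)"
  let ?q = "\<lambda>n::int. if n = 0 then Ident C Y else Zero C (obj_at ?M n) (zero_obj C)"
  have b: "bip_family C ?M ?Z ?T ?i ?j ?p ?q"
    using bip_Ident bip_zero_obj by (simp add: bip_family_def two_term_simps[OF s])
  have "cone_of C (?q (n + 1) \<cdot> diff_at ?M n \<cdot> ?i n) \<in> E" for n
  proof (cases "n = -1")
    case True
    then show ?thesis
      using c s by (simp add: two_term_simps[OF s] comp_Ident_l comp_Ident_r)
  next
    case False
    have "ty C (?q (n + 1) \<cdot> diff_at ?M n \<cdot> ?i n) = tp (zero_obj C) (zero_obj C)"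
      using False s by (auto simp: two_term_simps[OF s] arr_ty)
    then have "?q (n + 1) \<cdot> diff_at ?M n \<cdot> ?i n = Ident C (zero_obj C)"
      using to_zero_obj zero_obj_Ident by simp
    then show ?thesis
      using ext_Ident[OF E] by simp
  qed
  then show ?thesis
    unfolding good_complex_def cone_of_def using b two_term_cx[OF s] by blast
qed

text \<open>All components are the arrow from the zero object to itself, which is an identity and so
  has its cone in \<open>E\<close>.\<close>

lemma good_complex_zero:
  assumes E: "extension_closed (Kb C) E"
  shows "good_complex C E (emb_obj C (zero_obj C))" "zero_object (Kb C) (emb_obj C (zero_obj C))"
proof -
  let ?z = "zero_obj C" and ?M = "emb_obj C (zero_obj C)"
  let ?o = "\<lambda>n::int. Zero C ?z ?z"
  have "bip_family C ?M (\<lambda>_. ?z) (\<lambda>_. ?z) ?o ?o ?o ?o"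
    using bip_zero_obj by (simp add: bip_family_def emb_simps)
  moreover have "\<forall>n. cone_of C (?o (n + 1) \<cdot> diff_at ?M n \<cdot> ?o n) \<in> E"
    using ext_Ident[OF E zero_obj_Obj] by (simp add: emb_simps zero_obj_Obj comp_Zero_l[OF ty_Zero] zero_obj_Ident)
  ultimately show "good_complex C E ?M"
    unfolding good_complex_def using emb_cx[OF zero_obj_Obj] by blast
  show "zero_object (Kb C) ?M"
    using emb_cx[OF zero_obj_Obj]
    by (simp add: preadditive_category.zero_object_iff[OF Kb_preadditive] Kb_simps emb_simps zero_obj_Ident)
qed

text \<open>Triangulated classes are closed under isomorphism, and so the good complexes are
  completed by their isomorphic copies. An arrow between two such objects is conjugated to one
  between good complexes; the cones are isomorphic, and the second one is good.\<close>

lemma good_complexes_triangulated: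
  assumes E: "extension_closed (Kb C) E"
  shows "triangulated_subcat (Kb C) {M. \<exists>M'. good_complex C E M' \<and> isomorphic (Kb C) M M'}" (is "triangulated_subcat _ ?G")
proof -
  interpret K: preadditive_category "Kb C"
    by (rule Kb_preadditive)
  have iso: "Y \<in> ?G" if "isomorphic (Kb C) X Y" "X \<in> ?G" for X Y
    using that K.isomorphic_trans[OF K.isomorphic_sym] by blast
  have Obj: "?G \<subseteq> Obj (Kb C)"
    using K.isomorphic_ty K.ty_Dom_Obj by blast
  have zero: "X \<in> ?G" if "zero_object (Kb C) X" for X
    using K.isomorphic_zero_objects[OF that good_complex_zero(2)[OF E]] good_complex_zero(1)[OF E] by blast
  have shift: "Shift (Kb C) X \<in> ?G \<longleftrightarrow> X \<in> ?G" if X: "X \<in> Obj (Kb C)" for X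
  proof
    have cx: "bounded_complex C X"
      using X by (simp add: Kb_simps)
    {
      assume "X \<in> ?G"
      then obtain M where M: "good_complex C E M" "isomorphic (Kb C) X M"
        by blast
      then show "Shift (Kb C) X \<in> ?G"
        using good_complex_shift(1)[OF E M(1)] isomorphic_shift[OF M(2)] by (auto simp: Kb_simps(9))
    next
      assume "Shift (Kb C) X \<in> ?G"
      then obtain M where M: "good_complex C E M" "isomorphic (Kb C) (shift_cplx C X) M"
        by (auto simp: Kb_simps(9))
      then show "X \<in> ?G"
        using good_complex_shift(2)[OF E M(1)] isomorphic_unshift[OF M(2)] shift_unshift(2)[OF cx] by auto
    }
  qed
  have cone: "Cod (Kb C) v \<in> ?G" if d: "(u, v, w) \<in> Dist (Kb C)" and uX: "Dom (Kb C) u \<in> ?G" "Cod (Kb C) u \<in> ?G" for u v w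
  proof -
    let ?X = "Dom (Kb C) u" and ?Y = "Cod (Kb C) u"
    have "u \<in> Arr (Kb C)"
      using d by (auto simp: Kb_simps(10) Kb_triangles_def Let_def) (simp add: Kb_def Let_def)
    note tu = ty_Arr[OF this]
    obtain f where f: "cm C ?X ?Y f" "u = cl C ?X ?Y f"
      using ty_clE[OF tu] .
    obtain X0 a where X0: "good_complex C E X0" "arr_iso (Kb C) a" "ty (Kb C) a = tp ?X X0"
      using uX(1) by (auto simp: K.isomorphic_ty)
    obtain Y0 b where Y0: "good_complex C E Y0" "arr_iso (Kb C) b" "ty (Kb C) b = tp ?Y Y0"
      using uX(2) by (auto simp: K.isomorphic_ty)
    obtain a' where a': "ty (Kb C) a' = tp X0 ?X" "a' \<cdot>\<^bsub>Kb C\<^esub> a = Ident (Kb C) ?X"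
      using K.arr_isoE[OF X0(2,3)] by blast
    have t0: "ty (Kb C) (b \<cdot>\<^bsub>Kb C\<^esub> (u \<cdot>\<^bsub>Kb C\<^esub> a')) = tp X0 Y0"
      using K.ty_Comp[OF K.ty_Comp[OF a'(1) tu] Y0(3)] .
    obtain f0 where f0: "cm C X0 Y0 f0" "b \<cdot>\<^bsub>Kb C\<^esub> (u \<cdot>\<^bsub>Kb C\<^esub> a') = cl C X0 Y0 f0"
      using ty_clE[OF t0] .
    have "b \<cdot>\<^bsub>Kb C\<^esub> cl C ?X ?Y f = cl C X0 Y0 f0 \<cdot>\<^bsub>Kb C\<^esub> a"
      unfolding f0(2)[symmetric] f(2)[symmetric]
      by (simp add: tu X0(3) Y0(3) a' K.arr_ty K.comp_assoc K.comp_Ident_r[OF tu])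
    from cone_isomorphic[OF f(1) f0(1) X0(2,3) Y0(2,3) this]
    have "isomorphic (Kb C) (cone C ?X ?Y f) (cone C X0 Y0 f0)" .
    moreover have "isomorphic (Kb C) (Cod (Kb C) v) (cone C ?X ?Y f)"
      by (rule dist_cone_isomorphic[OF f(1)]) (use d f(2) in simp)
    ultimately have "isomorphic (Kb C) (Cod (Kb C) v) (cone C X0 Y0 f0)"
      using K.isomorphic_trans by blast
    then show ?thesis
      using good_complex_cone[OF E f0(1) X0(1) Y0(1)] by blast
  qed
  show ?thesis
    unfolding triangulated_subcat_def
  proof (intro conjI allI impI ballI)
    fix x assume "x \<in> Dist (Kb C)"
    then show "case x of (u, v, w) \<Rightarrow> Dom (Kb C) u \<in> ?G \<and> Cod (Kb C) u \<in> ?G \<longrightarrow> Cod (Kb C) v \<in> ?G"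
      using cone by (cases x) blast
  qed (use Obj zero iso shift in blast)+
qed

end

section \<open>Vanishing in the quotient\<close>

lemma factors_through_Cb:
  assumes "chain_map C (ChMap X Y \<phi>)"
  shows "factors_through (Cb C) (ChMap X Y \<phi>) N \<longleftrightarrow>
    (\<exists>M\<in>N. \<exists>u v. cm C X M u \<and> cm C M Y v \<and> (\<forall>n. v n \<cdot>\<^bsub>C\<^esub> u n = \<phi> n))" (is "?L \<longleftrightarrow> ?R")
proof
  assume ?L
  then obtain M u v where "M \<in> N" "u \<in> Hom (Cb C) X M" "v \<in> Hom (Cb C) M Y" "v \<cdot>\<^bsub>Cb C\<^esub> u = ChMap X Y \<phi>"
    by (auto simp: factors_through_def Cb_def)
  moreover from this have "u = ChMap X M (arr_at u)" "v = ChMap M Y (arr_at v)"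
    by (cases u; cases v; auto simp: Hom_def Cb_def)+
  ultimately show ?R
    by (intro bexI[of _ M] exI[of _ "arr_at u"] exI[of _ "arr_at v"]) (auto simp: Hom_def Cb_def cm_def)
next
  assume ?R
  then obtain M u v where *: "M \<in> N" "cm C X M u" "cm C M Y v" "\<forall>n. v n \<cdot>\<^bsub>C\<^esub> u n = \<phi> n"
    by blast
  then have "ChMap X M u \<in> Hom (Cb C) X M" "ChMap M Y v \<in> Hom (Cb C) M Y"
    "ChMap M Y v \<cdot>\<^bsub>Cb C\<^esub> ChMap X M u = ChMap X Y \<phi>" "ChMap X Y \<phi> \<in> Arr (Cb C)"
    "Dom (Cb C) (ChMap X Y \<phi>) = X" "Cod (Cb C) (ChMap X Y \<phi>) = Y"
    using assms by (auto simp: Hom_def Cb_def cm_def)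
  then show ?L
    unfolding factors_through_def using *(1) by auto
qed

context triangulated_subcategory
begin

text \<open>If the arrow is killed by precomposing with some \<open>t\<close> inverted in the
  quotient, it extends strictly over the cone of \<open>t\<close>, an object of \<open>N\<close>.
  Conversely, for a factorization through \<open>M\<close> in \<open>N\<close>,
  \<open>W_kills\<close> annihilates the first factor.\<close>

lemma qm_zero_iff_factors:
  assumes f: "cm C X Y \<phi>"
  shows "Q.qm (cl C X Y \<phi>) = Zero VQ X Y \<longleftrightarrow> factors_through (Cb C) (ChMap X Y \<phi>) N"
  unfolding factors_through_Cb[OF f[unfolded cm_def]]
proof
  assume "Q.qm (cl C X Y \<phi>) = Zero VQ X Y"
  then obtain P t where t: "t \<in> W" "ty (Kb C) t = tp P X" "cl C X Y \<phi> \<cdot>\<^bsub>Kb C\<^esub> t = Zero (Kb C) P Y"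
    unfolding Q.qm_zero_iff[OF ty_cl[OF f]] by blast
  obtain \<tau> where \<tau>: "cm C P X \<tau>" "t = cl C P X \<tau>"
    using ty_clE[OF t(2)] .
  obtain u where u: "cm C (cone C P X \<tau>) Y u" "\<And>n. \<phi> n = u n \<cdot> cinr C P X n"
    using factor_through_cone[OF \<tau>(1) f] t(3) \<tau>(2) by auto
  have "cone C P X \<tau> \<in> N"
    using t(1) W_iff[OF \<tau>(1)] \<tau>(2) by simp
  then show "\<exists>M\<in>N. \<exists>u v. cm C X M u \<and> cm C M Y v \<and> (\<forall>n. v n \<cdot> u n = \<phi> n)"
    using cm_cone_in[OF \<tau>(1)] u by (intro bexI[of _ "cone C P X \<tau>"] exI[of _ "\<lambda>n. cinr C P X n"] exI[of _ u]) simp_all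
next
  assume "\<exists>M\<in>N. \<exists>u v. cm C X M u \<and> cm C M Y v \<and> (\<forall>n. v n \<cdot> u n = \<phi> n)"
  then obtain M u v where M: "M \<in> N" "cm C X M u" "cm C M Y v" "\<And>n. v n \<cdot> u n = \<phi> n"
    by blast
  obtain P t where t: "t \<in> W" "ty (Kb C) t = tp P X" "cl C X M u \<cdot>\<^bsub>Kb C\<^esub> t = Zero (Kb C) P M"
    using W_kills[OF ty_cl[OF M(2)] M(1)] .
  have "cl C X Y \<phi> = cl C M Y v \<cdot>\<^bsub>Kb C\<^esub> cl C X M u"
    unfolding cl_Comp[OF M(2,3)] by (simp add: M(4))
  then have "cl C X Y \<phi> \<cdot>\<^bsub>Kb C\<^esub> t = Zero (Kb C) P Y"
    using t(3) K.comp_assoc[OF t(2) ty_cl[OF M(2)] ty_cl[OF M(3)]]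
      K.comp_Zero_r[OF ty_cl[OF M(3)] K.ty_Dom_Obj[OF t(2)]] by simp
  then show "Q.qm (cl C X Y \<phi>) = Zero VQ X Y"
    unfolding Q.qm_zero_iff[OF ty_cl[OF f]] using t(1,2) by blast
qed

text \<open>Moves a cone from degrees -1 and 0 to degrees 0 and 1: the shift of the two-term complex
  is literally the cone of \<open>-s\<close>.\<close>

lemma N_two_term_zero:
  assumes s: "ty C s = tp X Y" and c: "cone_of C s \<in> N"
  shows "two_term C 0 s \<in> N"
proof -
  note o[simp] = ty_Dom_Obj[OF s] ty_Cod_Obj[OF s] zero_obj_Obj
  note n = ty_neg[OF s]
  have "shift_cplx C (two_term C 0 s) = cone_of C (\<boxminus> s)"
  proof (rule cplx.expand, intro conjI ext)
    fix k :: int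
    have k: "(k + 1 = 0) = (k = -1)"
      by auto
    show "obj_at (shift_cplx C (two_term C 0 s)) k = obj_at (cone_of C (\<boxminus> s)) k"
      by (simp add: cone_of_def shift_simps two_term_simps[OF s] two_term_simps[OF n] k)
    show "diff_at (shift_cplx C (two_term C 0 s)) k = diff_at (cone_of C (\<boxminus> s)) k"
      by (simp add: cone_of_def shift_simps two_term_simps[OF s] two_term_simps[OF n] k neg_Zero)
  qed
  then show ?thesis
    using ext_neg[OF N_extension_closed s c] N_shift[OF two_term_cx[OF s, of 0]] by simp
qed

end

text \<open>Lets the projection onto an embedded object be treated as a map of two-term complexes,
  to which \<open>two_term_split_exact\<close> applies.\<close>

lemma (in additive_category) emb_two_term:
  assumes "X \<in> Obj C"
  shows "two_term C 0 (Zero C X (zero_obj C)) = emb_obj C X"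
proof (rule cplx.expand, intro conjI ext)
  note t = ty_Zero[OF assms zero_obj_Obj]
  show "obj_at (two_term C 0 (Zero C X (zero_obj C))) k = obj_at (emb_obj C X) k" for k
    by (simp add: two_term_simps[OF t] emb_simps)
  show "diff_at (two_term C 0 (Zero C X (zero_obj C))) k = diff_at (emb_obj C X) k" for k
    by (simp add: two_term_simps[OF t] emb_simps)
qed

context triangulated_subcategory
begin

text \<open>
  In the quotient the projections \<open>\<pi>\<^sub>j: T \<rightarrow> C\<^sub>j'\<close> and the weak equivalence \<open>\<tau>: T \<rightarrow> A\<close>
  satisfy \<open>s\<^sub>j \<pi>\<^sub>j = - i\<^sub>j \<tau>\<close>, because row \<open>j\<close> of \<open>r\<close> is a null-homotopy.  Hence \<open>\<gamma> = (f\<^sub>2 - f\<^sub>1) \<tau>\<close>.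
\<close>

lemma presented_eq_iff:
  assumes o: "A \<in> Obj C" "A' \<in> Obj C" "C1 \<in> Obj C" "C1' \<in> Obj C" "C2 \<in> Obj C" "C2' \<in> Obj C"
    and t: "ty C s1 = tp C1' C1" "ty C i1 = tp A C1" "ty C g1 = tp C1' A'"
      "ty C s2 = tp C2' C2" "ty C i2 = tp A C2" "ty C g2 = tp C2' A'"
    and s: "cone_of C s1 \<in> N" "cone_of C s2 \<in> N" "cone_of C (oplus C s1 s2) \<in> N"
    and w: "ty VQ w1 = tp (emb_obj C A) (emb_obj C C1')" "qa s1 \<cdot>\<^bsub>VQ\<^esub> w1 = qa i1"
      "ty VQ w2 = tp (emb_obj C A) (emb_obj C C2')" "qa s2 \<cdot>\<^bsub>VQ\<^esub> w2 = qa i2"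
  defines "r \<equiv> matarr C [A, C1', C2'] [C1, C2] [[i1, s1, Zero C C2' C1], [i2, Zero C C1' C2, s2]]"
    and "c \<equiv> matarr C [A, C1', C2'] [A'] [[Zero C A A', g1, \<boxminus> g2]]"
  shows "qa g1 \<cdot>\<^bsub>VQ\<^esub> w1 = qa g2 \<cdot>\<^bsub>VQ\<^esub> w2 \<longleftrightarrow>
    factors_through (Cb C) (degree_zero_map C (two_term C 0 r) (emb_obj C A') c) N"
proof -
  define P where "P = dsum C [A, C1', C2']"
  define R where "R = dsum C [C1, C2]"
  define p0 p1 p2 where "p0 = dsum_pr C [A, C1', C2'] 0" and "p1 = dsum_pr C [A, C1', C2'] 1" and "p2 = dsum_pr C [A, C1', C2'] 2"
  define j0 j1 j2 where "j0 = dsum_in C [A, C1', C2'] 0" and "j1 = dsum_in C [A, C1', C2'] 1" and "j2 = dsum_in C [A, C1', C2'] 2"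
  note D = dsum3[OF o(1,4,6), folded p0_def p1_def p2_def j0_def j1_def j2_def P_def]
  note bR = bin(1-5)[OF o(3,5), folded R_def]
  have r: "r = inl C C1 C2 \<cdot> (i1 \<cdot> p0 \<boxplus> s1 \<cdot> p1) \<boxplus> inr C C1 C2 \<cdot> (i2 \<cdot> p0 \<boxplus> s2 \<cdot> p2)"
    unfolding r_def using matarr_23[OF t(2) t(1) ty_Zero[OF o(6,3)] t(5) ty_Zero[OF o(4,5)] t(4), folded p0_def p1_def p2_def]
    by (simp add: D(1-7) o t bR arr_ty arr_mult)
  have c: "c = g1 \<cdot> p1 \<boxplus> \<boxminus> (g2 \<cdot> p2)"
    unfolding c_def using matarr_13[OF ty_Zero[OF o(1,2)] t(3) ty_neg[OF t(6)], folded p0_def p1_def p2_def]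
    by (simp add: D(1-7) o t arr_ty arr_mult comp_neg_l)
  have tr: "ty C r = tp P R"
    unfolding r by (simp add: D(1-7) t bR arr_ty)
  have tc: "ty C c = tp P A'"
    unfolding c by (simp add: D(1-7) t arr_ty)
  let ?T = "two_term C 0 r"
  note Tcx = two_term_cx[OF tr, of 0]
  \<comment> \<open>The class of the map that is \<open>x\<close> in degree 0. Every arrow
    \<open>x\<close> out of \<open>P\<close> is admissible, because the source begins in degree 0
    and the target ends there.\<close>
  define e where "e x Y = cl C ?T (emb_obj C Y) (dz C ?T (emb_obj C Y) x)" for x Y
  have ce: "cm C ?T (emb_obj C Y) (dz C ?T (emb_obj C Y) x)" if "ty C x = tp P Y" for x Y
    using that ty_Cod_Obj[OF that] D(1) zero_obj_Obj ty_Cod_Obj[OF tr]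
    by (intro cm_dz Tcx emb_cx) (simp_all add: two_term_simps[OF tr] emb_simps comp_Zero_l comp_Zero_r)
  have te: "ty (Kb C) (e x Y) = tp ?T (emb_obj C Y)" if "ty C x = tp P Y" for x Y
    unfolding e_def by (rule ty_cl[OF ce[OF that]])
  have eC: "e (f \<cdot> x) Z = emb_arr C f \<cdot>\<^bsub>Kb C\<^esub> e x Y" if "ty C x = tp P Y" "ty C f = tp Y Z" for f x Y Z
    unfolding e_def emb_arr_cl[OF that(2)] cl_Comp[OF ce[OF that(1)] cm_dz_emb[OF that(2)]]
    using dz_Comp[OF Tcx emb_cx emb_cx] ty_Cod_Obj[OF that(1)] ty_Cod_Obj[OF that(2)] by simp
  have eA: "e (x \<boxplus> y) Y = e x Y \<boxplus>\<^bsub>Kb C\<^esub> e y Y" if "ty C x = tp P Y" "ty C y = tp P Y" for x y Y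
    unfolding e_def cl_Add[OF ce[OF that(1)] ce[OF that(2)]]
    using dz_Add[OF Tcx emb_cx] ty_Cod_Obj[OF that(1)] by simp
  have er: "e (x \<cdot> r) Y = Zero (Kb C) ?T (emb_obj C Y)" if x: "ty C x = tp R Y" for x Y
  proof -
    note [simp] = ty_Dom_Obj[OF x] ty_Cod_Obj[OF x] zero_obj_Obj D(1) tr x
    \<comment> \<open>The null-homotopy is \<open>x\<close> itself, going from the degree 1 term
      \<open>R\<close> of the source to the degree 0 term \<open>Y\<close> of the target.\<close>
    let ?h = "\<lambda>n::int. if n = 1 then x else Zero C (obj_at ?T n) (obj_at (emb_obj C Y) (n - 1))"
    have "homotopy C ?T (emb_obj C Y) ?h (dz C ?T (emb_obj C Y) (x \<cdot> r)) (\<lambda>n. Zero C (obj_at ?T n) (obj_at (emb_obj C Y) n))"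
    proof (rule homotopyI)
      show "ty C (?h n) = tp (obj_at ?T n) (obj_at (emb_obj C Y) (n - 1))" for n
        by (simp add: two_term_simps[OF tr] emb_simps ty_Zero)
      fix n :: int
      consider "n = 0" | "n = 1" | "n \<noteq> 0 \<and> n \<noteq> 1"
        by blast
      then show "dz C ?T (emb_obj C Y) (x \<cdot> r) n = Zero C (obj_at ?T n) (obj_at (emb_obj C Y) n) \<boxplus>
          (diff_at (emb_obj C Y) (n - 1) \<cdot> ?h n \<boxplus> ?h (n + 1) \<cdot> diff_at ?T n)"
        by cases (simp_all add: dz_def two_term_simps[OF tr] emb_simps arr_ty arr_mult)
    qed
    from cl_eqI[OF ce cm_Zero[OF Tcx emb_cx] this] show ?thesis
      by (simp add: e_def Kb_simps(7) arr_ty)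
  qed
  define \<pi>1 \<pi>2 \<tau> where "\<pi>1 = Q.qm (e p1 C1')" and "\<pi>2 = Q.qm (e p2 C2')" and "\<tau> = Q.qm (e p0 A)"
  have tV: "ty VQ \<pi>1 = tp ?T (emb_obj C C1')" "ty VQ \<pi>2 = tp ?T (emb_obj C C2')" "ty VQ \<tau> = tp ?T (emb_obj C A)"
    unfolding \<pi>1_def \<pi>2_def \<tau>_def by (intro Q.ty_qm te D)+
  have row: "qa i \<cdot>\<^bsub>VQ\<^esub> \<tau> \<boxplus>\<^bsub>VQ\<^esub> qa s \<cdot>\<^bsub>VQ\<^esub> Q.qm (e p C') = Zero VQ ?T (emb_obj C Cs)"
    if i: "ty C i = tp A Cs" and s: "ty C s = tp C' Cs" and p: "ty C p = tp P C'" and x: "ty C x = tp R Cs"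
      and xr: "x \<cdot> r = i \<cdot> p0 \<boxplus> s \<cdot> p" for i s p x Cs C'
  proof -
    have oC: "Cs \<in> Obj C"
      using ty_Cod_Obj[OF i] .
    have "qa i \<cdot>\<^bsub>VQ\<^esub> \<tau> \<boxplus>\<^bsub>VQ\<^esub> qa s \<cdot>\<^bsub>VQ\<^esub> Q.qm (e p C') = Q.qm (e (i \<cdot> p0 \<boxplus> s \<cdot> p) Cs)"
      unfolding eA[OF ty_Comp[OF D(5) i] ty_Comp[OF p s]] eC[OF D(5) i] eC[OF p s] \<tau>_def qa_qm
      using Q.qm_Add[OF K.ty_Comp[OF te[OF D(5)] ty_emb_arr[OF i]] K.ty_Comp[OF te[OF p] ty_emb_arr[OF s]]]
        Q.qm_Comp[OF te[OF D(5)] ty_emb_arr[OF i]] Q.qm_Comp[OF te[OF p] ty_emb_arr[OF s]] by simp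
    also have "\<dots> = Zero VQ ?T (emb_obj C Cs)"
      unfolding xr[symmetric] er[OF x]
      by (rule Q.qm_Zero) (simp_all add: Kb_simps Tcx emb_cx oC)
    finally show ?thesis .
  qed
  have row1: "qa i1 \<cdot>\<^bsub>VQ\<^esub> \<tau> \<boxplus>\<^bsub>VQ\<^esub> qa s1 \<cdot>\<^bsub>VQ\<^esub> \<pi>1 = Zero VQ ?T (emb_obj C C1)"
    unfolding \<pi>1_def
    by (rule row[OF t(2,1) D(6) bR(3)]) (simp add: r bin[OF o(3,5)] bR o t D(1-7) arr_ty arr_mult)
  have row2: "qa i2 \<cdot>\<^bsub>VQ\<^esub> \<tau> \<boxplus>\<^bsub>VQ\<^esub> qa s2 \<cdot>\<^bsub>VQ\<^esub> \<pi>2 = Zero VQ ?T (emb_obj C C2)"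
    unfolding \<pi>2_def
    by (rule row[OF t(5,4) D(7) bR(4)]) (simp add: r bin[OF o(3,5)] bR o t D(1-7) arr_ty arr_mult)
  \<comment> \<open>The row relation amounts to \<open>qa s (w \<tau> + \<pi>) = 0\<close>, and
    \<open>qa s\<close> is invertible.\<close>
  have solve: "\<pi> = \<boxminus>\<^bsub>VQ\<^esub> (w \<cdot>\<^bsub>VQ\<^esub> \<tau>)"
    if s: "ty C s = tp C' Cs" "cone_of C s \<in> N" and i: "ty C i = tp A Cs" and w: "ty VQ w = tp (emb_obj C A) (emb_obj C C')" "qa s \<cdot>\<^bsub>VQ\<^esub> w = qa i"
      and p: "ty VQ \<pi> = tp ?T (emb_obj C C')" and z: "qa i \<cdot>\<^bsub>VQ\<^esub> \<tau> \<boxplus>\<^bsub>VQ\<^esub> qa s \<cdot>\<^bsub>VQ\<^esub> \<pi> = Zero VQ ?T (emb_obj C Cs)"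
    for s i w \<pi> C' Cs
  proof -
    note v = V.arr_inv[OF qa_iso[OF s] ty_qa[OF s(1)]]
    note [simp] = ty_qa[OF s(1)] ty_qa[OF i] w p tV(3) v V.arr_ty
    have "qa s \<cdot>\<^bsub>VQ\<^esub> (w \<cdot>\<^bsub>VQ\<^esub> \<tau> \<boxplus>\<^bsub>VQ\<^esub> \<pi>) = Zero VQ ?T (emb_obj C Cs)"
      using z by (simp add: V.comp_Add_r V.reassoc[OF w(2)])
    then have "arr_inv VQ (qa s) \<cdot>\<^bsub>VQ\<^esub> (qa s \<cdot>\<^bsub>VQ\<^esub> (w \<cdot>\<^bsub>VQ\<^esub> \<tau> \<boxplus>\<^bsub>VQ\<^esub> \<pi>)) = Zero VQ ?T (emb_obj C C')"
      using V.comp_Zero_r[OF v(1) V.ty_Dom_Obj[OF tV(3)]] by simp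
    then have "w \<cdot>\<^bsub>VQ\<^esub> \<tau> \<boxplus>\<^bsub>VQ\<^esub> \<pi> = Zero VQ ?T (emb_obj C C')"
      by (simp add: V.reassoc[OF v(2)] V.comp_Ident_l)
    then have "\<pi> \<boxplus>\<^bsub>VQ\<^esub> w \<cdot>\<^bsub>VQ\<^esub> \<tau> = Zero VQ ?T (emb_obj C C')"
      by (simp add: V.add_comm)
    then show ?thesis
      using V.neg_unique[of "w \<cdot>\<^bsub>VQ\<^esub> \<tau>" ?T "emb_obj C C'" \<pi>] by simp
  qed
  note pi = solve[OF t(1) s(1) t(2) w(1,2) tV(1) row1] solve[OF t(4) s(2) t(5) w(3,4) tV(2) row2]
  have "arr_iso VQ \<tau>"
  proof -
    \<comment> \<open>Regroups \<open>P\<close> as \<open>(C1' \<oplus> C2') \<oplus> A\<close>, so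
      that the first summand is the kernel of \<open>p0\<close>.\<close>
    define i where "i = j1 \<cdot> prl C C1' C2' \<boxplus> j2 \<cdot> prr C C1' C2'"
    define p where "p = inl C C1' C2' \<cdot> p1 \<boxplus> inr C C1' C2' \<cdot> p2"
    note [simp] = D(1-16) o t bin bR arr_ty zero_obj_Obj D(8-16)[THEN reassoc]
    have bs: "bip C (dsum C [C1', C2']) A P i j0 p p0"
    proof -
      have "i \<cdot> p = j1 \<cdot> p1 \<boxplus> j2 \<cdot> p2"
        unfolding i_def p_def by (simp add: arr_calc)
      then have "i \<cdot> p \<boxplus> j0 \<cdot> p0 = Ident C P"
        using D(17) by (simp add: arr_ac)
      then show ?thesis
        unfolding bip_def i_def p_def by (simp add: bin_Ident[symmetric] arr_calc)
    qed
    have ts: "ty C (oplus C s1 s2) = tp (dsum C [C1', C2']) R"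
      by (simp add: oplus_eq[OF t(1,4)] R_def[symmetric])
    have e1: "r \<cdot> i = Ident C R \<cdot> oplus C s1 s2"
      unfolding comp_Ident_l[OF ts] unfolding r i_def oplus_eq[OF t(1,4)] by (simp add: arr_calc)
    have e2: "Zero C A (zero_obj C) \<cdot> p0 = Zero C R (zero_obj C) \<cdot> r"
      using tr by (simp add: comp_Zero_l)
    have ex: "split_exact C (two_term C 0 (oplus C s1 s2)) ?T (two_term C 0 (Zero C A (zero_obj C)))
        (tt C 0 i (Ident C R)) (tt C 0 p0 (Zero C R (zero_obj C))) (tt C 0 p (Ident C R)) (tt C 0 j0 (Zero C (zero_obj C) R))"
      by (rule two_term_split_exact[OF ts tr ty_Zero[OF o(1) zero_obj_Obj] bs bip_Ident(1) e1 e2]) simp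
    have q: "tt C 0 p0 (Zero C R (zero_obj C)) = dz C ?T (emb_obj C A) p0"
      by (rule ext) (simp add: tt_def dz_def two_term_simps[OF tr] emb_simps)
    have "e p0 A \<in> W"
      using W_split_epi[OF ex N_two_term_zero[OF ts s(3)]] unfolding emb_two_term[OF o(1)] q e_def .
    then show ?thesis
      unfolding \<tau>_def by (rule Q.qm_iso)
  qed
  then obtain \<tau>' where \<tau>': "ty VQ \<tau>' = tp (emb_obj C A) ?T" "\<tau> \<cdot>\<^bsub>VQ\<^esub> \<tau>' = Ident VQ (emb_obj C A)"
    using V.arr_isoE[OF _ tV(3)] by blast
  let ?F1 = "qa g1 \<cdot>\<^bsub>VQ\<^esub> w1" and ?F2 = "qa g2 \<cdot>\<^bsub>VQ\<^esub> w2"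
  note tF = V.ty_Comp[OF w(1) ty_qa[OF t(3)]] V.ty_Comp[OF w(3) ty_qa[OF t(6)]]
  note oV = V.ty_Dom_Obj[OF tV(1)] V.ty_Cod_Obj[OF ty_qa[OF t(3)]] V.ty_Cod_Obj[OF tV(3)]
  have "Q.qm (e c A') = qa g1 \<cdot>\<^bsub>VQ\<^esub> \<pi>1 \<boxplus>\<^bsub>VQ\<^esub> \<boxminus>\<^bsub>VQ\<^esub> (qa g2) \<cdot>\<^bsub>VQ\<^esub> \<pi>2"
  proof -
    have c': "c = g1 \<cdot> p1 \<boxplus> \<boxminus> g2 \<cdot> p2"
      unfolding c by (simp add: comp_neg_l D(7) t)
    show ?thesis
      unfolding qa_neg[OF t(6), symmetric]
      unfolding c' eA[OF ty_Comp[OF D(6) t(3)] ty_Comp[OF D(7) ty_neg[OF t(6)]]] eC[OF D(6) t(3)] eC[OF D(7) ty_neg[OF t(6)]]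
        \<pi>1_def \<pi>2_def qa_qm
      using Q.qm_Add[OF K.ty_Comp[OF te[OF D(6)] ty_emb_arr[OF t(3)]] K.ty_Comp[OF te[OF D(7)] ty_emb_arr[OF ty_neg[OF t(6)]]]]
        Q.qm_Comp[OF te[OF D(6)] ty_emb_arr[OF t(3)]] Q.qm_Comp[OF te[OF D(7)] ty_emb_arr[OF ty_neg[OF t(6)]]] by simp
  qed
  also have "\<dots> = dif VQ ?F2 ?F1 \<cdot>\<^bsub>VQ\<^esub> \<tau>"
    unfolding pi by (simp add: tV w ty_qa[OF t(3)] ty_qa[OF t(6)] oV o emb_Obj V.arr_calc)
  finally have \<gamma>: "Q.qm (e c A') = dif VQ ?F2 ?F1 \<cdot>\<^bsub>VQ\<^esub> \<tau>" .
  have "?F1 = ?F2 \<longleftrightarrow> Q.qm (e c A') = Zero VQ ?T (emb_obj C A')"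
  proof
    assume "?F1 = ?F2"
    then show "Q.qm (e c A') = Zero VQ ?T (emb_obj C A')"
      unfolding \<gamma> using V.dif_self[OF tF(2)] V.comp_Zero_l[OF tV(3) oV(2)] by simp
  next
    assume "Q.qm (e c A') = Zero VQ ?T (emb_obj C A')"
    then have "(dif VQ ?F2 ?F1 \<cdot>\<^bsub>VQ\<^esub> \<tau>) \<cdot>\<^bsub>VQ\<^esub> \<tau>' = Zero VQ (emb_obj C A) (emb_obj C A')"
      unfolding \<gamma> using V.comp_Zero_l[OF \<tau>'(1) oV(2)] by simp
    then have "dif VQ ?F2 ?F1 = Zero VQ (emb_obj C A) (emb_obj C A')"
      using V.comp_assoc[OF \<tau>'(1) tV(3) V.ty_dif[OF tF(2,1)]] V.comp_Ident_r[OF V.ty_dif[OF tF(2,1)]] \<tau>'(2) by simp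
    then show "?F1 = ?F2"
      using V.dif_eq(1)[OF tF(2,1) V.ty_Zero[OF oV(3,2)]] V.add_Zero_l[OF tF(1)] by simp
  qed
  also have "\<dots> \<longleftrightarrow> factors_through (Cb C) (degree_zero_map C ?T (emb_obj C A') c) N"
    unfolding e_def degree_zero_map_dz by (rule qm_zero_iff_factors[OF ce[OF tc]])
  finally show ?thesis .
qed

end

section \<open>The matrix criterion\<close>

context additive_category
begin

text \<open>The four entries have separate meanings: \<open>m \<cdot> n = 0\<close> makes
  \<open>Z\<close>, \<open>T1 \<oplus> T2\<close>, \<open>Z'\<close> a complex with differentials
  \<open>n\<close> and \<open>m\<close>; \<open>m \<cdot> a0 = a1 \<cdot> r\<close> and
  \<open>b \<cdot> n = 0\<close> say that \<open>(a0, a1)\<close> and \<open>b\<close> are chain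
  maps into and out of it; and \<open>b \<cdot> a0 = c\<close> says that their composite is the
  given map.\<close>

lemma matrix_criterion:
  assumes o: "A' \<in> Obj C" "P \<in> Obj C" "R \<in> Obj C" "Z \<in> Obj C" "Z' \<in> Obj C" "T1 \<in> Obj C" "T2 \<in> Obj C"
    and t: "ty C k1 = tp Z T1" "ty C k2 = tp T2 Z'" "ty C p = tp Z T2" "ty C g = tp T1 Z'" "ty C a1 = tp R Z'"
      "ty C a0 = tp P (dsum C [T1, T2])" "ty C b = tp (dsum C [T1, T2]) A'" "ty C c = tp P A'" "ty C r = tp P R"
  defines "m \<equiv> g \<cdot> prl C T1 T2 \<boxplus> k2 \<cdot> prr C T1 T2" and "n \<equiv> inl C T1 T2 \<cdot> k1 \<boxplus> inr C T1 T2 \<cdot> p"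
  shows "matarr C [dsum C [T1, T2]] [A', Z'] [[b], [matarr C [T1, T2] [Z'] [[g, k2]]]]
        \<cdot> matarr C [P, Z] [dsum C [T1, T2]] [[a0, matarr C [Z] [T1, T2] [[k1], [p]]]]
      = matarr C [P, Z] [A', Z'] [[c, Zero C Z A'], [a1 \<cdot> r, Zero C Z Z']] \<longleftrightarrow>
    b \<cdot> a0 = c \<and> b \<cdot> n = Zero C Z A' \<and> m \<cdot> a0 = a1 \<cdot> r \<and> m \<cdot> n = Zero C Z Z'"
    (is "?L = ?R \<longleftrightarrow> ?E")
proof -
  have tm: "ty C m = tp (dsum C [T1, T2]) Z'" and tn: "ty C n = tp Z (dsum C [T1, T2])"
    unfolding m_def n_def by (simp_all add: o t bin arr_ty)
  note [simp] = o t bin tm tn arr_ty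
  have L: "?L = (inl C A' Z' \<cdot> b \<boxplus> inr C A' Z' \<cdot> m) \<cdot> (a0 \<cdot> prl C P Z \<boxplus> n \<cdot> prr C P Z)"
    unfolding matarr_12[OF t(4,2)] matarr_21[OF t(1,3)] m_def[symmetric] n_def[symmetric]
      matarr_21[OF t(7) tm] matarr_12[OF t(6) tn] ..
  have R: "?R = inl C A' Z' \<cdot> c \<cdot> prl C P Z \<boxplus> inr C A' Z' \<cdot> a1 \<cdot> r \<cdot> prl C P Z"
    unfolding matarr_22[OF t(8) ty_Zero[OF o(4,1)] ty_Comp[OF t(9,5)] ty_Zero[OF o(4,5)]]
    by (simp add: arr_mult)
  show ?thesis
  proof
    assume e: "?L = ?R"
    have "prl C A' Z' \<cdot> (?L \<cdot> inl C P Z) = prl C A' Z' \<cdot> (?R \<cdot> inl C P Z)"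
      "prr C A' Z' \<cdot> (?L \<cdot> inl C P Z) = prr C A' Z' \<cdot> (?R \<cdot> inl C P Z)"
      "prl C A' Z' \<cdot> (?L \<cdot> inr C P Z) = prl C A' Z' \<cdot> (?R \<cdot> inr C P Z)"
      "prr C A' Z' \<cdot> (?L \<cdot> inr C P Z) = prr C A' Z' \<cdot> (?R \<cdot> inr C P Z)"
      unfolding e by rule+
    then show ?E
      unfolding L R by (simp add: arr_mult)
  next
    assume e: ?E
    have e': "b \<cdot> (a0 \<cdot> x) = c \<cdot> x" "m \<cdot> (a0 \<cdot> x) = a1 \<cdot> (r \<cdot> x)" if "ty C x = tp W P" for x W
      using e that reassoc[of b a0 c "dsum C [T1, T2]" A' P x W] reassoc[of m a0 "a1 \<cdot> r" "dsum C [T1, T2]" Z' P x W]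
      by (simp_all add: comp_assoc)
    have e'': "b \<cdot> (n \<cdot> x) = Zero C W A'" "m \<cdot> (n \<cdot> x) = Zero C W Z'" if "ty C x = tp W Z" for x W
      using e that reassoc[of b n _ "dsum C [T1, T2]" A' Z x W] reassoc[of m n _ "dsum C [T1, T2]" Z' Z x W]
      by (simp_all add: comp_Zero_l)
    show "?L = ?R"
      unfolding L R by (simp add: e' e'' arr_calc)
  qed
qed

end

context triangulated_subcategory
begin

text \<open>The three-term complex arises as the cone of the map \<open>(p, g)\<close> from the
  complex of \<open>-k1\<close> to that of \<open>k2\<close>, both placed in degrees 0 and 1, so it
  lies in \<open>N\<close>. The sign of \<open>-k1\<close> cancels the one that a mapping cone puts
  on the differential of its source.\<close>

lemma factors_if_matrix:
  assumes o: "A' \<in> Obj C" "P \<in> Obj C" "R \<in> Obj C" "Z \<in> Obj C" "Z' \<in> Obj C" "T1 \<in> Obj C" "T2 \<in> Obj C"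
    and t: "ty C k1 = tp Z T1" "ty C k2 = tp T2 Z'" "ty C p = tp Z T2" "ty C g = tp T1 Z'" "ty C a1 = tp R Z'"
      "ty C a0 = tp P (dsum C [T1, T2])" "ty C b = tp (dsum C [T1, T2]) A'" "ty C c = tp P A'" "ty C r = tp P R"
    and k: "cone_of C k1 \<in> N" "cone_of C k2 \<in> N"
    and e: "b \<cdot> a0 = c" "b \<cdot> (inl C T1 T2 \<cdot> k1 \<boxplus> inr C T1 T2 \<cdot> p) = Zero C Z A'"
      "(g \<cdot> prl C T1 T2 \<boxplus> k2 \<cdot> prr C T1 T2) \<cdot> a0 = a1 \<cdot> r"
      "(g \<cdot> prl C T1 T2 \<boxplus> k2 \<cdot> prr C T1 T2) \<cdot> (inl C T1 T2 \<cdot> k1 \<boxplus> inr C T1 T2 \<cdot> p) = Zero C Z Z'"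
  shows "factors_through (Cb C) (degree_zero_map C (two_term C 0 r) (emb_obj C A') c) N"
proof -
  let ?T = "two_term C 0 r" and ?X = "two_term C 0 (\<boxminus> k1)" and ?Y = "two_term C 0 k2"
  note tn = ty_neg[OF t(1)]
  note z[simp] = zero_obj_Obj
  note [simp] = o t tn bin arr_ty
  have f: "cm C ?X ?Y (tt C 0 p g)"
  proof (rule cm_two_term[OF tn t(2) t(3,4)])
    show "k2 \<cdot> p = g \<cdot> \<boxminus> k1"
      using e(4) by (simp add: arr_calc)
  qed
  let ?M = "cone C ?X ?Y (tt C 0 p g)"
  have M: "?M \<in> N"
    using N_cone[OF f] N_two_term_zero[OF t(2) k(2)] N_two_term_zero[OF tn ext_neg[OF N_extension_closed t(1) k(1)]] by simp
  have Mo: "obj_at ?M n = (if n = 0 then dsum C [T1, T2] else if n = 1 then dsum C [zero_obj C, Z']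
      else if n = -1 then dsum C [Z, zero_obj C] else dsum C [zero_obj C, zero_obj C])" for n
  proof -
    have "(n + 1 = 0) = (n = -1)"
      by auto
    then show ?thesis
      by (simp add: cone_obj two_term_simps[OF tn] two_term_simps[OF t(2)])
  qed
  note Mcx = cone_cx[OF f]
  have tta: "tt C 0 p g n = (if n = 0 then p else if n = 1 then g else Zero C (zero_obj C) (zero_obj C))" for n
    by (simp add: tt_def)
  have d0: "diff_at ?M 0 = inr C (zero_obj C) Z' \<cdot> (g \<cdot> prl C T1 T2 \<boxplus> k2 \<cdot> prr C T1 T2)"
    unfolding cone_diff[OF f] by (simp add: two_term_simps[OF tn] two_term_simps[OF t(2)] tta) (simp add: arr_calc)
  have d1: "diff_at ?M (-1) = (inl C T1 T2 \<cdot> k1 \<boxplus> inr C T1 T2 \<cdot> p) \<cdot> prl C Z (zero_obj C)"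
    unfolding cone_diff[OF f] by (simp add: two_term_simps[OF tn] two_term_simps[OF t(2)] tta) (simp add: arr_calc)
  define u where "u n = (if n = 0 then a0 else if n = 1 then inr C (zero_obj C) Z' \<cdot> a1 else Zero C (zero_obj C) (obj_at ?M n))" for n :: int
  have u: "cm C ?T ?M u"
  proof (rule cmI)
    show "bounded_complex C ?T" "bounded_complex C ?M"
      using two_term_cx[OF t(9)] Mcx .
    show tu: "ty C (u n) = tp (obj_at ?T n) (obj_at ?M n)" for n
      by (simp add: u_def two_term_simps[OF t(9)] Mo)
    fix n :: int
    have oM: "obj_at ?M k \<in> Obj C" for k
      using cxD(1)[OF Mcx] .
    note tD = cxD(2)[OF Mcx]
    consider "n = 0" | "n = 1" | "n = -1" | "n \<noteq> 0 \<and> n \<noteq> 1 \<and> n \<noteq> -1"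
      by blast
    then show "diff_at ?M n \<cdot> u n = u (n + 1) \<cdot> diff_at ?T n"
    proof cases
      case 1
      then show ?thesis
        using comp_assoc[of a0 P "dsum C [T1, T2]" "g \<cdot> prl C T1 T2 \<boxplus> k2 \<cdot> prr C T1 T2" Z' "inr C (zero_obj C) Z'" "dsum C [zero_obj C, Z']"]
          comp_assoc[OF t(9) t(5), of "inr C (zero_obj C) Z'" "dsum C [zero_obj C, Z']"]
        unfolding 1 by (simp add: u_def d0 two_term_simps[OF t(9)] e(3))
    next
      case 2
      have "diff_at ?M 1 = Zero C (dsum C [zero_obj C, Z']) (dsum C [zero_obj C, zero_obj C])"
        unfolding cone_diff[OF f] by (simp add: two_term_simps[OF tn] two_term_simps[OF t(2)] tta) (simp add: arr_calc)
      then show ?thesis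
        using 2 by (simp add: u_def two_term_simps[OF t(9)] Mo arr_mult)
    next
      case 3
      then show ?thesis
        using tD[of "-1"] oM by (simp add: u_def two_term_simps[OF t(9)] Mo comp_Zero_r)
    next
      case 4
      then have "n + 1 \<noteq> 0"
        by auto
      then show ?thesis
        using 4 tD[of n] oM[of "n + 1"] by (auto simp: u_def two_term_simps[OF t(9)] comp_Zero_r comp_Zero_l[OF ty_Zero] Mo)
    qed
  qed
  have v: "cm C ?M (emb_obj C A') (dz C ?M (emb_obj C A') b)"
  proof (rule cm_dz[OF Mcx emb_cx[OF o(1)]])
    show "ty C b = tp (obj_at ?M 0) (obj_at (emb_obj C A') 0)"
      by (simp add: Mo emb_simps)
    show "diff_at (emb_obj C A') 0 \<cdot> b = Zero C (obj_at ?M 0) (obj_at (emb_obj C A') 1)"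
      by (simp add: Mo emb_simps comp_Zero_l)
    show "b \<cdot> diff_at ?M (- 1) = Zero C (obj_at ?M (- 1)) (obj_at (emb_obj C A') 0)"
      using reassoc[OF e(2) t(7), of Z "prl C Z (zero_obj C)" "dsum C [Z, zero_obj C]"]
      by (simp add: d1 Mo emb_simps comp_Zero_l)
  qed
  have c: "dz C ?M (emb_obj C A') b n \<cdot> u n = dz C ?T (emb_obj C A') c n" for n
    using e(1) cxD(1)[OF Mcx, of n]
    by (simp add: dz_def u_def two_term_simps[OF t(9)] emb_simps comp_Zero_l[OF ty_Zero] Mo arr_mult)
  have dz: "chain_map C (ChMap ?T (emb_obj C A') (dz C ?T (emb_obj C A') c))"
    using cm_Comp[OF u v] unfolding c cm_def .
  show ?thesis
    unfolding degree_zero_map_dz factors_through_Cb[OF dz] using M u v c by blast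
qed

text \<open>
  Replacing the middle object by a good complex introduces a homotopy \<open>h r\<close>, which is absorbed
  by adding the contractible summand \<open>id: R \<rightarrow> R\<close> to \<open>k\<^sub>2\<close>.
\<close>

lemma matrix_if_factors:
  assumes E: "extension_closed (Kb C) E" and good: "\<And>M. M \<in> N \<Longrightarrow> \<exists>M'. good_complex C E M' \<and> isomorphic (Kb C) M M'"
    and o: "A' \<in> Obj C" "P \<in> Obj C" "R \<in> Obj C" and t: "ty C c = tp P A'" "ty C r = tp P R"
    and fac: "factors_through (Cb C) (degree_zero_map C (two_term C 0 r) (emb_obj C A') c) N"
  obtains Z Z' T1 T2 k1 k2 p g a1 a0 b where
    "Z \<in> Obj C" "Z' \<in> Obj C" "T1 \<in> Obj C" "T2 \<in> Obj C"
    "ty C k1 = tp Z T1" "ty C k2 = tp T2 Z'" "ty C p = tp Z T2" "ty C g = tp T1 Z'" "ty C a1 = tp R Z'"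
    "ty C a0 = tp P (dsum C [T1, T2])" "ty C b = tp (dsum C [T1, T2]) A'"
    "cone_of C k1 \<in> E" "cone_of C k2 \<in> E"
    "b \<cdot> a0 = c" "b \<cdot> (inl C T1 T2 \<cdot> k1 \<boxplus> inr C T1 T2 \<cdot> p) = Zero C Z A'"
    "(g \<cdot> prl C T1 T2 \<boxplus> k2 \<cdot> prr C T1 T2) \<cdot> a0 = a1 \<cdot> r"
    "(g \<cdot> prl C T1 T2 \<boxplus> k2 \<cdot> prr C T1 T2) \<cdot> (inl C T1 T2 \<cdot> k1 \<boxplus> inr C T1 T2 \<cdot> p) = Zero C Z Z'"
proof -
  let ?T = "two_term C 0 r"
  let ?c = "dz C ?T (emb_obj C A') c"
  have cmc: "cm C ?T (emb_obj C A') ?c"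
    using fac by (simp add: factors_through_def Cb_def degree_zero_map_dz cm_def)
  obtain M u v where M: "M \<in> N" "cm C ?T M u" "cm C M (emb_obj C A') v" "\<And>n. v n \<cdot> u n = ?c n"
    using fac unfolding degree_zero_map_dz factors_through_Cb[OF cmc[unfolded cm_def]] by blast
  obtain M' where M': "good_complex C E M'" "isomorphic (Kb C) M M'"
    using good[OF M(1)] by blast
  obtain \<phi> \<psi> h k where iso: "cm C M M' \<phi>" "cm C M' M \<psi>" "homotopy C M M h (\<lambda>n. \<psi> n \<cdot> \<phi> n) (\<lambda>n. Ident C (obj_at M n))"
    using M'(2) unfolding isomorphic_Kb by blast
  note cu = cm_Comp[OF M(2) iso(1)] and cv = cm_Comp[OF iso(2) M(3)]
  define \<alpha> where "\<alpha> n = \<phi> n \<cdot> u n" for n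
  define \<beta> where "\<beta> n = v n \<cdot> \<psi> n" for n
  have \<alpha>: "cm C ?T M' \<alpha>" and \<beta>: "cm C M' (emb_obj C A') \<beta>"
    using cu cv by (simp_all add: \<alpha>_def[abs_def] \<beta>_def[abs_def])
  have "cl C ?T (emb_obj C A') ?c = cl C M (emb_obj C A') v \<cdot>\<^bsub>Kb C\<^esub> (Ident (Kb C) M \<cdot>\<^bsub>Kb C\<^esub> cl C ?T M u)"
    unfolding K.comp_Ident_l[OF ty_cl[OF M(2)]] cl_Comp[OF M(2,3)] M(4) ..
  also have "Ident (Kb C) M = cl C M' M \<psi> \<cdot>\<^bsub>Kb C\<^esub> cl C M M' \<phi>"
    unfolding cl_Comp[OF iso(1,2)] Kb_simps(5)
    by (rule cl_eqI[OF cm_Comp[OF iso(1,2)] cm_Ident[OF cmD(1)[OF iso(1)]] iso(3), symmetric])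
  also have "cl C M (emb_obj C A') v \<cdot>\<^bsub>Kb C\<^esub> ((cl C M' M \<psi> \<cdot>\<^bsub>Kb C\<^esub> cl C M M' \<phi>) \<cdot>\<^bsub>Kb C\<^esub> cl C ?T M u) =
      (cl C M (emb_obj C A') v \<cdot>\<^bsub>Kb C\<^esub> cl C M' M \<psi>) \<cdot>\<^bsub>Kb C\<^esub> (cl C M M' \<phi> \<cdot>\<^bsub>Kb C\<^esub> cl C ?T M u)"
    by (simp add: ty_cl[OF M(2)] ty_cl[OF M(3)] ty_cl[OF iso(1)] ty_cl[OF iso(2)] K.arr_ty K.comp_assoc)
  also have "\<dots> = cl C ?T (emb_obj C A') (\<lambda>n. \<beta> n \<cdot> \<alpha> n)"
    unfolding cl_Comp[OF M(2) iso(1)] cl_Comp[OF iso(2) M(3)] \<alpha>_def[symmetric] \<beta>_def[symmetric]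
    by (rule cl_Comp[OF \<alpha> \<beta>])
  finally obtain H where H: "homotopy C ?T (emb_obj C A') H ?c (\<lambda>n. \<beta> n \<cdot> \<alpha> n)"
    unfolding cl_eq[OF cmc cm_Comp[OF \<alpha> \<beta>]] by blast
  \<comment> \<open>\<open>T\<close> is concentrated in degrees 0 and 1 and the target in degree 0.
    So this is the component of \<open>H\<close> that enters, and it contributes
    \<open>\<eta> \<cdot> r\<close> to \<open>c\<close>.\<close>
  define \<eta> where "\<eta> = H 1"
  have t\<eta>: "ty C \<eta> = tp R A'"
    using homotopyD(1)[OF H, of 1] by (simp add: \<eta>_def two_term_simps[OF t(2)] emb_simps)
  have cxM: "bounded_complex C M'"
    using cmD[OF \<beta>] by simp
  have t\<alpha>: "ty C (\<alpha> 0) = tp P (obj_at M' 0)" "ty C (\<alpha> 1) = tp R (obj_at M' 1)" and t\<beta>: "ty C (\<beta> 0) = tp (obj_at M' 0) A'"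
    using cmD(3)[OF \<alpha>, of 0] cmD(3)[OF \<alpha>, of 1] cmD(3)[OF \<beta>, of 0] by (simp_all add: two_term_simps[OF t(2)] emb_simps)
  have td: "ty C (diff_at M' 0) = tp (obj_at M' 0) (obj_at M' 1)" "ty C (diff_at M' (-1)) = tp (obj_at M' (-1)) (obj_at M' 0)"
    using cxD(2)[OF cxM, of 0] cxD(2)[OF cxM, of "-1"] by simp_all
  have c: "c = \<beta> 0 \<cdot> \<alpha> 0 \<boxplus> \<eta> \<cdot> r"
    using homotopyD(2)[OF H, of 0] homotopyD(1)[OF H, of 0] o t t\<eta> t\<alpha> t\<beta>
    by (simp add: dz_def \<eta>_def two_term_simps[OF t(2)] emb_simps arr_ty comp_Zero_l add_Zero_l zero_obj_Obj)
  have d\<alpha>: "diff_at M' 0 \<cdot> \<alpha> 0 = \<alpha> 1 \<cdot> r"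
    using cmD(4)[OF \<alpha>, of 0] by (simp add: two_term_simps[OF t(2)])
  have d\<beta>: "\<beta> 0 \<cdot> diff_at M' (-1) = Zero C (obj_at M' (-1)) A'"
  proof -
    have "diff_at (emb_obj C A') (-1) \<cdot> \<beta> (-1) = \<beta> 0 \<cdot> diff_at M' (-1)"
      using cmD(4)[OF \<beta>, of "-1"] by simp
    then show ?thesis
      using cmD(3)[OF \<beta>, of "-1"] o(1) by (simp add: emb_simps comp_Zero_l)
  qed
  have dd: "diff_at M' 0 \<cdot> diff_at M' (-1) = Zero C (obj_at M' (-1)) (obj_at M' 1)"
    using cxD(3)[OF cxM, of 0 "-1"] by simp
  obtain Zf Tf i j p q where b: "bip C (Zf n) (Tf n) (obj_at M' n) (i n) (j n) (p n) (q n)"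
    and k: "cone_of C (q (n + 1) \<cdot> diff_at M' n \<cdot> i n) \<in> E" for n
    using M'(1) unfolding good_complex_def bip_family_def by blast
  note [simp] = o t t\<eta> t\<alpha> t\<beta> td bipD(1-7)[OF b] arr_ty bin
  \<comment> \<open>Of \<open>M'\<close>, only \<open>Z\<close> is kept in degree -1 and only
    \<open>T\<close> in degree 1: differentials are restricted there and projected here, which
    preserves the equations. The extra summand \<open>R\<close> is entered through \<open>r\<close>
    by \<open>a0\<close>, through its injection by \<open>a1\<close>, and left through
    \<open>\<eta>\<close> by \<open>b\<close>.\<close>
  let ?T1 = "Tf 0" and ?T2 = "dsum C [Zf 0, R]" and ?Z' = "dsum C [Tf 1, R]"
  let ?k1 = "q 0 \<cdot> diff_at M' (-1) \<cdot> i (-1)" and ?k = "q 1 \<cdot> diff_at M' 0 \<cdot> i 0"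
  let ?k2 = "oplus C ?k (Ident C R)"
  let ?p = "inl C (Zf 0) R \<cdot> p 0 \<cdot> diff_at M' (-1) \<cdot> i (-1)" and ?g = "inl C (Tf 1) R \<cdot> q 1 \<cdot> diff_at M' 0 \<cdot> j 0"
  let ?a1 = "inl C (Tf 1) R \<cdot> q 1 \<cdot> \<alpha> 1 \<boxplus> inr C (Tf 1) R"
  let ?a0 = "inl C ?T1 ?T2 \<cdot> q 0 \<cdot> \<alpha> 0 \<boxplus> inr C ?T1 ?T2 \<cdot> (inl C (Zf 0) R \<cdot> p 0 \<cdot> \<alpha> 0 \<boxplus> inr C (Zf 0) R \<cdot> r)"
  let ?b = "\<beta> 0 \<cdot> j 0 \<cdot> prl C ?T1 ?T2 \<boxplus> (\<beta> 0 \<cdot> i 0 \<cdot> prl C (Zf 0) R \<boxplus> \<eta> \<cdot> prr C (Zf 0) R) \<cdot> prr C ?T1 ?T2"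
  have tk: "ty C ?k = tp (Zf 0) (Tf 1)"
    by simp
  have k2: "?k2 = inl C (Tf 1) R \<cdot> ?k \<cdot> prl C (Zf 0) R \<boxplus> inr C (Tf 1) R \<cdot> prr C (Zf 0) R"
    unfolding oplus_eq[OF tk ty_Ident[OF o(3)]] by (simp add: comp_Ident_l)
  have tk2: "ty C ?k2 = tp ?T2 ?Z'"
    unfolding k2 by simp
  \<comment> \<open>Inserts the decomposition of the identity of \<open>M'\<close> in degree 0
    between \<open>x\<close> and \<open>y\<close>.\<close>
  have split: "x \<cdot> (i 0 \<cdot> (p 0 \<cdot> y)) \<boxplus> x \<cdot> (j 0 \<cdot> (q 0 \<cdot> y)) = x \<cdot> y"
    if "ty C y = tp U (obj_at M' 0)" "ty C x = tp (obj_at M' 0) V" for x y U V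
  proof -
    have "x \<cdot> ((i 0 \<cdot> p 0 \<boxplus> j 0 \<cdot> q 0) \<cdot> y) = x \<cdot> y"
      unfolding bipD(12)[OF b] using that by (simp add: comp_Ident_l)
    then show ?thesis
      using that by (simp add: arr_mult)
  qed
  show thesis
  proof (rule that[of "Zf (-1)" ?Z' ?T1 ?T2 ?k1 ?k2 ?p ?g ?a1 ?a0 ?b])
    show "ty C ?k2 = tp ?T2 ?Z'"
      by (rule tk2)
    show "cone_of C ?k1 \<in> E"
      using k[of "-1"] by simp
    show "cone_of C ?k2 \<in> E"
    proof (rule ext_triangular[OF E tk tk2 ty_Ident[OF o(3)] bip_dsum bip_dsum])
      show "?k2 \<cdot> inl C (Zf 0) R = inl C (Tf 1) R \<cdot> ?k" "Ident C R \<cdot> prr C (Zf 0) R = prr C (Tf 1) R \<cdot> ?k2"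
        unfolding k2 by (simp_all add: arr_calc)
      show "cone_of C ?k \<in> E" "cone_of C (Ident C R) \<in> E"
        using k[of 0] ext_Ident[OF E o(3)] by simp_all
    qed simp_all
    have "\<beta> 0 \<cdot> (j 0 \<cdot> (q 0 \<cdot> \<alpha> 0)) \<boxplus> (\<beta> 0 \<cdot> (i 0 \<cdot> (p 0 \<cdot> \<alpha> 0)) \<boxplus> \<eta> \<cdot> r) =
        (\<beta> 0 \<cdot> (i 0 \<cdot> (p 0 \<cdot> \<alpha> 0)) \<boxplus> \<beta> 0 \<cdot> (j 0 \<cdot> (q 0 \<cdot> \<alpha> 0))) \<boxplus> \<eta> \<cdot> r"
      by (simp add: arr_ac)
    also have "\<dots> = c"
      unfolding c using split[OF t\<alpha>(1) t\<beta>] by simp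
    finally show "?b \<cdot> ?a0 = c"
      by (simp add: arr_mult)
    have "\<beta> 0 \<cdot> (j 0 \<cdot> (q 0 \<cdot> (diff_at M' (-1) \<cdot> i (-1)))) \<boxplus> \<beta> 0 \<cdot> (i 0 \<cdot> (p 0 \<cdot> (diff_at M' (-1) \<cdot> i (-1)))) =
        \<beta> 0 \<cdot> (i 0 \<cdot> (p 0 \<cdot> (diff_at M' (-1) \<cdot> i (-1)))) \<boxplus> \<beta> 0 \<cdot> (j 0 \<cdot> (q 0 \<cdot> (diff_at M' (-1) \<cdot> i (-1))))"
      by (simp add: arr_ac)
    also have "\<dots> = Zero C (Zf (-1)) A'"
      using split[of "diff_at M' (-1) \<cdot> i (-1)" "Zf (-1)" "\<beta> 0" A'] reassoc[OF d\<beta> t\<beta> td(2) bipD(1)[OF b]]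
      by (simp add: comp_Zero_l)
    finally show "?b \<cdot> (inl C ?T1 ?T2 \<cdot> ?k1 \<boxplus> inr C ?T1 ?T2 \<cdot> ?p) = Zero C (Zf (-1)) A'"
      by (simp add: arr_mult)
    have s: "q 1 \<cdot> (diff_at M' 0 \<cdot> (i 0 \<cdot> (p 0 \<cdot> y))) \<boxplus> q 1 \<cdot> (diff_at M' 0 \<cdot> (j 0 \<cdot> (q 0 \<cdot> y))) = q 1 \<cdot> (diff_at M' 0 \<cdot> y)"
      if "ty C y = tp U (obj_at M' 0)" for y U
      using split[OF that, of "q 1 \<cdot> diff_at M' 0" "Tf 1"] that by (simp add: comp_assoc)
    have s': "inl C (Tf 1) R \<cdot> (q 1 \<cdot> (diff_at M' 0 \<cdot> (i 0 \<cdot> (p 0 \<cdot> y)))) \<boxplus> inl C (Tf 1) R \<cdot> (q 1 \<cdot> (diff_at M' 0 \<cdot> (j 0 \<cdot> (q 0 \<cdot> y)))) =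
        inl C (Tf 1) R \<cdot> (q 1 \<cdot> (diff_at M' 0 \<cdot> y))" if "ty C y = tp U (obj_at M' 0)" for y U
      using s[OF that, symmetric] that by (simp add: comp_Add_r)
    have "(?g \<cdot> prl C ?T1 ?T2 \<boxplus> ?k2 \<cdot> prr C ?T1 ?T2) \<cdot> ?a0 =
        (inl C (Tf 1) R \<cdot> (q 1 \<cdot> (diff_at M' 0 \<cdot> (i 0 \<cdot> (p 0 \<cdot> \<alpha> 0)))) \<boxplus> inl C (Tf 1) R \<cdot> (q 1 \<cdot> (diff_at M' 0 \<cdot> (j 0 \<cdot> (q 0 \<cdot> \<alpha> 0))))) \<boxplus>
        inr C (Tf 1) R \<cdot> r"
      unfolding k2 by (simp add: arr_mult arr_ac)
    also have "\<dots> = ?a1 \<cdot> r"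
      unfolding s'[OF t\<alpha>(1)] d\<alpha> by (simp add: arr_mult)
    finally show "(?g \<cdot> prl C ?T1 ?T2 \<boxplus> ?k2 \<cdot> prr C ?T1 ?T2) \<cdot> ?a0 = ?a1 \<cdot> r" .
    have "(?g \<cdot> prl C ?T1 ?T2 \<boxplus> ?k2 \<cdot> prr C ?T1 ?T2) \<cdot> (inl C ?T1 ?T2 \<cdot> ?k1 \<boxplus> inr C ?T1 ?T2 \<cdot> ?p) =
        inl C (Tf 1) R \<cdot> (q 1 \<cdot> (diff_at M' 0 \<cdot> (i 0 \<cdot> (p 0 \<cdot> (diff_at M' (-1) \<cdot> i (-1)))))) \<boxplus>
        inl C (Tf 1) R \<cdot> (q 1 \<cdot> (diff_at M' 0 \<cdot> (j 0 \<cdot> (q 0 \<cdot> (diff_at M' (-1) \<cdot> i (-1))))))"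
      unfolding k2 by (simp add: arr_mult arr_ac)
    also have "\<dots> = inl C (Tf 1) R \<cdot> (q 1 \<cdot> (diff_at M' 0 \<cdot> (diff_at M' (-1) \<cdot> i (-1))))"
      by (rule s'[of _ "Zf (-1)"]) simp
    also have "\<dots> = Zero C (Zf (-1)) ?Z'"
      unfolding reassoc[OF dd td(1) td(2) bipD(1)[OF b]] by (simp add: arr_mult cxD(1)[OF cxM])
    finally show "(?g \<cdot> prl C ?T1 ?T2 \<boxplus> ?k2 \<cdot> prr C ?T1 ?T2) \<cdot> (inl C ?T1 ?T2 \<cdot> ?k1 \<boxplus> inr C ?T1 ?T2 \<cdot> ?p) = Zero C (Zf (-1)) ?Z'" .
  qed simp_all
qed

end

section \<open>The theorem\<close>

context additive_category
begin

lemma ext_oplus: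
  assumes E: "extension_closed (Kb C) E" and s: "ty C s1 = tp X1 Y1" "ty C s2 = tp X2 Y2"
    and c: "cone_of C s1 \<in> E" "cone_of C s2 \<in> E"
  shows "cone_of C (oplus C s1 s2) \<in> E"
proof -
  note o[simp] = ty_Dom_Obj[OF s(1)] ty_Cod_Obj[OF s(1)] ty_Dom_Obj[OF s(2)] ty_Cod_Obj[OF s(2)]
  note [simp] = s bin arr_ty
  show ?thesis
    by (rule ext_triangular[OF E s(1) _ s(2) bip_dsum bip_dsum _ _ c]) (simp_all add: oplus_eq[OF s] arr_calc)
qed

text \<open>The entry \<open>x\<close> leads from the first summand into the second, so the second
  summand is the invariant one and the biproducts are read in reversed order.\<close>

lemma ext_lower_triangular:
  assumes E: "extension_closed (Kb C) E" and s: "ty C s1 = tp X1 Y1" "ty C s2 = tp X2 Y2" "ty C x = tp X1 Y2"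
    and c: "cone_of C s1 \<in> E" "cone_of C s2 \<in> E"
  shows "cone_of C (matarr C [X1, X2] [Y1, Y2] [[s1, Zero C X2 Y1], [x, s2]]) \<in> E" (is "cone_of C ?m \<in> E")
proof -
  note o[simp] = ty_Dom_Obj[OF s(1)] ty_Cod_Obj[OF s(1)] ty_Dom_Obj[OF s(2)] ty_Cod_Obj[OF s(2)]
  note [simp] = s bin arr_ty
  have bs: "bip C V U (dsum C [U, V]) (inr C U V) (inl C U V) (prr C U V) (prl C U V)"
    if "U \<in> Obj C" "V \<in> Obj C" for U V
    using bip_dsum[OF that] that by (simp add: bip_def add_comm)
  have m: "?m = inl C Y1 Y2 \<cdot> s1 \<cdot> prl C X1 X2 \<boxplus> (inr C Y1 Y2 \<cdot> x \<cdot> prl C X1 X2 \<boxplus> inr C Y1 Y2 \<cdot> s2 \<cdot> prr C X1 X2)"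
    unfolding matarr_22[OF s(1) ty_Zero[OF o(3,2)] s(3,2)] by (simp add: arr_mult)
  show ?thesis
    unfolding m
    by (rule ext_triangular[OF E s(2) _ s(1) bs bs _ _ c(2,1)]) (simp_all add: arr_calc)
qed

end

text \<open>Each formula is accompanied by the invertibility of its middle factor, since
  \<open>arr_inv\<close> is a definite description and carries no information about an arrow without
  an inverse.\<close>

theorem proposition3p1p7:
  fixes A :: "('o, 'm) acat" and S :: "'m set"
    and A1 A1' A2 A2' C1 C1' C2 C2' :: 'o
    and g1 s1 i1 g2 s2 i2 :: 'm
  assumes "additive_category A"
    and "S \<subseteq> Arr A"
    and C: "C = Kb A"
    and B: "B = cone_of A ` S"
    and D: "D = extension_closure C B"
    and DD: "DD = triangulated_generated C B"
    and V: "V = verdier_quotient C DD"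
    and q: "q = quot_arr A DD"
    and "A1 \<in> Obj A" "A1' \<in> Obj A" "A2 \<in> Obj A" "A2' \<in> Obj A"
    and "C1 \<in> Obj A" "C1' \<in> Obj A" "C2 \<in> Obj A" "C2' \<in> Obj A"
    and "g1 \<in> Hom A C1' A1'" "s1 \<in> Hom A C1' C1" "cone_of A s1 \<in> D" "i1 \<in> Hom A A1 C1"
    and "g2 \<in> Hom A C2' A2'" "s2 \<in> Hom A C2' C2" "cone_of A s2 \<in> D" "i2 \<in> Hom A A2 C2"
    and "f1 \<in> Hom V (emb_obj A A1) (emb_obj A A1')"
    and "f1 = q g1 \<cdot>\<^bsub>V\<^esub> arr_inv V (q s1) \<cdot>\<^bsub>V\<^esub> q i1"
    and "f2 \<in> Hom V (emb_obj A A2) (emb_obj A A2')"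
    and "f2 = q g2 \<cdot>\<^bsub>V\<^esub> arr_inv V (q s2) \<cdot>\<^bsub>V\<^esub> q i2"
  shows
    "(arr_iso V (q (oplus A s1 s2)) \<and>
      quot_oplus A DD [A1, A2] [A1', A2'] f1 f2 =
        q (oplus A g1 g2) \<cdot>\<^bsub>V\<^esub> arr_inv V (q (oplus A s1 s2)) \<cdot>\<^bsub>V\<^esub> q (oplus A i1 i2))
     \<and>
     (A1 = A2' \<longrightarrow>
       (let t = matarr A [C2', C1'] [C2, C1] [[s2, Zero A C1' C2], [neg A (i1 \<cdot>\<^bsub>A\<^esub> g2), s1]]
        in arr_iso V (q t) \<and>
           f1 \<cdot>\<^bsub>V\<^esub> f2 =
             q (matarr A [C2', C1'] [A1'] [[Zero A C2' A1', g1]])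
             \<cdot>\<^bsub>V\<^esub> arr_inv V (q t)
             \<cdot>\<^bsub>V\<^esub> q (matarr A [A2] [C2, C1] [[i2], [Zero A A2 C1]])))
     \<and>
     (\<forall>A0 A0'. A1 = A0 \<and> A2 = A0 \<and> A1' = A0' \<and> A2' = A0' \<longrightarrow>
       (arr_iso V (q (oplus A s1 s2)) \<and>
        Add V f1 f2 =
          q (matarr A [C1', C2'] [A0'] [[g1, g2]])
          \<cdot>\<^bsub>V\<^esub> arr_inv V (q (oplus A s1 s2))
          \<cdot>\<^bsub>V\<^esub> q (matarr A [A0] [C1, C2] [[i1], [i2]]))
       \<and>
       (let P = dsum A [A0, C1', C2'];
            R = dsum A [C1, C2];
            r = matarr A [A0, C1', C2'] [C1, C2]
                  [[i1, s1, Zero A C2' C1], [i2, Zero A C1' C2, s2]];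
            c = matarr A [A0, C1', C2'] [A0'] [[Zero A A0 A0', g1, neg A g2]];
            stmt1 = (f1 = f2);
            stmt2 = factors_through (Cb A)
                      (degree_zero_map A (two_term A 0 r) (emb_obj A A0') c) DD;
            stmt3 = (\<exists>Z \<in> Obj A. \<exists>Z' \<in> Obj A. \<exists>T1 \<in> Obj A. \<exists>T2 \<in> Obj A.
                     \<exists>k1 \<in> Hom A Z T1. \<exists>k2 \<in> Hom A T2 Z'. \<exists>p \<in> Hom A Z T2. \<exists>g \<in> Hom A T1 Z'.
                     \<exists>\<alpha>11 \<in> Hom A R Z'.
                     \<exists>\<alpha>10 \<in> Hom A P (dsum A [T1, T2]).
                     \<exists>\<alpha>2 \<in> Hom A (dsum A [T1, T2]) A0'.
                       cone_of A k1 \<in> D \<and> cone_of A k2 \<in> D \<and>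
                       matarr A [dsum A [T1, T2]] [A0', Z']
                           [[\<alpha>2], [matarr A [T1, T2] [Z'] [[g, k2]]]]
                         \<cdot>\<^bsub>A\<^esub> matarr A [P, Z] [dsum A [T1, T2]]
                           [[\<alpha>10, matarr A [Z] [T1, T2] [[k1], [p]]]]
                       = matarr A [P, Z] [A0', Z']
                           [[c, Zero A Z A0'], [\<alpha>11 \<cdot>\<^bsub>A\<^esub> r, Zero A Z Z']])
        in (stmt1 \<longleftrightarrow> stmt2) \<and> (stmt2 \<longleftrightarrow> stmt3)))"
proof -
  interpret additive_category A
    by (rule assms(1))
  have BO: "B \<subseteq> Obj C"
  proof
    fix X assume "X \<in> B"
    then obtain s where s: "s \<in> Arr A" "X = cone_of A s"
      using assms(2) unfolding B by blast
    show "X \<in> Obj C"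
      using two_term_cx[OF ty_Arr[OF s(1)]] by (simp add: C Kb_simps(1) s(2) cone_of_def)
  qed
  have E: "extension_closed (Kb A) D"
    using extension_closed_closure BO unfolding C D by blast
  interpret T: triangulated_subcategory A DD
    using triangulated_subcat_generated BO unfolding C DD
    by (intro triangulated_subcategory.intro triangulated_subcategory_axioms.intro assms(1)) blast
  have BD: "B \<subseteq> D" "B \<subseteq> DD"
    unfolding D DD extension_closure_def triangulated_generated_def by auto
  \<comment> \<open>\<open>DD\<close> is itself extension-closed and contains the generators. Thus a
    cone in \<open>D\<close> makes an arrow invertible in the quotient.\<close>
  have DN: "D \<subseteq> DD"
    using T.N_extension_closed BD(2) unfolding D extension_closure_def C by blast
  \<comment> \<open>By minimality of \<open>DD\<close>: the isomorphic copies of good complexes form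
    a triangulated class, and the generators are good because their cones lie in
    \<open>D\<close>.\<close>
  have good: "\<exists>M'. good_complex A D M' \<and> isomorphic (Kb A) M M'" if "M \<in> DD" for M
  proof -
    let ?G = "{M. \<exists>M'. good_complex A D M' \<and> isomorphic (Kb A) M M'}"
    have "B \<subseteq> ?G"
    proof
      fix X assume X: "X \<in> B"
      then obtain s where s: "s \<in> S" "X = cone_of A s"
        unfolding B by blast
      then have "s \<in> Arr A"
        using assms(2) by blast
      from ty_Arr[OF this] have "ty A s = tp (Dom A s) (Cod A s)" .
      from good_complex_cone_of[OF E this] have "good_complex A D X"
        using X BD(1) s(2) by auto
      moreover have "X \<in> Obj (Kb A)"
        using X BO C by blast
      ultimately show "X \<in> ?G"
        using T.K.isomorphic_refl by blast
    qed
    then have "DD \<subseteq> ?G"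
      using good_complexes_triangulated[OF E] unfolding DD triangulated_generated_def C by blast
    then show ?thesis
      using that by blast
  qed
  have VQ: "V = verdier_quotient (Kb A) DD"
    using V C by simp
  note t = assms(17)[unfolded Hom_ty] assms(18)[unfolded Hom_ty] assms(20)[unfolded Hom_ty]
    assms(21)[unfolded Hom_ty] assms(22)[unfolded Hom_ty] assms(24)[unfolded Hom_ty]
  note cD = assms(19) assms(23)
  have cN: "cone_of A s1 \<in> DD" "cone_of A s2 \<in> DD"
    using cD DN by auto
  have op: "cone_of A (oplus A s1 s2) \<in> DD"
    using ext_oplus[OF E t(2,5) cD] DN by blast
  have top: "ty A (oplus A s1 s2) = tp (dsum A [C1', C2']) (dsum A [C1, C2])"
    using assms(13-16) by (simp add: oplus_eq[OF t(2,5)] arr_ty bin t)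
  have isoS: "arr_iso V (q (oplus A s1 s2))"
    unfolding VQ q by (rule T.qa_iso[OF top op])
  define w1 where "w1 = arr_inv V (q s1) \<cdot>\<^bsub>V\<^esub> q i1"
  define w2 where "w2 = arr_inv V (q s2) \<cdot>\<^bsub>V\<^esub> q i2"
  note w1 = T.presentation[OF t(2) cN(1) t(3), folded q VQ, folded w1_def]
  note w2 = T.presentation[OF t(5) cN(2) t(6), folded q VQ, folded w2_def]
  have f: "f1 = q g1 \<cdot>\<^bsub>V\<^esub> w1" "f2 = q g2 \<cdot>\<^bsub>V\<^esub> w2"
    using assms(26,28) unfolding w1_def w2_def .
  note o = assms(9,10,13,14,11,12,15,16)
  note pres = o t(2,3,1) t(5,6,4) w1[unfolded VQ q] w2[unfolded VQ q]
  have item1: "quot_oplus A DD [A1, A2] [A1', A2'] f1 f2 =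
      q (oplus A g1 g2) \<cdot>\<^bsub>V\<^esub> arr_inv V (q (oplus A s1 s2)) \<cdot>\<^bsub>V\<^esub> q (oplus A i1 i2)"
    unfolding f VQ q by (rule T.presented_oplus[OF pres isoS[unfolded VQ q]])
  have item2: "let t = matarr A [C2', C1'] [C2, C1] [[s2, Zero A C1' C2], [neg A (i1 \<cdot>\<^bsub>A\<^esub> g2), s1]]
        in arr_iso V (q t) \<and>
           f1 \<cdot>\<^bsub>V\<^esub> f2 =
             q (matarr A [C2', C1'] [A1'] [[Zero A C2' A1', g1]])
             \<cdot>\<^bsub>V\<^esub> arr_inv V (q t)
             \<cdot>\<^bsub>V\<^esub> q (matarr A [A2] [C2, C1] [[i2], [Zero A A2 C1]])" if e: "A1 = A2'"
  proof -
    let ?t = "matarr A [C2', C1'] [C2, C1] [[s2, Zero A C1' C2], [neg A (i1 \<cdot>\<^bsub>A\<^esub> g2), s1]]"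
    have tx: "ty A (neg A (i1 \<cdot>\<^bsub>A\<^esub> g2)) = tp C2' C1"
      using ty_neg[OF ty_Comp[OF t(4)[folded e] t(3)]] .
    have ct: "cone_of A ?t \<in> DD"
      using ext_lower_triangular[OF E t(5,2) tx cD(2,1)] DN by blast
    have tt: "ty A ?t = tp (dsum A [C2', C1']) (dsum A [C2, C1])"
      unfolding matarr_22[OF t(5) ty_Zero[OF assms(14,15)] tx t(2)]
      using assms(13-16) by (simp add: arr_ty bin t(2,5) tx)
    have iso: "arr_iso V (q ?t)"
      unfolding VQ q by (rule T.qa_iso[OF tt ct])
    show ?thesis
      unfolding Let_def using iso T.presented_comp[OF pres e iso[unfolded VQ q]] unfolding f VQ q by simp
  qed
  have item3a: "Add V f1 f2 =
          q (matarr A [C1', C2'] [A1'] [[g1, g2]]) \<cdot>\<^bsub>V\<^esub> arr_inv V (q (oplus A s1 s2)) \<cdot>\<^bsub>V\<^esub> q (matarr A [A1] [C1, C2] [[i1], [i2]])"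
    if e: "A1 = A2" "A1' = A2'"
    unfolding f VQ q by (rule T.presented_add[OF pres e isoS[unfolded VQ q]])
  have item3b: "let P = dsum A [A1, C1', C2'];
            R = dsum A [C1, C2];
            r = matarr A [A1, C1', C2'] [C1, C2]
                  [[i1, s1, Zero A C2' C1], [i2, Zero A C1' C2, s2]];
            c = matarr A [A1, C1', C2'] [A1'] [[Zero A A1 A1', g1, neg A g2]];
            stmt1 = (f1 = f2);
            stmt2 = factors_through (Cb A)
                      (degree_zero_map A (two_term A 0 r) (emb_obj A A1') c) DD;
            stmt3 = (\<exists>Z \<in> Obj A. \<exists>Z' \<in> Obj A. \<exists>T1 \<in> Obj A. \<exists>T2 \<in> Obj A.
                     \<exists>k1 \<in> Hom A Z T1. \<exists>k2 \<in> Hom A T2 Z'. \<exists>p \<in> Hom A Z T2. \<exists>g \<in> Hom A T1 Z'.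
                     \<exists>\<alpha>11 \<in> Hom A R Z'.
                     \<exists>\<alpha>10 \<in> Hom A P (dsum A [T1, T2]).
                     \<exists>\<alpha>2 \<in> Hom A (dsum A [T1, T2]) A1'.
                       cone_of A k1 \<in> D \<and> cone_of A k2 \<in> D \<and>
                       matarr A [dsum A [T1, T2]] [A1', Z']
                           [[\<alpha>2], [matarr A [T1, T2] [Z'] [[g, k2]]]]
                         \<cdot>\<^bsub>A\<^esub> matarr A [P, Z] [dsum A [T1, T2]]
                           [[\<alpha>10, matarr A [Z] [T1, T2] [[k1], [p]]]]
                       = matarr A [P, Z] [A1', Z']
                           [[c, Zero A Z A1'], [\<alpha>11 \<cdot>\<^bsub>A\<^esub> r, Zero A Z Z']])
        in (stmt1 \<longleftrightarrow> stmt2) \<and> (stmt2 \<longleftrightarrow> stmt3)"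
    if e: "A1 = A2" "A1' = A2'"
  proof -
    define P where "P = dsum A [A1, C1', C2']"
    define R where "R = dsum A [C1, C2]"
    define r where "r = matarr A [A1, C1', C2'] [C1, C2] [[i1, s1, Zero A C2' C1], [i2, Zero A C1' C2, s2]]"
    define c where "c = matarr A [A1, C1', C2'] [A1'] [[Zero A A1 A1', g1, neg A g2]]"
    note i2 = t(6)[folded e] and g2 = t(4)[folded e] and w2' = w2[unfolded VQ q, folded e]
    note d3 = dsum3(1-7)[OF o(1,4,8), folded P_def, unfolded One_nat_def]
    have oo: "A1' \<in> Obj A" "P \<in> Obj A" "R \<in> Obj A"
      using o d3(1) bin(5)[OF o(3,7)] by (auto simp: R_def)
    have tr: "ty A r = tp P R"
      unfolding r_def matarr_23[OF t(3,2) ty_Zero[OF o(8,3)] i2 ty_Zero[OF o(4,7)] t(5)]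
      using o by (simp add: R_def arr_ty bin d3 t(2,3,5) i2)
    have tc: "ty A c = tp P A1'"
      unfolding c_def matarr_13[OF ty_Zero[OF o(1,2)] t(1) ty_neg[OF g2]]
      using o by (simp add: arr_ty d3 t(1) g2)
    let ?stmt2 = "factors_through (Cb A) (degree_zero_map A (two_term A 0 r) (emb_obj A A1') c) DD"
    let ?stmt3 = "\<exists>Z \<in> Obj A. \<exists>Z' \<in> Obj A. \<exists>T1 \<in> Obj A. \<exists>T2 \<in> Obj A.
                     \<exists>k1 \<in> Hom A Z T1. \<exists>k2 \<in> Hom A T2 Z'. \<exists>p \<in> Hom A Z T2. \<exists>g \<in> Hom A T1 Z'.
                     \<exists>\<alpha>11 \<in> Hom A R Z'.
                     \<exists>\<alpha>10 \<in> Hom A P (dsum A [T1, T2]).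
                     \<exists>\<alpha>2 \<in> Hom A (dsum A [T1, T2]) A1'.
                       cone_of A k1 \<in> D \<and> cone_of A k2 \<in> D \<and>
                       matarr A [dsum A [T1, T2]] [A1', Z']
                           [[\<alpha>2], [matarr A [T1, T2] [Z'] [[g, k2]]]]
                         \<cdot>\<^bsub>A\<^esub> matarr A [P, Z] [dsum A [T1, T2]]
                           [[\<alpha>10, matarr A [Z] [T1, T2] [[k1], [p]]]]
                       = matarr A [P, Z] [A1', Z']
                           [[c, Zero A Z A1'], [\<alpha>11 \<cdot>\<^bsub>A\<^esub> r, Zero A Z Z']]"
    have s12: "f1 = f2 \<longleftrightarrow> ?stmt2"
      using T.presented_eq_iff[OF o(1-4,7,8) t(2,3,1) t(5) i2 g2 cN op w1[unfolded VQ q] w2', folded r_def c_def]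
      unfolding f VQ q .
    have s23: ?stmt3 if s2: ?stmt2
    proof -
      obtain Z Z' T1 T2 k1 k2 p g a1 a0 b where
        x: "Z \<in> Obj A" "Z' \<in> Obj A" "T1 \<in> Obj A" "T2 \<in> Obj A"
        and y: "ty A k1 = tp Z T1" "ty A k2 = tp T2 Z'" "ty A p = tp Z T2" "ty A g = tp T1 Z'" "ty A a1 = tp R Z'"
          "ty A a0 = tp P (dsum A [T1, T2])" "ty A b = tp (dsum A [T1, T2]) A1'"
        and k: "cone_of A k1 \<in> D" "cone_of A k2 \<in> D"
        and eqs: "b \<cdot>\<^bsub>A\<^esub> a0 = c" "b \<cdot>\<^bsub>A\<^esub> (inl A T1 T2 \<cdot>\<^bsub>A\<^esub> k1 \<boxplus>\<^bsub>A\<^esub> inr A T1 T2 \<cdot>\<^bsub>A\<^esub> p) = Zero A Z A1'"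
          "(g \<cdot>\<^bsub>A\<^esub> prl A T1 T2 \<boxplus>\<^bsub>A\<^esub> k2 \<cdot>\<^bsub>A\<^esub> prr A T1 T2) \<cdot>\<^bsub>A\<^esub> a0 = a1 \<cdot>\<^bsub>A\<^esub> r"
          "(g \<cdot>\<^bsub>A\<^esub> prl A T1 T2 \<boxplus>\<^bsub>A\<^esub> k2 \<cdot>\<^bsub>A\<^esub> prr A T1 T2) \<cdot>\<^bsub>A\<^esub> (inl A T1 T2 \<cdot>\<^bsub>A\<^esub> k1 \<boxplus>\<^bsub>A\<^esub> inr A T1 T2 \<cdot>\<^bsub>A\<^esub> p) = Zero A Z Z'"
        using T.matrix_if_factors[OF E good oo tc tr s2] .
      note m = matrix_criterion[OF oo x y tc tr, THEN iffD2, OF conjI[OF eqs(1) conjI[OF eqs(2) conjI[OF eqs(3,4)]]]]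
      show ?thesis
        by (rule bexI[OF _ x(1)], rule bexI[OF _ x(2)], rule bexI[OF _ x(3)], rule bexI[OF _ x(4)],
            rule bexI[of _ k1], rule bexI[of _ k2], rule bexI[of _ p], rule bexI[of _ g], rule bexI[of _ a1],
            rule bexI[of _ a0], rule bexI[of _ b])
          (use m k y in \<open>simp_all only: Hom_ty simp_thms\<close>)
    qed
    have s32: ?stmt2 if s3: ?stmt3
    proof -
      obtain Z Z' T1 T2 k1 k2 p g a1 a0 b where
        x: "Z \<in> Obj A" "Z' \<in> Obj A" "T1 \<in> Obj A" "T2 \<in> Obj A"
        and y: "ty A k1 = tp Z T1" "ty A k2 = tp T2 Z'" "ty A p = tp Z T2" "ty A g = tp T1 Z'" "ty A a1 = tp R Z'"
          "ty A a0 = tp P (dsum A [T1, T2])" "ty A b = tp (dsum A [T1, T2]) A1'"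
        and k: "cone_of A k1 \<in> D" "cone_of A k2 \<in> D"
        and m: "matarr A [dsum A [T1, T2]] [A1', Z'] [[b], [matarr A [T1, T2] [Z'] [[g, k2]]]]
            \<cdot>\<^bsub>A\<^esub> matarr A [P, Z] [dsum A [T1, T2]] [[a0, matarr A [Z] [T1, T2] [[k1], [p]]]]
          = matarr A [P, Z] [A1', Z'] [[c, Zero A Z A1'], [a1 \<cdot>\<^bsub>A\<^esub> r, Zero A Z Z']]"
        using s3 by (elim bexE conjE, unfold Hom_ty, intro that)
      \<comment> \<open>For this direction it is enough that the two cones lie in the larger class
        \<open>DD\<close>, which places the three-term complex there.\<close>
      have kN: "cone_of A k1 \<in> DD" "cone_of A k2 \<in> DD"
        using k DN by auto
      note m' = matrix_criterion[OF oo x y tc tr, THEN iffD1, OF m]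
      show ?thesis
        using T.factors_if_matrix[OF oo x y tc tr kN] m' by blast
    qed
    show ?thesis
      unfolding Let_def P_def[symmetric] R_def[symmetric] r_def[symmetric] c_def[symmetric]
      using s12 s23 s32 by blast
  qed
  show ?thesis
  proof (intro conjI impI allI)
    fix A0 A0' assume e: "A1 = A0 \<and> A2 = A0 \<and> A1' = A0' \<and> A2' = A0'"
    then have e': "A1 = A2" "A1' = A2'" "A0 = A1" "A0' = A1'"
      by auto
    show "Add V f1 f2 =
          q (matarr A [C1', C2'] [A0'] [[g1, g2]])
          \<cdot>\<^bsub>V\<^esub> arr_inv V (q (oplus A s1 s2))
          \<cdot>\<^bsub>V\<^esub> q (matarr A [A0] [C1, C2] [[i1], [i2]])"
      unfolding e'(3,4) by (rule item3a[OF e'(1,2)])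
  qed (use isoS item1 item2 item3b in auto)
qed

end
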